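(* Let $\mathcal{A}$ be a commutative $C^*$-algebra. Then the Varopoulos algebra $V_{\mathcal{A}}=\mathcal{A}\otimes_\gamma\mathcal{A}$ is neither Arens regular nor strongly Arens irregular if and only if $\mathcal{A}$ is non-scattered.
   Context: $\mathcal{A}\otimes_\gamma\mathcal{A}$ is the projective Banach space tensor product (completion of $\mathcal{A}\otimes\mathcal{A}$ in $\|u\|_\gamma=\inf\{\sum_k\|x_k\|\|y_k\|:u=\sum_kx_k\otimes y_k\}$), a Banach algebra with product determined by $(a\otimes b)(c\otimes d)=ac\otimes bd$. For a Banach algebra $\mathcal{C}$, the left Arens product on $\mathcal{C}^{**}$ is $\langle X\Box Y,f\rangle=\langle X,Y\Box f\rangle$, $\langle Y\Box f,a\rangle=\langle Y,f\Box a\rangle$, $\langle f\Box a,b\rangle=\langle f,ab\rangle$ for $X,Y\in\mathcal{C}^{**}$, $f\in\mathcal{C}^*$, $a,b\in\mathcal{C}$. The (left) topological centre $Z_t(\mathcal{C}^{**})$ is the set of $X\in\mathcal{C}^{**}$ such that $Y\mapsto X\Box Y$ is $w^*$-$w^*$-continuous on $\mathcal{C}^{**}$. $\mathcal{C}$ is Arens regular if $Z_t(\mathcal{C}^{**})=\mathcal{C}^{**}$, and (left) strongly Arens irregular if $Z_t(\mathcal{C}^{**})=\mathcal{C}$ (canonically embedded). A $C^*$-algebra is scattered if every positive functional on it is a finite or countable (pointwise) sum of pure functionals (non-negative multiples of pure states); non-scattered means not scattered. *)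

theory Defs
  imports "HOL-Analysis.Analysis"
begin

section \<open>Complex Banach algebras and C*-algebras\<close>

class complex_vector = real_vector +
  fixes scaleC :: "complex \<Rightarrow> 'a \<Rightarrow> 'a"
  assumes scaleC_add_right: "scaleC c (x + y) = scaleC c x + scaleC c y"
    and scaleC_add_left: "scaleC (c + d) x = scaleC c x + scaleC d x"
    and scaleC_scaleC: "scaleC c (scaleC d x) = scaleC (c * d) x"
    and scaleR_scaleC: "scaleR r x = scaleC (complex_of_real r) x"

class complex_algebra = complex_vector + real_algebra +
  assumes mult_scaleC_left: "scaleC c x * y = scaleC c (x * y)"
    and mult_scaleC_right: "x * scaleC c y = scaleC c (x * y)"

class complex_normed_vector = complex_vector + real_normed_vector +
  assumes norm_scaleC: "norm (scaleC c x) = cmod c * norm x"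

class complex_normed_algebra = complex_algebra + complex_normed_vector + real_normed_algebra

class complex_banach_algebra = complex_normed_algebra + complete_space
begin

subclass banach ..

end

text \<open>Algebras are not assumed to be unital.\<close>

class cstar_algebra = complex_banach_algebra +
  fixes star :: "'a \<Rightarrow> 'a"
  assumes star_add: "star (x + y) = star x + star y"
    and star_scaleC: "star (scaleC c x) = scaleC (cnj c) (star x)"
    and star_mult: "star (x * y) = star y * star x"
    and star_star: "star (star x) = x"
    and norm_star_mult: "norm (star x * x) = (norm x)\<^sup>2"

lemma scaleC_one: "scaleC 1 x = (x :: 'a :: complex_vector)"
  using scaleR_scaleC[of 1 x] by simp

lemma scaleC_minus1: "scaleC (-1) x = - (x :: 'a :: complex_vector)"
  using scaleR_scaleC[of "-1" x] by simp

definition clinear_form :: "('a::complex_vector \<Rightarrow> complex) \<Rightarrow> bool" where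
  "clinear_form f \<longleftrightarrow> (\<forall>x y. f (x + y) = f x + f y) \<and> (\<forall>c x. f (scaleC c x) = c * f x)"

definition cbilinear_form :: "('a::complex_vector \<Rightarrow> 'b::complex_vector \<Rightarrow> complex) \<Rightarrow> bool" where
  "cbilinear_form \<phi> \<longleftrightarrow> (\<forall>x. clinear_form (\<phi> x)) \<and> (\<forall>y. clinear_form (\<lambda>x. \<phi> x y))"


section \<open>The dual space\<close>

text \<open>The type \<open>'a \<Rightarrow>\<^sub>L complex\<close> consists of the bounded real-linear maps; the dual consists
  of the complex-linear ones among them, with the operator norm.\<close>

typedef (overloaded) 'a cdual =
  "{f :: 'a::complex_normed_vector \<Rightarrow>\<^sub>L complex. clinear_form (blinfun_apply f)}"
  morphisms blinfun_of_cdual Abs_cdual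
  by (rule exI[of _ 0]) (simp add: clinear_form_def)

setup_lifting type_definition_cdual

definition cdual_apply :: "'a::complex_normed_vector cdual \<Rightarrow> 'a \<Rightarrow> complex" where
  "cdual_apply f = blinfun_apply (blinfun_of_cdual f)"

instantiation cdual :: (complex_normed_vector) real_normed_vector
begin

lift_definition zero_cdual :: "'a cdual" is 0
  by (simp add: clinear_form_def)

lift_definition plus_cdual :: "'a cdual \<Rightarrow> 'a cdual \<Rightarrow> 'a cdual" is "(+)"
  by (simp add: clinear_form_def plus_blinfun.rep_eq algebra_simps)

lift_definition minus_cdual :: "'a cdual \<Rightarrow> 'a cdual \<Rightarrow> 'a cdual" is "(-)"
  by (simp add: clinear_form_def minus_blinfun.rep_eq algebra_simps)

lift_definition uminus_cdual :: "'a cdual \<Rightarrow> 'a cdual" is uminus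
  by (simp add: clinear_form_def uminus_blinfun.rep_eq algebra_simps)

lift_definition scaleR_cdual :: "real \<Rightarrow> 'a cdual \<Rightarrow> 'a cdual" is scaleR
  by (simp add: clinear_form_def scaleR_blinfun.rep_eq algebra_simps)

lift_definition norm_cdual :: "'a cdual \<Rightarrow> real" is norm .

definition dist_cdual :: "'a cdual \<Rightarrow> 'a cdual \<Rightarrow> real" where
  "dist_cdual f g = norm (f - g)"

definition sgn_cdual :: "'a cdual \<Rightarrow> 'a cdual" where
  "sgn_cdual f = scaleR (inverse (norm f)) f"

definition uniformity_cdual :: "('a cdual \<times> 'a cdual) filter" where
  "uniformity_cdual = (INF e\<in>{0<..}. principal {(x, y). dist x y < e})"

definition open_cdual :: "'a cdual set \<Rightarrow> bool" where
  "open_cdual U = (\<forall>x\<in>U. eventually (\<lambda>(x', y). x' = x \<longrightarrow> y \<in> U) uniformity)"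

instance
proof
  fix f g h :: "'a cdual" and r s :: real
  show "f + g + h = f + (g + h)" by transfer simp
  show "f + g = g + f" by transfer simp
  show "0 + f = f" by transfer simp
  show "- f + f = 0" by transfer simp
  show "f - g = f + - g" by transfer simp
  show "r *\<^sub>R (f + g) = r *\<^sub>R f + r *\<^sub>R g" by transfer (simp add: algebra_simps)
  show "(r + s) *\<^sub>R f = r *\<^sub>R f + s *\<^sub>R f" by transfer (simp add: algebra_simps)
  show "r *\<^sub>R s *\<^sub>R f = (r * s) *\<^sub>R f" by transfer simp
  show "1 *\<^sub>R f = f" by transfer simp
  show "dist f g = norm (f - g)" by (rule dist_cdual_def)
  show "sgn f = inverse (norm f) *\<^sub>R f" by (rule sgn_cdual_def)
  show "uniformity = (INF e\<in>{0<..}. principal {(x, y :: 'a cdual). dist x y < e})"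
    by (rule uniformity_cdual_def)
  show "open U = (\<forall>x\<in>U. \<forall>\<^sub>F (x', y) in uniformity. x' = x \<longrightarrow> y \<in> U)" for U :: "'a cdual set"
    by (rule open_cdual_def)
  show "(norm f = 0) = (f = 0)" by transfer simp
  show "norm (f + g) \<le> norm f + norm g" by transfer (rule norm_triangle_ineq)
  show "norm (r *\<^sub>R f) = \<bar>r\<bar> * norm f" by transfer simp
qed

end

instantiation cdual :: (complex_normed_vector) complex_normed_vector
begin

lift_definition scaleC_cdual :: "complex \<Rightarrow> 'a cdual \<Rightarrow> 'a cdual"
  is "\<lambda>c f. blinfun_compose (blinfun_mult_right c) f"
  by (simp add: clinear_form_def algebra_simps)

instance
proof
  fix f g :: "'a cdual" and r :: real and c d :: complex
  show "scaleC c (f + g) = scaleC c f + scaleC c g"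
    by transfer (auto intro!: blinfun_eqI simp: plus_blinfun.rep_eq algebra_simps)
  show "scaleC (c + d) f = scaleC c f + scaleC d f"
    by transfer (auto intro!: blinfun_eqI simp: plus_blinfun.rep_eq algebra_simps)
  show "scaleC c (scaleC d f) = scaleC (c * d) f"
    by transfer (auto intro!: blinfun_eqI simp: algebra_simps)
  show "r *\<^sub>R f = scaleC (complex_of_real r) f"
    by transfer (auto intro!: blinfun_eqI simp: scaleR_blinfun.rep_eq scaleR_conv_of_real)
  show "norm (scaleC c f) = cmod c * norm f"
  proof transfer
    fix c :: complex and f :: "'a \<Rightarrow>\<^sub>L complex"
    have "onorm (\<lambda>x. c * blinfun_apply f x) = onorm (\<lambda>x. cmod c *\<^sub>R blinfun_apply f x)"
      unfolding onorm_def by (simp add: norm_mult)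
    also have "\<dots> = \<bar>cmod c\<bar> * onorm (blinfun_apply f)"
      by (rule onorm_scaleR) (rule blinfun.bounded_linear_right)
    finally show "norm (blinfun_compose (blinfun_mult_right c) f) = cmod c * norm f"
      by (simp add: norm_blinfun.rep_eq blinfun_compose.rep_eq o_def)
  qed
qed

end

lemma cdual_apply_add_right: "cdual_apply f (x + y) = cdual_apply f x + cdual_apply f y"
  by (simp add: cdual_apply_def blinfun.add_right)

lemma cdual_apply_scaleC_right: "cdual_apply f (scaleC c x) = c * cdual_apply f x"
  using blinfun_of_cdual[of f] by (simp add: cdual_apply_def clinear_form_def)

lemma cdual_apply_add_left: "cdual_apply (f + g) x = cdual_apply f x + cdual_apply g x"
  by (simp add: cdual_apply_def plus_cdual.rep_eq plus_blinfun.rep_eq)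

lemma cdual_apply_scaleC_left: "cdual_apply (scaleC c f) x = c * cdual_apply f x"
  by (simp add: cdual_apply_def scaleC_cdual.rep_eq)

lemma norm_cdual_apply: "cmod (cdual_apply f x) \<le> norm f * norm x"
  by (simp add: cdual_apply_def norm_cdual.rep_eq norm_blinfun)

definition cdual_of :: "('a::complex_normed_vector \<Rightarrow> complex) \<Rightarrow> 'a cdual" where
  "cdual_of f = Abs_cdual (Blinfun f)"

lemma clinear_form_bounded_linear:
  assumes "clinear_form f" and "\<And>x. cmod (f x) \<le> K * norm x"
  shows "bounded_linear f"
proof (rule bounded_linear_intro[where K = K])
  show "f (x + y) = f x + f y" for x y using assms(1) by (simp add: clinear_form_def)
  show "f (r *\<^sub>R x) = r *\<^sub>R f x" for r x
    using assms(1) by (simp add: clinear_form_def scaleR_scaleC scaleR_conv_of_real)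
  show "norm (f x) \<le> norm x * K" for x using assms(2)[of x] by (simp add: mult.commute)
qed

text \<open>The function \<open>cdual_of\<close> is only meaningful on bounded complex-linear functionals.\<close>

lemma cdual_apply_cdual_of:
  assumes "clinear_form f" and "\<And>x. cmod (f x) \<le> K * norm x"
  shows "cdual_apply (cdual_of f) = f"
proof -
  have "blinfun_apply (Blinfun f) = f"
    by (rule bounded_linear_Blinfun_apply[OF clinear_form_bounded_linear[OF assms]])
  with assms(1) show ?thesis
    by (simp add: cdual_apply_def cdual_of_def Abs_cdual_inverse)
qed

lemma norm_cdual_le:
  assumes "\<And>x. cmod (cdual_apply f x) \<le> K * norm x" and "K \<ge> 0"
  shows "norm f \<le> K"
  using assms by (simp add: cdual_apply_def norm_cdual.rep_eq norm_blinfun_bound)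

lemma cdual_eqI: "(\<And>x. cdual_apply f x = cdual_apply g x) \<Longrightarrow> f = g"
  by (metis blinfun_eqI blinfun_of_cdual_inject cdual_apply_def)

text \<open>The weak* topology is the topology of pointwise convergence.\<close>

definition weak_star_topology :: "'a::complex_normed_vector cdual topology" where
  "weak_star_topology = pullback_topology UNIV cdual_apply (product_topology (\<lambda>_. euclidean) UNIV)"

definition canonical_embedding :: "'a::complex_normed_vector \<Rightarrow> 'a cdual cdual" where
  "canonical_embedding a = cdual_of (\<lambda>f. cdual_apply f a)"


section \<open>The left Arens product\<close>

definition arens_fa :: "'a::complex_normed_algebra cdual \<Rightarrow> 'a \<Rightarrow> 'a cdual" where
  "arens_fa f a = cdual_of (\<lambda>b. cdual_apply f (a * b))"

definition arens_Yf :: "'a::complex_normed_algebra cdual cdual \<Rightarrow> 'a cdual \<Rightarrow> 'a cdual" where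
  "arens_Yf Y f = cdual_of (\<lambda>a. cdual_apply Y (arens_fa f a))"

definition arens_product ::
    "'a::complex_normed_algebra cdual cdual \<Rightarrow> 'a cdual cdual \<Rightarrow> 'a cdual cdual" where
  "arens_product X Y = cdual_of (\<lambda>f. cdual_apply X (arens_Yf Y f))"

lemma canonical_embedding_apply: "cdual_apply (canonical_embedding a) f = cdual_apply f a"
proof -
  have "cdual_apply (cdual_of (\<lambda>f. cdual_apply f a)) = (\<lambda>f. cdual_apply f a)"
    by (rule cdual_apply_cdual_of[where K = "norm a"])
       (auto simp: clinear_form_def cdual_apply_add_left cdual_apply_scaleC_left
          intro: order_trans[OF norm_cdual_apply] simp: mult.commute)
  then show ?thesis by (simp add: canonical_embedding_def)
qed

lemma arens_fa_apply: "cdual_apply (arens_fa f a) b = cdual_apply f (a * b)"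
  and norm_arens_fa: "norm (arens_fa f a) \<le> norm f * norm a"
proof -
  have b: "cmod (cdual_apply f (a * b)) \<le> (norm f * norm a) * norm b" for b
    by (rule order_trans[OF norm_cdual_apply])
       (simp add: mult.assoc mult_left_mono norm_mult_ineq)
  have "cdual_apply (arens_fa f a) = (\<lambda>b. cdual_apply f (a * b))"
    unfolding arens_fa_def using b
    by (intro cdual_apply_cdual_of)
       (auto simp: clinear_form_def distrib_left cdual_apply_add_right
          mult_scaleC_right cdual_apply_scaleC_right)
  then show "cdual_apply (arens_fa f a) b = cdual_apply f (a * b)" for b by simp
  then show "norm (arens_fa f a) \<le> norm f * norm a"
    using b by (intro norm_cdual_le) auto
qed

lemma arens_Yf_apply: "cdual_apply (arens_Yf Y f) a = cdual_apply Y (arens_fa f a)"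
  and norm_arens_Yf: "norm (arens_Yf Y f) \<le> norm Y * norm f"
proof -
  have b: "cmod (cdual_apply Y (arens_fa f a)) \<le> (norm Y * norm f) * norm a" for a
    by (rule order_trans[OF norm_cdual_apply])
       (simp add: mult.assoc mult_left_mono norm_arens_fa)
  have 1: "arens_fa f (a + a') = arens_fa f a + arens_fa f a'" for a a'
    by (rule cdual_eqI)
       (simp add: arens_fa_apply cdual_apply_add_left distrib_right cdual_apply_add_right)
  have 2: "arens_fa f (scaleC c a) = scaleC c (arens_fa f a)" for c a
    by (rule cdual_eqI)
       (simp add: arens_fa_apply cdual_apply_scaleC_left mult_scaleC_left cdual_apply_scaleC_right)
  have "cdual_apply (arens_Yf Y f) = (\<lambda>a. cdual_apply Y (arens_fa f a))"
    unfolding arens_Yf_def using b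
    by (intro cdual_apply_cdual_of)
       (auto simp: clinear_form_def 1 2 cdual_apply_add_right cdual_apply_scaleC_right)
  then show "cdual_apply (arens_Yf Y f) a = cdual_apply Y (arens_fa f a)" for a by simp
  then show "norm (arens_Yf Y f) \<le> norm Y * norm f"
    using b by (intro norm_cdual_le) auto
qed

lemma arens_product_apply: "cdual_apply (arens_product X Y) f = cdual_apply X (arens_Yf Y f)"
proof -
  have b: "cmod (cdual_apply X (arens_Yf Y f)) \<le> (norm X * norm Y) * norm f" for f
    by (rule order_trans[OF norm_cdual_apply])
       (simp add: mult.assoc mult_left_mono norm_arens_Yf)
  have "arens_fa (f + f') a = arens_fa f a + arens_fa f' a" for f f' :: "'a cdual" and a
    by (rule cdual_eqI) (simp add: arens_fa_apply cdual_apply_add_left)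
  then have 1: "arens_Yf Y (f + f') = arens_Yf Y f + arens_Yf Y f'" for f f'
    by (intro cdual_eqI) (simp add: arens_Yf_apply cdual_apply_add_left cdual_apply_add_right)
  have "arens_fa (scaleC c f) a = scaleC c (arens_fa f a)" for f :: "'a cdual" and c a
    by (rule cdual_eqI) (simp add: arens_fa_apply cdual_apply_scaleC_left)
  then have 2: "arens_Yf Y (scaleC c f) = scaleC c (arens_Yf Y f)" for c f
    by (intro cdual_eqI) (simp add: arens_Yf_apply cdual_apply_scaleC_left cdual_apply_scaleC_right)
  have "cdual_apply (arens_product X Y) = (\<lambda>f. cdual_apply X (arens_Yf Y f))"
    unfolding arens_product_def using b
    by (intro cdual_apply_cdual_of)
       (auto simp: clinear_form_def 1 2 cdual_apply_add_right cdual_apply_scaleC_right)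
  then show ?thesis by simp
qed

definition topological_centre :: "'a::complex_banach_algebra cdual cdual set" where
  "topological_centre =
     {X. continuous_map weak_star_topology weak_star_topology (\<lambda>Y. arens_product X Y)}"

definition arens_regular :: "'a::complex_banach_algebra itself \<Rightarrow> bool" where
  "arens_regular _ \<longleftrightarrow> (topological_centre :: 'a cdual cdual set) = UNIV"

definition strongly_arens_irregular :: "'a::complex_banach_algebra itself \<Rightarrow> bool" where
  "strongly_arens_irregular _ \<longleftrightarrow>
     (topological_centre :: 'a cdual cdual set) = range canonical_embedding"


section \<open>The algebraic tensor product\<close>

text \<open>The space \<open>A \<otimes> B\<close> is realised inside the algebraic dual of the space of bilinear forms
  on \<open>A \<times> B\<close>, as the span of the evaluations \<open>\<phi> \<mapsto> \<phi> a b\<close>. As scalars can be absorbed in the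
  first factor, this span consists of the finite sums of evaluations.\<close>

definition tensor_functional ::
    "('a::complex_vector \<times> 'b::complex_vector) list \<Rightarrow> ('a \<Rightarrow> 'b \<Rightarrow> complex) \<Rightarrow> complex" where
  "tensor_functional xs \<phi> = (if cbilinear_form \<phi> then \<Sum>(x, y)\<leftarrow>xs. \<phi> x y else 0)"

typedef (overloaded) ('a::complex_vector, 'b::complex_vector) tensor =
  "range (tensor_functional :: ('a \<times> 'b) list \<Rightarrow> _)"
  by blast

setup_lifting type_definition_tensor

lift_definition elem_tensor :: "'a::complex_vector \<Rightarrow> 'b::complex_vector \<Rightarrow> ('a, 'b) tensor"
  is "\<lambda>x y. tensor_functional [(x, y)]" by blast

lemma cbilinear_form_simps:
  assumes "cbilinear_form \<phi>"
  shows "\<phi> (x + x') y = \<phi> x y + \<phi> x' y" "\<phi> x (y + y') = \<phi> x y + \<phi> x y'"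
    "\<phi> (scaleC c x) y = c * \<phi> x y" "\<phi> x (scaleC c y) = c * \<phi> x y"
    "\<phi> (- x) y = - \<phi> x y" "\<phi> (r *\<^sub>R x) y = r *\<^sub>R \<phi> x y"
proof -
  show 1: "\<phi> (x + x') y = \<phi> x y + \<phi> x' y" "\<phi> x (y + y') = \<phi> x y + \<phi> x y'"
    "\<phi> (scaleC c x) y = c * \<phi> x y" "\<phi> x (scaleC c y) = c * \<phi> x y" for x c
    using assms by (simp_all add: cbilinear_form_def clinear_form_def)
  show "\<phi> (- x) y = - \<phi> x y" using 1(3)[of "-1" x] by (simp add: scaleC_minus1)
  show "\<phi> (r *\<^sub>R x) y = r *\<^sub>R \<phi> x y" by (simp add: scaleR_scaleC 1(3) scaleR_conv_of_real)
qed

lemma tensor_functional_append: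
  "tensor_functional (xs @ ys) = (\<lambda>\<phi>. tensor_functional xs \<phi> + tensor_functional ys \<phi>)"
  by (auto simp: tensor_functional_def fun_eq_iff)

lemma tensor_functional_scaleC:
  "tensor_functional (map (\<lambda>(x, y). (scaleC c x, y)) xs) = (\<lambda>\<phi>. c * tensor_functional xs \<phi>)"
proof
  fix \<phi> show "tensor_functional (map (\<lambda>(x, y). (scaleC c x, y)) xs) \<phi> = c * tensor_functional xs \<phi>"
    by (induction xs)
       (auto simp: tensor_functional_def cbilinear_form_simps distrib_left split: if_splits)
qed

instantiation tensor :: (complex_vector, complex_vector) complex_vector
begin

lift_definition zero_tensor :: "('a, 'b) tensor" is "\<lambda>_. 0"
  by (rule range_eqI[of _ _ "[]"]) (auto simp: tensor_functional_def)

lift_definition plus_tensor :: "('a, 'b) tensor \<Rightarrow> ('a, 'b) tensor \<Rightarrow> ('a, 'b) tensor"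
  is "\<lambda>s t \<phi>. s \<phi> + t \<phi>"
  by (auto simp flip: tensor_functional_append)

lift_definition scaleC_tensor :: "complex \<Rightarrow> ('a, 'b) tensor \<Rightarrow> ('a, 'b) tensor"
  is "\<lambda>c s \<phi>. c * s \<phi>"
  by (auto simp flip: tensor_functional_scaleC)

definition scaleR_tensor :: "real \<Rightarrow> ('a, 'b) tensor \<Rightarrow> ('a, 'b) tensor" where
  "scaleR_tensor r s = scaleC (complex_of_real r) s"

definition uminus_tensor :: "('a, 'b) tensor \<Rightarrow> ('a, 'b) tensor" where
  "uminus_tensor s = scaleC (-1) s"

definition minus_tensor :: "('a, 'b) tensor \<Rightarrow> ('a, 'b) tensor \<Rightarrow> ('a, 'b) tensor" where
  "minus_tensor s t = s + (- t)"

instance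
proof
  fix s t u :: "('a, 'b) tensor" and c d :: complex and q r :: real
  show "s + t + u = s + (t + u)" by transfer (simp add: algebra_simps)
  show "s + t = t + s" by transfer (simp add: algebra_simps)
  show "0 + s = s" by transfer simp
  show "- s + s = 0" unfolding uminus_tensor_def by transfer simp
  show "s - t = s + - t" by (rule minus_tensor_def)
  show A: "scaleC c (s + t) = scaleC c s + scaleC c t" for c
    by transfer (simp add: algebra_simps)
  show B: "scaleC (c + d) s = scaleC c s + scaleC d s" for c d
    by transfer (simp add: algebra_simps)
  show C: "scaleC c (scaleC d s) = scaleC (c * d) s" for c d
    by transfer (simp add: algebra_simps)
  show "r *\<^sub>R s = scaleC (complex_of_real r) s" by (rule scaleR_tensor_def)
  show "r *\<^sub>R (s + t) = r *\<^sub>R s + r *\<^sub>R t" by (simp add: scaleR_tensor_def A)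
  show "(q + r) *\<^sub>R s = q *\<^sub>R s + r *\<^sub>R s" by (simp add: scaleR_tensor_def B)
  show "q *\<^sub>R r *\<^sub>R s = (q * r) *\<^sub>R s" by (simp add: scaleR_tensor_def C)
  show "1 *\<^sub>R s = s" unfolding scaleR_tensor_def by transfer simp
qed

end

lemma elem_tensor_bilinear:
  "elem_tensor (x + x') y = elem_tensor x y + elem_tensor x' y"
  "elem_tensor x (y + y') = elem_tensor x y + elem_tensor x y'"
  "elem_tensor (scaleC c x) y = scaleC c (elem_tensor x y)"
  "elem_tensor x (scaleC c y) = scaleC c (elem_tensor x y)"
  by (transfer; auto simp: tensor_functional_def fun_eq_iff cbilinear_form_simps)+

lemma tensor_functional_eq_sum:
  "tensor_functional xs = Rep_tensor (\<Sum>(x, y)\<leftarrow>xs. elem_tensor x y)"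
proof (induction xs)
  case Nil
  then show ?case by (simp add: zero_tensor.rep_eq tensor_functional_def fun_eq_iff)
next
  case (Cons p xs)
  then show ?case
    using tensor_functional_append[of "[p]" xs]
    by (cases p) (simp add: plus_tensor.rep_eq elem_tensor.rep_eq)
qed

lemma tensor_is_sum: "\<exists>xs. u = (\<Sum>(x, y)\<leftarrow>xs. elem_tensor x y)"
  using Rep_tensor[of u] by (auto simp: tensor_functional_eq_sum Rep_tensor_inject)

text \<open>The list product represents the bilinear extension of \<open>(a \<otimes> b) (c \<otimes> d) = ac \<otimes> bd\<close>;
  the product of tensors, defined below without choosing representatives, is characterised by
  \<open>elem_tensor_mult\<close>.\<close>

definition list_product :: "('a::times \<times> 'b::times) list \<Rightarrow> ('a \<times> 'b) list \<Rightarrow> ('a \<times> 'b) list" where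
  "list_product xs ys = concat (map (\<lambda>(a, b). map (\<lambda>(c, d). (a * c, b * d)) ys) xs)"

lemma list_product_simps:
  "list_product [] ys = []"
  "list_product ((a, b) # xs) ys = map (\<lambda>(c, d). (a * c, b * d)) ys @ list_product xs ys"
  by (simp_all add: list_product_def)

lemma cbilinear_form_mult:
  fixes \<phi> :: "'a::complex_algebra \<Rightarrow> 'b::complex_algebra \<Rightarrow> complex"
  assumes "cbilinear_form \<phi>"
  shows "cbilinear_form (\<lambda>c d. \<phi> (a * c) (b * d))"
  by (auto simp: cbilinear_form_def clinear_form_def distrib_left mult_scaleC_right
      cbilinear_form_simps[OF assms])

lemma tensor_functional_mult:
  fixes xs ys :: "('a::complex_algebra \<times> 'b::complex_algebra) list"
  assumes \<phi>: "cbilinear_form \<phi>"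
  shows "tensor_functional xs (\<lambda>a b. tensor_functional ys (\<lambda>c d. \<phi> (a * c) (b * d)))
    = tensor_functional (list_product xs ys) \<phi>"
proof -
  let ?\<psi> = "\<lambda>a b. \<Sum>(c, d)\<leftarrow>ys. \<phi> (a * c) (b * d)"
  have eq: "(\<lambda>a b. tensor_functional ys (\<lambda>c d. \<phi> (a * c) (b * d))) = ?\<psi>"
    by (simp add: tensor_functional_def cbilinear_form_mult[OF \<phi>])
  have \<psi>: "cbilinear_form ?\<psi>"
    by (induction ys)
       (auto simp: cbilinear_form_def clinear_form_def distrib_right distrib_left mult_scaleC_left
          cbilinear_form_simps[OF \<phi>] split: prod.splits)
  have "(\<Sum>(a, b)\<leftarrow>xs. ?\<psi> a b) = (\<Sum>(x, y)\<leftarrow>list_product xs ys. \<phi> x y)"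
    by (induction xs) (auto simp: list_product_simps o_def case_prod_unfold)
  then show ?thesis
    unfolding eq by (simp add: tensor_functional_def \<psi> \<phi>)
qed

instantiation tensor :: (complex_algebra, complex_algebra) complex_algebra
begin

lift_definition times_tensor :: "('a, 'b) tensor \<Rightarrow> ('a, 'b) tensor \<Rightarrow> ('a, 'b) tensor"
  is "\<lambda>s t \<phi>. if cbilinear_form \<phi> then s (\<lambda>a b. t (\<lambda>c d. \<phi> (a * c) (b * d))) else 0"
proof -
  fix s t :: "('a \<Rightarrow> 'b \<Rightarrow> complex) \<Rightarrow> complex"
  assume "s \<in> range tensor_functional" "t \<in> range tensor_functional"
  then obtain xs ys where s: "s = tensor_functional xs" and t: "t = tensor_functional ys" by blast
  have "(\<lambda>\<phi>. if cbilinear_form \<phi> then s (\<lambda>a b. t (\<lambda>c d. \<phi> (a * c) (b * d))) else 0)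
      = tensor_functional (list_product xs ys)"
    unfolding s t by (auto simp: fun_eq_iff tensor_functional_mult) (simp add: tensor_functional_def)
  then show "(\<lambda>\<phi>. if cbilinear_form \<phi> then s (\<lambda>a b. t (\<lambda>c d. \<phi> (a * c) (b * d))) else 0)
      \<in> range tensor_functional" by blast
qed

lemma elem_tensor_mult: "elem_tensor a b * elem_tensor c d = elem_tensor (a * c) (b * d)"
  for a c :: 'a and b d :: 'b
proof transfer
  fix a c :: 'a and b d :: 'b
  show "(\<lambda>\<phi>. if cbilinear_form \<phi> then tensor_functional [(a, b)]
          (\<lambda>a b. tensor_functional [(c, d)] (\<lambda>c d. \<phi> (a * c) (b * d))) else 0)
      = tensor_functional [(a * c, b * d)]"
    by (auto simp: fun_eq_iff tensor_functional_mult list_product_def) (simp add: tensor_functional_def)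
qed

lemma sum_elem_tensor_mult:
  fixes xs ys :: "('a \<times> 'b) list"
  shows "(\<Sum>(x, y)\<leftarrow>xs. elem_tensor x y) * (\<Sum>(x, y)\<leftarrow>ys. elem_tensor x y)
    = (\<Sum>(x, y)\<leftarrow>list_product xs ys. elem_tensor x y)"
  by (rule Rep_tensor_inject[THEN iffD1])
     (auto simp: fun_eq_iff times_tensor.rep_eq tensor_functional_eq_sum[symmetric] tensor_functional_mult,
      simp add: tensor_functional_def)

instance
proof
  fix s t u :: "('a, 'b) tensor" and c :: complex and r :: real
  show dr: "(s + t) * u = s * u + t * u" for s t u :: "('a, 'b) tensor"
    by transfer (auto simp: fun_eq_iff)
  have "s * (t + u) = s * t + s * u \<and> scaleC c s * t = scaleC c (s * t)
      \<and> s * scaleC c t = scaleC c (s * t)" for c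
  proof -
    obtain xs where s: "s = (\<Sum>(x, y)\<leftarrow>xs. elem_tensor x y)" using tensor_is_sum by blast
    obtain ys where t: "t = (\<Sum>(x, y)\<leftarrow>ys. elem_tensor x y)" using tensor_is_sum by blast
    obtain zs where u: "u = (\<Sum>(x, y)\<leftarrow>zs. elem_tensor x y)" using tensor_is_sum by blast
    have sc: "scaleC c (\<Sum>(x, y)\<leftarrow>xs. elem_tensor x y)
        = (\<Sum>(x, y)\<leftarrow>map (\<lambda>(x, y). (scaleC c x, y)) xs. elem_tensor x y)"
      for xs :: "('a \<times> 'b) list"
      by (rule Rep_tensor_inject[THEN iffD1])
        (simp only: scaleC_tensor.rep_eq tensor_functional_eq_sum[symmetric] tensor_functional_scaleC)
    have z: "scaleC c (0::('a, 'b) tensor) = 0" by transfer simp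
    have "(\<Sum>(x, y)\<leftarrow>list_product xs (ys @ zs). elem_tensor x y)
      = (\<Sum>(x, y)\<leftarrow>list_product xs ys. elem_tensor x y) + (\<Sum>(x, y)\<leftarrow>list_product xs zs. elem_tensor x y)"
      by (induction xs) (auto simp: list_product_simps)
    then have 1: "s * (t + u) = s * t + s * u"
      unfolding s t u by (simp add: sum_elem_tensor_mult flip: sum_list_append map_append)
    have m: "list_product (map (\<lambda>(x, y). (scaleC c x, y)) xs) ys
        = map (\<lambda>(x, y). (scaleC c x, y)) (list_product xs ys)"
      by (induction xs) (auto simp: list_product_simps mult_scaleC_left)
    have m': "list_product xs (map (\<lambda>(x, y). (scaleC c x, y)) ys)
        = map (\<lambda>(x, y). (scaleC c x, y)) (list_product xs ys)"
      by (induction xs) (auto simp: list_product_simps mult_scaleC_right)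
    show ?thesis
      using 1 unfolding s t sc sum_elem_tensor_mult m m' by simp
  qed
  note * = this
  show "s * (t + u) = s * t + s * u" "scaleC c s * t = scaleC c (s * t)"
    "s * scaleC c t = scaleC c (s * t)" using * by blast+
  show "r *\<^sub>R s * t = r *\<^sub>R (s * t)" "s * r *\<^sub>R t = r *\<^sub>R (s * t)"
    using * by (simp_all add: scaleR_tensor_def)
  show "s * t * u = s * (t * u)"
  proof -
    obtain xs where s: "s = (\<Sum>(x, y)\<leftarrow>xs. elem_tensor x y)" using tensor_is_sum by blast
    obtain ys where t: "t = (\<Sum>(x, y)\<leftarrow>ys. elem_tensor x y)" using tensor_is_sum by blast
    obtain zs where u: "u = (\<Sum>(x, y)\<leftarrow>zs. elem_tensor x y)" using tensor_is_sum by blast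
    have 1: "list_product (xs @ xs') zs = list_product xs zs @ list_product xs' zs"
      for xs xs' :: "('a \<times> 'b) list" by (simp add: list_product_def)
    have 2: "list_product (map (\<lambda>(c, d). (a * c, b * d)) ys) zs
        = map (\<lambda>(c, d). (a * c, b * d)) (list_product ys zs)" for a b
      by (induction ys) (auto simp: list_product_simps mult.assoc)
    have "list_product (list_product xs ys) zs = list_product xs (list_product ys zs)"
      by (induction xs) (auto simp: list_product_simps 1 2)
    then show ?thesis unfolding s t u sum_elem_tensor_mult by simp
  qed
qed

end


section \<open>The projective tensor product\<close>

definition projective_norm ::
    "('a::complex_normed_vector, 'b::complex_normed_vector) tensor \<Rightarrow> real" where
  "projective_norm u =
     Inf {(\<Sum>(x, y)\<leftarrow>xs. norm x * norm y) | xs. u = (\<Sum>(x, y)\<leftarrow>xs. elem_tensor x y)}"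

lemma list_cost_nonneg: "0 \<le> (\<Sum>(x, y)\<leftarrow>xs. norm x * norm y)"
  by (rule sum_list_nonneg) auto

lemma projective_norm_le: "projective_norm (\<Sum>(x, y)\<leftarrow>xs. elem_tensor x y) \<le> (\<Sum>(x, y)\<leftarrow>xs. norm x * norm y)"
  unfolding projective_norm_def
  by (rule cInf_lower) (auto intro!: bdd_belowI[of _ 0] list_cost_nonneg)

lemma projective_norm_nonneg: "0 \<le> projective_norm u"
  unfolding projective_norm_def using tensor_is_sum[of u]
  by (intro cInf_greatest) (auto intro: list_cost_nonneg)

lemma projective_norm_approx:
  assumes "0 < e"
  obtains xs where "u = (\<Sum>(x, y)\<leftarrow>xs. elem_tensor x y)"
    "(\<Sum>(x, y)\<leftarrow>xs. norm x * norm y) < projective_norm u + e"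
proof -
  let ?S = "{(\<Sum>(x, y)\<leftarrow>xs. norm x * norm y) | xs. u = (\<Sum>(x, y)\<leftarrow>xs. elem_tensor x y)}"
  have "?S \<noteq> {}" using tensor_is_sum[of u] by blast
  moreover have "Inf ?S < projective_norm u + e" using assms by (simp add: projective_norm_def)
  ultimately obtain z where "z \<in> ?S" "z < projective_norm u + e"
    using cInf_lessD by meson
  with that show ?thesis by blast
qed

lemma projective_norm_zero: "projective_norm 0 = 0"
  using projective_norm_le[of "[]"] by (intro antisym projective_norm_nonneg) simp

lemma projective_norm_triangle: "projective_norm (u + v) \<le> projective_norm u + projective_norm v"
proof (rule field_le_epsilon)
  fix e :: real assume "0 < e"
  then have e: "0 < e / 2" by simp
  obtain xs where xs: "u = (\<Sum>(x, y)\<leftarrow>xs. elem_tensor x y)"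
    "(\<Sum>(x, y)\<leftarrow>xs. norm x * norm y) < projective_norm u + e / 2" by (rule projective_norm_approx[OF e])
  obtain ys where ys: "v = (\<Sum>(x, y)\<leftarrow>ys. elem_tensor x y)"
    "(\<Sum>(x, y)\<leftarrow>ys. norm x * norm y) < projective_norm v + e / 2" by (rule projective_norm_approx[OF e])
  show "projective_norm (u + v) \<le> projective_norm u + projective_norm v + e"
    using projective_norm_le[of "xs @ ys"] xs ys by simp
qed

lemma scaleC_sum_elem_tensor:
  "scaleC c (\<Sum>(x, y)\<leftarrow>xs. elem_tensor x y)
    = (\<Sum>(x, y)\<leftarrow>map (\<lambda>(x, y). (scaleC c x, y)) xs. elem_tensor x y)"
  by (rule Rep_tensor_inject[THEN iffD1])
    (simp only: scaleC_tensor.rep_eq tensor_functional_eq_sum[symmetric] tensor_functional_scaleC)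

lemma projective_norm_scaleC: "projective_norm (scaleC c u) = cmod c * projective_norm u"
proof -
  have le: "projective_norm (scaleC c u) \<le> cmod c * projective_norm u"
    for c and u :: "('a, 'b) tensor"
  proof (rule field_le_epsilon)
    fix e :: real assume "0 < e"
    then have e: "0 < e / (cmod c + 1)" by (simp add: add_nonneg_pos)
    obtain xs where xs: "u = (\<Sum>(x, y)\<leftarrow>xs. elem_tensor x y)"
      "(\<Sum>(x, y)\<leftarrow>xs. norm x * norm y) < projective_norm u + e / (cmod c + 1)"
      by (rule projective_norm_approx[OF e])
    have "projective_norm (scaleC c u) \<le> (\<Sum>(x, y)\<leftarrow>map (\<lambda>(x, y). (scaleC c x, y)) xs. norm x * norm y)"
      unfolding xs(1) scaleC_sum_elem_tensor by (rule projective_norm_le)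
    also have "\<dots> = cmod c * (\<Sum>(x, y)\<leftarrow>xs. norm x * norm y)"
      by (induction xs) (auto simp: norm_scaleC algebra_simps)
    also have "\<dots> \<le> cmod c * (projective_norm u + e / (cmod c + 1))"
      using xs(2) by (intro mult_left_mono) auto
    also have "\<dots> \<le> cmod c * projective_norm u + e"
    proof -
      have "cmod c * (e / (cmod c + 1)) = (cmod c / (cmod c + 1)) * e" by simp
      also have "\<dots> \<le> 1 * e"
        using \<open>0 < e\<close> by (intro mult_right_mono) (auto simp: divide_le_eq_1 add_nonneg_pos)
      finally show ?thesis by (simp add: distrib_left)
    qed
    finally show "projective_norm (scaleC c u) \<le> cmod c * projective_norm u + e" .
  qed
  show ?thesis
  proof (cases "c = 0")
    case True
    then show ?thesis
      using le[of 0 u] projective_norm_nonneg[of "scaleC 0 u"] by simp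
  next
    case False
    have "projective_norm u = projective_norm (scaleC (inverse c) (scaleC c u))"
      using False by (simp add: scaleC_scaleC scaleC_one)
    also have "\<dots> \<le> cmod (inverse c) * projective_norm (scaleC c u)" by (rule le)
    finally have "cmod c * projective_norm u \<le> cmod c * (cmod (inverse c) * projective_norm (scaleC c u))"
      by (rule mult_left_mono) simp
    also have "\<dots> = projective_norm (scaleC c u)"
      using False by (simp add: norm_inverse)
    finally show ?thesis using le[of c u] by simp
  qed
qed

lemma projective_norm_minus: "projective_norm (- u) = projective_norm u"
  using projective_norm_scaleC[of "-1" u] by (simp add: scaleC_minus1)

lemma projective_norm_minus_commute: "projective_norm (u - v) = projective_norm (v - u)"
  using projective_norm_minus[of "u - v"] by simp

lemma projective_norm_diff_triangle:
  "projective_norm (u - w) \<le> projective_norm (u - v) + projective_norm (v - w)"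
  using projective_norm_triangle[of "u - v" "v - w"] by simp

lemma projective_norm_abs_diff: "\<bar>projective_norm u - projective_norm v\<bar> \<le> projective_norm (u - v)"
  using projective_norm_triangle[of "u - v" v] projective_norm_triangle[of "v - u" u]
  by (simp add: projective_norm_minus_commute[of v u])

lemma projective_norm_mult:
  fixes u v :: "('a::complex_normed_algebra, 'b::complex_normed_algebra) tensor"
  shows "projective_norm (u * v) \<le> projective_norm u * projective_norm v"
proof -
  have *: "(\<Sum>(x, y)\<leftarrow>list_product xs ys. norm x * norm y)
      \<le> (\<Sum>(x, y)\<leftarrow>xs. norm x * norm y) * (\<Sum>(x, y)\<leftarrow>ys. norm x * norm y)"
    for xs ys :: "('a \<times> 'b) list"
  proof (induction xs)
    case Nil
    then show ?case by (simp add: list_product_simps)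
  next
    case (Cons p xs)
    obtain a b where p: "p = (a, b)" by (cases p)
    have "(\<Sum>(x, y)\<leftarrow>map (\<lambda>(c, d). (a * c, b * d)) ys. norm x * norm y)
        \<le> norm a * norm b * (\<Sum>(x, y)\<leftarrow>ys. norm x * norm y)"
    proof (induction ys)
      case (Cons q ys)
      obtain c d where q: "q = (c, d)" by (cases q)
      have "norm (a * c) * norm (b * d) \<le> (norm a * norm c) * (norm b * norm d)"
        by (intro mult_mono norm_mult_ineq) auto
      with Cons show ?case by (simp add: q algebra_simps)
    qed simp
    with Cons show ?case by (simp add: p list_product_simps algebra_simps)
  qed
  have "projective_norm (u * v) \<le> (projective_norm u + e) * (projective_norm v + e)" if e: "0 < e" for e
  proof -
    obtain xs where xs: "u = (\<Sum>(x, y)\<leftarrow>xs. elem_tensor x y)"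
      "(\<Sum>(x, y)\<leftarrow>xs. norm x * norm y) < projective_norm u + e" by (rule projective_norm_approx[OF e])
    obtain ys where ys: "v = (\<Sum>(x, y)\<leftarrow>ys. elem_tensor x y)"
      "(\<Sum>(x, y)\<leftarrow>ys. norm x * norm y) < projective_norm v + e" by (rule projective_norm_approx[OF e])
    have "projective_norm (u * v) \<le> (\<Sum>(x, y)\<leftarrow>list_product xs ys. norm x * norm y)"
      unfolding xs(1) ys(1) sum_elem_tensor_mult by (rule projective_norm_le)
    also have "\<dots> \<le> (\<Sum>(x, y)\<leftarrow>xs. norm x * norm y) * (\<Sum>(x, y)\<leftarrow>ys. norm x * norm y)" by (rule *)
    also have "\<dots> \<le> (projective_norm u + e) * (projective_norm v + e)"
      using xs(2) ys(2) list_cost_nonneg[of ys] list_cost_nonneg[of xs] e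
        projective_norm_nonneg[of u]
      by (intro mult_mono) auto
    finally show ?thesis .
  qed
  then have "\<forall>\<^sub>F e in at_right 0. projective_norm (u * v) \<le> (projective_norm u + e) * (projective_norm v + e)"
    by (auto simp: eventually_at_right_less intro: eventually_at_rightI[of 0 1])
  moreover have "((\<lambda>e. (projective_norm u + e) * (projective_norm v + e)) \<longlongrightarrow>
      (projective_norm u + 0) * (projective_norm v + 0)) (at_right 0)"
    by (intro tendsto_intros)
  ultimately have "projective_norm (u * v) \<le> (projective_norm u + 0) * (projective_norm v + 0)"
    by (intro tendsto_lowerbound) auto
  then show ?thesis by simp
qed

text \<open>The completion consists of the Cauchy sequences modulo null sequences. As definiteness of
  the projective norm is not needed for this construction, it is not proved here.\<close>

definition tensor_Cauchy ::
    "(nat \<Rightarrow> ('a::complex_normed_vector, 'b::complex_normed_vector) tensor) \<Rightarrow> bool" where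
  "tensor_Cauchy s \<longleftrightarrow> (\<forall>e>0. \<exists>N. \<forall>m\<ge>N. \<forall>n\<ge>N. projective_norm (s m - s n) < e)"

definition tensor_Cauchy_rel ::
    "(nat \<Rightarrow> ('a::complex_normed_vector, 'b::complex_normed_vector) tensor) \<Rightarrow>
     (nat \<Rightarrow> ('a, 'b) tensor) \<Rightarrow> bool" where
  "tensor_Cauchy_rel s t \<longleftrightarrow> tensor_Cauchy s \<and> tensor_Cauchy t
     \<and> (\<lambda>n. projective_norm (s n - t n)) \<longlonglongrightarrow> 0"

lemma tendsto_0_le_projective:
  assumes "f \<longlonglongrightarrow> 0" "\<And>n. projective_norm (s n) \<le> f n"
  shows "(\<lambda>n. projective_norm (s n)) \<longlonglongrightarrow> 0"
  by (rule tendsto_sandwich[OF _ _ tendsto_const assms(1)])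
     (simp_all add: assms(2) projective_norm_nonneg)

lemma tensor_Cauchy_const: "tensor_Cauchy (\<lambda>_. u)"
  by (simp add: tensor_Cauchy_def projective_norm_zero)

lemma tensor_Cauchy_rel_refl: "tensor_Cauchy s \<Longrightarrow> tensor_Cauchy_rel s s"
  by (simp add: tensor_Cauchy_rel_def projective_norm_zero)

lemma tensor_CauchyI:
  assumes "tensor_Cauchy s" "\<And>m n. projective_norm (t m - t n) \<le> K * projective_norm (s m - s n)"
  shows "tensor_Cauchy t"
  unfolding tensor_Cauchy_def
proof safe
  fix e :: real assume "0 < e"
  define L where "L = \<bar>K\<bar> + 1"
  have L: "L > 0" "K \<le> L" by (auto simp: L_def)
  with \<open>0 < e\<close> have "0 < e / L" by simp
  then obtain N where N: "\<And>m n. m \<ge> N \<Longrightarrow> n \<ge> N \<Longrightarrow> projective_norm (s m - s n) < e / L"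
    using assms(1) unfolding tensor_Cauchy_def by blast
  have "projective_norm (t m - t n) < e" if "m \<ge> N" "n \<ge> N" for m n
  proof -
    have "projective_norm (t m - t n) \<le> L * projective_norm (s m - s n)"
      using assms(2)[of m n] mult_right_mono[OF L(2) projective_norm_nonneg] order_trans by blast
    also have "\<dots> < L * (e / L)" using N[OF that] L(1) by (intro mult_strict_left_mono)
    finally show ?thesis using L(1) by simp
  qed
  then show "\<exists>N. \<forall>m\<ge>N. \<forall>n\<ge>N. projective_norm (t m - t n) < e" by blast
qed

lemma tensor_Cauchy_add:
  assumes "tensor_Cauchy s" "tensor_Cauchy t" shows "tensor_Cauchy (\<lambda>n. s n + t n)"
  unfolding tensor_Cauchy_def
proof safe
  fix e :: real assume "0 < e"
  then have "0 < e / 2" by simp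
  obtain M where M: "\<And>m n. m \<ge> M \<Longrightarrow> n \<ge> M \<Longrightarrow> projective_norm (s m - s n) < e / 2"
    using assms(1) \<open>0 < e / 2\<close> unfolding tensor_Cauchy_def by blast
  obtain N where N: "\<And>m n. m \<ge> N \<Longrightarrow> n \<ge> N \<Longrightarrow> projective_norm (t m - t n) < e / 2"
    using assms(2) \<open>0 < e / 2\<close> unfolding tensor_Cauchy_def by blast
  have "projective_norm (s m + t m - (s n + t n)) < e" if "m \<ge> max M N" "n \<ge> max M N" for m n
  proof -
    have "projective_norm (s m + t m - (s n + t n)) = projective_norm ((s m - s n) + (t m - t n))"
      by (simp add: algebra_simps)
    also have "\<dots> \<le> projective_norm (s m - s n) + projective_norm (t m - t n)"
      by (rule projective_norm_triangle)
    also have "\<dots> < e" using M[of m n] N[of m n] that by simp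
    finally show ?thesis .
  qed
  then show "\<exists>N. \<forall>m\<ge>N. \<forall>n\<ge>N. projective_norm (s m + t m - (s n + t n)) < e" by blast
qed

lemma tensor_Cauchy_scaleC: "tensor_Cauchy s \<Longrightarrow> tensor_Cauchy (\<lambda>n. scaleC c (s n))"
proof (erule tensor_CauchyI[where K = "cmod c"])
  fix m n
  have "scaleC c (s m) - scaleC c (s n) = scaleC c (s m - s n)"
    using scaleC_add_right[of c "s m - s n" "s n"] by (simp add: algebra_simps)
  then show "projective_norm (scaleC c (s m) - scaleC c (s n)) \<le> cmod c * projective_norm (s m - s n)"
    by (simp add: projective_norm_scaleC)
qed

lemma tensor_Cauchy_minus: "tensor_Cauchy s \<Longrightarrow> tensor_Cauchy (\<lambda>n. - s n)"
  using tensor_Cauchy_scaleC[of s "-1"] by (simp add: scaleC_minus1)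

lemma tensor_Cauchy_norm_convergent:
  assumes "tensor_Cauchy s" shows "convergent (\<lambda>n. projective_norm (s n))"
proof -
  have "Cauchy (\<lambda>n. projective_norm (s n))"
    unfolding Cauchy_def dist_real_def
  proof safe
    fix e :: real assume "0 < e"
    then obtain N where N: "\<forall>m\<ge>N. \<forall>n\<ge>N. projective_norm (s m - s n) < e"
      using assms unfolding tensor_Cauchy_def by blast
    show "\<exists>M. \<forall>m\<ge>M. \<forall>n\<ge>M. \<bar>projective_norm (s m) - projective_norm (s n)\<bar> < e"
      using N projective_norm_abs_diff le_less_trans by blast
  qed
  then show ?thesis by (simp add: Cauchy_convergent_iff)
qed

lemma tensor_Cauchy_LIMSEQ:
  "tensor_Cauchy s \<Longrightarrow> (\<lambda>n. projective_norm (s n)) \<longlonglongrightarrow> lim (\<lambda>n. projective_norm (s n))"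
  using tensor_Cauchy_norm_convergent convergent_LIMSEQ_iff by blast

lemma tensor_Cauchy_bounded:
  assumes "tensor_Cauchy s" shows "\<exists>K>0. \<forall>n. projective_norm (s n) \<le> K"
proof -
  have "Bseq (\<lambda>n. projective_norm (s n))"
    using tensor_Cauchy_norm_convergent[OF assms] by (rule convergent_imp_Bseq)
  then show ?thesis by (simp add: Bseq_def projective_norm_nonneg)
qed

lemma projective_norm_mult_diff:
  fixes a b c d :: "('a::complex_normed_algebra, 'b::complex_normed_algebra) tensor"
  assumes "projective_norm a \<le> K" "projective_norm d \<le> L"
  shows "projective_norm (a * b - c * d) \<le> K * projective_norm (b - d) + L * projective_norm (a - c)"
proof -
  have "a * b - c * d = a * (b - d) + (a - c) * d" by (simp add: algebra_simps)
  then have "projective_norm (a * b - c * d)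
      \<le> projective_norm a * projective_norm (b - d) + projective_norm (a - c) * projective_norm d"
    using projective_norm_triangle[of "a * (b - d)" "(a - c) * d"]
      projective_norm_mult[of a "b - d"] projective_norm_mult[of "a - c" d] by simp
  also have "\<dots> \<le> K * projective_norm (b - d) + projective_norm (a - c) * L"
    using assms by (intro add_mono mult_right_mono mult_left_mono projective_norm_nonneg)
  finally show ?thesis by (simp add: mult.commute)
qed

lemma tensor_Cauchy_mult:
  fixes s t :: "nat \<Rightarrow> ('a::complex_normed_algebra, 'b::complex_normed_algebra) tensor"
  assumes "tensor_Cauchy s" "tensor_Cauchy t" shows "tensor_Cauchy (\<lambda>n. s n * t n)"
  unfolding tensor_Cauchy_def
proof safe
  fix e :: real assume "0 < e"
  obtain K where K: "K > 0" "\<And>n. projective_norm (s n) \<le> K" 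
    using tensor_Cauchy_bounded[OF assms(1)] by blast
  obtain L where L: "L > 0" "\<And>n. projective_norm (t n) \<le> L" 
    using tensor_Cauchy_bounded[OF assms(2)] by blast
  have e: "0 < e / (2 * L)" "0 < e / (2 * K)" using \<open>0 < e\<close> K L by simp_all
  obtain M where M: "\<And>m n. m \<ge> M \<Longrightarrow> n \<ge> M \<Longrightarrow> projective_norm (s m - s n) < e / (2 * L)"
    using assms(1) e(1) unfolding tensor_Cauchy_def by blast
  obtain N where N: "\<And>m n. m \<ge> N \<Longrightarrow> n \<ge> N \<Longrightarrow> projective_norm (t m - t n) < e / (2 * K)"
    using assms(2) e(2) unfolding tensor_Cauchy_def by blast
  have "projective_norm (s m * t m - s n * t n) < e" if "m \<ge> max M N" "n \<ge> max M N" for m n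
  proof -
    have "projective_norm (s m * t m - s n * t n)
        \<le> K * projective_norm (t m - t n) + L * projective_norm (s m - s n)"
      by (rule projective_norm_mult_diff[OF K(2) L(2)])
    also have "\<dots> < K * (e / (2 * K)) + L * (e / (2 * L))"
      using M[of m n] N[of m n] that K(1) L(1) by (intro add_strict_mono mult_strict_left_mono) auto
    also have "\<dots> = e" using K(1) L(1) by simp
    finally show ?thesis .
  qed
  then show "\<exists>N. \<forall>m\<ge>N. \<forall>n\<ge>N. projective_norm (s m * t m - s n * t n) < e" by blast
qed

quotient_type (overloaded) ('a, 'b) projective_tensor =
  "nat \<Rightarrow> ('a::complex_normed_vector, 'b::complex_normed_vector) tensor" / partial: tensor_Cauchy_rel
proof (rule part_equivpI)
  show "\<exists>s :: nat \<Rightarrow> ('a, 'b) tensor. tensor_Cauchy_rel s s"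
    using tensor_Cauchy_rel_refl[OF tensor_Cauchy_const] by blast
  show "symp (tensor_Cauchy_rel :: (nat \<Rightarrow> ('a, 'b) tensor) \<Rightarrow> _)"
    unfolding symp_def tensor_Cauchy_rel_def by (simp add: projective_norm_minus_commute)
  show "transp (tensor_Cauchy_rel :: (nat \<Rightarrow> ('a, 'b) tensor) \<Rightarrow> _)"
  proof (rule transpI)
    fix s t u :: "nat \<Rightarrow> ('a, 'b) tensor"
    assume *: "tensor_Cauchy_rel s t" "tensor_Cauchy_rel t u"
    have **: "(\<lambda>n. projective_norm (s n - t n) + projective_norm (t n - u n)) \<longlonglongrightarrow> 0"
      using * unfolding tensor_Cauchy_rel_def by (intro tendsto_add_zero) auto
    have "(\<lambda>n. projective_norm (s n - u n)) \<longlonglongrightarrow> 0"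
      by (rule tendsto_0_le_projective[OF **]) (rule projective_norm_diff_triangle)
    with * show "tensor_Cauchy_rel s u" by (simp add: tensor_Cauchy_rel_def)
  qed
qed


lemma tensor_Cauchy_rel_self [simp]: "tensor_Cauchy_rel s s \<longleftrightarrow> tensor_Cauchy s"
  using tensor_Cauchy_rel_refl unfolding tensor_Cauchy_rel_def by blast

lemma tensor_Cauchy_rel_eqI: "tensor_Cauchy s \<Longrightarrow> (\<And>n. s n = t n) \<Longrightarrow> tensor_Cauchy_rel s t"
  by (metis ext tensor_Cauchy_rel_refl)

lemma tensor_Cauchy_rel_add:
  assumes "tensor_Cauchy_rel s s'" "tensor_Cauchy_rel t t'"
  shows "tensor_Cauchy_rel (\<lambda>n. s n + t n) (\<lambda>n. s' n + t' n)"
proof -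
  have "(\<lambda>n. projective_norm (s n - s' n) + projective_norm (t n - t' n)) \<longlonglongrightarrow> 0"
    using assms unfolding tensor_Cauchy_rel_def by (intro tendsto_add_zero) auto
  then have "(\<lambda>n. projective_norm (s n + t n - (s' n + t' n))) \<longlonglongrightarrow> 0"
    by (rule tendsto_0_le_projective) (simp only: add_diff_add projective_norm_triangle)
  then show ?thesis using assms by (simp add: tensor_Cauchy_rel_def tensor_Cauchy_add)
qed

lemma tensor_Cauchy_rel_scaleC:
  assumes "tensor_Cauchy_rel s s'"
  shows "tensor_Cauchy_rel (\<lambda>n. scaleC c (s n)) (\<lambda>n. scaleC c (s' n))"
proof -
  have "scaleC c (s n) - scaleC c (s' n) = scaleC c (s n - s' n)" for n
    using scaleC_add_right[of c "s n - s' n" "s' n"] by (simp add: algebra_simps)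
  moreover have "(\<lambda>n. cmod c * projective_norm (s n - s' n)) \<longlonglongrightarrow> 0"
    using assms unfolding tensor_Cauchy_rel_def by (intro tendsto_mult_right_zero) auto
  ultimately show ?thesis
    using assms by (simp add: tensor_Cauchy_rel_def tensor_Cauchy_scaleC projective_norm_scaleC)
qed

lemma tensor_Cauchy_rel_mult:
  fixes s t :: "nat \<Rightarrow> ('a::complex_normed_algebra, 'b::complex_normed_algebra) tensor"
  assumes "tensor_Cauchy_rel s s'" "tensor_Cauchy_rel t t'"
  shows "tensor_Cauchy_rel (\<lambda>n. s n * t n) (\<lambda>n. s' n * t' n)"
proof -
  have C: "tensor_Cauchy s" "tensor_Cauchy s'" "tensor_Cauchy t" "tensor_Cauchy t'"
    using assms by (auto simp: tensor_Cauchy_rel_def)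
  obtain K where K: "\<And>n. projective_norm (s n) \<le> K" using tensor_Cauchy_bounded[OF C(1)] by blast
  obtain L where L: "\<And>n. projective_norm (t' n) \<le> L" using tensor_Cauchy_bounded[OF C(4)] by blast
  have "(\<lambda>n. K * projective_norm (t n - t' n) + L * projective_norm (s n - s' n)) \<longlonglongrightarrow> 0"
    using assms unfolding tensor_Cauchy_rel_def
    by (intro tendsto_add_zero tendsto_mult_right_zero) auto
  then have "(\<lambda>n. projective_norm (s n * t n - s' n * t' n)) \<longlonglongrightarrow> 0"
    by (rule tendsto_0_le_projective) (rule projective_norm_mult_diff[OF K L])
  then show ?thesis using C by (simp add: tensor_Cauchy_rel_def tensor_Cauchy_mult)
qed

lemma tensor_Cauchy_rel_lim:
  assumes "tensor_Cauchy_rel s t"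
  shows "lim (\<lambda>n. projective_norm (s n)) = lim (\<lambda>n. projective_norm (t n))"
proof -
  have C: "tensor_Cauchy s" "tensor_Cauchy t" using assms by (auto simp: tensor_Cauchy_rel_def)
  have "(\<lambda>n. projective_norm (s n) - projective_norm (t n)) \<longlonglongrightarrow> 0"
  proof (rule Lim_null_comparison)
    show "\<forall>\<^sub>F n in sequentially. norm (projective_norm (s n) - projective_norm (t n)) \<le> projective_norm (s n - t n)"
      by (simp add: projective_norm_abs_diff)
  qed (use assms in \<open>simp add: tensor_Cauchy_rel_def\<close>)
  moreover have "(\<lambda>n. projective_norm (s n) - projective_norm (t n)) \<longlonglongrightarrow>
      lim (\<lambda>n. projective_norm (s n)) - lim (\<lambda>n. projective_norm (t n))"
    using C by (intro tendsto_diff tensor_Cauchy_LIMSEQ)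
  ultimately have "0 = lim (\<lambda>n. projective_norm (s n)) - lim (\<lambda>n. projective_norm (t n))"
    by (rule LIMSEQ_unique)
  then show ?thesis by simp
qed

instantiation projective_tensor :: (complex_normed_vector, complex_normed_vector) complex_vector
begin

lift_definition zero_projective_tensor :: "('a, 'b) projective_tensor" is "\<lambda>_. 0"
  by (simp add: tensor_Cauchy_const)

lift_definition plus_projective_tensor ::
  "('a, 'b) projective_tensor \<Rightarrow> ('a, 'b) projective_tensor \<Rightarrow> ('a, 'b) projective_tensor"
  is "\<lambda>s t n. s n + t n"
  by (rule tensor_Cauchy_rel_add)

lift_definition scaleC_projective_tensor ::
  "complex \<Rightarrow> ('a, 'b) projective_tensor \<Rightarrow> ('a, 'b) projective_tensor"
  is "\<lambda>c s n. scaleC c (s n)"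
  by (rule tensor_Cauchy_rel_scaleC)

definition scaleR_projective_tensor ::
  "real \<Rightarrow> ('a, 'b) projective_tensor \<Rightarrow> ('a, 'b) projective_tensor" where
  "scaleR_projective_tensor r s = scaleC (complex_of_real r) s"

definition uminus_projective_tensor ::
  "('a, 'b) projective_tensor \<Rightarrow> ('a, 'b) projective_tensor" where
  "uminus_projective_tensor s = scaleC (-1) s"

definition minus_projective_tensor ::
  "('a, 'b) projective_tensor \<Rightarrow> ('a, 'b) projective_tensor \<Rightarrow> ('a, 'b) projective_tensor" where
  "minus_projective_tensor s t = s + (- t)"

instance
proof
  fix s t u :: "('a, 'b) projective_tensor" and c d :: complex and q r :: real
  show "s + t + u = s + (t + u)"
    by transfer (rule tensor_Cauchy_rel_eqI, simp_all add: tensor_Cauchy_add add.assoc)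
  show "s + t = t + s"
    by transfer (rule tensor_Cauchy_rel_eqI, simp_all add: tensor_Cauchy_add add.commute)
  show "0 + s = s" by transfer simp
  show "- s + s = 0" unfolding uminus_projective_tensor_def
    by transfer (rule tensor_Cauchy_rel_eqI, simp_all add: tensor_Cauchy_add tensor_Cauchy_const scaleC_minus1)
  show "s - t = s + - t" by (rule minus_projective_tensor_def)
  show A: "scaleC c (s + t) = scaleC c s + scaleC c t" for c
    by transfer (rule tensor_Cauchy_rel_eqI, simp_all add: tensor_Cauchy_add tensor_Cauchy_scaleC scaleC_add_right)
  show B: "scaleC (c + d) s = scaleC c s + scaleC d s" for c d
    by transfer (rule tensor_Cauchy_rel_eqI, simp_all add: tensor_Cauchy_add tensor_Cauchy_scaleC scaleC_add_left)
  show C: "scaleC c (scaleC d s) = scaleC (c * d) s" for c d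
    by transfer (rule tensor_Cauchy_rel_eqI, simp_all add: tensor_Cauchy_scaleC scaleC_scaleC)
  show "r *\<^sub>R s = scaleC (complex_of_real r) s" by (rule scaleR_projective_tensor_def)
  show "r *\<^sub>R (s + t) = r *\<^sub>R s + r *\<^sub>R t" by (simp add: scaleR_projective_tensor_def A)
  show "(q + r) *\<^sub>R s = q *\<^sub>R s + r *\<^sub>R s" by (simp add: scaleR_projective_tensor_def B)
  show "q *\<^sub>R r *\<^sub>R s = (q * r) *\<^sub>R s" by (simp add: scaleR_projective_tensor_def C)
  show "1 *\<^sub>R s = s" unfolding scaleR_projective_tensor_def by transfer (simp add: scaleC_one)
qed

end

lemma abs_projective_tensor_diff:
  assumes "tensor_Cauchy s" "tensor_Cauchy t"
  shows "abs_projective_tensor s - abs_projective_tensor t = abs_projective_tensor (\<lambda>n. s n - t n)"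
proof -
  have "- abs_projective_tensor t = scaleC (-1) (abs_projective_tensor t)"
    by (rule uminus_projective_tensor_def)
  also have "\<dots> = abs_projective_tensor (\<lambda>n. scaleC (-1) (t n))"
    using assms(2) by (simp only: scaleC_projective_tensor.abs_eq tensor_Cauchy_rel_self)
  also have "\<dots> = abs_projective_tensor (\<lambda>n. - t n)" by (simp only: scaleC_minus1)
  finally have "abs_projective_tensor s - abs_projective_tensor t
      = abs_projective_tensor s + abs_projective_tensor (\<lambda>n. - t n)"
    by (simp only: minus_projective_tensor_def)
  also have "\<dots> = abs_projective_tensor (\<lambda>n. s n - t n)"
    using assms by (simp add: plus_projective_tensor.abs_eq tensor_Cauchy_minus)
  finally show ?thesis .
qed

instantiation projective_tensor :: (complex_normed_vector, complex_normed_vector) complex_normed_vector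
begin

lift_definition norm_projective_tensor :: "('a, 'b) projective_tensor \<Rightarrow> real"
  is "\<lambda>s. lim (\<lambda>n. projective_norm (s n))"
  by (rule tensor_Cauchy_rel_lim)

definition dist_projective_tensor ::
  "('a, 'b) projective_tensor \<Rightarrow> ('a, 'b) projective_tensor \<Rightarrow> real" where
  "dist_projective_tensor s t = norm (s - t)"

definition sgn_projective_tensor ::
  "('a, 'b) projective_tensor \<Rightarrow> ('a, 'b) projective_tensor" where
  "sgn_projective_tensor s = scaleR (inverse (norm s)) s"

definition uniformity_projective_tensor ::
  "(('a, 'b) projective_tensor \<times> ('a, 'b) projective_tensor) filter" where
  "uniformity_projective_tensor = (INF e\<in>{0<..}. principal {(x, y). dist x y < e})"

definition open_projective_tensor :: "('a, 'b) projective_tensor set \<Rightarrow> bool" where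
  "open_projective_tensor U = (\<forall>x\<in>U. eventually (\<lambda>(x', y). x' = x \<longrightarrow> y \<in> U) uniformity)"

instance
proof
  fix s t :: "('a, 'b) projective_tensor" and c :: complex and r :: real
  show "dist s t = norm (s - t)" by (rule dist_projective_tensor_def)
  show "sgn s = inverse (norm s) *\<^sub>R s" by (rule sgn_projective_tensor_def)
  show "uniformity = (INF e\<in>{0<..}. principal {(x, y :: ('a, 'b) projective_tensor). dist x y < e})"
    by (rule uniformity_projective_tensor_def)
  show "open U = (\<forall>x\<in>U. \<forall>\<^sub>F (x', y) in uniformity. x' = x \<longrightarrow> y \<in> U)"
    for U :: "('a, 'b) projective_tensor set"
    by (rule open_projective_tensor_def)
  show "(norm s = 0) = (s = 0)"
  proof transfer
    fix s :: "nat \<Rightarrow> ('a, 'b) tensor" assume "tensor_Cauchy_rel s s"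
    then have s: "tensor_Cauchy s" by simp
    then have "(\<lambda>n. projective_norm (s n)) \<longlonglongrightarrow> lim (\<lambda>n. projective_norm (s n))"
      by (rule tensor_Cauchy_LIMSEQ)
    then have "(lim (\<lambda>n. projective_norm (s n)) = 0) = ((\<lambda>n. projective_norm (s n)) \<longlonglongrightarrow> 0)"
      using limI by metis
    then show "(lim (\<lambda>n. projective_norm (s n)) = 0) = tensor_Cauchy_rel s (\<lambda>_. 0)"
      using s by (simp add: tensor_Cauchy_rel_def tensor_Cauchy_const)
  qed
  show "norm (s + t) \<le> norm s + norm t"
  proof transfer
    fix s t :: "nat \<Rightarrow> ('a, 'b) tensor" assume "tensor_Cauchy_rel s s" "tensor_Cauchy_rel t t"
    then have C: "tensor_Cauchy s" "tensor_Cauchy t" by simp_all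
    show "lim (\<lambda>n. projective_norm (s n + t n))
        \<le> lim (\<lambda>n. projective_norm (s n)) + lim (\<lambda>n. projective_norm (t n))"
    proof (rule LIMSEQ_le)
      show "(\<lambda>n. projective_norm (s n + t n)) \<longlonglongrightarrow> lim (\<lambda>n. projective_norm (s n + t n))"
        by (rule tensor_Cauchy_LIMSEQ[OF tensor_Cauchy_add[OF C]])
      show "(\<lambda>n. projective_norm (s n) + projective_norm (t n)) \<longlonglongrightarrow>
          lim (\<lambda>n. projective_norm (s n)) + lim (\<lambda>n. projective_norm (t n))"
        by (intro tendsto_add tensor_Cauchy_LIMSEQ C)
    qed (simp add: projective_norm_triangle)
  qed
  show *: "norm (scaleC c s) = cmod c * norm s" for c
  proof transfer
    fix c :: complex and s :: "nat \<Rightarrow> ('a, 'b) tensor" assume "tensor_Cauchy_rel s s"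
    then have "(\<lambda>n. projective_norm (s n)) \<longlonglongrightarrow> lim (\<lambda>n. projective_norm (s n))"
      by (intro tensor_Cauchy_LIMSEQ) simp
    then show "lim (\<lambda>n. projective_norm (scaleC c (s n))) = cmod c * lim (\<lambda>n. projective_norm (s n))"
      unfolding projective_norm_scaleC by (intro limI tendsto_mult_left)
  qed
  show "norm (r *\<^sub>R s) = \<bar>r\<bar> * norm s" by (simp add: scaleR_projective_tensor_def *)
qed

end

text \<open>The canonical map from the algebraic tensor product into its completion.\<close>

definition projective_of ::
  "('a::complex_normed_vector, 'b::complex_normed_vector) tensor \<Rightarrow> ('a, 'b) projective_tensor" where
  "projective_of u = abs_projective_tensor (\<lambda>_. u)"

lemma norm_projective_of: "norm (projective_of u) = projective_norm u"
  by (simp add: projective_of_def norm_projective_tensor.abs_eq tensor_Cauchy_const)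

lemma projective_of_add: "projective_of (u + v) = projective_of u + projective_of v"
  by (simp add: projective_of_def plus_projective_tensor.abs_eq tensor_Cauchy_const)

lemma projective_of_scaleC: "projective_of (scaleC c u) = scaleC c (projective_of u)"
  by (simp add: projective_of_def scaleC_projective_tensor.abs_eq tensor_Cauchy_const)

lemma projective_of_diff: "projective_of (u - v) = projective_of u - projective_of v"
  using projective_of_add[of "u - v" v] by (simp add: algebra_simps)

lemma projective_of_LIMSEQ:
  assumes "tensor_Cauchy s"
  shows "(\<lambda>n. projective_of (s n)) \<longlonglongrightarrow> abs_projective_tensor s"
proof (rule LIMSEQ_I)
  fix e :: real assume "0 < e"
  then have "0 < e / 2" by simp
  then obtain N where N: "\<And>m n. m \<ge> N \<Longrightarrow> n \<ge> N \<Longrightarrow> projective_norm (s m - s n) < e / 2"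
    using assms unfolding tensor_Cauchy_def by blast
  have "norm (projective_of (s n) - abs_projective_tensor s) < e" if "n \<ge> N" for n
  proof -
    have C: "tensor_Cauchy (\<lambda>m. s n - s m)"
      using tensor_Cauchy_add[OF tensor_Cauchy_const tensor_Cauchy_minus[OF assms]] by simp
    have "norm (projective_of (s n) - abs_projective_tensor s) = lim (\<lambda>m. projective_norm (s n - s m))"
      using assms C
      by (simp add: projective_of_def abs_projective_tensor_diff tensor_Cauchy_const
          norm_projective_tensor.abs_eq)
    also have "\<dots> \<le> e / 2"
    proof (rule LIMSEQ_le_const2)
      show "(\<lambda>m. projective_norm (s n - s m)) \<longlonglongrightarrow> lim (\<lambda>m. projective_norm (s n - s m))"
        by (rule tensor_Cauchy_LIMSEQ[OF C])
      show "\<exists>M. \<forall>m\<ge>M. projective_norm (s n - s m) \<le> e / 2"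
        using N[OF that] less_imp_le by blast
    qed
    finally show ?thesis using \<open>0 < e\<close> by simp
  qed
  then show "\<exists>N. \<forall>n\<ge>N. norm (projective_of (s n) - abs_projective_tensor s) < e" by blast
qed

lemma projective_of_dense:
  fixes x :: "('a::complex_normed_vector, 'b::complex_normed_vector) projective_tensor"
  shows "x \<in> closure (range projective_of)"
proof -
  have "\<exists>s. tensor_Cauchy s \<and> x = abs_projective_tensor s"
    by (rule projective_tensor.abs_induct[of _ x]) auto
  then obtain s where s: "tensor_Cauchy s" "x = abs_projective_tensor s" by blast
  show ?thesis
    unfolding closure_sequential s(2)
  proof (intro exI conjI)
    show "\<forall>n. projective_of (s n) \<in> range projective_of" by simp
    show "(\<lambda>n. projective_of (s n)) \<longlonglongrightarrow> abs_projective_tensor s"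
      by (rule projective_of_LIMSEQ[OF s(1)])
  qed
qed

instance projective_tensor :: (complex_normed_vector, complex_normed_vector) complete_space
proof
  fix X :: "nat \<Rightarrow> ('a, 'b) projective_tensor" assume X: "Cauchy X"
  have "\<exists>u. norm (X n - projective_of u) < inverse (real (Suc n))" for n
  proof -
    have "X n \<in> closure (range projective_of)" by (rule projective_of_dense)
    moreover have "0 < inverse (real (Suc n))" by simp
    ultimately obtain y where "y \<in> range projective_of" "dist y (X n) < inverse (real (Suc n))"
      unfolding closure_approachable by blast
    then show ?thesis by (auto simp only: dist_norm norm_minus_commute)
  qed
  then obtain u where u: "\<And>n. norm (X n - projective_of (u n)) < inverse (real (Suc n))" by metis
  have lim: "(\<lambda>n. X n - projective_of (u n)) \<longlonglongrightarrow> 0"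
    by (rule Lim_null_comparison[OF _ LIMSEQ_inverse_real_of_nat])
       (rule always_eventually, use u less_imp_le in blast)
  have C: "tensor_Cauchy u"
    unfolding tensor_Cauchy_def
  proof safe
    fix e :: real assume "0 < e"
    then have e: "0 < e / 3" by simp
    obtain M where M: "\<And>m n. m \<ge> M \<Longrightarrow> n \<ge> M \<Longrightarrow> norm (X m - X n) < e / 3"
      using X e unfolding Cauchy_def dist_norm by blast
    obtain N where N: "\<And>n. n \<ge> N \<Longrightarrow> norm (X n - projective_of (u n)) < e / 3"
      using LIMSEQ_D[OF lim e] by auto
    have "projective_norm (u m - u n) < e" if "m \<ge> max M N" "n \<ge> max M N" for m n
    proof -
      have "projective_norm (u m - u n) = norm (projective_of (u m) - projective_of (u n))"
        by (simp only: projective_of_diff flip: norm_projective_of)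
      also have "\<dots> = norm ((X m - X n) - (X m - projective_of (u m)) + (X n - projective_of (u n)))"
        by simp
      also have "\<dots> \<le> norm (X m - X n) + norm (X m - projective_of (u m)) + norm (X n - projective_of (u n))"
        by (intro norm_triangle_le add_mono norm_triangle_ineq4) auto
      also have "\<dots> < e / 3 + e / 3 + e / 3"
        using that by (intro add_strict_mono M N) auto
      finally show ?thesis by simp
    qed
    then show "\<exists>N. \<forall>m\<ge>N. \<forall>n\<ge>N. projective_norm (u m - u n) < e" by blast
  qed
  have "(\<lambda>n. (X n - projective_of (u n)) + projective_of (u n)) \<longlonglongrightarrow> 0 + abs_projective_tensor u"
    by (intro tendsto_add lim projective_of_LIMSEQ C)
  then show "convergent X" by (auto simp: convergent_def)
qed

instantiation projective_tensor :: (complex_normed_algebra, complex_normed_algebra) complex_normed_algebra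
begin

lift_definition times_projective_tensor ::
  "('a, 'b) projective_tensor \<Rightarrow> ('a, 'b) projective_tensor \<Rightarrow> ('a, 'b) projective_tensor"
  is "\<lambda>s t n. s n * t n"
  by (rule tensor_Cauchy_rel_mult)

instance
proof
  fix s t u :: "('a, 'b) projective_tensor" and c :: complex and r :: real
  show "s * t * u = s * (t * u)"
    by transfer (rule tensor_Cauchy_rel_eqI, simp_all add: tensor_Cauchy_mult mult.assoc)
  show "(s + t) * u = s * u + t * u"
    by transfer (rule tensor_Cauchy_rel_eqI, simp_all add: tensor_Cauchy_mult tensor_Cauchy_add distrib_right)
  show "s * (t + u) = s * t + s * u"
    by transfer (rule tensor_Cauchy_rel_eqI, simp_all add: tensor_Cauchy_mult tensor_Cauchy_add distrib_left)
  show *: "scaleC c s * t = scaleC c (s * t)" for c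
    by transfer (rule tensor_Cauchy_rel_eqI, simp_all add: tensor_Cauchy_mult tensor_Cauchy_scaleC mult_scaleC_left)
  show **: "s * scaleC c t = scaleC c (s * t)" for c
    by transfer (rule tensor_Cauchy_rel_eqI, simp_all add: tensor_Cauchy_mult tensor_Cauchy_scaleC mult_scaleC_right)
  show "r *\<^sub>R s * t = r *\<^sub>R (s * t)" "s * r *\<^sub>R t = r *\<^sub>R (s * t)"
    by (simp_all add: scaleR_projective_tensor_def * **)
  show "norm (s * t) \<le> norm s * norm t"
  proof transfer
    fix s t :: "nat \<Rightarrow> ('a, 'b) tensor" assume "tensor_Cauchy_rel s s" "tensor_Cauchy_rel t t"
    then have C: "tensor_Cauchy s" "tensor_Cauchy t" by simp_all
    show "lim (\<lambda>n. projective_norm (s n * t n))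
        \<le> lim (\<lambda>n. projective_norm (s n)) * lim (\<lambda>n. projective_norm (t n))"
    proof (rule LIMSEQ_le)
      show "(\<lambda>n. projective_norm (s n * t n)) \<longlonglongrightarrow> lim (\<lambda>n. projective_norm (s n * t n))"
        by (rule tensor_Cauchy_LIMSEQ[OF tensor_Cauchy_mult[OF C]])
      show "(\<lambda>n. projective_norm (s n) * projective_norm (t n)) \<longlonglongrightarrow>
          lim (\<lambda>n. projective_norm (s n)) * lim (\<lambda>n. projective_norm (t n))"
        by (intro tendsto_mult tensor_Cauchy_LIMSEQ C)
    qed (simp add: projective_norm_mult)
  qed
qed

end

instance projective_tensor :: (complex_normed_algebra, complex_normed_algebra) complex_banach_algebra ..

lemma projective_of_mult: "projective_of (u * v) = projective_of u * projective_of v"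
  by (simp add: projective_of_def times_projective_tensor.abs_eq tensor_Cauchy_const)

type_synonym 'a varopoulos = "('a, 'a) projective_tensor"


section \<open>Scattered C*-algebras\<close>

text \<open>Positive functionals are merely linear maps here; on a C*-algebra they are automatically
  bounded.\<close>

definition positive_functional :: "('a::cstar_algebra \<Rightarrow> complex) \<Rightarrow> bool" where
  "positive_functional f \<longleftrightarrow> clinear_form f \<and> (\<forall>x. f (star x * x) \<in> \<real>\<^sub>\<ge>\<^sub>0)"

definition states :: "'a::cstar_algebra cdual set" where
  "states = {f. positive_functional (cdual_apply f) \<and> norm f = 1}"

definition pure_state :: "'a::cstar_algebra cdual \<Rightarrow> bool" where
  "pure_state f \<longleftrightarrow> f extreme_point_of states"

definition pure_functional :: "('a::cstar_algebra \<Rightarrow> complex) \<Rightarrow> bool" where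
  "pure_functional f \<longleftrightarrow>
     (\<exists>g r. pure_state g \<and> 0 \<le> r \<and> f = (\<lambda>x. complex_of_real r * cdual_apply g x))"

text \<open>The index set \<open>I\<close> may be empty, finite or infinite.\<close>

definition scattered :: "'a::cstar_algebra itself \<Rightarrow> bool" where
  "scattered _ \<longleftrightarrow>
     (\<forall>f :: 'a \<Rightarrow> complex. positive_functional f \<longrightarrow>
        (\<exists>(I :: nat set) g. (\<forall>i\<in>I. pure_functional (g i)) \<and>
           (\<forall>x. ((\<lambda>i. g i x) has_sum f x) I)))"

end

theory Submission
  imports Defs
begin

text \<open>Write \<open>A = C\<^sub>0(X)\<close>, where \<open>X\<close> is the set of nonzero *-characters; functionals on \<open>V\<close> are bounded
  bilinear forms on \<open>A\<close>.

  If some functional on \<open>A\<close> is not atomic, the hull of the ideal on which it is atomic is a nonempty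
  subset of \<open>X\<close> without isolated points. Repeatedly splitting open sets that meet it gives selfadjoint
  contractions \<open>\<rho>\<^sub>n\<close> that take all sign patterns, hence a mean \<open>\<phi>\<close> of characters under which the \<open>\<rho>\<^sub>n\<close> are independent
  signs. The form \<open>(a, b) \<mapsto> \<Sum>\<^sub>i\<^sub><\<^sub>j \<phi>(a w\<^sub>i\<^sub>j) \<phi>(b w\<^sub>i\<^sub>j)\<close> with \<open>w\<^sub>i\<^sub>j = \<rho>\<^sub>2\<^sub>i \<rho>\<^sub>2\<^sub>j\<^sub>+\<^sub>1\<close>, bounded by Bessel's inequality, has
  different iterated limits along \<open>\<rho>\<^sub>2\<^sub>i \<otimes> \<rho>\<^sub>2\<^sub>i\<close> and \<open>\<rho>\<^sub>2\<^sub>j\<^sub>+\<^sub>1 \<otimes> \<rho>\<^sub>2\<^sub>j\<^sub>+\<^sub>1\<close>, so \<open>V\<close> is not Arens regular. For orthogonal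
  peak functions \<open>e\<^sub>n\<close>, averaging over signs shows that \<open>f \<mapsto> \<Sum>\<^sub>n f(e\<^sub>n \<otimes> e\<^sub>n)\<close> lies in the topological centre; it does
  not lie in \<open>V\<close>.

  If all functionals on \<open>A\<close> are atomic, Khinchine's inequality bounds the size of orthogonal families on which a
  bounded bilinear form stays large. Every such form is therefore a norm limit of combinations of products
  of characters, on which the Arens product is weak* continuous in both variables.

  Finally, \<open>A\<close> is scattered iff all functionals are atomic, because pure states are characters and \<open>\<phi>\<close> is not a sum
  of multiples of characters.\<close>

section \<open>Dual spaces\<close>

text \<open>A functional on \<open>A\<close> alone cannot separate iterated limits, because
  C*-algebras are Arens regular. The tensor square leaves room for it: the form pairs two
  square-summable coefficient families, and such a pairing stays bounded under any truncation of the
  index set, here to i < j. In the opposite direction, N orthogonal contractions with functionals of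
  mass at least \<epsilon>/2 each can be combined with signs into one functional of mass of order
  \<epsilon> times the square root of N; the signed sum is still a contraction, so this mass is at
  most the norm of the form, and N is bounded. Two obstacles shape the details. \<open>A\<close>
  need not have a unit, so constants are replaced by elements that are one where it matters, and
  functions applied to elements must vanish at 0. Measures on X are avoided as well: integrals are
  weak* cluster points of finite means of characters, and atoms are detected by evaluating
  functionals at peaking elements. Characters are read off from minimal seminorms on
  \<open>A\<close> itself, so no quotient by a maximal ideal is formed.\<close>

lemma clinear_form_cdual_apply: "clinear_form (cdual_apply f)"
  by (simp add: clinear_form_def cdual_apply_add_right cdual_apply_scaleC_right)

lemma clinear_form_simps:
  assumes "clinear_form f"
  shows "f (x + y) = f x + f y" "f (scaleC c x) = c * f x" "f 0 = 0" "f (- x) = - f x"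
    "f (x - y) = f x - f y" "f (r *\<^sub>R x) = of_real r * f x" "f (sum h I) = (\<Sum>i\<in>I. f (h i))"
proof -
  show add: "f (x + y) = f x + f y" for x y using assms by (simp add: clinear_form_def)
  show sc: "f (scaleC c x) = c * f x" for c x using assms by (simp add: clinear_form_def)
  show z: "f 0 = 0" using add[of 0 0] by simp
  show m: "f (- x) = - f x" for x using sc[of "-1" x] by (simp add: scaleC_minus1)
  show "f (x - y) = f x - f y" using add[of x "- y"] m[of y] by simp
  show "f (r *\<^sub>R x) = of_real r * f x" by (simp add: scaleR_scaleC sc)
  show "f (sum h I) = (\<Sum>i\<in>I. f (h i))" by (induction I rule: infinite_finite_induct) (auto simp: z add)
qed

lemmas cdual_apply_simps = clinear_form_simps[OF clinear_form_cdual_apply]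

lemma cdual_apply_diff_left: "cdual_apply (f - g) x = cdual_apply f x - cdual_apply g x"
  using cdual_apply_add_left[of "f - g" g x] by simp

lemma cdual_apply_zero_left: "cdual_apply 0 x = 0"
  using cdual_apply_add_left[of 0 0 x] by simp

lemma cdual_apply_sum_left: "cdual_apply (sum h I) x = (\<Sum>i\<in>I. cdual_apply (h i) x)"
  by (induction I rule: infinite_finite_induct) (auto simp: cdual_apply_add_left cdual_apply_zero_left)

lemma bounded_linear_cdual_apply: "bounded_linear (cdual_apply f)"
  by (rule clinear_form_bounded_linear[OF clinear_form_cdual_apply norm_cdual_apply])

lemma norm_canonical_embedding_le: "norm (canonical_embedding a) \<le> norm a"
  by (rule norm_cdual_le) (auto simp: canonical_embedding_apply mult.commute[of "norm a"] norm_cdual_apply)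

text \<open>Banach--Alaoglu for sequences; the cluster point is a limit along a finer filter.\<close>

lemma cdual_cluster_point:
  fixes f :: "nat \<Rightarrow> 'a::complex_normed_vector cdual"
  assumes bd: "\<And>n. norm (f n) \<le> C"
  shows "\<exists>g F. F \<noteq> bot \<and> F \<le> sequentially \<and>
    (\<forall>x. ((\<lambda>n. cdual_apply (f n) x) \<longlongrightarrow> cdual_apply g x) F)"
proof -
  define K where "K = PiE UNIV (\<lambda>x::'a. cball (0::complex) (C * norm x))"
  have "compactin (product_topology (\<lambda>_. euclidean) UNIV) K"
    unfolding K_def compactin_PiE by simp
  then have K: "compact K"
    by (simp add: euclidean_product_topology)
  have b: "cmod (cdual_apply (f n) x) \<le> C * norm x" for n x
    using norm_cdual_apply[of "f n" x] mult_right_mono[OF bd[of n], of "norm x"] by simp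
  then have fK: "cdual_apply (f n) \<in> K" for n
    by (auto simp: K_def)
  let ?G = "filtermap (\<lambda>n. cdual_apply (f n)) sequentially"
  have "\<exists>g\<in>K. inf (nhds g) ?G \<noteq> bot"
    using K fK unfolding compact_filter by (auto simp: eventually_filtermap filtermap_bot_iff)
  then obtain g0 where g0: "g0 \<in> K" "inf (nhds g0) ?G \<noteq> bot" by blast
  \<comment> \<open>The indices whose functionals are close to \<open>g0\<close>. Intersecting with
    \<open>sequentially\<close> turns the cluster point into a limit that still depends on large
    \<open>n\<close> only.\<close>
  define F where "F = inf sequentially (filtercomap (\<lambda>n. cdual_apply (f n)) (nhds g0))"
  have nb: "F \<noteq> bot"
  proof
    assume "F = bot"
    then have "eventually (\<lambda>_. False) F" by simp
    then obtain P Q where PQ: "eventually P sequentially" "eventually Q (nhds g0)"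
      "\<And>n. P n \<Longrightarrow> Q (cdual_apply (f n)) \<Longrightarrow> False"
      unfolding F_def eventually_inf eventually_filtercomap by blast
    have "eventually (\<lambda>y. \<not> Q y) ?G"
      unfolding eventually_filtermap using PQ(1) by eventually_elim (use PQ(3) in blast)
    then have "eventually (\<lambda>_. False) (inf (nhds g0) ?G)"
      unfolding eventually_inf using PQ(2) by blast
    with g0(2) show False by (simp add: eventually_False)
  qed
  have le: "F \<le> sequentially" by (simp add: F_def)
  have lim0: "((\<lambda>n. cdual_apply (f n)) \<longlongrightarrow> g0) F"
    unfolding F_def by (rule filterlim_mono[OF filterlim_filtercomap order_refl]) simp
  have lim: "((\<lambda>n. cdual_apply (f n) x) \<longlongrightarrow> g0 x) F" for x
  proof -
    show ?thesis
    proof (rule topological_tendstoI)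
      fix S assume S: "open S" "g0 x \<in> S"
      have "open ((\<lambda>h::'a \<Rightarrow> complex. h x) -` S)"
        by (rule open_vimage[OF S(1) continuous_on_product_coordinates])
      from topological_tendstoD[OF lim0 this] S(2)
      show "eventually (\<lambda>n. cdual_apply (f n) x \<in> S) F" by simp
    qed
  qed
  have "clinear_form g0"
    unfolding clinear_form_def
  proof (intro conjI allI)
    fix x y c
    have "((\<lambda>n. cdual_apply (f n) (x + y)) \<longlongrightarrow> g0 x + g0 y) F"
      unfolding cdual_apply_add_right by (intro tendsto_add lim)
    with lim show "g0 (x + y) = g0 x + g0 y" using tendsto_unique[OF nb] by blast
    have "((\<lambda>n. cdual_apply (f n) (scaleC c x)) \<longlongrightarrow> c * g0 x) F"
      unfolding cdual_apply_scaleC_right by (intro tendsto_mult tendsto_const lim)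
    with lim show "g0 (scaleC c x) = c * g0 x" using tendsto_unique[OF nb] by blast
  qed
  moreover have "cmod (g0 x) \<le> C * norm x" for x
    using g0(1) by (auto simp: K_def)
  ultimately have "cdual_apply (cdual_of g0) = g0" by (rule cdual_apply_cdual_of)
  then show ?thesis using nb le lim by (intro exI[of _ "cdual_of g0"] exI[of _ F]) simp
qed

text \<open>Values at cluster points are computed through this: nothing is known about
  \<open>F\<close>, but a sequence that is constant from \<open>N\<close> on has only one limit
  along it.\<close>

lemma eventually_const_tendsto:
  assumes "F \<noteq> bot" "F \<le> sequentially" "(u \<longlongrightarrow> l) F" "\<And>n. n \<ge> N \<Longrightarrow> u n = (c::'a::t2_space)"
  shows "l = c"
proof -
  have "eventually (\<lambda>n. u n = c) sequentially" using assms(4) unfolding eventually_sequentially by blast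
  then have "eventually (\<lambda>n. u n = c) F" using assms(2) by (simp add: le_filter_def)
  then have "(u \<longlongrightarrow> c) F" by (rule tendsto_eventually)
  with assms(1,3) show ?thesis using tendsto_unique by blast
qed

section \<open>Weak* continuity of the Arens product\<close>

lemma continuous_map_weak_star_apply:
  "continuous_map weak_star_topology euclidean (\<lambda>Y. cdual_apply Y f)"
proof -
  have "continuous_map weak_star_topology euclidean ((\<lambda>h. h f) \<circ> cdual_apply)"
    unfolding weak_star_topology_def
    by (rule continuous_map_pullback) (metis UNIV_I continuous_map_product_projection)
  then show ?thesis by (simp add: o_def)
qed

text \<open>The weak* topology is initial for the evaluations, so continuity may be checked one
  functional \<open>f\<close> at a time, and evaluation at \<open>g\<close> is continuous.\<close>

lemma topological_centreI:
  assumes "\<And>f. \<exists>g. \<forall>Y. cdual_apply (arens_product X Y) f = cdual_apply Y g"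
  shows "X \<in> topological_centre"
proof -
  have "continuous_map weak_star_topology (product_topology (\<lambda>_. euclidean) UNIV)
      (cdual_apply \<circ> arens_product X)"
    unfolding continuous_map_componentwise_UNIV
  proof
    fix f
    obtain g where g: "\<And>Y. cdual_apply (arens_product X Y) f = cdual_apply Y g"
      using assms[of f] by blast
    show "continuous_map weak_star_topology euclidean (\<lambda>x. (cdual_apply \<circ> arens_product X) x f)"
      by (simp add: g continuous_map_weak_star_apply)
  qed
  then have "continuous_map weak_star_topology weak_star_topology (arens_product X)"
    by (subst (2) weak_star_topology_def) (rule continuous_map_pullback', auto)
  then show ?thesis by (simp add: topological_centre_def)
qed

lemma limitin_weak_star:
  assumes "\<And>f. ((\<lambda>n. cdual_apply (Y n) f) \<longlongrightarrow> cdual_apply Z f) F"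
  shows "limitin weak_star_topology Y Z F"
proof -
  have "limitin (product_topology (\<lambda>_. euclidean) UNIV) (\<lambda>n. cdual_apply (Y n)) (cdual_apply Z) F"
    unfolding limitin_componentwise using assms by simp
  then show ?thesis
    unfolding weak_star_topology_def limitin_def
    by (auto simp: openin_pullback_topology topspace_pullback_topology)
qed

lemma topological_centre_tendsto:
  assumes "X \<in> topological_centre" "\<And>f. ((\<lambda>n. cdual_apply (Y n) f) \<longlongrightarrow> cdual_apply Z f) F"
  shows "((\<lambda>n. cdual_apply (arens_product X (Y n)) f) \<longlongrightarrow> cdual_apply (arens_product X Z) f) F"
proof -
  have "continuous_map weak_star_topology euclidean ((\<lambda>W. cdual_apply W f) \<circ> arens_product X)"
    using assms(1) unfolding topological_centre_def
    by (intro continuous_map_compose[OF _ continuous_map_weak_star_apply]) simp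
  from continuous_map_limit[OF this limitin_weak_star[OF assms(2)]]
  show ?thesis by (simp add: o_def)
qed

text \<open>The double limit criterion. At cluster points \<open>X\<close>, \<open>Y\<close> of the
  two sequences the product takes the value lim_i lim_j = 1 at \<open>f\<close>; if \<open>X\<close>
  were in the topological centre, the value would also be lim_j lim_i = 0.\<close>

lemma not_arens_regularI:
  fixes x y :: "nat \<Rightarrow> 'a::complex_banach_algebra" and f :: "'a cdual"
  assumes x: "\<And>n. norm (x n) \<le> C" and y: "\<And>n. norm (y n) \<le> C"
    and lt: "\<And>i j. i < j \<Longrightarrow> cdual_apply f (x i * y j) = 1"
    and ge: "\<And>i j. j \<le> i \<Longrightarrow> cdual_apply f (x i * y j) = 0"
  shows "\<not> arens_regular TYPE('a)"
proof
  assume ar: "arens_regular TYPE('a)"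
  have nx: "norm (canonical_embedding (x n)) \<le> C" for n using x norm_canonical_embedding_le order_trans by blast
  have ny: "norm (canonical_embedding (y n)) \<le> C" for n using y norm_canonical_embedding_le order_trans by blast
  obtain X F where X: "F \<noteq> bot" "F \<le> sequentially"
    "\<forall>h. ((\<lambda>n. cdual_apply (canonical_embedding (x n)) h) \<longlongrightarrow> cdual_apply X h) F"
    using cdual_cluster_point[of "\<lambda>n. canonical_embedding (x n)", OF nx] by blast
  obtain Y G where Y: "G \<noteq> bot" "G \<le> sequentially"
    "\<forall>h. ((\<lambda>n. cdual_apply (canonical_embedding (y n)) h) \<longlongrightarrow> cdual_apply Y h) G"
    using cdual_cluster_point[of "\<lambda>n. canonical_embedding (y n)", OF ny] by blast
  have "cdual_apply Y (arens_fa f (x i)) = 1" for i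
    by (rule eventually_const_tendsto[OF Y(1,2) Y(3)[rule_format], where N = "Suc i"])
       (simp add: canonical_embedding_apply arens_fa_apply lt)
  then have 1: "cdual_apply X (arens_Yf Y f) = 1"
    by (intro eventually_const_tendsto[OF X(1,2) X(3)[rule_format], where N = 0])
       (simp add: canonical_embedding_apply arens_Yf_apply)
  have 0: "cdual_apply X (arens_Yf (canonical_embedding (y j)) f) = 0" for j
    by (rule eventually_const_tendsto[OF X(1,2) X(3)[rule_format], where N = j])
       (simp add: canonical_embedding_apply arens_Yf_apply arens_fa_apply ge)
  have "X \<in> topological_centre" using ar by (simp add: arens_regular_def)
  then have "((\<lambda>n. cdual_apply (arens_product X (canonical_embedding (y n))) f)
      \<longlongrightarrow> cdual_apply (arens_product X Y) f) G"
    by (rule topological_centre_tendsto) (rule Y(3)[rule_format])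
  from eventually_const_tendsto[OF Y(1,2) this, of 0 0]
  have "cdual_apply (arens_product X Y) f = 0" by (simp add: arens_product_apply 0)
  with 1 show False by (simp add: arens_product_apply)
qed

section \<open>Functionals on the projective tensor product\<close>

abbreviation ptensor ::
  "'a::complex_normed_vector \<Rightarrow> 'b::complex_normed_vector \<Rightarrow> ('a, 'b) projective_tensor" where
  "ptensor a b \<equiv> projective_of (elem_tensor a b)"

lemma ptensor_mult: "ptensor a b * ptensor c d = ptensor (a * c) (b * d)"
  by (simp add: elem_tensor_mult flip: projective_of_mult)

lemma norm_ptensor_le: "norm (ptensor a b) \<le> norm a * norm b"
  using projective_norm_le[of "[(a, b)]"] by (simp add: norm_projective_of)

lemma cbilinear_form_ptensor: "cbilinear_form (\<lambda>a b. cdual_apply f (ptensor a b))"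
  by (simp add: cbilinear_form_def clinear_form_def elem_tensor_bilinear projective_of_add
      projective_of_scaleC cdual_apply_simps)

lemma cmod_ptensor_le: "cmod (cdual_apply f (ptensor a b)) \<le> norm f * norm a * norm b"
  using norm_cdual_apply[of f "ptensor a b"] mult_left_mono[OF norm_ptensor_le[of a b], of "norm f"]
  by (simp add: mult.assoc)

lemma projective_of_zero: "projective_of 0 = 0"
  using projective_of_diff[of 0 0] by simp

lemma cdual_apply_projective_of_sum:
  "cdual_apply f (projective_of (\<Sum>(x, y)\<leftarrow>xs. elem_tensor x y)) = (\<Sum>(x, y)\<leftarrow>xs. cdual_apply f (ptensor x y))"
  by (induction xs) (auto simp: projective_of_zero projective_of_add cdual_apply_simps)

text \<open>Finite sums of elementary tensors are dense. Scalar multiples need no case of their own,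
  since they are absorbed in the first factor.\<close>

lemma projective_of_induct [case_names closed add elem]:
  fixes P :: "('a::complex_normed_vector, 'b::complex_normed_vector) projective_tensor \<Rightarrow> bool"
  assumes "closed {t. P t}" "\<And>s t. P s \<Longrightarrow> P t \<Longrightarrow> P (s + t)" "\<And>a b. P (ptensor a b)"
  shows "P t"
proof -
  have z: "P 0"
    using assms(3)[of 0 0] elem_tensor_bilinear(3)[of 0 0 0] projective_of_scaleC[of 0 "elem_tensor 0 0"]
    by (metis projective_of_diff cancel_comm_monoid_add_class.diff_cancel add.right_neutral elem_tensor_bilinear(1) add_diff_cancel)
  have "P (projective_of (\<Sum>(x, y)\<leftarrow>xs. elem_tensor x y))" for xs
    by (induction xs) (auto simp: projective_of_zero projective_of_add z assms)
  then have "range projective_of \<subseteq> {t. P t}" using tensor_is_sum by (metis (no_types, lifting) image_subsetI mem_Collect_eq)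
  then have "closure (range projective_of) \<subseteq> {t. P t}" by (rule closure_minimal[OF _ assms(1)])
  with projective_of_dense[of t] show ?thesis by blast
qed

text \<open>The projective norm is an infimum over representations, so a bound for the bilinear form
  passes to every sum of elementary tensors, and by density to the completion.\<close>

lemma ptensor_functional_norm_le:
  assumes "\<And>a b. cmod (cdual_apply f (ptensor a b)) \<le> K * norm a * norm b" "K \<ge> 0"
  shows "norm f \<le> K"
proof (rule norm_cdual_le[OF _ assms(2)])
  have el: "cmod (cdual_apply f (projective_of u)) \<le> K * norm (projective_of u)" for u
  proof (rule field_le_epsilon)
    fix e :: real assume "e > 0"
    \<comment> \<open>Dividing by \<open>K + 1\<close> instead of \<open>K\<close> covers the case
      \<open>K = 0\<close>; the same device recurs in later estimates.\<close>
    then have "e / (K + 1) > 0" using assms(2) by simp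
    then obtain xs where xs: "u = (\<Sum>(x, y)\<leftarrow>xs. elem_tensor x y)"
      "(\<Sum>(x, y)\<leftarrow>xs. norm x * norm y) < projective_norm u + e / (K + 1)" by (rule projective_norm_approx)
    have "cmod (\<Sum>(x, y)\<leftarrow>xs. cdual_apply f (ptensor x y)) \<le> K * (\<Sum>(x, y)\<leftarrow>xs. norm x * norm y)"
    proof (induction xs)
      case (Cons p xs)
      then show ?case using assms(1)[of "fst p" "snd p"]
        by (auto simp: case_prod_beta distrib_left mult.assoc intro: order_trans[OF norm_triangle_ineq])
    qed simp
    also have "\<dots> \<le> K * (projective_norm u + e / (K + 1))"
      using xs(2) assms(2) by (intro mult_left_mono) auto
    also have "\<dots> \<le> K * projective_norm u + e"
      using \<open>e > 0\<close> assms(2) by (simp add: distrib_left field_simps)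
    finally show "cmod (cdual_apply f (projective_of u)) \<le> K * norm (projective_of u) + e"
      by (simp add: xs(1) cdual_apply_projective_of_sum norm_projective_of)
  qed
  let ?S = "{t. cmod (cdual_apply f t) \<le> K * norm t}"
  have "closed ?S"
    by (intro closed_Collect_le continuous_intros linear_continuous_on bounded_linear_cdual_apply)
  moreover have "range projective_of \<subseteq> ?S" using el by auto
  ultimately have "closure (range projective_of) \<subseteq> ?S" using closure_minimal by blast
  then show "cmod (cdual_apply f t) \<le> K * norm t" for t
    using projective_of_dense[of t] by blast
qed

lemma ptensor_functional_near_norm:
  assumes "d > 0"
  obtains a b where "norm a \<le> 1" "norm b \<le> 1" "cmod (cdual_apply f (ptensor a b)) > norm f - d"
proof (cases "norm f - d < 0")
  case True
  then show ?thesis using that[of 0 0] norm_ge_zero[of "cdual_apply f (ptensor 0 0)"]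
    by (simp add: less_le_trans)
next
  case False
  have "\<not> (\<forall>a b. cmod (cdual_apply f (ptensor a b)) \<le> (norm f - d) * norm a * norm b)"
    using ptensor_functional_norm_le[of f "norm f - d"] False assms by auto
  then obtain a b where ab: "cmod (cdual_apply f (ptensor a b)) > (norm f - d) * norm a * norm b"
    by (auto simp: not_le)
  have "cdual_apply f (ptensor 0 b) = 0" "cdual_apply f (ptensor a 0) = 0"
    using cbilinear_form_ptensor[of f] clinear_form_simps(3) unfolding cbilinear_form_def by blast+
  then have "a \<noteq> 0" "b \<noteq> 0" using ab by auto
  let ?a = "(1 / norm a) *\<^sub>R a" and ?b = "(1 / norm b) *\<^sub>R b"
  have "ptensor ?a ?b = scaleC (of_real (1 / norm a) * of_real (1 / norm b)) (ptensor a b)"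
    by (simp add: scaleR_scaleC elem_tensor_bilinear projective_of_scaleC scaleC_scaleC mult.commute)
  then have "cmod (cdual_apply f (ptensor ?a ?b)) = cmod (cdual_apply f (ptensor a b)) / (norm a * norm b)"
    by (simp add: cdual_apply_simps norm_mult norm_divide)
  also have "\<dots> > norm f - d"
    using ab \<open>a \<noteq> 0\<close> \<open>b \<noteq> 0\<close> by (simp add: field_simps)
  finally show ?thesis using that[of ?a ?b] \<open>a \<noteq> 0\<close> \<open>b \<noteq> 0\<close> by simp
qed

text \<open>Tensors are represented as functionals on bilinear forms, so
  \<open>Rep_tensor u F\<close> is the value at \<open>u\<close> of the linear map induced by
  \<open>F\<close>.\<close>

lemma Rep_tensor_bound:
  assumes F: "cbilinear_form F" "\<And>a b. cmod (F a b) \<le> K * norm a * norm b" "K \<ge> 0"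
  shows "cmod (Rep_tensor u F) \<le> K * projective_norm u"
proof (rule field_le_epsilon)
  fix e :: real assume "e > 0"
  then have "e / (K + 1) > 0" using F(3) by simp
  then obtain xs where xs: "u = (\<Sum>(x, y)\<leftarrow>xs. elem_tensor x y)"
    "(\<Sum>(x, y)\<leftarrow>xs. norm x * norm y) < projective_norm u + e / (K + 1)" by (rule projective_norm_approx)
  have "cmod (\<Sum>(x, y)\<leftarrow>xs. F x y) \<le> K * (\<Sum>(x, y)\<leftarrow>xs. norm x * norm y)"
  proof (induction xs)
    case (Cons p xs)
    then show ?case using F(2)[of "fst p" "snd p"]
      by (auto simp: case_prod_beta distrib_left mult.assoc intro: order_trans[OF norm_triangle_ineq])
  qed simp
  also have "\<dots> \<le> K * (projective_norm u + e / (K + 1))"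
    using xs(2) F(3) by (intro mult_left_mono) auto
  also have "\<dots> \<le> K * projective_norm u + e"
    using \<open>e > 0\<close> F(3) by (simp add: distrib_left field_simps)
  finally show "cmod (Rep_tensor u F) \<le> K * projective_norm u + e"
    unfolding xs(1) tensor_functional_eq_sum[symmetric] by (simp add: tensor_functional_def F(1))
qed

lemma Rep_tensor_diff: "Rep_tensor (u - v) F = Rep_tensor u F - Rep_tensor v F"
  using plus_tensor.rep_eq[of "u - v" v] by (simp add: fun_eq_iff)

lemma tensor_Cauchy_Rep:
  assumes F: "cbilinear_form F" "\<And>a b. cmod (F a b) \<le> K * norm a * norm b" "K \<ge> 0"
    and s: "tensor_Cauchy s"
  shows "(\<lambda>n. Rep_tensor (s n) F) \<longlonglongrightarrow> lim (\<lambda>n. Rep_tensor (s n) F)"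
proof -
  have "Cauchy (\<lambda>n. Rep_tensor (s n) F)"
    unfolding Cauchy_def dist_norm
  proof safe
    fix e :: real assume "e > 0"
    then have "e / (K + 1) > 0" using F(3) by simp
    then obtain N where N: "\<And>m n. m \<ge> N \<Longrightarrow> n \<ge> N \<Longrightarrow> projective_norm (s m - s n) < e / (K + 1)"
      using s unfolding tensor_Cauchy_def by blast
    have "cmod (Rep_tensor (s m) F - Rep_tensor (s n) F) < e" if "m \<ge> N" "n \<ge> N" for m n
    proof -
      have "cmod (Rep_tensor (s m) F - Rep_tensor (s n) F) \<le> K * projective_norm (s m - s n)"
        using Rep_tensor_bound[OF F, of "s m - s n"] by (simp add: Rep_tensor_diff)
      also have "\<dots> \<le> (K + 1) * projective_norm (s m - s n)"
        using projective_norm_nonneg by (intro mult_right_mono) auto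
      also have "\<dots> < (K + 1) * (e / (K + 1))"
        using N[OF that] F(3) by (intro mult_strict_left_mono) auto
      finally show ?thesis using F(3) by simp
    qed
    then show "\<exists>M. \<forall>m\<ge>M. \<forall>n\<ge>M. cmod (Rep_tensor (s m) F - Rep_tensor (s n) F) < e" by blast
  qed
  then show ?thesis by (simp add: Cauchy_convergent_iff convergent_LIMSEQ_iff)
qed

text \<open>The universal property of the projective tensor product. With
  \<open>ptensor_functional_norm_le\<close> it identifies the dual of the completion with the
  bounded bilinear forms.\<close>

lemma bilinear_extension:
  fixes F :: "'a::complex_normed_vector \<Rightarrow> 'b::complex_normed_vector \<Rightarrow> complex"
  assumes F: "cbilinear_form F" "\<And>a b. cmod (F a b) \<le> K * norm a * norm b" "K \<ge> 0"
  obtains f where "\<And>a b. cdual_apply f (ptensor a b) = F a b" "norm f \<le> K"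
proof -
  define s where "s t = (SOME s. tensor_Cauchy s \<and> t = abs_projective_tensor s)"
    for t :: "('a, 'b) projective_tensor"
  have "\<exists>s. tensor_Cauchy s \<and> t = abs_projective_tensor s" for t :: "('a, 'b) projective_tensor"
    by (rule projective_tensor.abs_induct[of _ t]) auto
  then have s: "tensor_Cauchy (s t)" "abs_projective_tensor (s t) = t" for t
    unfolding s_def by (metis (mono_tags, lifting) someI_ex)+
  define h where "h t = lim (\<lambda>n. Rep_tensor (s t n) F)" for t
  \<comment> \<open>Equivalent Cauchy sequences differ by a null sequence, so the value does not
    depend on the chosen representative, and linearity may be checked on any convenient one.\<close>
  have h: "(\<lambda>n. Rep_tensor (v n) F) \<longlonglongrightarrow> h (abs_projective_tensor v)" if v: "tensor_Cauchy v" for v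
  proof -
    let ?t = "abs_projective_tensor v"
    have "tensor_Cauchy_rel (s ?t) v"
      using s[of ?t] v Quotient_rel[OF Quotient_projective_tensor, of "s ?t" v] by simp
    then have "(\<lambda>n. K * projective_norm (s ?t n - v n)) \<longlonglongrightarrow> 0"
      unfolding tensor_Cauchy_rel_def by (intro tendsto_mult_right_zero) auto
    then have "(\<lambda>n. Rep_tensor (s ?t n) F - Rep_tensor (v n) F) \<longlonglongrightarrow> 0"
      by (rule Lim_null_comparison[rotated])
         (intro always_eventually allI, simp flip: Rep_tensor_diff add: Rep_tensor_bound[OF F])
    from tendsto_diff[OF tensor_Cauchy_Rep[OF F s(1)[of ?t]] this]
    show ?thesis by (simp add: h_def)
  qed
  have lin: "clinear_form h"
    unfolding clinear_form_def
  proof (intro conjI allI)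
    fix t u and c
    have "(\<lambda>n. Rep_tensor (s t n) F + Rep_tensor (s u n) F) \<longlonglongrightarrow> h t + h u"
      using h[OF s(1)[of t]] h[OF s(1)[of u]] by (intro tendsto_add) (simp_all add: s)
    moreover have "(\<lambda>n. Rep_tensor (s t n + s u n) F) \<longlonglongrightarrow> h (t + u)"
      using h[OF tensor_Cauchy_add[OF s(1)[of t] s(1)[of u]]] plus_projective_tensor.abs_eq[of "s t" "s u"]
      by (simp add: s)
    ultimately show "h (t + u) = h t + h u"
      using LIMSEQ_unique by (fastforce simp: plus_tensor.rep_eq)
    have "(\<lambda>n. c * Rep_tensor (s t n) F) \<longlonglongrightarrow> c * h t"
      using h[OF s(1)[of t]] by (intro tendsto_mult tendsto_const) (simp add: s)
    moreover have "(\<lambda>n. Rep_tensor (scaleC c (s t n)) F) \<longlonglongrightarrow> h (scaleC c t)"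
      using h[OF tensor_Cauchy_scaleC[OF s(1)[of t]], of c] scaleC_projective_tensor.abs_eq[of "s t" c]
      by (simp add: s)
    ultimately show "h (scaleC c t) = c * h t"
      using LIMSEQ_unique by (fastforce simp: scaleC_tensor.rep_eq)
  qed
  have hb: "cmod (h t) \<le> K * norm t" for t
  proof (rule LIMSEQ_le)
    show "(\<lambda>n. cmod (Rep_tensor (s t n) F)) \<longlonglongrightarrow> cmod (h t)"
      using h[OF s(1)[of t]] by (intro tendsto_norm) (simp add: s)
    show "(\<lambda>n. K * projective_norm (s t n)) \<longlonglongrightarrow> K * norm t"
      using tensor_Cauchy_LIMSEQ[OF s(1)[of t]] norm_projective_tensor.abs_eq[of "s t"]
      by (intro tendsto_mult tendsto_const) (simp add: s)
  qed (use Rep_tensor_bound[OF F] in auto)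
  have app: "cdual_apply (cdual_of h) = h" by (rule cdual_apply_cdual_of[OF lin hb])
  show ?thesis
  proof (rule that[of "cdual_of h"])
    show "norm (cdual_of h) \<le> K" by (rule norm_cdual_le) (auto simp: app hb F(3))
    have "(\<lambda>n. Rep_tensor (elem_tensor a b) F) \<longlonglongrightarrow> h (ptensor a b)" for a b
      using h[OF tensor_Cauchy_const] by (simp add: projective_of_def)
    moreover have "Rep_tensor (elem_tensor a b) F = F a b" for a b
      by (simp add: elem_tensor.rep_eq tensor_functional_def F(1))
    ultimately show "cdual_apply (cdual_of h) (ptensor a b) = F a b" for a b
      by (simp add: app LIMSEQ_const_iff)
  qed
qed

section \<open>Gelfand theory of commutative C*-algebras\<close>

lemma scaleC_diff_right: "scaleC c (x - y) = scaleC c x - scaleC c (y::'a::complex_vector)"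
  using scaleC_add_right[of c "x - y" y] by simp

lemma scaleC_diff_left: "scaleC (c - d) x = scaleC c x - scaleC d (x::'a::complex_vector)"
  using scaleC_add_left[of "c - d" d x] by simp

lemma scaleC_zero_left: "scaleC 0 x = (0::'a::complex_vector)"
  using scaleC_diff_left[of 0 0 x] by simp

lemma scaleC_minus_left: "scaleC (- c) x = - scaleC c (x::'a::complex_vector)"
  using scaleC_diff_left[of 0 c x] by (simp add: scaleC_zero_left)

lemma star_simps:
  "star (0::'a::cstar_algebra) = 0" "star (- x) = - star (x::'a)" "star (x - y) = star x - star (y::'a)"
  "star (r *\<^sub>R x) = r *\<^sub>R star (x::'a)"
proof -
  show z: "star (0::'a) = 0" using star_add[of "0::'a" 0] by simp
  show m: "star (- x) = - star x" for x :: 'a using star_add[of x "- x"] z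
    by (simp add: add_eq_0_iff)
  show "star (x - y) = star x - star y" for x y :: 'a using star_add[of x "- y"] m[of y] by simp
  show "star (r *\<^sub>R x) = r *\<^sub>R star x" for x :: 'a by (simp add: scaleR_scaleC star_scaleC)
qed

lemma norm_star: "norm (star x) = norm (x::'a::cstar_algebra)"
proof -
  have le: "norm y \<le> norm (star y)" for y :: 'a
  proof (cases "y = 0")
    case False
    have "(norm y)\<^sup>2 \<le> norm (star y) * norm y" using norm_mult_ineq[of "star y" y] by (simp add: norm_star_mult)
    with False show ?thesis by (simp add: power2_eq_square)
  qed simp
  show ?thesis using le[of x] le[of "star x"] by (simp add: star_star)
qed

text \<open>Commutativity makes every element normal: the C*-identity for \<open>x * x\<close>
  reduces to the C*-identity for the selfadjoint element \<open>star x * x\<close>.\<close>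

lemma norm_square_commutative: "norm (x * x) = (norm (x::'a::{cstar_algebra, comm_ring}))\<^sup>2"
proof -
  define y where "y = star x * x"
  have y: "star y = y" by (simp add: y_def star_mult star_star)
  have "(norm (x * x))\<^sup>2 = norm (star (x * x) * (x * x))" by (rule norm_star_mult[symmetric])
  also have "star (x * x) * (x * x) = star y * y" unfolding y by (simp add: y_def star_mult mult_ac)
  also have "norm \<dots> = ((norm x)\<^sup>2)\<^sup>2" by (simp add: norm_star_mult) (simp add: y_def norm_star_mult)
  finally show ?thesis by (rule power2_eq_imp_eq) simp_all
qed

text \<open>The square condition stands in for the spectral radius formula. Unlike multiplicativity
  it holds for the norm itself, and it survives both infima of chains and localisation.\<close>

definition square_seminorm :: "('a::{complex_normed_algebra, comm_ring} \<Rightarrow> real) \<Rightarrow> bool" where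
  "square_seminorm p \<longleftrightarrow> (\<forall>x y. p (x + y) \<le> p x + p y) \<and> (\<forall>c x. p (scaleC c x) = cmod c * p x)
     \<and> (\<forall>x y. p (x * y) \<le> p x * p y) \<and> (\<forall>x. p (x * x) = (p x)\<^sup>2) \<and> (\<forall>x. p x \<le> norm x)"

lemma square_seminormD:
  assumes "square_seminorm p"
  shows "p (x + y) \<le> p x + p y" "p (scaleC c x) = cmod c * p x" "p (x * y) \<le> p x * p y"
    "p (x * x) = (p x)\<^sup>2" "p x \<le> norm x" "p 0 = 0" "p (- x) = p x" "0 \<le> p x" "p x - p y \<le> p (x - y)"
proof -
  show a: "p (x + y) \<le> p x + p y" "p (scaleC c x) = cmod c * p x" "p (x * y) \<le> p x * p y"
    "p (x * x) = (p x)\<^sup>2" "p x \<le> norm x" for x y c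
    using assms by (auto simp: square_seminorm_def)
  show z: "p 0 = 0" using a(2)[of 0 0] a(2)[of 2 0] by (metis mult_eq_0_iff norm_zero scaleC_scaleC mult_zero_left
        scaleR_scaleC of_real_0 scaleR_zero_left)
  show m: "p (- x) = p x" for x using a(2)[of "-1" x] by (simp add: scaleC_minus1)
  show "0 \<le> p x" using a(1)[of x "- x"] by (simp add: z m)
  show "p x - p y \<le> p (x - y)" using a(1)[of "x - y" y] by simp
qed

text \<open>The seminorm \<open>Q x = lim p (b\<^sup>n x) / (p b)\<^sup>n\<close>. A minimal seminorm coincides with its \<open>Q\<close>, which
  makes it multiplicative.\<close>

lemma square_seminorm_localize:
  fixes p :: "'a::{complex_normed_algebra, comm_ring} \<Rightarrow> real"
  assumes p: "square_seminorm p" and b: "p b > 0"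
  shows "\<exists>Q. square_seminorm Q \<and> (\<forall>x. Q x \<le> p x) \<and> (\<forall>x. Q (b * x) = p b * Q x) \<and> Q b = p b \<and>
    (\<forall>k c. (\<forall>x. p (k * x) = c * p x) \<longrightarrow> (\<forall>x. Q (k * x) = c * Q x))"
proof -
  note P = square_seminormD[OF p]
  define w where "w n x = (((*) b) ^^ n) x" for n x
  have w0: "w 0 x = x" and wS: "w (Suc n) x = b * w n x" for n x by (simp_all add: w_def)
  have wadd: "w n (x + y) = w n x + w n y" for n x y
    by (induction n) (simp_all add: w0 wS distrib_left)
  have wsc: "w n (scaleC c x) = scaleC c (w n x)" for n c x
    by (induction n) (simp_all add: w0 wS mult_scaleC_right)
  have wm: "w n (k * x) = k * w n x" for n k x
    by (induction n) (simp_all add: w0 wS mult_ac)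
  have wmm: "w (n + n) (x * y) = w n x * w n y" for n x y
    by (induction n) (simp_all add: w0 wS mult_ac)
  define q where "q n x = p (w n x) / p b ^ n" for n x
  have q0: "0 \<le> q n x" for n x using P(8) b by (simp add: q_def)
  have dec: "decseq (\<lambda>n. q n x)" for x
  proof (rule decseq_SucI)
    fix n show "q (Suc n) x \<le> q n x"
      using P(3)[of b "w n x"] b by (simp add: q_def wS field_simps)
  qed
  define Q where "Q x = lim (\<lambda>n. q n x)" for x
  have lim: "(\<lambda>n. q n x) \<longlonglongrightarrow> Q x" for x
  proof -
    have "convergent (\<lambda>n. q n x)"
      using decseq_convergent[of "\<lambda>n. q n x" 0] dec q0 by (metis convergentI)
    then show ?thesis by (simp add: Q_def convergent_LIMSEQ_iff)
  qed
  \<comment> \<open>A product of two \<open>n\<close>-th terms carries the exponent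
    \<open>2 * n\<close>, so the inequalities for products compare with the subsequence of even
    terms.\<close>
  have lim2: "(\<lambda>n. q (n + n) x) \<longlonglongrightarrow> Q x" for x
    using LIMSEQ_subseq_LIMSEQ[OF lim, of "\<lambda>n. n + n" x] by (simp add: strict_mono_def o_def)
  have Qle: "Q x \<le> q n x" for n x using decseq_ge[OF dec lim] .
  have wb: "w (Suc (n + n)) b = w n b * w n b" for n
    using wmm[of n b b] wm[of "n + n" b b] by (simp add: wS)
  \<comment> \<open>The sequence decreases, so it is constant as soon as it returns to
    \<open>p b\<close> infinitely often. It does: from \<open>n\<close> the square condition leads
    to \<open>2 * n + 1\<close>.\<close>
  have ev: "\<exists>n\<ge>m. q n b = p b" for m
  proof (induction m)
    case 0
    then show ?case by (intro exI[of _ 0]) (simp add: q_def w0)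
  next
    case (Suc m)
    then obtain n where n: "n \<ge> m" "q n b = p b" by blast
    then have "p (w n b) = p b * p b ^ n" using b by (simp add: q_def field_simps)
    then have "q (Suc (n + n)) b = p b" using b
      by (simp add: q_def wb P(4) power2_eq_square power_add)
    with n(1) show ?case by (intro exI[of _ "Suc (n + n)"]) simp
  qed
  have Qb: "Q b = p b"
  proof (rule antisym)
    show "Q b \<le> p b" using Qle[of b 0] by (simp add: q_def w0)
    have "p b \<le> q m b" for m using ev[of m] dec[of b] by (metis decseq_def)
    then show "p b \<le> Q b" using lim[of b] LIMSEQ_le_const by blast
  qed
  have "square_seminorm Q"
    unfolding square_seminorm_def
  proof (intro conjI allI)
    fix x y :: 'a and c
    have "q n (x + y) \<le> q n x + q n y" for n
      using P(1)[of "w n x" "w n y"] b by (simp add: q_def wadd divide_right_mono flip: add_divide_distrib)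
    then show "Q (x + y) \<le> Q x + Q y"
      by (intro LIMSEQ_le[OF lim tendsto_add[OF lim lim]]) auto
    have "q n (scaleC c x) = cmod c * q n x" for n by (simp add: q_def wsc P(2))
    then show "Q (scaleC c x) = cmod c * Q x"
      using LIMSEQ_unique[OF lim[of "scaleC c x"]] tendsto_mult_left[OF lim[of x], of "cmod c"] by simp
    have "q (n + n) (x * y) \<le> q n x * q n y" for n
      using P(3)[of "w n x" "w n y"] b by (simp add: q_def wmm power_add divide_right_mono)
    then show "Q (x * y) \<le> Q x * Q y"
      by (intro LIMSEQ_le[OF lim2 tendsto_mult[OF lim lim]]) auto
    have "q (n + n) (x * x) = (q n x)\<^sup>2" for n
      by (simp add: q_def wmm power_add P(4) power2_eq_square)
    then show "Q (x * x) = (Q x)\<^sup>2"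
      using LIMSEQ_unique[OF lim2[of "x * x"]] tendsto_power[OF lim[of x], of 2] by simp
    show "Q x \<le> norm x" using Qle[of x 0] P(5)[of x] by (simp add: q_def w0)
  qed
  moreover have "Q x \<le> p x" for x using Qle[of x 0] by (simp add: q_def w0)
  moreover have "Q (k * x) = c * Q x" if "\<And>x. p (k * x) = c * p x" for k c x
  proof -
    have "q n (k * x) = c * q n x" for n using that by (simp add: q_def wm)
    then show ?thesis
      using LIMSEQ_unique[OF lim[of "k * x"]] tendsto_mult_left[OF lim[of x], of c] by simp
  qed
  moreover have "Q (b * x) = p b * Q x" for x
  proof -
    have "q n (b * x) = p b * q (Suc n) x" for n using b by (simp add: q_def wm wS)
    then show ?thesis
      using LIMSEQ_unique[OF lim[of "b * x"]] tendsto_mult_left[OF LIMSEQ_Suc[OF lim[of x]], of "p b"] by simp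
  qed
  ultimately show ?thesis using Qb by (intro exI[of _ Q]) simp
qed

text \<open>Zorn's lemma, but only among seminorms for which \<open>k\<close> is already
  multiplicative and keeps its norm; otherwise a minimal seminorm could be zero.\<close>

lemma multiplicative_seminorm_exists:
  fixes k :: "'a::{cstar_algebra, comm_ring}"
  assumes "k \<noteq> 0"
  obtains p where "square_seminorm p" "\<And>x y. p (x * y) = p x * p y" "p k = norm k"
proof -
  define A where "A = {p :: 'a \<Rightarrow> real. square_seminorm p \<and> (\<forall>x. p (k * x) = norm k * p x) \<and> p k = norm k}"
  \<comment> \<open>The norm need not be multiplicative at \<open>k\<close>; localising it at
    \<open>k\<close> produces a first element of \<open>A\<close>.\<close>
  have "square_seminorm (norm :: 'a \<Rightarrow> real)"
    by (auto simp: square_seminorm_def norm_triangle_ineq norm_scaleC norm_mult_ineq norm_square_commutative)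
  then obtain p0 where "square_seminorm p0" "\<And>x. p0 (k * x) = norm k * p0 x" "p0 k = norm k"
    using square_seminorm_localize[of norm k] assms by auto
  then have "p0 \<in> A" by (simp add: A_def)
  have sq: "square_seminorm p" if "p \<in> A" for p using that by (simp add: A_def)
  define R where "R p q \<longleftrightarrow> q \<le> p" for p q :: "'a \<Rightarrow> real"
  have "\<exists>m\<in>A. \<forall>a\<in>A. R m a \<longrightarrow> a = m"
  proof (rule predicate_Zorn)
    show "partial_order_on A (relation_of R A)"
      by (rule partial_order_on_relation_ofI) (auto simp: R_def)
    fix C assume C: "C \<in> Chains (relation_of R A)"
    have CA: "C \<subseteq> A" and ch: "\<And>q r. q \<in> C \<Longrightarrow> r \<in> C \<Longrightarrow> q \<le> r \<or> r \<le> q"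
      using C unfolding Chains_def relation_of_def R_def by auto
    show "\<exists>u\<in>A. \<forall>a\<in>C. R a u"
    proof (cases "C = {}")
      case True
      with \<open>p0 \<in> A\<close> show ?thesis by auto
    next
      case False
      \<comment> \<open>The infimum of a chain is taken as a limit along the chain, so that the
        equations in the definition pass to it as well as the inequalities.\<close>
      define F where "F = (INF q\<in>C. principal {r\<in>C. r \<le> q})"
      have ev: "eventually P F \<longleftrightarrow> (\<exists>q\<in>C. \<forall>r\<in>C. r \<le> q \<longrightarrow> P r)" for P
      proof -
        have "\<exists>x\<in>C. principal {r \<in> C. r \<le> x} \<le> inf (principal {r \<in> C. r \<le> a}) (principal {r \<in> C. r \<le> b})"
          if "a \<in> C" "b \<in> C" for a b
          using ch[OF that] that by (auto intro: order_trans)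
        then show ?thesis unfolding F_def
          by (subst eventually_INF_base[OF False]) (auto simp: eventually_principal)
      qed
      have nb: "F \<noteq> bot"
      proof
        assume "F = bot"
        then have "eventually (\<lambda>_. False) F" by simp
        then show False unfolding ev by auto
      qed
      have inC: "eventually (\<lambda>q. q \<in> C) F" unfolding ev using False by auto
      define u where "u x = (INF q\<in>C. q x)" for x
      have bdd: "bdd_below ((\<lambda>q. q x) ` C)" for x
        using square_seminormD(8)[OF sq] CA by (intro bdd_belowI[of _ 0]) auto
      have ule: "u x \<le> q x" if "q \<in> C" for q x
        unfolding u_def by (rule cINF_lower[OF bdd that])
      have lim: "((\<lambda>q. q x) \<longlongrightarrow> u x) F" for x
      proof (rule order_tendstoI)
        fix a assume "a < u x"
        then show "eventually (\<lambda>q. a < q x) F" unfolding ev using ule False by (meson ex_in_conv less_le_trans)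
      next
        fix a assume "u x < a"
        then obtain q where q: "q \<in> C" "q x < a"
          unfolding u_def using cINF_less_iff[OF False bdd] by auto
        then show "eventually (\<lambda>q. q x < a) F" unfolding ev by (auto simp: le_fun_def intro: le_less_trans)
      qed
      have evC: "eventually P F" if "\<And>q. q \<in> C \<Longrightarrow> P q" for P
        using inC by eventually_elim (rule that)
      have "square_seminorm u"
        unfolding square_seminorm_def
      proof (intro conjI allI)
        fix x y :: 'a and c
        note S = square_seminormD[OF sq[OF subsetD[OF CA]]]
        show "u (x + y) \<le> u x + u y"
          by (rule tendsto_le[OF nb tendsto_add[OF lim lim] lim]) (rule evC, rule S)
        show "u (x * y) \<le> u x * u y"
          by (rule tendsto_le[OF nb tendsto_mult[OF lim lim] lim]) (rule evC, rule S)
        show "u x \<le> norm x"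
          by (rule tendsto_le[OF nb tendsto_const lim]) (rule evC, rule S)
        have "((\<lambda>q. q (scaleC c x)) \<longlongrightarrow> cmod c * u x) F"
          by (rule Lim_transform_eventually[OF tendsto_mult_left[OF lim]]) (rule evC, simp add: S(2))
        then show "u (scaleC c x) = cmod c * u x" using tendsto_unique[OF nb lim] by blast
        have "((\<lambda>q. q (x * x)) \<longlongrightarrow> (u x)\<^sup>2) F"
          by (rule Lim_transform_eventually[OF tendsto_power[OF lim]]) (rule evC, simp add: S(4))
        then show "u (x * x) = (u x)\<^sup>2" using tendsto_unique[OF nb lim] by blast
      qed
      moreover have "u (k * x) = norm k * u x" for x
      proof -
        have "((\<lambda>q. q (k * x)) \<longlongrightarrow> norm k * u x) F"
          by (rule Lim_transform_eventually[OF tendsto_mult_left[OF lim]]) (rule evC, use CA in \<open>auto simp: A_def\<close>)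
        then show ?thesis using tendsto_unique[OF nb lim] by blast
      qed
      moreover have "u k = norm k"
      proof -
        have "((\<lambda>q. q k) \<longlongrightarrow> norm k) F"
          by (rule tendsto_eventually) (rule evC, use CA in \<open>auto simp: A_def\<close>)
        then show ?thesis using tendsto_unique[OF nb lim] by blast
      qed
      ultimately have "u \<in> A" by (simp add: A_def)
      then show ?thesis using ule by (auto simp: R_def le_fun_def)
    qed
  qed
  then obtain p where p: "p \<in> A" "\<And>q. q \<in> A \<Longrightarrow> q \<le> p \<Longrightarrow> q = p" by (auto simp: R_def)
  note P = square_seminormD[OF sq[OF p(1)]]
  have "p (b * x) = p b * p x" for b x
  proof (cases "p b = 0")
    case True
    then show ?thesis using P(3)[of b x] P(8)[of "b * x"] by simp
  next
    case False
    then have pos: "p b > 0" using P(8)[of b] by simp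
    obtain Q where Q: "square_seminorm Q" "\<And>x. Q x \<le> p x" "\<And>x. Q (b * x) = p b * Q x" "Q b = p b"
      "\<forall>k c. (\<forall>x. p (k * x) = c * p x) \<longrightarrow> (\<forall>x. Q (k * x) = c * Q x)"
      using square_seminorm_localize[OF sq[OF p(1)] pos] by blast
    have "\<forall>x. p (k * x) = norm k * p x" using p(1) by (simp add: A_def)
    with Q(5) have k: "Q (k * x) = norm k * Q x" for x by blast
    \<comment> \<open>Localising at \<open>b\<close> could only lower the value at \<open>k\<close>.
      It does not, because \<open>Q (k * b)\<close> is known exactly and
      \<open>Q b = p b\<close>.\<close>
    have "norm k * p b \<le> Q k * p b"
      using k[of b] square_seminormD(3)[OF Q(1), of k b] by (simp add: Q(4))
    then have "Q k = norm k" using pos Q(2)[of k] p(1) by (simp add: A_def)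
    with Q(1) k have "Q \<in> A" by (simp add: A_def)
    then have "Q = p" using p(2) Q(2) by (auto simp: le_fun_def)
    with Q(3) show ?thesis by simp
  qed
  then show ?thesis using that sq[OF p(1)] p(1) by (simp add: A_def)
qed

text \<open>Gelfand--Mazur without complex analysis (Ostrowski): were the minimum \<open>m\<close> of the distance
  function positive, factoring \<open>t\<^sup>N - s\<^sup>N\<close> for \<open>N = 2\<^sup>n\<close> would show that it is locally constant where it
  is attained.\<close>

lemma multiplicative_seminorm_eigenvalue:
  fixes p :: "'a::{cstar_algebra, comm_ring} \<Rightarrow> real"
  assumes p: "square_seminorm p" and mult: "\<And>x y. p (x * y) = p x * p y" and a: "p a > 0"
  shows "\<exists>l. p (x * a - scaleC l a) = 0"
proof (rule ccontr)
  assume no: "\<nexists>l. p (x * a - scaleC l a) = 0"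
  note P = square_seminormD[OF p]
  \<comment> \<open>Without a unit, the distance from \<open>x\<close> to the scalar
    \<open>l\<close> is measured after multiplication by \<open>a\<close>.\<close>
  define g where "g l = p (x * a - scaleC l a)" for l
  have gd: "g l - g l' \<le> cmod (l - l') * p a" for l l'
  proof -
    have "(x * a - scaleC l a) - (x * a - scaleC l' a) = - scaleC (l - l') a"
      using scaleC_add_left[of "l - l'" l' a] by (simp add: algebra_simps)
    then show ?thesis using P(9)[of "x * a - scaleC l a" "x * a - scaleC l' a"] P(7)[of "scaleC (l - l') a"]
      by (simp add: g_def P(2))
  qed
  have glow: "g l \<ge> cmod l * p a - p (x * a)" for l
    using P(9)[of "scaleC l a" "x * a"] P(7)[of "x * a - scaleC l a"] by (simp add: g_def P(2))
  have cont: "continuous_on S g" for S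
  proof -
    have "(p a)-lipschitz_on S g"
    proof (rule lipschitz_onI)
      fix l l' show "dist (g l) (g l') \<le> p a * dist l l'"
        using gd[of l l'] gd[of l' l] by (simp add: dist_norm norm_minus_commute abs_le_iff mult.commute)
    qed (use a in simp)
    then show ?thesis by (rule lipschitz_on_continuous_on)
  qed
  \<comment> \<open>Outside this radius \<open>g\<close> exceeds \<open>g 0 = p (x * a)\<close>, so
    a minimum over the disc is a global one.\<close>
  define r where "r = 2 * p (x * a) / p a"
  have "r \<ge> 0" using P(8) a by (simp add: r_def)
  then have "\<exists>l0\<in>cball 0 r. \<forall>l\<in>cball 0 r. g l0 \<le> g l"
    by (intro continuous_attains_inf cont) auto
  then obtain l0 where l0: "\<And>l. cmod l \<le> r \<Longrightarrow> g l0 \<le> g l"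
    by (metis mem_cball_0)
  have min: "g l0 \<le> g l" for l
  proof (cases "cmod l \<le> r")
    case False
    then have "2 * p (x * a) < cmod l * p a" using a by (simp add: r_def field_simps)
    with glow[of l] have "p (x * a) \<le> g l" by simp
    moreover have "g 0 = p (x * a)" using scaleR_scaleC[of 0 a] by (simp add: g_def)
    ultimately show ?thesis using l0[of 0] \<open>r \<ge> 0\<close> by simp
  qed (rule l0)
  define m where "m = g l0"
  have m: "m > 0" "\<And>l. m \<le> g l" using no P(8) min by (auto simp: m_def g_def less_le)
  have local: "g (l1 + w) = m" if l1: "g l1 = m" and w: "cmod w * p a < m" for l1 w
  proof -
    define t where "t = x * a - scaleC l1 a"
    define sq where "sq n u = ((\<lambda>u. u * u) ^^ n) u" for n and u :: 'a
    have sq: "sq 0 u = u" "sq (Suc n) u = sq n u * sq n u" for n u by (simp_all add: sq_def)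
    have psq: "p (sq n u) = p u ^ (2 ^ n)" for n u
      by (induction n) (simp_all add: sq mult power_mult power2_eq_square flip: power_add mult_2)
    have gt: "p (t - scaleC v a) = g (l1 + v)" for v
      by (simp add: t_def g_def scaleC_add_left algebra_simps)
    \<comment> \<open>Let N = 2^n and z^N = -1. Then t^(2N) - v^(2N) a^(2N) is the product of t^N -
      v^N a^N and t^N - (zv)^N a^N. The induction hypothesis applies to both; in the second factor
      \<open>g (l1 + z * v)\<close> is at least the minimum \<open>m\<close>.\<close>
    have key: "g (l1 + v) * m ^ (2 ^ n - 1) \<le> p (sq n t - scaleC (v ^ (2 ^ n)) (sq n a))" for n v
    proof (induction n arbitrary: v)
      case 0
      then show ?case by (simp add: sq gt)
    next
      case (Suc n)
      define z where "z = cis (pi / 2 ^ n)"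
      have z: "z ^ (2 ^ n) = -1" using Complex.DeMoivre[of "pi / 2 ^ n" "2 ^ n"] by (simp add: z_def)
      let ?T = "sq n t" and ?S = "sq n a" and ?v = "v ^ (2 ^ n)"
      have "scaleC (v ^ 2 ^ Suc n) (sq (Suc n) a) = scaleC ?v ?S * scaleC ?v ?S"
        by (simp add: sq mult_scaleC_left mult_scaleC_right scaleC_scaleC mult_2 power_add)
      moreover have "scaleC ((z * v) ^ (2 ^ n)) ?S = - scaleC ?v ?S"
        by (simp add: power_mult_distrib z scaleC_minus_left)
      ultimately have "sq (Suc n) t - scaleC (v ^ 2 ^ Suc n) (sq (Suc n) a)
          = (?T - scaleC ?v ?S) * (?T - scaleC ((z * v) ^ (2 ^ n)) ?S)"
        by (simp add: sq algebra_simps)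
      then have eq: "p (sq (Suc n) t - scaleC (v ^ 2 ^ Suc n) (sq (Suc n) a))
          = p (?T - scaleC ?v ?S) * p (?T - scaleC ((z * v) ^ (2 ^ n)) ?S)" by (simp add: mult)
      have "m * m ^ (2 ^ n - 1) \<le> p (?T - scaleC ((z * v) ^ (2 ^ n)) ?S)"
        using Suc.IH[of "z * v"] m(2)[of "l1 + z * v"] m(1)
        by (meson mult_right_mono order_trans zero_le_power less_imp_le)
      then have "(g (l1 + v) * m ^ (2 ^ n - 1)) * (m * m ^ (2 ^ n - 1))
          \<le> p (?T - scaleC ?v ?S) * p (?T - scaleC ((z * v) ^ (2 ^ n)) ?S)"
        using Suc.IH[of v] m P(8) by (intro mult_mono) auto
      moreover have "m ^ (2 ^ n - 1) * (m * m ^ (2 ^ n - 1)) = m ^ (2 ^ Suc n - 1)"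
      proof -
        have "(2 ^ n - 1) + Suc (2 ^ n - 1) = 2 ^ Suc n - (1::nat)"
          using one_le_power[of "2::nat" n] by simp
        then show ?thesis by (metis power_Suc power_add)
      qed
      ultimately show ?case unfolding eq by (simp add: mult.assoc)
    qed
    define \<rho> where "\<rho> = cmod w * p a / m"
    have \<rho>: "0 \<le> \<rho>" "\<rho> < 1" using w m(1) a by (simp_all add: \<rho>_def)
    have bound: "g (l1 + w) \<le> m * (1 + \<rho> ^ (2 ^ n))" for n
    proof -
      let ?N = "2 ^ n :: nat"
      have "g (l1 + w) * m ^ (?N - 1) \<le> p (sq n t) + p (scaleC (w ^ ?N) (sq n a))"
        using key[of w n] P(1)[of "sq n t" "- scaleC (w ^ ?N) (sq n a)"] P(7) by simp
      also have "p (sq n t) = m ^ ?N" using gt[of 0] l1 scaleR_scaleC[of 0 a] by (simp add: psq)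
      also have "p (scaleC (w ^ ?N) (sq n a)) = m ^ ?N * \<rho> ^ ?N"
        using m(1) by (simp add: P(2) psq norm_power \<rho>_def power_divide power_mult_distrib)
      also have "m ^ ?N = m * m ^ (?N - 1)" by (metis power_eq_if power_not_zero zero_neq_numeral)
      finally have "g (l1 + w) * m ^ (?N - 1) \<le> (m * (1 + \<rho> ^ ?N)) * m ^ (?N - 1)"
        by (simp add: algebra_simps)
      then show ?thesis using m(1) by simp
    qed
    have "(\<lambda>n. \<rho> ^ (2 ^ n)) \<longlonglongrightarrow> 0"
      using LIMSEQ_subseq_LIMSEQ[OF LIMSEQ_realpow_zero[OF \<rho>], of "\<lambda>n. 2 ^ n"]
      by (simp add: strict_mono_def o_def)
    then have "(\<lambda>n. m * (1 + \<rho> ^ (2 ^ n))) \<longlonglongrightarrow> m * (1 + 0)" by (intro tendsto_intros)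
    then have "g (l1 + w) \<le> m" using bound by (intro LIMSEQ_le_const) auto
    with m(2)[of "l1 + w"] show ?thesis by simp
  qed
  \<comment> \<open>Half the admissible step length. Repeated steps keep the value \<open>m\<close>
    along an unbounded sequence of scalars, although \<open>g l\<close> grows like
    \<open>cmod l * p a\<close>.\<close>
  define w :: complex where "w = of_real (m / (2 * p a))"
  have w: "cmod w * p a < m" using m(1) a by (simp add: w_def norm_divide norm_mult)
  have all: "g (l0 + of_nat n * w) = m" for n
  proof (induction n)
    case 0
    then show ?case by (simp add: m_def)
  next
    case (Suc n)
    then show ?case using local[OF Suc.IH w] by (simp add: algebra_simps)
  qed
  have "cmod w * p a > 0" using m(1) a by (simp add: w_def norm_divide norm_mult)
  then obtain n where n: "real n * (cmod w * p a) > m + p (x * a) + cmod l0 * p a"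
    using reals_Archimedean3 by blast
  have "real n * cmod w - cmod l0 \<le> cmod (l0 + of_nat n * w)"
    using norm_triangle_ineq4[of "l0 + of_nat n * w" l0] by (simp add: norm_mult)
  then have "(real n * cmod w - cmod l0) * p a \<le> cmod (l0 + of_nat n * w) * p a"
    using a by (intro mult_right_mono) auto
  with glow[of "l0 + of_nat n * w"] all[of n] n show False by (simp add: algebra_simps)
qed

text \<open>The zero functional is included.\<close>

definition chars :: "('a::cstar_algebra \<Rightarrow> complex) set" where
  "chars = {\<omega>. clinear_form \<omega> \<and> (\<forall>x y. \<omega> (x * y) = \<omega> x * \<omega> y) \<and> (\<forall>x. \<omega> (star x) = cnj (\<omega> x))
     \<and> (\<forall>x. cmod (\<omega> x) \<le> norm x)}"

lemma charsD:
  assumes "\<omega> \<in> chars"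
  shows "clinear_form \<omega>" "\<omega> (x * y) = \<omega> x * \<omega> y" "\<omega> (star x) = cnj (\<omega> x)" "cmod (\<omega> x) \<le> norm x"
  using assms by (auto simp: chars_def)

lemmas chars_linear = clinear_form_simps[OF charsD(1)]

text \<open>The eigenvalue of multiplication by \<open>x\<close> on \<open>k\<close>, modulo the
  null space of \<open>p\<close>, is unique and therefore linear and multiplicative in
  \<open>x\<close>. As \<open>p\<close> is multiplicative, its modulus is
  \<open>p x\<close>.\<close>

lemma selfadjoint_norming_char:
  fixes k :: "'a::{cstar_algebra, comm_ring}"
  assumes k: "star k = k"
  shows "\<exists>\<omega>\<in>chars. cmod (\<omega> k) = norm k"
proof (cases "k = 0")
  case True
  then show ?thesis by (intro bexI[of _ "\<lambda>_. 0"]) (auto simp: chars_def clinear_form_def)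
next
  case False
  obtain p where p: "square_seminorm p" and mult: "\<And>x y. p (x * y) = p x * p y" and pk: "p k = norm k"
    using multiplicative_seminorm_exists[OF False] by blast
  note P = square_seminormD[OF p]
  have pk0: "p k > 0" using pk False by simp
  obtain \<omega> where \<omega>: "\<And>x. p (x * k - scaleC (\<omega> x) k) = 0"
    using multiplicative_seminorm_eigenvalue[OF p mult pk0] by metis
  have uniq: "\<omega> x = l" if "p (x * k - scaleC l k) = 0" for x l
  proof -
    have "scaleC (\<omega> x - l) k = (x * k - scaleC l k) - (x * k - scaleC (\<omega> x) k)"
      using scaleC_add_left[of "\<omega> x - l" l k] by (simp add: algebra_simps)
    then have "p (scaleC (\<omega> x - l) k) \<le> 0"
      using P(1)[of "x * k - scaleC l k" "- (x * k - scaleC (\<omega> x) k)"] P(7)[of "x * k - scaleC (\<omega> x) k"] that \<omega>[of x]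
      by simp
    then have "cmod (\<omega> x - l) * p k = 0" using P(2)[of "\<omega> x - l" k] P(8)[of "scaleC (\<omega> x - l) k"] by simp
    with pk0 show ?thesis by simp
  qed
  have p0: "p u = 0" if "p v = 0" "p w = 0" "u = v + w" for u v w
    using P(1)[of v w] P(8)[of u] that by simp
  have add: "\<omega> (x + y) = \<omega> x + \<omega> y" for x y
    by (rule uniq, rule p0[OF \<omega>[of x] \<omega>[of y]]) (simp add: distrib_right scaleC_add_left)
  have sc: "\<omega> (scaleC c x) = c * \<omega> x" for c x
  proof (rule uniq)
    have "scaleC c x * k - scaleC (c * \<omega> x) k = scaleC c (x * k - scaleC (\<omega> x) k)"
      by (simp add: mult_scaleC_left scaleC_scaleC scaleC_diff_right)
    then show "p (scaleC c x * k - scaleC (c * \<omega> x) k) = 0" by (simp add: P(2) \<omega>)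
  qed
  have mu: "\<omega> (x * y) = \<omega> x * \<omega> y" for x y
  proof (rule uniq)
    have "(x * y * k - scaleC (\<omega> x * \<omega> y) k) * k
        = (x * k) * (y * k - scaleC (\<omega> y) k) + scaleC (\<omega> y) k * (x * k - scaleC (\<omega> x) k)"
      by (simp add: algebra_simps mult_scaleC_left mult_scaleC_right scaleC_scaleC)
    then have "p ((x * y * k - scaleC (\<omega> x * \<omega> y) k) * k) = 0"
      by (rule p0[rotated 2]) (simp_all add: mult \<omega>)
    with pk0 show "p (x * y * k - scaleC (\<omega> x * \<omega> y) k) = 0" by (simp add: mult)
  qed
  have lin: "clinear_form \<omega>" using add sc by (simp add: clinear_form_def)
  have abs: "cmod (\<omega> x) = p x" for x
  proof -
    have "p (x * k) = p (scaleC (\<omega> x) k)"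
      using P(9)[of "x * k" "scaleC (\<omega> x) k"] P(9)[of "scaleC (\<omega> x) k" "x * k"] \<omega>[of x]
        P(7)[of "x * k - scaleC (\<omega> x) k"] by simp
    with pk0 show ?thesis by (simp add: mult P(2))
  qed
  have real: "Im (\<omega> h) = 0" if h: "star h = h" for h
  proof (rule ccontr)
    define \<beta> where "\<beta> = Im (\<omega> h)"
    assume "Im (\<omega> h) \<noteq> 0"
    then have \<beta>: "\<beta> \<noteq> 0" by (simp add: \<beta>_def)
    \<comment> \<open>Arens' trick: the square of |\<omega>(h) + it| contains the term 2\<beta>t,
      while the squared norm of h + it, with \<open>k\<close> in place of a unit, contributes at
      most ||h||^2 + t^2. This \<open>t\<close> makes 2\<beta>t exceed ||h||^2 by one.\<close>
    define t where "t = ((norm h)\<^sup>2 + 1) / (2 * \<beta>)"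
    define z where "z = h * k + scaleC (\<i> * of_real t) k"
    have "star z * z = h * h * (k * k) + scaleC (of_real (t\<^sup>2)) (k * k)"
      by (simp add: z_def star_add star_mult star_scaleC h k algebra_simps mult_scaleC_left
          mult_scaleC_right scaleC_scaleC power2_eq_square)
         (simp add: scaleC_minus_left scaleC_scaleC)
    then have "(norm z)\<^sup>2 \<le> norm (h * h * (k * k)) + t\<^sup>2 * norm (k * k)"
      using norm_triangle_ineq[of "h * h * (k * k)" "scaleC (of_real (t\<^sup>2)) (k * k)"]
      by (simp add: norm_scaleC norm_power flip: norm_star_mult)
    also have "norm (h * h * (k * k)) \<le> (norm h)\<^sup>2 * norm (k * k)"
      using norm_mult_ineq[of "h * h" "k * k"] by (simp add: norm_square_commutative)
    finally have 1: "(norm z)\<^sup>2 \<le> ((norm h)\<^sup>2 + t\<^sup>2) * (norm k)\<^sup>2"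
      by (simp add: norm_square_commutative algebra_simps)
    have "\<omega> z = (\<omega> h + \<i> * of_real t) * \<omega> k" by (simp add: z_def add sc mu distrib_right)
    then have "(cmod (\<omega> z))\<^sup>2 = (cmod (\<omega> h + \<i> * of_real t))\<^sup>2 * (norm k)\<^sup>2"
      by (simp only: norm_mult power_mult_distrib abs[of k] pk)
    then have "(cmod (\<omega> z))\<^sup>2 = ((Re (\<omega> h))\<^sup>2 + (\<beta> + t)\<^sup>2) * (norm k)\<^sup>2"
      by (simp add: cmod_power2 \<beta>_def)
    moreover have "(cmod (\<omega> z))\<^sup>2 \<le> (norm z)\<^sup>2" using P(5)[of z] P(8)[of z] by (simp add: abs power_mono)
    ultimately have "((Re (\<omega> h))\<^sup>2 + (\<beta> + t)\<^sup>2) * (norm k)\<^sup>2 \<le> ((norm h)\<^sup>2 + t\<^sup>2) * (norm k)\<^sup>2"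
      using 1 by simp
    then have "(Re (\<omega> h))\<^sup>2 + (\<beta> + t)\<^sup>2 \<le> (norm h)\<^sup>2 + t\<^sup>2" using False by simp
    moreover have "2 * \<beta> * t = (norm h)\<^sup>2 + 1" using \<beta> by (simp add: t_def)
    moreover have "(\<beta> + t)\<^sup>2 = \<beta>\<^sup>2 + 2 * \<beta> * t + t\<^sup>2" by (simp add: power2_sum)
    ultimately show False using zero_le_power2[of "Re (\<omega> h)"] zero_le_power2[of \<beta>] by linarith
  qed
  have st: "\<omega> (star x) = cnj (\<omega> x)" for x
  proof -
    have "Im (\<omega> (x + star x)) = 0" by (rule real) (simp add: star_add star_star add.commute)
    moreover have "Im (\<omega> (scaleC \<i> (x - star x))) = 0"
      by (rule real) (simp add: star_simps star_scaleC star_star scaleC_diff_right scaleC_minus_left)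
    ultimately show ?thesis
      by (simp add: add sc clinear_form_simps[OF lin] complex_eq_iff)
  qed
  have "\<omega> \<in> chars" using lin mu st P(5) by (simp add: chars_def abs)
  then show ?thesis by (intro bexI[of _ \<omega>]) (simp_all add: abs pk)
qed

lemma norming_char:
  fixes x :: "'a::{cstar_algebra, comm_ring}"
  obtains \<omega> where "\<omega> \<in> chars" "cmod (\<omega> x) = norm x"
proof -
  have "star (star x * x) = star x * x" by (simp add: star_mult star_star)
  then obtain \<omega> where \<omega>: "\<omega> \<in> chars" "cmod (\<omega> (star x * x)) = norm (star x * x)"
    using selfadjoint_norming_char by blast
  then have "(cmod (\<omega> x))\<^sup>2 = (norm x)\<^sup>2"
    by (simp add: charsD norm_mult norm_star_mult power2_eq_square)
  with \<omega>(1) show ?thesis using that by simp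
qed

lemma norm_le_chars:
  fixes x :: "'a::{cstar_algebra, comm_ring}"
  assumes "\<And>\<omega>. \<omega> \<in> chars \<Longrightarrow> cmod (\<omega> x) \<le> C"
  shows "norm x \<le> C"
  using norming_char[of x] assms by metis

text \<open>Injectivity of the Gelfand transform. Identities in the algebra are verified pointwise
  from here on.\<close>

lemma chars_eqI:
  fixes x :: "'a::{cstar_algebra, comm_ring}"
  assumes "\<And>\<omega>. \<omega> \<in> chars \<Longrightarrow> \<omega> x = \<omega> y"
  shows "x = y"
  using norm_le_chars[of "x - y" 0] assms by (simp add: chars_linear)

section \<open>Functional calculus\<close>

lemma scaleC_zero_right: "scaleC c 0 = (0::'a::complex_vector)"
  using scaleC_diff_right[of c 0 0] by simp

lemma char_star_mult: "\<omega> \<in> chars \<Longrightarrow> \<omega> (star x * x) = of_real ((cmod (\<omega> x))\<^sup>2)"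
  by (simp only: charsD complex_norm_square mult.commute)

lemma selfadjoint_Im:
  assumes "star a = a" "\<omega> \<in> chars"
  shows "Im (\<omega> a) = 0"
  using charsD(3)[OF assms(2), of a] assms(1) by (simp add: complex_eq_iff)

lemma selfadjointI:
  fixes a :: "'a::{cstar_algebra, comm_ring}"
  assumes "\<And>\<omega>. \<omega> \<in> chars \<Longrightarrow> Im (\<omega> a) = 0"
  shows "star a = a"
  by (rule chars_eqI) (simp add: charsD(3) complex_eq_iff assms)

lemma continuous_function_of_selfadjoint:
  fixes a :: "'a::{cstar_algebra, comm_ring}"
  assumes h: "continuous_on UNIV h" "h 0 = (0::real)" and a: "star a = a"
  shows "\<exists>b. \<forall>\<omega>\<in>chars. \<omega> b = of_real (h (Re (\<omega> a)))"
proof -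
  define R where "R = norm a"
  have R: "Re (\<omega> a) \<in> {-R..R}" if "\<omega> \<in> chars" for \<omega>
    using charsD(4)[OF that, of a] abs_Re_le_cmod[of "\<omega> a"] by (auto simp: R_def abs_le_iff)
  have real: "of_real (Re (\<omega> a)) = \<omega> a" if "\<omega> \<in> chars" for \<omega>
    using selfadjoint_Im[OF a that] by (simp add: complex_eq_iff)
  have poly: "\<exists>b. \<forall>\<omega>\<in>chars. \<omega> b = of_real (p (Re (\<omega> a)) - p 0)"
    if "real_polynomial_function p" for p :: "real \<Rightarrow> real"
    using that
  proof induction
    case (linear f)
    have f: "f t = t * f 1" for t
      using linear_simps(5)[OF linear, of t 1] by simp
    show ?case
    proof (intro exI ballI)
      fix \<omega> :: "'a \<Rightarrow> complex" assume "\<omega> \<in> chars"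
      then show "\<omega> (f 1 *\<^sub>R a) = of_real (f (Re (\<omega> a)) - f 0)"
        using real[of \<omega>] by (subst (1 2) f) (simp add: chars_linear)
    qed
  next
    case (const c)
    show ?case by (intro exI[of _ 0]) (simp add: chars_linear)
  next
    case (add f g)
    then obtain b c where "\<forall>\<omega>\<in>chars. \<omega> b = of_real (f (Re (\<omega> a)) - f 0)"
      "\<forall>\<omega>\<in>chars. \<omega> c = of_real (g (Re (\<omega> a)) - g 0)" by blast
    then show ?case by (intro exI[of _ "b + c"]) (simp add: chars_linear algebra_simps)
  next
    case (mult f g)
    then obtain b c where bc: "\<forall>\<omega>\<in>chars. \<omega> b = of_real (f (Re (\<omega> a)) - f 0)"
      "\<forall>\<omega>\<in>chars. \<omega> c = of_real (g (Re (\<omega> a)) - g 0)" by blast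
    \<comment> \<open>With \<open>b\<close>, \<open>c\<close> standing for f - f(0) and g - g(0),
      this expands f g - f(0) g(0) without a constant term.\<close>
    show ?case
      by (intro exI[of _ "b * c + f 0 *\<^sub>R c + g 0 *\<^sub>R b"])
         (simp add: bc chars_linear charsD(2) algebra_simps)
  qed
  have "\<exists>b. \<forall>\<omega>\<in>chars. cmod (\<omega> b - of_real (h (Re (\<omega> a)))) \<le> inverse (real (Suc n))" for n
  proof -
    \<comment> \<open>Half of the error is spent on the approximation, half on removing
      \<open>p 0\<close>, which is small because \<open>h 0 = 0\<close>.\<close>
    have "0 < inverse (real (Suc n)) / 2" by simp
    then obtain p where p: "real_polynomial_function p" "\<And>x. x \<in> insert 0 {-R..R} \<Longrightarrow> \<bar>h x - p x\<bar> < inverse (real (Suc n)) / 2"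
      using Stone_Weierstrass_real_polynomial_function[of "insert 0 {-R..R}" h "inverse (real (Suc n)) / 2"]
        continuous_on_subset[OF h(1)] by (metis compact_insert compact_Icc subset_UNIV)
    obtain b where b: "\<forall>\<omega>\<in>chars. \<omega> b = of_real (p (Re (\<omega> a)) - p 0)" using poly[OF p(1)] by blast
    show ?thesis
    proof (intro exI ballI)
      fix \<omega> :: "'a \<Rightarrow> complex" assume \<omega>: "\<omega> \<in> chars"
      have "\<omega> b - of_real (h (Re (\<omega> a))) = of_real ((p (Re (\<omega> a)) - p 0) - h (Re (\<omega> a)))"
        using b \<omega> by simp
      then have "cmod (\<omega> b - of_real (h (Re (\<omega> a)))) = \<bar>(p (Re (\<omega> a)) - p 0) - h (Re (\<omega> a))\<bar>"
        by (simp only: norm_of_real)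
      also have "\<dots> \<le> inverse (real (Suc n))"
        using p(2)[of "Re (\<omega> a)"] p(2)[of 0] R[OF \<omega>] h(2) unfolding abs_less_iff abs_le_iff insert_iff
        by (smt (verit) field_sum_of_halves)
      finally show "cmod (\<omega> b - of_real (h (Re (\<omega> a)))) \<le> inverse (real (Suc n))" .
    qed
  qed
  then obtain b where b: "\<And>n \<omega>. \<omega> \<in> chars \<Longrightarrow> cmod (\<omega> (b n) - of_real (h (Re (\<omega> a)))) \<le> inverse (real (Suc n))"
    by metis
  have "Cauchy b"
    unfolding Cauchy_def
  proof safe
    fix e :: real assume "e > 0"
    then obtain N where N: "inverse (real (Suc N)) < e / 2" using reals_Archimedean half_gt_zero by blast
    have "dist (b m) (b n) < e" if mn: "m \<ge> N" "n \<ge> N" for m n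
    proof -
      have i: "inverse (real (Suc k)) \<le> inverse (real (Suc N))" if "k \<ge> N" for k
        using that by (simp add: le_imp_inverse_le)
      have "norm (b m - b n) \<le> 2 * inverse (real (Suc N))"
      proof (rule norm_le_chars)
        fix \<omega> :: "'a \<Rightarrow> complex" assume \<omega>: "\<omega> \<in> chars"
        have "\<omega> (b m - b n) = (\<omega> (b m) - of_real (h (Re (\<omega> a)))) - (\<omega> (b n) - of_real (h (Re (\<omega> a))))"
          using \<omega> by (simp add: chars_linear)
        also have "cmod \<dots> \<le> cmod (\<omega> (b m) - of_real (h (Re (\<omega> a)))) + cmod (\<omega> (b n) - of_real (h (Re (\<omega> a))))"
          by (rule norm_triangle_ineq4)
        finally show "cmod (\<omega> (b m - b n)) \<le> 2 * inverse (real (Suc N))"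
          using b[OF \<omega>, of m] b[OF \<omega>, of n] i[OF mn(1)] i[OF mn(2)] by linarith
      qed
      with N show ?thesis by (simp add: dist_norm)
    qed
    then show "\<exists>M. \<forall>m\<ge>M. \<forall>n\<ge>M. dist (b m) (b n) < e" by blast
  qed
  then obtain c where c: "b \<longlonglongrightarrow> c" using Cauchy_convergent convergent_def by blast
  have "\<omega> c = of_real (h (Re (\<omega> a)))" if \<omega>: "\<omega> \<in> chars" for \<omega>
  proof -
    have "bounded_linear \<omega>"
      by (rule clinear_form_bounded_linear[of _ 1]) (use charsD[OF \<omega>] in auto)
    then have "(\<lambda>n. \<omega> (b n)) \<longlonglongrightarrow> \<omega> c" using c by (rule bounded_linear.tendsto)
    moreover have "(\<lambda>n. \<omega> (b n) - of_real (h (Re (\<omega> a)))) \<longlonglongrightarrow> 0"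
      by (rule Lim_null_comparison[OF _ LIMSEQ_inverse_real_of_nat]) (use b[OF \<omega>] in auto)
    ultimately show ?thesis
      using LIMSEQ_unique Lim_null by blast
  qed
  then show ?thesis by blast
qed

definition fcalc :: "(real \<Rightarrow> real) \<Rightarrow> 'a::{cstar_algebra, comm_ring} \<Rightarrow> 'a" where
  "fcalc h a = (SOME b. \<forall>\<omega>\<in>chars. \<omega> b = of_real (h (Re (\<omega> a))))"

lemma fcalc_apply:
  assumes "continuous_on UNIV h" "h 0 = 0" "star a = a" "\<omega> \<in> chars"
  shows "\<omega> (fcalc h a) = of_real (h (Re (\<omega> a)))"
  using someI_ex[OF continuous_function_of_selfadjoint[OF assms(1-3)]] assms(4) by (simp add: fcalc_def)

lemma star_fcalc:
  assumes "continuous_on UNIV h" "h 0 = 0" "star a = a"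
  shows "star (fcalc h a) = fcalc h a"
  by (rule selfadjointI) (simp add: fcalc_apply[OF assms])

definition pos_elem :: "'a::cstar_algebra \<Rightarrow> bool" where
  "pos_elem a \<longleftrightarrow> (\<forall>\<omega>\<in>chars. \<exists>t\<ge>0. \<omega> a = of_real t)"

definition unit_elem :: "'a::cstar_algebra \<Rightarrow> bool" where
  "unit_elem a \<longleftrightarrow> (\<forall>\<omega>\<in>chars. \<exists>t\<in>{0..1}. \<omega> a = of_real t)"

lemma pos_elemI: "(\<And>\<omega>. \<omega> \<in> chars \<Longrightarrow> \<exists>t\<ge>0. \<omega> a = of_real t) \<Longrightarrow> pos_elem a"
  by (simp add: pos_elem_def)

lemma pos_elem_fcalc:
  assumes "continuous_on UNIV h" "h 0 = 0" "star a = a" "\<And>t. h t \<ge> 0"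
  shows "pos_elem (fcalc h a)"
  by (rule pos_elemI) (auto simp: fcalc_apply[OF assms(1-3)] assms(4))

lemma unit_elem_fcalc:
  assumes "continuous_on UNIV h" "h 0 = 0" "star a = a" "\<And>t. h t \<in> {0..1}"
  shows "unit_elem (fcalc h a)"
  unfolding unit_elem_def using assms(4) by (auto simp: fcalc_apply[OF assms(1-3)])

lemma unit_elem_pos: "unit_elem a \<Longrightarrow> pos_elem a"
  by (fastforce simp: unit_elem_def pos_elem_def)

lemma pos_elem_selfadjoint: "pos_elem a \<Longrightarrow> star a = (a::'a::{cstar_algebra, comm_ring})"
  by (rule selfadjointI) (auto simp: pos_elem_def)

lemma unit_elem_norm: "unit_elem a \<Longrightarrow> norm (a::'a::{cstar_algebra, comm_ring}) \<le> 1"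
  by (rule norm_le_chars) (auto simp: unit_elem_def)

lemma pos_elem_square:
  fixes a :: "'a::{cstar_algebra, comm_ring}"
  assumes "pos_elem a"
  obtains x where "pos_elem x" "a = star x * x"
proof
  let ?h = "\<lambda>t. sqrt (max 0 t)"
  have h: "continuous_on UNIV ?h" "?h 0 = 0" by (auto intro!: continuous_intros)
  have s: "star a = a" by (rule pos_elem_selfadjoint[OF assms])
  show "pos_elem (fcalc ?h a)" by (rule pos_elem_fcalc[OF h s]) auto
  show "a = star (fcalc ?h a) * fcalc ?h a"
  proof (rule chars_eqI)
    fix \<omega> :: "'a \<Rightarrow> complex" assume \<omega>: "\<omega> \<in> chars"
    obtain t where "t \<ge> 0" "\<omega> a = of_real t" using assms \<omega> by (auto simp: pos_elem_def)
    then show "\<omega> a = \<omega> (star (fcalc ?h a) * fcalc ?h a)"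
      using \<omega> by (simp add: charsD(2,3) fcalc_apply[OF h s] flip: of_real_mult)
  qed
qed

lemma unit_elem_mult: "unit_elem a \<Longrightarrow> unit_elem b \<Longrightarrow> unit_elem (a * b)"
  unfolding unit_elem_def by (force simp: charsD(2) mult_le_one simp flip: of_real_mult)

text \<open>The element \<open>1 - (1 - a) (1 - b)\<close>, written without a unit.\<close>

lemma unit_elem_join:
  assumes "unit_elem a" "unit_elem b"
  shows "unit_elem (a + b - a * b)"
  unfolding unit_elem_def
proof
  fix \<omega> :: "'a \<Rightarrow> complex" assume \<omega>: "\<omega> \<in> chars"
  obtain s t where st: "s \<in> {0..1}" "\<omega> a = of_real s" "t \<in> {0..1}" "\<omega> b = of_real t"
    using assms \<omega> unfolding unit_elem_def by blast
  have "0 \<le> (1 - s) * (1 - t)" "(1 - s) * (1 - t) \<le> 1" using st by (auto intro!: mult_nonneg_nonneg mult_le_one)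
  then have "s + t - s * t \<in> {0..1}" by (simp add: algebra_simps)
  then show "\<exists>r\<in>{0..1}. \<omega> (a + b - a * b) = of_real r"
    using st \<omega> by (intro bexI[of _ "s + t - s * t"]) (simp_all add: charsD(2) chars_linear)
qed

lemma norm_mult_unit_elem_le:
  fixes a :: "'a::{cstar_algebra, comm_ring}"
  assumes "unit_elem u"
  shows "norm (a * u) \<le> norm a" "norm (a - a * u) \<le> norm a"
proof -
  have *: "cmod (\<omega> (a * u)) \<le> norm a \<and> cmod (\<omega> (a - a * u)) \<le> norm a" if \<omega>: "\<omega> \<in> chars" for \<omega>
  proof -
    obtain t where t: "0 \<le> t" "t \<le> 1" "\<omega> u = of_real t" using assms \<omega> by (auto simp: unit_elem_def)
    have "\<omega> (a - a * u) = \<omega> a * of_real (1 - t)" using \<omega> t by (simp add: chars_linear charsD(2) algebra_simps)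
    then have "cmod (\<omega> (a - a * u)) = cmod (\<omega> a) * (1 - t)" using t by (simp only: norm_mult norm_of_real abs_of_nonneg)
    moreover have "cmod (\<omega> (a * u)) = cmod (\<omega> a) * t" using t \<omega> by (simp add: charsD(2) norm_mult)
    moreover have "cmod (\<omega> a) * t \<le> cmod (\<omega> a)" "cmod (\<omega> a) * (1 - t) \<le> cmod (\<omega> a)"
      using t by (auto intro!: mult_left_le)
    ultimately show ?thesis using charsD(4)[OF \<omega>, of a] by linarith
  qed
  show "norm (a * u) \<le> norm a" "norm (a - a * u) \<le> norm a" by (rule norm_le_chars, use * in blast)+
qed

text \<open>Each character is nonzero on at most one summand.\<close>

lemma orthogonal_sum_norm:
  fixes x :: "'i \<Rightarrow> 'a::{cstar_algebra, comm_ring}"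
  assumes "\<And>i j. i \<in> I \<Longrightarrow> j \<in> I \<Longrightarrow> i \<noteq> j \<Longrightarrow> x i * x j = 0" "\<And>i. i \<in> I \<Longrightarrow> norm (x i) \<le> C" "0 \<le> C"
  shows "norm (sum x I) \<le> C"
proof (cases "finite I")
  case True
  show ?thesis
  proof (rule norm_le_chars)
    fix \<omega> :: "'a \<Rightarrow> complex" assume \<omega>: "\<omega> \<in> chars"
    show "cmod (\<omega> (sum x I)) \<le> C"
    proof (cases "\<exists>i\<in>I. \<omega> (x i) \<noteq> 0")
      case False
      with \<omega> assms(3) show ?thesis by (simp add: chars_linear)
    next
      case True
      then obtain i where i: "i \<in> I" "\<omega> (x i) \<noteq> 0" by blast
      have "\<omega> (x j) = 0" if "j \<in> I - {i}" for j
        using assms(1)[of i j] i that charsD(2)[OF \<omega>, of "x i" "x j"] chars_linear(3)[OF \<omega>] by auto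
      then have "\<omega> (sum x I) = \<omega> (x i)"
        using \<omega> \<open>finite I\<close> i(1) by (simp add: chars_linear sum.remove)
      with charsD(4)[OF \<omega>, of "x i"] assms(2)[OF i(1)] show ?thesis by simp
    qed
  qed
qed (use assms(3) in simp)

section \<open>Finite sets of characters\<close>

definition spec :: "('a::cstar_algebra \<Rightarrow> complex) set" where
  "spec = {\<omega>\<in>chars. \<exists>x. \<omega> x \<noteq> 0}"

definition vanish :: "('a::cstar_algebra \<Rightarrow> complex) set \<Rightarrow> 'a set" where
  "vanish M = {a. \<forall>\<omega>\<in>M. \<omega> a = 0}"

lemma spec_chars: "\<omega> \<in> spec \<Longrightarrow> \<omega> \<in> chars"
  by (simp add: spec_def)

text \<open>The element (\<psi>(x) - x) z separates; the factor \<open>z\<close> replaces the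
  missing unit and keeps \<open>\<omega>\<close> from vanishing.\<close>

lemma char_separates:
  assumes \<omega>: "\<omega> \<in> spec" and \<psi>: "\<psi> \<in> chars" "\<psi> \<noteq> \<omega>"
  shows "\<exists>w. \<omega> w \<noteq> 0 \<and> \<psi> w = 0"
proof -
  obtain x where x: "\<psi> x \<noteq> \<omega> x" using \<psi>(2) by auto
  obtain z where z: "\<omega> z \<noteq> 0" using \<omega> by (auto simp: spec_def)
  let ?w = "scaleC (\<psi> x) z - x * z"
  have "\<psi> ?w = 0" "\<omega> ?w = (\<psi> x - \<omega> x) * \<omega> z"
    using \<psi>(1) spec_chars[OF \<omega>] by (simp_all add: chars_linear charsD(2) algebra_simps)
  with x z show ?thesis by (intro exI[of _ ?w]) simp
qed

lemma char_normalize: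
  assumes "\<omega> \<in> chars" "\<omega> w \<noteq> 0"
  shows "\<exists>v. star v = v \<and> \<omega> v = 1 \<and> (\<forall>\<psi>\<in>chars. \<psi> w = 0 \<longrightarrow> \<psi> v = 0)"
proof (intro exI conjI ballI impI)
  let ?v = "(1 / (cmod (\<omega> w))\<^sup>2) *\<^sub>R (star w * w)"
  show "star ?v = ?v" by (simp add: star_simps star_mult star_star)
  show "\<omega> ?v = 1" using assms by (simp add: chars_linear char_star_mult)
  show "\<psi> ?v = 0" if "\<psi> \<in> chars" "\<psi> w = 0" for \<psi> using that by (simp add: chars_linear char_star_mult)
qed

lemma char_peak:
  fixes \<omega> :: "'a::{cstar_algebra, comm_ring} \<Rightarrow> complex"
  assumes \<omega>: "\<omega> \<in> spec" and M: "finite M" "M \<subseteq> chars" "\<omega> \<notin> M"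
  shows "\<exists>d. star d = d \<and> \<omega> d = 1 \<and> (\<forall>\<psi>\<in>M. \<psi> d = 0)"
  using M
proof (induction M rule: finite_induct)
  case empty
  obtain x where "\<omega> x \<noteq> 0" using \<omega> by (auto simp: spec_def)
  then show ?case using char_normalize[OF spec_chars[OF \<omega>]] by blast
next
  case (insert \<psi> M)
  then obtain d where d: "star d = d" "\<omega> d = 1" "\<forall>\<psi>\<in>M. \<psi> d = 0" by auto
  obtain w where w: "\<omega> w \<noteq> 0" "\<psi> w = 0"
    using char_separates[OF \<omega>, of \<psi>] insert by auto
  obtain v where v: "star v = v" "\<omega> v = 1" "\<forall>\<psi>\<in>chars. \<psi> w = 0 \<longrightarrow> \<psi> v = 0"
    using char_normalize[of \<omega> w, OF spec_chars[OF \<omega>] w(1)] by blast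
  have "\<omega> (d * v) = 1" using d v spec_chars[OF \<omega>] by (simp add: charsD)
  moreover have "star (d * v) = d * v" using d v by (simp add: star_mult mult.commute)
  moreover have "\<rho> (d * v) = 0" if "\<rho> \<in> insert \<psi> M" for \<rho>
  proof -
    have "\<rho> \<in> chars" using insert that by auto
    with that w d v show ?thesis by (auto simp: charsD)
  qed
  ultimately show ?case by blast
qed

lemma char_interpolation:
  fixes M :: "('a::{cstar_algebra, comm_ring} \<Rightarrow> complex) set"
  assumes M: "finite M" "M \<subseteq> spec"
  obtains t where "star t = t" "\<And>\<omega>. \<omega> \<in> M \<Longrightarrow> \<omega> t = of_real (v \<omega>)"
proof -
  have "\<exists>d. star d = d \<and> \<omega> d = 1 \<and> (\<forall>\<psi>\<in>M - {\<omega>}. \<psi> d = 0)" if "\<omega> \<in> M" for \<omega>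
    using that M by (intro char_peak) (auto simp: spec_def)
  then obtain d where d: "\<And>\<omega>. \<omega> \<in> M \<Longrightarrow> star (d \<omega>) = d \<omega>" "\<And>\<omega>. \<omega> \<in> M \<Longrightarrow> \<omega> (d \<omega>) = 1"
    "\<And>\<omega> \<psi>. \<omega> \<in> M \<Longrightarrow> \<psi> \<in> M - {\<omega>} \<Longrightarrow> \<psi> (d \<omega>) = 0" by metis
  let ?t = "\<Sum>\<omega>\<in>M. v \<omega> *\<^sub>R d \<omega>"
  show ?thesis
  proof (rule that[of ?t])
    show "star ?t = ?t"
      by (rule selfadjointI) (auto simp: chars_linear selfadjoint_Im d(1))
    fix \<psi> assume \<psi>: "\<psi> \<in> M"
    then have c: "\<psi> \<in> chars" using M spec_chars by blast
    have "\<psi> ?t = (\<Sum>\<omega>\<in>M. of_real (v \<omega>) * \<psi> (d \<omega>))" using c by (simp add: chars_linear)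
    also have "\<dots> = (\<Sum>\<omega>\<in>M. if \<omega> = \<psi> then of_real (v \<psi>) else 0)"
      using d \<psi> by (intro sum.cong) auto
    finally show "\<psi> ?t = of_real (v \<psi>)" using M(1) \<psi> by simp
  qed
qed

text \<open>A single selfadjoint element takes distinct positive integer values on \<open>M\<close>,
  and tent functions around these integers have products zero.\<close>

lemma orthogonal_bumps:
  fixes M :: "('a::{cstar_algebra, comm_ring} \<Rightarrow> complex) set"
  assumes M: "finite M" "M \<subseteq> spec"
  obtains e where "\<And>\<omega>. \<omega> \<in> M \<Longrightarrow> unit_elem (e \<omega>)" "\<And>\<omega>. \<omega> \<in> M \<Longrightarrow> \<omega> (e \<omega>) = 1"
    "\<And>\<omega> \<psi>. \<omega> \<noteq> \<psi> \<Longrightarrow> e \<omega> * e \<psi> = 0"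
proof -
  obtain f :: "_ \<Rightarrow> nat" where f: "inj_on f M" using finite_imp_inj_to_nat_seg[OF M(1)] by blast
  obtain t where t: "star t = t" "\<And>\<omega>. \<omega> \<in> M \<Longrightarrow> \<omega> t = of_real (real (Suc (f \<omega>)))"
    using char_interpolation[OF M, of "\<lambda>\<omega>. real (Suc (f \<omega>))"] by blast
  \<comment> \<open>Half-width 1/2 makes tents around distinct integers disjoint. The centres start
    at 1, so that every tent vanishes at 0.\<close>
  define h where "h c x = max 0 (1 - 2 * \<bar>x - c\<bar>)" for c x :: real
  have h: "continuous_on UNIV (h c)" for c unfolding h_def by (intro continuous_intros)
  have h0: "h (real (Suc n)) 0 = 0" for n by (simp add: h_def)
  define e where "e \<omega> = (if \<omega> \<in> M then fcalc (h (real (Suc (f \<omega>)))) t else 0)" for \<omega>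
  show ?thesis
  proof (rule that[of e])
    show "unit_elem (e \<omega>)" if "\<omega> \<in> M" for \<omega>
    proof -
      have "unit_elem (fcalc (h (real (Suc (f \<omega>)))) t)"
        by (rule unit_elem_fcalc[OF h h0 t(1)]) (auto simp: h_def)
      with that show ?thesis by (simp add: e_def)
    qed
    show "\<omega> (e \<omega>) = 1" if "\<omega> \<in> M" for \<omega>
    proof -
      have "\<omega> \<in> chars" using that M spec_chars by blast
      then show ?thesis
        using that t(2)[OF that] by (simp add: e_def fcalc_apply[OF h h0 t(1)] h_def del: of_nat_Suc)
    qed
    show "e \<omega> * e \<psi> = 0" if "\<omega> \<noteq> \<psi>" for \<omega> \<psi>
    proof (cases "\<omega> \<in> M \<and> \<psi> \<in> M")
      case True
      then have "f \<omega> \<noteq> f \<psi>" using f that by (auto simp: inj_on_def)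
      then have "\<bar>real (f \<omega>) - real (f \<psi>)\<bar> \<ge> 1" by linarith
      then have "h (real (Suc (f \<omega>))) x * h (real (Suc (f \<psi>))) x = 0" for x
      proof -
        have "\<bar>x - real (Suc (f \<omega>))\<bar> \<ge> 1/2 \<or> \<bar>x - real (Suc (f \<psi>))\<bar> \<ge> 1/2"
          using \<open>\<bar>real (f \<omega>) - real (f \<psi>)\<bar> \<ge> 1\<close> unfolding of_nat_Suc by linarith
        then show ?thesis unfolding h_def mult_eq_0_iff by (elim disj_forward) (simp_all add: max_def)
      qed
      then have "of_real (h (real (Suc (f \<omega>))) x) * of_real (h (real (Suc (f \<psi>))) x) = (0::complex)" for x
        by (metis of_real_0 of_real_mult)
      then show ?thesis
        using True by (intro chars_eqI) (simp add: e_def charsD(2) fcalc_apply[OF h h0 t(1)] chars_linear del: of_nat_Suc)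
    qed (auto simp: e_def)
  qed
qed

lemma orthogonal_bumps_off:
  assumes "\<omega> \<noteq> \<psi>" "\<psi> \<in> M" "M \<subseteq> spec" "\<And>\<omega> \<psi>. \<omega> \<noteq> \<psi> \<Longrightarrow> e \<omega> * e \<psi> = 0" "\<psi> (e \<psi>) = 1"
  shows "\<psi> (e \<omega>) = 0"
proof -
  have c: "\<psi> \<in> chars" using assms(2,3) spec_chars by blast
  have "\<psi> (e \<omega>) * \<psi> (e \<psi>) = \<psi> (e \<omega> * e \<psi>)" using c by (simp add: charsD)
  also have "\<dots> = 0" using assms(1,4) c by (simp add: chars_linear)
  finally show ?thesis using assms(5) by simp
qed

text \<open>The sum over the bumps is a contractive projection with kernel \<open>vanish M\<close>.
  It reduces a functional that is small on \<open>vanish M\<close> to its finitely many values on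
  bumps.\<close>

lemma bump_projection:
  fixes M :: "('a::{cstar_algebra, comm_ring} \<Rightarrow> complex) set" and e :: "('a \<Rightarrow> complex) \<Rightarrow> 'a"
  assumes M: "finite M" "M \<subseteq> spec"
    and e0: "\<forall>\<omega>\<in>M. unit_elem (e \<omega>) \<and> \<omega> (e \<omega>) = 1"
    and e3: "\<forall>\<omega> \<psi>. \<omega> \<noteq> \<psi> \<longrightarrow> e \<omega> * e \<psi> = 0"
  shows "a - (\<Sum>\<omega>\<in>M. scaleC (\<omega> a) (e \<omega>)) \<in> vanish M"
    "norm (\<Sum>\<omega>\<in>M. scaleC (\<omega> a) (e \<omega>)) \<le> norm a"
    "norm (a - (\<Sum>\<omega>\<in>M. scaleC (\<omega> a) (e \<omega>))) \<le> 2 * norm a"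
proof -
  have e: "\<And>\<omega>. \<omega> \<in> M \<Longrightarrow> unit_elem (e \<omega>)" "\<And>\<omega>. \<omega> \<in> M \<Longrightarrow> \<omega> (e \<omega>) = 1"
    "\<And>\<omega> \<psi>. \<omega> \<noteq> \<psi> \<Longrightarrow> e \<omega> * e \<psi> = 0" using e0 e3 by blast+
  show "a - (\<Sum>\<omega>\<in>M. scaleC (\<omega> a) (e \<omega>)) \<in> vanish M"
    unfolding vanish_def
  proof safe
    fix \<psi> assume \<psi>: "\<psi> \<in> M"
    then have c: "\<psi> \<in> chars" using M spec_chars by blast
    have "(\<Sum>\<omega>\<in>M. \<omega> a * \<psi> (e \<omega>)) = (\<Sum>\<omega>\<in>M. if \<omega> = \<psi> then \<psi> a else 0)"
      using orthogonal_bumps_off[where e = e, OF _ \<psi> M(2) e(3) e(2)[OF \<psi>]] e(2) \<psi> by (intro sum.cong) auto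
    then show "\<psi> (a - (\<Sum>\<omega>\<in>M. scaleC (\<omega> a) (e \<omega>))) = 0"
      using c M(1) \<psi> by (simp add: chars_linear)
  qed
  show n: "norm (\<Sum>\<omega>\<in>M. scaleC (\<omega> a) (e \<omega>)) \<le> norm a"
  proof (rule orthogonal_sum_norm)
    fix \<omega> assume \<omega>: "\<omega> \<in> M"
    have "cmod (\<omega> a) * norm (e \<omega>) \<le> norm a * 1"
      using charsD(4)[of \<omega> a] M \<omega> spec_chars unit_elem_norm[OF e(1)[OF \<omega>]] by (intro mult_mono) auto
    then show "norm (scaleC (\<omega> a) (e \<omega>)) \<le> norm a" by (simp add: norm_scaleC)
  next
    fix \<omega> \<psi> assume "\<omega> \<in> M" "\<psi> \<in> M" "\<omega> \<noteq> \<psi>"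
    then show "scaleC (\<omega> a) (e \<omega>) * scaleC (\<psi> a) (e \<psi>) = 0"
      by (simp add: mult_scaleC_left mult_scaleC_right e(3) scaleC_zero_right)
  qed simp
  show "norm (a - (\<Sum>\<omega>\<in>M. scaleC (\<omega> a) (e \<omega>))) \<le> 2 * norm a"
    using norm_triangle_ineq4[of a "\<Sum>\<omega>\<in>M. scaleC (\<omega> a) (e \<omega>)"] n by simp
qed

definition clamp01 :: "real \<Rightarrow> real" where
  "clamp01 t = max 0 (min 1 t)"

lemma clamp01_simps [simp]: "clamp01 0 = 0" "0 \<le> clamp01 t" "clamp01 t \<le> 1"
  by (simp_all add: clamp01_def)

lemma continuous_on_clamp01 [continuous_intros]:
  "continuous_on S f \<Longrightarrow> continuous_on S (\<lambda>x. clamp01 (f x))"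
  unfolding clamp01_def by (intro continuous_intros)

text \<open>Since \<open>u * e = e\<close> and \<open>e\<close> is one on \<open>M\<close>, the element \<open>u\<close> is one near \<open>M\<close>, and \<open>a - a * u\<close> vanishes there.\<close>

lemma vanish_near:
  fixes M :: "('a::{cstar_algebra, comm_ring} \<Rightarrow> complex) set"
  assumes M: "finite M" "M \<subseteq> spec" and a: "a \<in> vanish M" and \<eta>: "\<eta> > 0"
  obtains u e where "unit_elem u" "unit_elem e" "u * e = e" "\<And>\<omega>. \<omega> \<in> M \<Longrightarrow> \<omega> e = 1" "norm (a * u) \<le> \<eta>"
proof -
  obtain t where t: "star t = t" "\<And>\<omega>. \<omega> \<in> M \<Longrightarrow> \<omega> t = 1"
    using char_interpolation[OF M, of "\<lambda>_. 1"] by (metis of_real_1)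
  define d where "d = fcalc clamp01 t"
  have cc: "continuous_on UNIV clamp01" using continuous_on_clamp01[OF continuous_on_id] by simp
  have d: "\<omega> d = of_real (clamp01 (Re (\<omega> t)))" if "\<omega> \<in> chars" for \<omega>
    unfolding d_def by (rule fcalc_apply[OF cc _ t(1) that]) simp
  \<comment> \<open>\<open>s\<close> is one on \<open>M\<close> and at most zero wherever |a|
    exceeds \<eta>, so functions of \<open>s\<close> supported on the positive axis see only the
    region where \<open>a\<close> is small.\<close>
  define s where "s = d - (1 / \<eta>\<^sup>2) *\<^sub>R (star a * a)"
  have s: "\<omega> s = of_real (clamp01 (Re (\<omega> t)) - (cmod (\<omega> a))\<^sup>2 / \<eta>\<^sup>2)" if "\<omega> \<in> chars" for \<omega>
    using that by (simp add: s_def chars_linear d char_star_mult)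
  have sa: "star s = s" by (rule selfadjointI) (simp add: s)
  \<comment> \<open>\<open>h1\<close> is already one from 1/3 on, whereas \<open>h2\<close> is zero
    up to 2/3; the gap gives \<open>u * e = e\<close>.\<close>
  define h1 where "h1 x = clamp01 (3 * x)" for x
  define h2 where "h2 x = clamp01 (3 * x - 2)" for x
  have h1: "continuous_on UNIV h1" "h1 0 = 0" unfolding h1_def by (auto intro!: continuous_intros)
  have h2: "continuous_on UNIV h2" "h2 0 = 0" unfolding h2_def by (auto intro!: continuous_intros simp: clamp01_def)
  define u where "u = fcalc h1 s"
  define e where "e = fcalc h2 s"
  note u = fcalc_apply[OF h1 sa, folded u_def] and e = fcalc_apply[OF h2 sa, folded e_def]
  show ?thesis
  proof (rule that[of u e])
    show "unit_elem u" unfolding u_def by (rule unit_elem_fcalc[OF h1 sa]) (simp add: h1_def)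
    show "unit_elem e" unfolding e_def by (rule unit_elem_fcalc[OF h2 sa]) (simp add: h2_def)
    have "h1 x * h2 x = h2 x" for x by (auto simp: h1_def h2_def clamp01_def max_def min_def)
    then have "of_real (h1 x) * of_real (h2 x) = (of_real (h2 x) :: complex)" for x by (metis of_real_mult)
    then show "u * e = e" by (intro chars_eqI) (simp add: charsD u e)
    show "\<omega> e = 1" if "\<omega> \<in> M" for \<omega>
    proof -
      have c: "\<omega> \<in> chars" using that M spec_chars by blast
      have "\<omega> a = 0" using a that by (simp add: vanish_def)
      then show ?thesis using c t(2)[OF that] by (simp add: e s) (simp add: h2_def clamp01_def)
    qed
    show "norm (a * u) \<le> \<eta>"
    proof (rule norm_le_chars)
      fix \<omega> :: "'a \<Rightarrow> complex" assume c: "\<omega> \<in> chars"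
      show "cmod (\<omega> (a * u)) \<le> \<eta>"
      proof (cases "cmod (\<omega> a) \<le> \<eta>")
        case True
        have "cmod (\<omega> a) * cmod (\<omega> u) \<le> cmod (\<omega> a) * 1"
          using c by (intro mult_left_mono) (simp_all add: u h1_def)
        with True c show ?thesis by (simp add: charsD norm_mult)
      next
        case False
        then have "(cmod (\<omega> a))\<^sup>2 / \<eta>\<^sup>2 \<ge> 1" using \<eta> by (simp add: power_mono)
        then have "Re (\<omega> s) \<le> 0" using clamp01_simps(3)[of "Re (\<omega> t)"] by (simp only: s[OF c] Re_complex_of_real)
        then have "\<omega> u = 0" using c by (simp add: u h1_def clamp01_def)
        then show ?thesis using c \<eta> by (simp add: charsD)
      qed
    qed
  qed
qed

text \<open>Both elements are functions of s = 2 |c|^2 / \<eta>^2. Where |c| exceeds \<eta> one has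
  s \<ge> 2 and \<open>h\<close> is one; where \<open>h\<close> is nonzero one has s > 1 and
  \<open>e\<close> is one; and \<open>e\<close> vanishes with \<open>c\<close>.\<close>

lemma local_unit:
  fixes c :: "'a::{cstar_algebra, comm_ring}"
  assumes \<eta>: "\<eta> > 0"
  obtains h e where "unit_elem h" "unit_elem e" "h * e = h" "norm (c - c * h) \<le> \<eta>"
    "\<And>\<omega>. \<omega> \<in> chars \<Longrightarrow> \<omega> c = 0 \<Longrightarrow> \<omega> e = 0" 
proof -
  define s where "s = (2 / \<eta>\<^sup>2) *\<^sub>R (star c * c)"
  have s: "\<omega> s = of_real (2 * (cmod (\<omega> c))\<^sup>2 / \<eta>\<^sup>2)" if "\<omega> \<in> chars" for \<omega>
    using that by (simp add: s_def chars_linear char_star_mult)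
  have sa: "star s = s" by (rule selfadjointI) (simp add: s)
  define h1 where "h1 x = clamp01 (x - 1)" for x
  have h1: "continuous_on UNIV h1" "h1 0 = 0" unfolding h1_def by (auto intro!: continuous_intros simp: clamp01_def)
  have h2: "continuous_on UNIV clamp01" "clamp01 0 = 0" using continuous_on_clamp01[OF continuous_on_id] by auto
  define h where "h = fcalc h1 s"
  define e where "e = fcalc clamp01 s"
  note h = fcalc_apply[OF h1 sa, folded h_def] and e = fcalc_apply[OF h2 sa, folded e_def]
  show ?thesis
  proof (rule that[of h e])
    show "unit_elem h" unfolding h_def by (rule unit_elem_fcalc[OF h1 sa]) (simp add: h1_def)
    show "unit_elem e" unfolding e_def by (rule unit_elem_fcalc[OF h2 sa]) simp
    have "h1 x * clamp01 x = h1 x" for x by (auto simp: h1_def clamp01_def max_def min_def)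
    then have "of_real (h1 x) * of_real (clamp01 x) = (of_real (h1 x) :: complex)" for x by (metis of_real_mult)
    then show "h * e = h" by (intro chars_eqI) (simp add: charsD h e)
    show "\<omega> e = 0" if "\<omega> \<in> chars" "\<omega> c = 0" for \<omega> using that by (simp add: e s)
    show "norm (c - c * h) \<le> \<eta>"
    proof (rule norm_le_chars)
      fix \<omega> :: "'a \<Rightarrow> complex" assume \<omega>: "\<omega> \<in> chars"
      have "\<omega> (c - c * h) = \<omega> c * of_real (1 - h1 (Re (\<omega> s)))"
        using \<omega> by (simp add: chars_linear charsD h algebra_simps)
      then have n: "cmod (\<omega> (c - c * h)) = cmod (\<omega> c) * (1 - h1 (Re (\<omega> s)))"
        by (simp only: norm_mult norm_of_real) (simp add: h1_def)
      show "cmod (\<omega> (c - c * h)) \<le> \<eta>"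
      proof (cases "cmod (\<omega> c) \<le> \<eta>")
        case True
        have "cmod (\<omega> c) * (1 - h1 (Re (\<omega> s))) \<le> cmod (\<omega> c) * 1" by (intro mult_left_mono) (auto simp: h1_def)
        with True n show ?thesis by simp
      next
        case False
        then have "(cmod (\<omega> c))\<^sup>2 / \<eta>\<^sup>2 \<ge> 1" using \<eta> by (simp add: power_mono)
        then have "Re (\<omega> s) \<ge> 2" by (simp only: s[OF \<omega>] Re_complex_of_real)
        then have "h1 (Re (\<omega> s)) = 1" by (simp add: h1_def clamp01_def)
        with n \<eta> show ?thesis by simp
      qed
    qed
  qed
qed

section \<open>Closed ideals\<close>

lemma compact_chars: "compact (chars :: ('a::cstar_algebra \<Rightarrow> complex) set)"
proof -
  define K where "K = PiE UNIV (\<lambda>x::'a. cball (0::complex) (norm x))"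
  have "compactin (product_topology (\<lambda>_. euclidean) UNIV) K"
    unfolding K_def compactin_PiE by simp
  then have K: "compact K" by (simp add: euclidean_product_topology)
  have c: "continuous_on UNIV (\<lambda>\<omega>::'a \<Rightarrow> complex. \<omega> x)" for x
    by (rule continuous_on_product_coordinates)
  have "closed {\<omega> :: 'a \<Rightarrow> complex. (\<forall>x y. \<omega> (x + y) = \<omega> x + \<omega> y) \<and> (\<forall>c x. \<omega> (scaleC c x) = c * \<omega> x)
      \<and> (\<forall>x y. \<omega> (x * y) = \<omega> x * \<omega> y) \<and> (\<forall>x. \<omega> (star x) = cnj (\<omega> x))}"
    by (intro closed_Collect_conj closed_Collect_all closed_Collect_eq continuous_intros c)
  from compact_Int_closed[OF K this] show ?thesis
    by (rule back_subst[of compact]) (auto simp: chars_def clinear_form_def K_def)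
qed

text \<open>By compactness a finite sum q of terms |j|^2 with j in \<open>J\<close> is bounded below
  by some m > 0 on the set where |d| is not small. Then q d / max(q, m) lies in the ideal and is
  uniformly close to \<open>d\<close>.\<close>

lemma closed_ideal_synthesis:
  fixes d :: "'a::{cstar_algebra, comm_ring}"
  assumes J: "0 \<in> J" "\<And>x y. x \<in> J \<Longrightarrow> y \<in> J \<Longrightarrow> x + y \<in> J" "\<And>x y. x \<in> J \<Longrightarrow> x * y \<in> J" "closed J"
    and d: "\<And>\<omega>. \<omega> \<in> chars \<Longrightarrow> (\<And>j. j \<in> J \<Longrightarrow> \<omega> j = 0) \<Longrightarrow> \<omega> d = 0"
  shows "d \<in> J"
proof -
  have "\<exists>y\<in>J. dist y d < \<delta>" if "\<delta> > 0" for \<delta>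
  proof -
    define K where "K = chars \<inter> {\<omega> :: 'a \<Rightarrow> complex. \<delta> / 2 \<le> cmod (\<omega> d)}"
    have c: "continuous_on S (\<lambda>\<omega>::'a \<Rightarrow> complex. \<omega> x)" for x S
      by (rule continuous_on_subset[OF continuous_on_product_coordinates]) simp
    have K: "compact K"
      unfolding K_def by (intro compact_Int_closed compact_chars closed_Collect_le continuous_intros c)
    have "\<exists>j\<in>J. \<omega> j \<noteq> 0" if "\<omega> \<in> K" for \<omega>
    proof (rule ccontr)
      assume "\<not> (\<exists>j\<in>J. \<omega> j \<noteq> 0)"
      then have "\<omega> d = 0" using d[of \<omega>] that by (auto simp: K_def)
      with that \<open>\<delta> > 0\<close> show False by (simp add: K_def)
    qed
    then have cov: "K \<subseteq> (\<Union>j\<in>J. {\<omega>. \<omega> j \<noteq> 0})" by blast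
    have op: "open {\<omega> :: 'a \<Rightarrow> complex. \<omega> j \<noteq> 0}" if "j \<in> J" for j
      by (intro open_Collect_neq continuous_intros c)
    obtain C where C: "C \<subseteq> J" "finite C" "K \<subseteq> (\<Union>j\<in>C. {\<omega>. \<omega> j \<noteq> 0})"
      by (rule compactE_image[OF K op cov])
    define q where "q = (\<Sum>j\<in>C. j * star j)"
    have q: "\<omega> q = of_real (\<Sum>j\<in>C. (cmod (\<omega> j))\<^sup>2)" if "\<omega> \<in> chars" for \<omega>
      using that by (simp only: q_def chars_linear charsD of_real_sum complex_norm_square)
    have "(\<Sum>j\<in>D. j * star j) \<in> J" if "D \<subseteq> C" for D
      using finite_subset[OF that C(2)] that
      by (induction D rule: finite_induct) (use C(1) J in auto)
    then have qJ: "q \<in> J" by (simp add: q_def)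
    have "\<exists>m>0. \<forall>\<omega>\<in>K. m \<le> (\<Sum>j\<in>C. (cmod (\<omega> j))\<^sup>2)"
    proof (cases "K = {}")
      case True
      then show ?thesis by (intro exI[of _ 1]) auto
    next
      case False
      have "\<exists>\<omega>\<in>K. \<forall>\<psi>\<in>K. (\<Sum>j\<in>C. (cmod (\<omega> j))\<^sup>2) \<le> (\<Sum>j\<in>C. (cmod (\<psi> j))\<^sup>2)"
        by (intro continuous_attains_inf K False continuous_intros c)
      then obtain \<omega> where \<omega>: "\<omega> \<in> K" "\<forall>\<psi>\<in>K. (\<Sum>j\<in>C. (cmod (\<omega> j))\<^sup>2) \<le> (\<Sum>j\<in>C. (cmod (\<psi> j))\<^sup>2)" by blast
      obtain i where i: "i \<in> C" "\<omega> i \<noteq> 0" using C(3) \<omega>(1) by blast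
      have "0 < (\<Sum>j\<in>C. (cmod (\<omega> j))\<^sup>2)"
        by (rule sum_pos2[OF C(2) i(1)]) (use i(2) in auto)
      with \<omega>(2) show ?thesis by blast
    qed
    then obtain m where m: "m > 0" "\<And>\<omega>. \<omega> \<in> K \<Longrightarrow> m \<le> (\<Sum>j\<in>C. (cmod (\<omega> j))\<^sup>2)" by blast
    \<comment> \<open>The inverse of max(t, m), shifted to vanish at 0; the constant 1/m is added
      back in \<open>b\<close> as a multiple of \<open>d\<close>.\<close>
    define v where "v t = 1 / max t m - 1 / m" for t
    have v: "continuous_on UNIV v" "v 0 = 0"
    proof -
      have "max t m \<noteq> 0" for t using m(1) by linarith
      then show "continuous_on UNIV v" unfolding v_def by (intro continuous_intros) auto
      show "v 0 = 0" using m(1) by (simp add: v_def)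
    qed
    have sa: "star q = q" by (rule selfadjointI) (simp add: q)
    define b where "b = d * fcalc v q + (1 / m) *\<^sub>R d"
    have "norm (q * b - d) \<le> \<delta> / 2"
    proof (rule norm_le_chars)
      fix \<omega> :: "'a \<Rightarrow> complex" assume \<omega>: "\<omega> \<in> chars"
      define t where "t = (\<Sum>j\<in>C. (cmod (\<omega> j))\<^sup>2)"
      have t: "t \<ge> 0" by (simp add: t_def sum_nonneg)
      have "\<omega> (q * b - d) = - (\<omega> d * of_real (1 - t * (v t + 1 / m)))"
        using \<omega> by (simp add: chars_linear charsD b_def fcalc_apply[OF v sa] q t_def[symmetric] algebra_simps)
      then have n: "cmod (\<omega> (q * b - d)) = cmod (\<omega> d) * \<bar>1 - t * (v t + 1 / m)\<bar>"
        by (simp only: norm_minus_cancel norm_mult norm_of_real)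
      show "cmod (\<omega> (q * b - d)) \<le> \<delta> / 2"
      proof (cases "t \<ge> m")
        case True
        then have "1 - t * (v t + 1 / m) = 0" using m(1) by (simp add: v_def max_def)
        with n that show ?thesis by simp
      next
        case False
        then have "\<omega> \<notin> K" using m(2)[of \<omega>] by (auto simp: t_def)
        then have "cmod (\<omega> d) \<le> \<delta> / 2" using \<omega> by (simp add: K_def)
        moreover have "\<bar>1 - t * (v t + 1 / m)\<bar> \<le> 1"
          using False m(1) t by (simp add: v_def max_def abs_le_iff)
        ultimately have "cmod (\<omega> d) * \<bar>1 - t * (v t + 1 / m)\<bar> \<le> \<delta> / 2 * 1"
          by (intro mult_mono) (use that in auto)
        with n show ?thesis by simp
      qed
    qed
    then show ?thesis using J(3)[OF qJ, of b] that by (intro bexI[of _ "q * b"]) (auto simp: dist_norm)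
  qed
  then have "d \<in> closure J" by (auto simp: closure_approachable)
  with J(4) show ?thesis by simp
qed

section \<open>Atomic functionals and perfect sets of characters\<close>

text \<open>A functional on \<open>A = C\<^sub>0(X)\<close> is atomic iff the measure representing it is discrete.\<close>

definition atomic :: "'a::{cstar_algebra, comm_ring} cdual \<Rightarrow> bool" where
  "atomic f \<longleftrightarrow> (\<forall>\<epsilon>>0. \<exists>M. finite M \<and> M \<subseteq> spec \<and> (\<forall>a\<in>vanish M. cmod (cdual_apply f a) \<le> \<epsilon> * norm a))"

text \<open>Dense in itself: the sets where some \<open>g\<close> is nonzero form a base of the
  topology of X.\<close>

definition perfect :: "('a::{cstar_algebra, comm_ring} \<Rightarrow> complex) set \<Rightarrow> bool" where
  "perfect S \<longleftrightarrow> S \<subseteq> spec \<and> S \<noteq> {} \<and> (\<forall>\<omega>\<in>S. \<forall>g. \<omega> g \<noteq> 0 \<longrightarrow> (\<exists>\<psi>\<in>S. \<psi> \<noteq> \<omega> \<and> \<psi> g \<noteq> 0))"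

lemma atomicE:
  assumes "atomic f" "\<epsilon> > 0"
  obtains M where "finite M" "M \<subseteq> spec" "\<And>a. a \<in> vanish M \<Longrightarrow> cmod (cdual_apply f a) \<le> \<epsilon> * norm a"
  using assms unfolding atomic_def by metis

lemma mult_divide_add_one_le: "0 \<le> n \<Longrightarrow> 0 \<le> d \<Longrightarrow> n * (d / (n + 1)) \<le> (d::real)"
  by (simp add: pos_divide_le_eq algebra_simps)

lemma cmod_align: "\<exists>\<theta>. cmod \<theta> = 1 \<and> cmod (u + \<theta> * v) = cmod u + cmod v"
proof (cases "u = 0 \<or> v = 0")
  case True
  then show ?thesis by (intro exI[of _ 1]) auto
next
  case False
  let ?\<theta> = "sgn u / sgn v"
  have "?\<theta> * v = sgn u * of_real (cmod v)" using False by (simp add: sgn_eq field_simps)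
  moreover have "u = sgn u * of_real (cmod u)" using False by (simp add: sgn_eq)
  ultimately have "u + ?\<theta> * v = sgn u * of_real (cmod u + cmod v)" by (metis distrib_left of_real_add)
  then have "cmod (u + ?\<theta> * v) = cmod (sgn u) * \<bar>cmod u + cmod v\<bar>" by (simp only: norm_mult norm_of_real)
  then show ?thesis using False by (intro exI[of _ ?\<theta>]) (simp add: norm_divide norm_sgn)
qed

lemma orthogonal_add_norm:
  fixes x y :: "'a::{cstar_algebra, comm_ring}"
  assumes "x * y = 0" "norm x \<le> C" "norm y \<le> C"
  shows "norm (x + y) \<le> C"
proof (rule norm_le_chars)
  fix \<omega> :: "'a \<Rightarrow> complex" assume \<omega>: "\<omega> \<in> chars"
  have "\<omega> x * \<omega> y = 0" using charsD(2)[OF \<omega>, of x y] assms(1) \<omega> by (simp add: chars_linear)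
  then have "cmod (\<omega> (x + y)) \<le> max (norm x) (norm y)"
    using charsD(4)[OF \<omega>, of x] charsD(4)[OF \<omega>, of y] \<omega> by (auto simp: chars_linear)
  with assms show "cmod (\<omega> (x + y)) \<le> C" by simp
qed

lemma vanish_mult: "a \<in> vanish M \<Longrightarrow> M \<subseteq> chars \<Longrightarrow> a * b \<in> vanish M"
  by (auto simp: vanish_def charsD)

lemma vanish_diff: "a \<in> vanish M \<Longrightarrow> b \<in> vanish M \<Longrightarrow> M \<subseteq> chars \<Longrightarrow> a - b \<in> vanish M"
  by (auto simp: vanish_def chars_linear subset_iff)

text \<open>Inner regularity without a measure: a contraction \<open>c\<close> in
  \<open>vanish M0\<close> that almost attains the norm \<open>N\<close> of \<open>f\<close> there
  leaves little for elements orthogonal to \<open>c * h\<close>. So on \<open>vanish M0\<close> the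
  functional is close to its localisation by \<open>e\<close>, which is atomic by
  assumption.\<close>

lemma atomic_if_locally_atomic:
  fixes f :: "'a::{cstar_algebra, comm_ring} cdual"
  assumes M0: "finite M0" "M0 \<subseteq> spec" and at: "\<And>d. d \<in> vanish M0 \<Longrightarrow> atomic (arens_fa f d)"
  shows "atomic f"
  unfolding atomic_def
proof (intro allI impI)
  fix \<epsilon> :: real assume "\<epsilon> > 0"
  define \<delta> where "\<delta> = \<epsilon> / 3"
  have \<delta>: "\<delta> > 0" using \<open>\<epsilon> > 0\<close> by (simp add: \<delta>_def)
  have M0c: "M0 \<subseteq> chars" using M0 spec_chars by blast
  let ?V = "{cmod (cdual_apply f c) | c. c \<in> vanish M0 \<and> norm c \<le> 1}"
  define N where "N = Sup ?V"
  have bdd: "bdd_above ?V"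
  proof (rule bdd_aboveI)
    fix r assume "r \<in> ?V"
    then obtain c where c: "r = cmod (cdual_apply f c)" "norm c \<le> 1" by blast
    then show "r \<le> norm f" using norm_cdual_apply[of f c] mult_left_mono[of "norm c" 1 "norm f"] by simp
  qed
  have up: "cmod (cdual_apply f c) \<le> N" if "c \<in> vanish M0" "norm c \<le> 1" for c
    unfolding N_def by (rule cSup_upper[OF _ bdd]) (use that in blast)
  have "0 \<in> vanish M0" using M0c by (auto simp: vanish_def chars_linear)
  then have "?V \<noteq> {}" using norm_zero zero_le_one by fastforce
  then obtain c where c: "c \<in> vanish M0" "norm c \<le> 1" "N - \<delta> < cmod (cdual_apply f c)"
    using less_cSupD[of ?V "N - \<delta>"] \<delta> unfolding N_def by auto
  have "\<delta> / (norm f + 1) > 0" using \<delta> by (simp add: add_nonneg_pos)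
  then obtain h e where he: "unit_elem h" "unit_elem e" "h * e = h" "norm (c - c * h) \<le> \<delta> / (norm f + 1)"
    "\<And>\<omega>. \<omega> \<in> chars \<Longrightarrow> \<omega> c = 0 \<Longrightarrow> \<omega> e = 0"
    using local_unit[of "\<delta> / (norm f + 1)" c] by blast
  have e: "e \<in> vanish M0" using he(5) c(1) M0c by (auto simp: vanish_def)
  have "cmod (cdual_apply f (c - c * h)) \<le> norm f * (\<delta> / (norm f + 1))"
    using norm_cdual_apply[of f "c - c * h"] mult_left_mono[OF he(4), of "norm f"] by simp
  also have "\<dots> \<le> \<delta>" using \<delta> by (intro mult_divide_add_one_le) auto
  finally have "cmod (cdual_apply f c) - cmod (cdual_apply f (c * h)) \<le> \<delta>"
    using norm_triangle_ineq2[of "cdual_apply f c" "cdual_apply f (c * h)"] by (simp add: cdual_apply_simps)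
  with c(3) have ch: "N - 2 * \<delta> < cmod (cdual_apply f (c * h))" by simp
  have small1: "cmod (cdual_apply f (a - a * e)) \<le> 2 * \<delta>" if a: "a \<in> vanish M0" "norm a \<le> 1" for a
  proof -
    \<comment> \<open>After this rotation the values at two orthogonal contractions add up in
      modulus, and the total is still at most \<open>N\<close>.\<close>
    obtain \<theta> where \<theta>: "cmod \<theta> = 1"
      "cmod (cdual_apply f (c * h) + \<theta> * cdual_apply f (a - a * e))
        = cmod (cdual_apply f (c * h)) + cmod (cdual_apply f (a - a * e))" using cmod_align by blast
    let ?x = "scaleC \<theta> (a - a * e)"
    have "(c * h) * (a - a * e) = c * a * (h - h * e)" by (simp add: algebra_simps)
    then have "(c * h) * ?x = 0" by (simp add: mult_scaleC_right he(3) scaleC_zero_right)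
    then have "norm (c * h + ?x) \<le> 1"
      using norm_mult_unit_elem_le(1)[OF he(1), of c] norm_mult_unit_elem_le(2)[OF he(2), of a] c(2) a(2) \<theta>(1)
      by (intro orthogonal_add_norm) (simp_all add: norm_scaleC)
    moreover have "c * h + ?x \<in> vanish M0"
      using vanish_mult[OF c(1) M0c, of h] vanish_diff[OF a(1) vanish_mult[OF a(1) M0c, of e] M0c] M0c
      by (auto simp: vanish_def chars_linear subset_iff)
    ultimately have "cmod (cdual_apply f (c * h + ?x)) \<le> N" using up by blast
    then show ?thesis using ch \<theta>(2) by (simp add: cdual_apply_simps)
  qed
  have small: "cmod (cdual_apply f (a - a * e)) \<le> 2 * \<delta> * norm a" if a: "a \<in> vanish M0" for a
  proof (cases "a = 0")
    case True
    then show ?thesis by (simp add: cdual_apply_simps)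
  next
    case False
    let ?a = "(1 / norm a) *\<^sub>R a"
    have "?a \<in> vanish M0" "norm ?a \<le> 1" using a False M0c by (auto simp: vanish_def chars_linear subset_iff)
    from small1[OF this] have "cmod (cdual_apply f ((1 / norm a) *\<^sub>R (a - a * e))) \<le> 2 * \<delta>"
      by (simp add: scaleR_diff_right)
    then have "\<bar>1 / norm a\<bar> * cmod (cdual_apply f (a - a * e)) \<le> 2 * \<delta>"
      by (simp only: cdual_apply_simps(6) norm_mult norm_of_real)
    then show ?thesis using False by (simp add: field_simps)
  qed
  obtain M where M: "finite M" "M \<subseteq> spec" "\<And>a. a \<in> vanish M \<Longrightarrow> cmod (cdual_apply (arens_fa f e) a) \<le> \<delta> * norm a"
    by (rule atomicE[OF at[OF e] \<delta>]) blast
  show "\<exists>M. finite M \<and> M \<subseteq> spec \<and> (\<forall>a\<in>vanish M. cmod (cdual_apply f a) \<le> \<epsilon> * norm a)"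
  proof (intro exI conjI ballI)
    show "finite (M \<union> M0)" "M \<union> M0 \<subseteq> spec" using M M0 by auto
    fix a assume a: "a \<in> vanish (M \<union> M0)"
    have "cdual_apply f a = cdual_apply f (a - a * e) + cdual_apply (arens_fa f e) a"
      by (simp add: cdual_apply_simps arens_fa_apply mult.commute)
    then have "cmod (cdual_apply f a) \<le> cmod (cdual_apply f (a - a * e)) + cmod (cdual_apply (arens_fa f e) a)"
      using norm_triangle_ineq by metis
    also have "\<dots> \<le> 2 * \<delta> * norm a + \<delta> * norm a"
      using a by (intro add_mono small M(3)) (auto simp: vanish_def)
    finally show "cmod (cdual_apply f a) \<le> \<epsilon> * norm a" by (simp add: \<delta>_def)
  qed
qed

lemma closed_atomic_multipliers:
  fixes f :: "'a::{cstar_algebra, comm_ring} cdual"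
  shows "closed {d. atomic (arens_fa f d)}"
proof -
  have "atomic (arens_fa f d)" if d: "d \<in> closure {d. atomic (arens_fa f d)}" for d
    unfolding atomic_def
  proof (intro allI impI)
    fix \<epsilon> :: real assume "\<epsilon> > 0"
    then have "\<epsilon> / (2 * (norm f + 1)) > 0" by (simp add: add_nonneg_pos)
    then obtain j where j: "atomic (arens_fa f j)" "norm (j - d) < \<epsilon> / (2 * (norm f + 1))"
      using d unfolding closure_approachable dist_norm by blast
    obtain M where M: "finite M" "M \<subseteq> spec" "\<And>a. a \<in> vanish M \<Longrightarrow> cmod (cdual_apply (arens_fa f j) a) \<le> \<epsilon> / 2 * norm a"
      by (rule atomicE[OF j(1), of "\<epsilon> / 2"]) (use \<open>\<epsilon> > 0\<close> in auto)
    have "cmod (cdual_apply (arens_fa f d) a) \<le> \<epsilon> * norm a" if a: "a \<in> vanish M" for a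
    proof -
      have "cdual_apply (arens_fa f d) a = cdual_apply (arens_fa f j) a - cdual_apply f ((j - d) * a)"
        by (simp add: arens_fa_apply cdual_apply_simps algebra_simps)
      then have "cmod (cdual_apply (arens_fa f d) a) \<le> cmod (cdual_apply (arens_fa f j) a) + cmod (cdual_apply f ((j - d) * a))"
        using norm_triangle_ineq4 by metis
      also have "cmod (cdual_apply f ((j - d) * a)) \<le> norm f * (norm (j - d) * norm a)"
        using norm_cdual_apply[of f "(j - d) * a"] norm_mult_ineq[of "j - d" a]
        by (meson mult_left_mono norm_ge_zero order_trans)
      also have "\<dots> \<le> (norm f + 1) * (\<epsilon> / (2 * (norm f + 1)) * norm a)"
        using j(2) \<open>\<epsilon> > 0\<close> by (intro mult_mono) auto
      also have "\<dots> = \<epsilon> / 2 * norm a"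
        using norm_ge_zero[of f] by (simp add: field_simps add_nonneg_eq_0_iff)
      finally show ?thesis using M(3)[OF a] by simp
    qed
    then show "\<exists>M. finite M \<and> M \<subseteq> spec \<and> (\<forall>a\<in>vanish M. cmod (cdual_apply (arens_fa f d) a) \<le> \<epsilon> * norm a)"
      using M by blast
  qed
  then show ?thesis using closure_subset_eq by blast
qed

text \<open>The hull of the ideal of all \<open>d\<close> for which \<open>f(d \<cdot>)\<close> is atomic is perfect.\<close>

lemma non_atomic_imp_perfect:
  fixes f :: "'a::{cstar_algebra, comm_ring} cdual"
  assumes na: "\<not> atomic f"
  shows "\<exists>S :: ('a \<Rightarrow> complex) set. perfect S"
proof -
  define J where "J = {d. atomic (arens_fa f d)}"
  define S where "S = {\<omega>\<in>spec. \<forall>j\<in>J. \<omega> j = 0}"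
  have syn: "d \<in> J" if d: "\<And>\<omega>. \<omega> \<in> S \<Longrightarrow> \<omega> d = 0" for d
  proof (rule closed_ideal_synthesis)
    show "closed J" unfolding J_def by (rule closed_atomic_multipliers)
    show "0 \<in> J" unfolding J_def atomic_def
      by (auto simp: arens_fa_apply cdual_apply_simps intro!: exI[of _ "{}"])
    show "x + y \<in> J" if "x \<in> J" "y \<in> J" for x y
      unfolding J_def atomic_def mem_Collect_eq
    proof (intro allI impI)
      fix \<epsilon> :: real assume "\<epsilon> > 0"
      then have e: "\<epsilon> / 2 > 0" by simp
      obtain M where M: "finite M" "M \<subseteq> spec" "\<And>a. a \<in> vanish M \<Longrightarrow> cmod (cdual_apply (arens_fa f x) a) \<le> \<epsilon> / 2 * norm a"
        using \<open>x \<in> J\<close> e atomicE[of "arens_fa f x"] unfolding J_def mem_Collect_eq by metis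
      obtain M' where M': "finite M'" "M' \<subseteq> spec" "\<And>a. a \<in> vanish M' \<Longrightarrow> cmod (cdual_apply (arens_fa f y) a) \<le> \<epsilon> / 2 * norm a"
        using \<open>y \<in> J\<close> e atomicE[of "arens_fa f y"] unfolding J_def mem_Collect_eq by metis
      have "cmod (cdual_apply (arens_fa f (x + y)) a) \<le> \<epsilon> * norm a" if "a \<in> vanish (M \<union> M')" for a
      proof -
        have "cdual_apply (arens_fa f (x + y)) a = cdual_apply (arens_fa f x) a + cdual_apply (arens_fa f y) a"
          by (simp add: arens_fa_apply cdual_apply_simps distrib_right)
        then have "cmod (cdual_apply (arens_fa f (x + y)) a) \<le> cmod (cdual_apply (arens_fa f x) a) + cmod (cdual_apply (arens_fa f y) a)"
          using norm_triangle_ineq by metis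
        also have "\<dots> \<le> \<epsilon> / 2 * norm a + \<epsilon> / 2 * norm a"
          using that by (intro add_mono M(3) M'(3)) (auto simp: vanish_def)
        finally show ?thesis by simp
      qed
      then show "\<exists>M. finite M \<and> M \<subseteq> spec \<and> (\<forall>a\<in>vanish M. cmod (cdual_apply (arens_fa f (x + y)) a) \<le> \<epsilon> * norm a)"
        using M(1,2) M'(1,2) by (intro exI[of _ "M \<union> M'"]) auto
    qed
    show "x * y \<in> J" if "x \<in> J" for x y
      unfolding J_def atomic_def mem_Collect_eq
    proof (intro allI impI)
      fix \<epsilon> :: real assume "\<epsilon> > 0"
      then have e: "\<epsilon> / (norm y + 1) > 0" by (simp add: add_nonneg_pos)
      obtain M where M: "finite M" "M \<subseteq> spec" "\<And>a. a \<in> vanish M \<Longrightarrow> cmod (cdual_apply (arens_fa f x) a) \<le> \<epsilon> / (norm y + 1) * norm a"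
        using \<open>x \<in> J\<close> e atomicE[of "arens_fa f x"] unfolding J_def mem_Collect_eq by metis
      have "cmod (cdual_apply (arens_fa f (x * y)) a) \<le> \<epsilon> * norm a" if "a \<in> vanish M" for a
      proof -
        have "M \<subseteq> chars" using M(2) spec_chars by blast
        then have "y * a \<in> vanish M" using vanish_mult[OF that, of y] by (simp add: mult.commute)
        then have "cmod (cdual_apply (arens_fa f x) (y * a)) \<le> \<epsilon> / (norm y + 1) * norm (y * a)" by (rule M(3))
        also have "\<dots> \<le> \<epsilon> / (norm y + 1) * ((norm y + 1) * norm a)"
          using norm_mult_ineq[of y a] e by (intro mult_left_mono) (auto simp: distrib_right add_increasing2)
        also have "\<dots> = \<epsilon> * norm a" using norm_ge_zero[of y] by (simp add: add_nonneg_eq_0_iff)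
        finally show ?thesis by (simp add: arens_fa_apply mult.assoc)
      qed
      then show "\<exists>M. finite M \<and> M \<subseteq> spec \<and> (\<forall>a\<in>vanish M. cmod (cdual_apply (arens_fa f (x * y)) a) \<le> \<epsilon> * norm a)"
        using M(1,2) by blast
    qed
    show "\<omega> d = 0" if "\<omega> \<in> chars" "\<And>j. j \<in> J \<Longrightarrow> \<omega> j = 0" for \<omega>
      using that d[of \<omega>] by (auto simp: S_def spec_def)
  qed
  have "S \<noteq> {}"
  proof
    assume "S = {}"
    then have "atomic (arens_fa f d)" for d using syn[of d] by (simp add: J_def)
    then have "atomic f" by (rule atomic_if_locally_atomic[OF finite.emptyI empty_subsetI])
    with na show False by simp
  qed
  \<comment> \<open>If \<open>g\<close> isolated \<open>\<omega>\<close> in \<open>S\<close>, then g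
    d would vanish on \<open>S\<close> for every \<open>d\<close> vanishing at
    \<open>\<omega>\<close>. So f(g \<cdot>) would be locally atomic off one point, hence atomic,
    and \<open>g\<close> would lie in \<open>J\<close>.\<close>
  moreover have "\<exists>\<psi>\<in>S. \<psi> \<noteq> \<omega> \<and> \<psi> g \<noteq> 0" if \<omega>: "\<omega> \<in> S" "\<omega> g \<noteq> 0" for \<omega> g
  proof (rule ccontr)
    assume no: "\<not> (\<exists>\<psi>\<in>S. \<psi> \<noteq> \<omega> \<and> \<psi> g \<noteq> 0)"
    have "atomic (arens_fa f g)"
    proof (rule atomic_if_locally_atomic[of "{\<omega>}"])
      fix d assume d: "d \<in> vanish {\<omega>}"
      have "g * d \<in> J"
      proof (rule syn)
        fix \<psi> assume \<psi>: "\<psi> \<in> S"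
        then have "\<psi> \<in> chars" by (simp add: S_def spec_chars)
        then show "\<psi> (g * d) = 0" using no \<psi> d by (cases "\<psi> = \<omega>") (auto simp: charsD vanish_def)
      qed
      moreover have "arens_fa (arens_fa f g) d = arens_fa f (g * d)"
        by (rule cdual_eqI) (simp add: arens_fa_apply mult.assoc)
      ultimately show "atomic (arens_fa (arens_fa f g) d)" by (simp add: J_def)
    qed (use \<omega>(1) in \<open>auto simp: S_def\<close>)
    then have "g \<in> J" by (simp add: J_def)
    with \<omega> show False by (simp add: S_def)
  qed
  ultimately have "perfect S" unfolding perfect_def by (auto simp: S_def)
  then show ?thesis by blast
qed

section \<open>Rademacher systems\<close>

definition sg :: "nat set \<Rightarrow> nat \<Rightarrow> real" where
  "sg T i = (if i \<in> T then 1 else - 1)"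

lemma sg_square: "sg T i * sg T i = 1"
  by (simp add: sg_def)

text \<open>Perfectness only speaks about the set where one element is nonzero. The finitely many
  inequalities are therefore packed into a single product of cut-offs at 2/3.\<close>

lemma open_pattern_witness:
  fixes r :: "nat \<Rightarrow> 'a::{cstar_algebra, comm_ring}"
  assumes r: "\<And>i. i < n \<Longrightarrow> star (r i) = r i" and \<omega>: "\<omega> \<in> spec" "\<And>i. i < n \<Longrightarrow> sg T i * Re (\<omega> (r i)) > 2/3"
  shows "\<exists>g. \<omega> g \<noteq> 0 \<and> (\<forall>\<psi>\<in>chars. \<psi> g \<noteq> 0 \<longrightarrow> (\<forall>i<n. sg T i * Re (\<psi> (r i)) > 2/3))"
  using r \<omega>(2)
proof (induction n)
  case 0
  then show ?case using \<omega>(1) by (auto simp: spec_def)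
next
  case (Suc n)
  then obtain g where g: "\<omega> g \<noteq> 0" "\<forall>\<psi>\<in>chars. \<psi> g \<noteq> 0 \<longrightarrow> (\<forall>i<n. sg T i * Re (\<psi> (r i)) > 2/3)" by auto
  define h where "h x = max 0 (x - 2/3)" for x :: real
  have h: "continuous_on UNIV h" "h 0 = 0" unfolding h_def by (auto intro!: continuous_intros)
  let ?a = "sg T n *\<^sub>R r n"
  have sa: "star ?a = ?a" using Suc.prems(1)[of n] by (simp add: star_simps)
  have ap: "\<psi> (g * fcalc h ?a) = \<psi> g * of_real (h (sg T n * Re (\<psi> (r n))))" if "\<psi> \<in> chars" for \<psi>
    using that by (simp add: charsD fcalc_apply[OF h sa] chars_linear)
  have "\<omega> (g * fcalc h ?a) \<noteq> 0"
    using g(1) Suc.prems(2)[of n] spec_chars[OF \<omega>(1)] by (simp add: ap) (simp add: h_def)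
  moreover have "\<forall>i<Suc n. sg T i * Re (\<psi> (r i)) > 2/3" if \<psi>: "\<psi> \<in> chars" "\<psi> (g * fcalc h ?a) \<noteq> 0" for \<psi>
  proof -
    have "\<psi> g \<noteq> 0" "h (sg T n * Re (\<psi> (r n))) \<noteq> 0" using \<psi> by (auto simp: ap)
    then show ?thesis using g(2) \<psi>(1) by (auto simp: less_Suc_eq h_def max_def split: if_splits)
  qed
  ultimately show ?case by blast
qed

text \<open>The strict inequality keeps the sign patterns stable under small changes of the character.\<close>

definition patterns :: "('a::{cstar_algebra, comm_ring} \<Rightarrow> complex) set \<Rightarrow> nat \<Rightarrow> (nat \<Rightarrow> 'a) \<Rightarrow> bool" where
  "patterns S n r \<longleftrightarrow> (\<forall>i<n. star (r i) = r i) \<and>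
     (\<forall>T\<subseteq>{..<n}. \<exists>\<omega>\<in>S. \<forall>i<n. sg T i * Re (\<omega> (r i)) > 2/3)"

text \<open>Perfectness yields two characters \<open>A T\<close>, \<open>B T\<close> for each
  pattern \<open>T\<close>. The new element takes the value 1 on the first and -1 on the second,
  which splits every pattern in two.\<close>

lemma patterns_Suc:
  fixes r :: "nat \<Rightarrow> 'a::{cstar_algebra, comm_ring}"
  assumes S: "perfect S" and p: "patterns S n r"
  shows "\<exists>x. patterns S (Suc n) (r(n := x))"
proof -
  have Sspec: "S \<subseteq> spec" using S by (simp add: perfect_def)
  have sa: "\<And>i. i < n \<Longrightarrow> star (r i) = r i" using p by (simp add: patterns_def)
  define ok where "ok T \<omega> \<longleftrightarrow> (\<forall>i<n. sg T i * Re (\<omega> (r i)) > 2/3)" for T and \<omega> :: "'a \<Rightarrow> complex"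
  have ex: "\<exists>\<omega>\<in>S. \<exists>\<psi>\<in>S. \<psi> \<noteq> \<omega> \<and> ok T \<omega> \<and> ok T \<psi>" if T: "T \<subseteq> {..<n}" for T
  proof -
    obtain \<omega> where \<omega>: "\<omega> \<in> S" "ok T \<omega>" using p T by (auto simp: patterns_def ok_def)
    obtain g where g: "\<omega> g \<noteq> 0" "\<forall>\<psi>\<in>chars. \<psi> g \<noteq> 0 \<longrightarrow> ok T \<psi>"
      using open_pattern_witness[where r = r and n = n and \<omega> = \<omega> and T = T, OF sa] \<omega> Sspec
      unfolding ok_def by (metis subsetD)
    obtain \<psi> where "\<psi> \<in> S" "\<psi> \<noteq> \<omega>" "\<psi> g \<noteq> 0"
      using S \<omega>(1) g(1) unfolding perfect_def by blast
    with g(2) \<omega> Sspec spec_chars show ?thesis by blast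
  qed
  then obtain A B where AB: "\<And>T. T \<subseteq> {..<n} \<Longrightarrow> A T \<in> S" "\<And>T. T \<subseteq> {..<n} \<Longrightarrow> B T \<in> S"
    "\<And>T. T \<subseteq> {..<n} \<Longrightarrow> B T \<noteq> A T" "\<And>T. T \<subseteq> {..<n} \<Longrightarrow> ok T (A T)" "\<And>T. T \<subseteq> {..<n} \<Longrightarrow> ok T (B T)"
    by metis
  \<comment> \<open>A character realises only one pattern; hence no \<open>B T\<close> coincides
    with any \<open>A T'\<close>, and the interpolation data are consistent.\<close>
  have okeq: "T = T'" if "T \<subseteq> {..<n}" "T' \<subseteq> {..<n}" "ok T \<omega>" "ok T' \<omega>" for T T' \<omega>
  proof -
    have "i \<in> T \<longleftrightarrow> i \<in> T'" if "i < n" for i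
    proof -
      have "2/3 < sg T i * Re (\<omega> (r i))" "2/3 < sg T' i * Re (\<omega> (r i))"
        using \<open>ok T \<omega>\<close> \<open>ok T' \<omega>\<close> that unfolding ok_def by blast+
      then show ?thesis unfolding sg_def by (auto split: if_splits)
    qed
    with that(1,2) show ?thesis by blast
  qed
  have neq: "B T \<noteq> A T'" if "T \<subseteq> {..<n}" "T' \<subseteq> {..<n}" for T T'
    using AB(3,4,5) okeq that by metis
  let ?P = "Pow {..<n}"
  have "finite (A ` ?P \<union> B ` ?P)" "A ` ?P \<union> B ` ?P \<subseteq> spec" using AB(1,2) Sspec by auto
  then obtain t where t: "star t = t" "\<And>\<omega>. \<omega> \<in> A ` ?P \<union> B ` ?P \<Longrightarrow> \<omega> t = of_real (if \<omega> \<in> A ` ?P then 1 else - 1)"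
    using char_interpolation[of "A ` ?P \<union> B ` ?P" "\<lambda>\<omega>. if \<omega> \<in> A ` ?P then 1 else - 1"] by blast
  have tA: "A T t = 1" if "T \<subseteq> {..<n}" for T using t(2)[of "A T"] that by simp
  have tB: "B T t = - 1" if "T \<subseteq> {..<n}" for T
  proof -
    have "B T \<notin> A ` ?P" using neq[OF that] by blast
    then show ?thesis using t(2)[of "B T"] that by simp
  qed
  have "patterns S (Suc n) (r(n := t))"
    unfolding patterns_def
  proof (intro conjI allI impI)
    show "star ((r(n := t)) i) = (r(n := t)) i" if "i < Suc n" for i
      using that sa t(1) by (cases "i = n") auto
    fix T assume T: "T \<subseteq> {..<Suc n}"
    define T0 where "T0 = T - {n}"
    have T0: "T0 \<subseteq> {..<n}" using T by (auto simp: T0_def less_Suc_eq)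
    have sgT: "sg T i = sg T0 i" if "i < n" for i using that by (simp add: sg_def T0_def)
    show "\<exists>\<omega>\<in>S. \<forall>i<Suc n. 2/3 < sg T i * Re (\<omega> ((r(n := t)) i))"
    proof (cases "n \<in> T")
      case True
      then show ?thesis using AB(1)[OF T0] AB(4)[OF T0] tA[OF T0]
        by (intro bexI[of _ "A T0"]) (auto simp: less_Suc_eq sgT ok_def, simp add: sg_def)
    next
      case False
      then show ?thesis using AB(2)[OF T0] AB(5)[OF T0] tB[OF T0]
        by (intro bexI[of _ "B T0"]) (auto simp: less_Suc_eq sgT ok_def, simp add: sg_def)
    qed
  qed
  then show ?thesis by blast
qed

text \<open>Earlier elements are never changed when the system grows, so the stages have a common
  extension to infinitely many elements, with all finite patterns realised.\<close>

lemma rademacher_system: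
  fixes S :: "('a::{cstar_algebra, comm_ring} \<Rightarrow> complex) set"
  assumes S: "perfect S"
  obtains \<rho> :: "nat \<Rightarrow> 'a" and X where "\<And>i. star (\<rho> i) = \<rho> i" "\<And>i. norm (\<rho> i) \<le> 1"
    "\<And>n T. X n T \<in> spec" "\<And>n T i. i < n \<Longrightarrow> X n T (\<rho> i) = of_real (sg T i)"
proof -
  have "\<exists>f. \<forall>n. patterns S n (f n) \<and> (\<forall>i<n. f (Suc n) i = f n i)"
  proof (rule dependent_nat_choice)
    show "\<exists>r. patterns S 0 r" using S by (auto simp: patterns_def perfect_def)
    fix r n assume "patterns S n r"
    then obtain x where "patterns S (Suc n) (r(n := x))" using patterns_Suc[OF S] by blast
    then show "\<exists>r'. patterns S (Suc n) r' \<and> (\<forall>i<n. r' i = r i)"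
      by (intro exI[of _ "r(n := x)"]) auto
  qed
  then obtain f where f: "\<And>n. patterns S n (f n)" "\<And>n i. i < n \<Longrightarrow> f (Suc n) i = f n i" by blast
  define r where "r i = f (Suc i) i" for i
  have fr: "f n i = r i" if "i < n" for n i
    using that by (induction n) (auto simp: f(2) r_def less_Suc_eq)
  have sa: "star (r i) = r i" for i
    using f(1)[of "Suc i"] by (simp add: patterns_def r_def)
  have "\<exists>\<omega>\<in>S. \<forall>i<n. sg T i * Re (\<omega> (r i)) > 2/3" for n T
  proof -
    obtain \<omega> where \<omega>: "\<omega> \<in> S" "\<forall>i<n. sg (T \<inter> {..<n}) i * Re (\<omega> (f n i)) > 2/3"
      using f(1)[of n] unfolding patterns_def by (metis inf_le2)
    have "sg (T \<inter> {..<n}) i = sg T i" if "i < n" for i using that by (simp add: sg_def)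
    with \<omega> fr show ?thesis by (intro bexI[of _ \<omega>]) auto
  qed
  then obtain X where chi: "\<And>n T. X n T \<in> S" "\<And>n T i. i < n \<Longrightarrow> sg T i * Re (X n T (r i)) > 2/3" by metis
  \<comment> \<open>Slope 3/2 carries values beyond 2/3 in modulus to exact signs, while clipping
    bounds the norm by one.\<close>
  define h where "h x = max (-1) (min 1 (3/2 * x))" for x :: real
  have h: "continuous_on UNIV h" "h 0 = 0" unfolding h_def by (auto intro!: continuous_intros)
  have chs: "X n T \<in> spec" for n T using chi(1) S by (auto simp: perfect_def)
  show ?thesis
  proof (rule that[of "\<lambda>i. fcalc h (r i)" X])
    show "star (fcalc h (r i)) = fcalc h (r i)" for i by (rule star_fcalc[OF h sa])
    show "norm (fcalc h (r i)) \<le> 1" for i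
      by (rule norm_le_chars) (simp add: fcalc_apply[OF h sa], simp add: h_def)
    show "X n T \<in> spec" for n T by (rule chs)
    show "X n T (fcalc h (r i)) = of_real (sg T i)" if "i < n" for n T i
      using chi(2)[OF that, of T] spec_chars[OF chs, of n T]
      by (simp add: fcalc_apply[OF h sa]) (auto simp: h_def sg_def max_def min_def split: if_splits)
  qed
qed

section \<open>Independence of the signs and Bessel's inequality\<close>

definition flip :: "nat \<Rightarrow> nat set \<Rightarrow> nat set" where
  "flip m T = (if m \<in> T then T - {m} else insert m T)"

lemma sg_flip: "sg (flip m T) i = (if i = m then - sg T i else sg T i)"
  by (cases "m \<in> T") (simp_all add: sg_def flip_def)

lemma sign_sum_zero:
  fixes h :: "nat set \<Rightarrow> real"
  assumes m: "m < n" and h: "\<And>T. h (flip m T) = - h T"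
  shows "(\<Sum>T\<in>Pow {..<n}. h T) = 0"
proof -
  have "(\<Sum>T\<in>Pow {..<n}. h T) = (\<Sum>T\<in>Pow {..<n}. - h T)"
    by (rule sum.reindex_bij_witness[of _ "flip m" "flip m"])
       (use m h in \<open>auto simp: flip_def split: if_splits\<close>)
  then show ?thesis by (simp add: sum_negf)
qed

text \<open>Even indices carry the first factor and odd ones the second, so different pairs give
  different Walsh functions: some coordinate occurs exactly once in the product, and flipping it
  cancels the sum.\<close>

lemma sg_pairs_orthonormal:
  assumes "2 * i < n" "2 * j + 1 < n" "2 * k < n" "2 * l + 1 < n"
  shows "(\<Sum>T\<in>Pow {..<n}. (sg T (2 * i) * sg T (2 * j + 1)) * (sg T (2 * k) * sg T (2 * l + 1)))
    = (if (i, j) = (k, l) then 2 ^ n else 0)"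
proof (cases "i = k \<and> j = l")
  case True
  have "(sg T (2 * i) * sg T (2 * j + 1)) * (sg T (2 * i) * sg T (2 * j + 1)) = 1" for T
    by (simp add: sg_def)
  with True show ?thesis by (simp add: card_Pow)
next
  case False
  show ?thesis
  proof (cases "i = k")
    case True
    with False have "j \<noteq> l" by simp
    have p: "2 * i \<noteq> 2 * j + 1" "2 * k \<noteq> 2 * j + 1" by presburger+
    have "(\<Sum>T\<in>Pow {..<n}. (sg T (2 * i) * sg T (2 * j + 1)) * (sg T (2 * k) * sg T (2 * l + 1))) = 0"
      by (rule sign_sum_zero[OF assms(2)]) (use \<open>j \<noteq> l\<close> p in \<open>simp add: sg_flip\<close>)
    with False show ?thesis by simp
  next
    case ik: False
    have p: "2 * j + 1 \<noteq> 2 * i" "2 * l + 1 \<noteq> 2 * i" by presburger+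
    have "(\<Sum>T\<in>Pow {..<n}. (sg T (2 * i) * sg T (2 * j + 1)) * (sg T (2 * k) * sg T (2 * l + 1))) = 0"
      by (rule sign_sum_zero[OF assms(1)]) (use ik p in \<open>simp add: sg_flip\<close>)
    with False show ?thesis by simp
  qed
qed

lemma bessel_real:
  fixes A :: "'t \<Rightarrow> real" and W :: "'p \<Rightarrow> 't \<Rightarrow> real"
  assumes fin: "finite \<Omega>" "finite P" and N: "N > 0"
    and on: "\<And>p q. p \<in> P \<Longrightarrow> q \<in> P \<Longrightarrow> (\<Sum>t\<in>\<Omega>. W p t * W q t) = (if p = q then N else 0)"
  shows "(\<Sum>p\<in>P. ((\<Sum>t\<in>\<Omega>. A t * W p t) / N)\<^sup>2) \<le> (\<Sum>t\<in>\<Omega>. (A t)\<^sup>2) / N"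
proof -
  define c where "c p = (\<Sum>t\<in>\<Omega>. A t * W p t) / N" for p
  have cN: "(\<Sum>t\<in>\<Omega>. A t * W p t) = N * c p" for p using N by (simp add: c_def)
  define s where "s t = (\<Sum>p\<in>P. c p * W p t)" for t
  have "(\<Sum>t\<in>\<Omega>. A t * s t) = (\<Sum>t\<in>\<Omega>. \<Sum>p\<in>P. c p * (A t * W p t))"
    by (simp add: s_def sum_distrib_left mult_ac)
  also have "\<dots> = (\<Sum>p\<in>P. c p * (\<Sum>t\<in>\<Omega>. A t * W p t))"
    by (subst sum.swap) (simp add: sum_distrib_left)
  also have "\<dots> = N * (\<Sum>p\<in>P. (c p)\<^sup>2)"
    unfolding cN by (simp add: sum_distrib_left power2_eq_square mult_ac)
  finally have 1: "(\<Sum>t\<in>\<Omega>. A t * s t) = N * (\<Sum>p\<in>P. (c p)\<^sup>2)" .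
  have "(\<Sum>t\<in>\<Omega>. s t * s t) = (\<Sum>t\<in>\<Omega>. \<Sum>p\<in>P. \<Sum>q\<in>P. c p * c q * (W p t * W q t))"
    by (simp add: s_def sum_product mult_ac)
  also have "\<dots> = (\<Sum>p\<in>P. \<Sum>q\<in>P. c p * c q * (\<Sum>t\<in>\<Omega>. W p t * W q t))"
    by (subst sum.swap, rule sum.cong[OF refl], subst sum.swap) (simp add: sum_distrib_left)
  also have "\<dots> = (\<Sum>p\<in>P. \<Sum>q\<in>P. if p = q then N * (c p)\<^sup>2 else 0)"
    by (intro sum.cong refl) (simp add: on power2_eq_square)
  also have "\<dots> = N * (\<Sum>p\<in>P. (c p)\<^sup>2)"
    using fin(2) by (simp add: sum_distrib_left)
  finally have 2: "(\<Sum>t\<in>\<Omega>. s t * s t) = N * (\<Sum>p\<in>P. (c p)\<^sup>2)" .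
  have "0 \<le> (\<Sum>t\<in>\<Omega>. (A t - s t)\<^sup>2)" by (rule sum_nonneg) simp
  also have "\<dots> = (\<Sum>t\<in>\<Omega>. (A t)\<^sup>2) - 2 * (\<Sum>t\<in>\<Omega>. A t * s t) + (\<Sum>t\<in>\<Omega>. s t * s t)"
  proof -
    have "(A t - s t)\<^sup>2 = (A t)\<^sup>2 - 2 * (A t * s t) + s t * s t" for t
      by (simp add: power2_eq_square algebra_simps)
    then show ?thesis by (simp add: sum.distrib sum_subtractf sum_distrib_left)
  qed
  finally have "N * (\<Sum>p\<in>P. (c p)\<^sup>2) \<le> (\<Sum>t\<in>\<Omega>. (A t)\<^sup>2)" by (simp add: 1 2)
  then show ?thesis using N by (simp add: c_def field_simps)
qed

lemma bessel_complex:
  fixes A :: "'t \<Rightarrow> complex" and W :: "'p \<Rightarrow> 't \<Rightarrow> real"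
  assumes fin: "finite \<Omega>" "finite P" and N: "N > 0"
    and on: "\<And>p q. p \<in> P \<Longrightarrow> q \<in> P \<Longrightarrow> (\<Sum>t\<in>\<Omega>. W p t * W q t) = (if p = q then N else 0)"
  shows "(\<Sum>p\<in>P. (cmod ((\<Sum>t\<in>\<Omega>. A t * of_real (W p t)) / of_real N))\<^sup>2) \<le> (\<Sum>t\<in>\<Omega>. (cmod (A t))\<^sup>2) / N"
proof -
  have "(\<Sum>p\<in>P. (cmod ((\<Sum>t\<in>\<Omega>. A t * of_real (W p t)) / of_real N))\<^sup>2)
      = (\<Sum>p\<in>P. ((\<Sum>t\<in>\<Omega>. Re (A t) * W p t) / N)\<^sup>2) + (\<Sum>p\<in>P. ((\<Sum>t\<in>\<Omega>. Im (A t) * W p t) / N)\<^sup>2)"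
    by (simp add: cmod_power2 sum.distrib)
  also have "\<dots> \<le> (\<Sum>t\<in>\<Omega>. (Re (A t))\<^sup>2) / N + (\<Sum>t\<in>\<Omega>. (Im (A t))\<^sup>2) / N"
    by (intro add_mono bessel_real fin N on)
  also have "\<dots> = (\<Sum>t\<in>\<Omega>. (cmod (A t))\<^sup>2) / N"
    by (simp add: cmod_power2 sum.distrib add_divide_distrib)
  finally show ?thesis .
qed

section \<open>Failure of Arens regularity\<close>

lemma cbilinear_form_product:
  assumes "clinear_form f" "clinear_form g"
  shows "cbilinear_form (\<lambda>a b. f a * g b)"
  using assms by (simp add: cbilinear_form_def clinear_form_def algebra_simps)

lemma cbilinear_form_sum:
  assumes "\<And>i. i \<in> I \<Longrightarrow> cbilinear_form (F i)"
  shows "cbilinear_form (\<lambda>a b. \<Sum>i\<in>I. F i a b)"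
  using assms
  by (induction I rule: infinite_finite_induct)
     (auto simp: cbilinear_form_def clinear_form_def algebra_simps)

text \<open>The integral over the fair coin measure on the first \<open>n\<close> signs, realised by
  one character per pattern.\<close>

definition sign_mean :: "(nat \<Rightarrow> nat set \<Rightarrow> 'a \<Rightarrow> complex) \<Rightarrow> nat \<Rightarrow> 'a::cstar_algebra \<Rightarrow> complex" where
  "sign_mean X n a = (\<Sum>T\<in>Pow {..<n}. X n T a) / of_real (2 ^ n)"

lemma clinear_form_sign_mean:
  assumes "\<And>n T. X n T \<in> chars"
  shows "clinear_form (sign_mean X n)"
  by (auto simp: clinear_form_def sign_mean_def chars_linear[OF assms] sum.distrib add_divide_distrib
      sum_distrib_left)

lemma perfect_imp_not_arens_regular:
  fixes S :: "('a::{cstar_algebra, comm_ring} \<Rightarrow> complex) set"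
  assumes S: "perfect S"
  shows "\<not> arens_regular TYPE('a varopoulos)"
proof -
  obtain \<rho> :: "nat \<Rightarrow> 'a" and X where \<rho>: "\<And>i. star (\<rho> i) = \<rho> i" "\<And>i. norm (\<rho> i) \<le> 1"
    "\<And>n T. X n T \<in> spec" "\<And>n T i. i < n \<Longrightarrow> X n T (\<rho> i) = of_real (sg T i)"
    using rademacher_system[OF S] by blast
  have Xc: "X n T \<in> chars" for n T using \<rho>(3) spec_chars by blast
  define w where "w = (\<lambda>(i, j). \<rho> (2 * i) * \<rho> (2 * j + 1))"
  define W where "W = (\<lambda>(i, j) T. sg T (2 * i) * sg T (2 * j + 1))"
  define P where "P n = {(i, j). i < j \<and> j < (n::nat)}" for n
  define Q where "Q n = {..<n::nat} \<times> {..<n}" for n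
  have PQ: "P n \<subseteq> Q n" for n by (auto simp: P_def Q_def)
  have fin: "finite (P n)" for n by (rule finite_subset[OF PQ]) (simp add: Q_def)
  have Xw: "X (2 * n) T (a * w p) = X (2 * n) T a * of_real (W p T)" if "p \<in> Q n" for n T a p
    using that by (auto simp: Q_def w_def W_def charsD[OF Xc] \<rho>(4) split: prod.splits)
  have on: "(\<Sum>T\<in>Pow {..<2 * n}. W p T * W q T) = (if p = q then 2 ^ (2 * n) else 0)"
    if "p \<in> Q n" "q \<in> Q n" for n p q
    using sg_pairs_orthonormal[of "fst p" "2 * n" "snd p" "fst q" "snd q"] that
    by (auto simp: Q_def W_def split: prod.splits)
  \<comment> \<open>With 2n signs all indices 2i and 2j + 1 for i, j < n are available.\<close>
  define \<phi> where "\<phi> n = sign_mean X (2 * n)" for n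
  have \<phi>lin: "clinear_form (\<phi> n)" for n unfolding \<phi>_def by (rule clinear_form_sign_mean[OF Xc])
  have \<phi>w: "\<phi> n (a * w p) = (\<Sum>T\<in>Pow {..<2 * n}. X (2 * n) T a * of_real (W p T)) / of_real (2 ^ (2 * n))"
    if "p \<in> Q n" for n a p
    by (simp add: \<phi>_def sign_mean_def Xw[OF that])
  have \<phi>ww: "\<phi> n (w p * w q) = (if p = q then 1 else 0)" if "p \<in> Q n" "q \<in> Q n" for n p q
  proof -
    have "X (2 * n) T (w p) = of_real (W p T)" for T
      using that(1) by (auto simp: Q_def w_def W_def charsD[OF Xc] \<rho>(4) split: prod.splits)
    then have "\<phi> n (w p * w q) = of_real (\<Sum>T\<in>Pow {..<2 * n}. W p T * W q T) / of_real (2 ^ (2 * n))"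
      by (simp add: \<phi>w[OF that(2)])
    then show ?thesis unfolding on[OF that] by simp
  qed
  have bessel: "(\<Sum>p\<in>P n. (cmod (\<phi> n (a * w p)))\<^sup>2) \<le> (norm a)\<^sup>2" for n a
  proof -
    have "(\<Sum>p\<in>P n. (cmod (\<phi> n (a * w p)))\<^sup>2)
        = (\<Sum>p\<in>P n. (cmod ((\<Sum>T\<in>Pow {..<2 * n}. X (2 * n) T a * of_real (W p T)) / of_real (2 ^ (2 * n))))\<^sup>2)"
      using PQ by (intro sum.cong refl) (auto simp: \<phi>w subset_iff)
    also have "\<dots> \<le> (\<Sum>T\<in>Pow {..<2 * n}. (cmod (X (2 * n) T a))\<^sup>2) / 2 ^ (2 * n)"
    proof (rule bessel_complex)
      show "(\<Sum>T\<in>Pow {..<2 * n}. W p T * W q T) = (if p = q then 2 ^ (2 * n) else 0)"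
        if "p \<in> P n" "q \<in> P n" for p q using that PQ[of n] by (intro on) auto
    qed (auto simp: fin)
    also have "\<dots> \<le> (\<Sum>T\<in>Pow {..<2 * n}. (norm a)\<^sup>2) / 2 ^ (2 * n)"
      by (intro divide_right_mono sum_mono power_mono charsD(4)[OF Xc]) auto
    also have "\<dots> = (norm a)\<^sup>2" by (simp add: card_Pow)
    finally show ?thesis .
  qed
  define F where "F n a b = (\<Sum>p\<in>P n. \<phi> n (a * w p) * \<phi> n (b * w p))" for n a b
  \<comment> \<open>Cauchy-Schwarz, then Bessel in each variable. The bound is uniform in
    \<open>n\<close>, which is what the passage to a cluster point requires.\<close>
  have Fb: "cmod (F n a b) \<le> 1 * norm a * norm b" for n a b
  proof -
    have "(cmod (F n a b))\<^sup>2 \<le> (\<Sum>p\<in>P n. cmod (\<phi> n (a * w p)) * cmod (\<phi> n (b * w p)))\<^sup>2"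
      unfolding F_def norm_mult[symmetric] by (intro power_mono norm_sum) auto
    also have "\<dots> \<le> (\<Sum>p\<in>P n. (cmod (\<phi> n (a * w p)))\<^sup>2) * (\<Sum>p\<in>P n. (cmod (\<phi> n (b * w p)))\<^sup>2)"
      by (rule Cauchy_Schwarz_ineq_sum)
    also have "\<dots> \<le> (norm a)\<^sup>2 * (norm b)\<^sup>2"
      by (intro mult_mono bessel sum_nonneg) auto
    finally have "(cmod (F n a b))\<^sup>2 \<le> (norm a * norm b)\<^sup>2" by (simp add: power_mult_distrib)
    then have "cmod (F n a b) \<le> norm a * norm b" by (rule power2_le_imp_le) simp
    then show ?thesis by simp
  qed
  have "clinear_form (\<lambda>a. \<phi> n (a * w p))" for n p
    by (simp add: clinear_form_def distrib_right mult_scaleC_left clinear_form_simps[OF \<phi>lin])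
  then have "cbilinear_form (F n)" for n
    unfolding F_def by (intro cbilinear_form_sum cbilinear_form_product)
  then have "\<exists>f. (\<forall>a b. cdual_apply f (ptensor a b) = F n a b) \<and> norm f \<le> 1" for n
    using bilinear_extension[of "F n" 1] Fb by (metis zero_le_one)
  then obtain f where f: "\<And>n a b. cdual_apply (f n) (ptensor a b) = F n a b" "\<And>n. norm (f n) \<le> 1" by metis
  obtain g G where g: "G \<noteq> bot" "G \<le> sequentially" "\<And>x. ((\<lambda>n. cdual_apply (f n) x) \<longlongrightarrow> cdual_apply g x) G"
    using cdual_cluster_point[of f, OF f(2)] by blast
  define x where "x i = ptensor (\<rho> (2 * i)) (\<rho> (2 * i))" for i
  define y where "y j = ptensor (\<rho> (2 * j + 1)) (\<rho> (2 * j + 1))" for j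
  have xy: "x i * y j = ptensor (w (i, j)) (w (i, j))" for i j
    by (simp add: x_def y_def w_def ptensor_mult)
  \<comment> \<open>For n > i + j orthonormality leaves only the summand \<open>p = (i, j)\<close>,
    which is present exactly if i < j; the values are then constant in \<open>n\<close>.\<close>
  have gxy: "cdual_apply g (x i * y j) = (if i < j then 1 else 0)" for i j
  proof (rule eventually_const_tendsto[OF g])
    fix n assume n: "n \<ge> Suc (i + j)"
    then have ij: "(i, j) \<in> Q n" by (simp add: Q_def)
    have "F n (w (i, j)) (w (i, j)) = (\<Sum>p\<in>P n. if p = (i, j) then 1 else 0)"
      unfolding F_def using PQ ij by (intro sum.cong refl) (auto simp: \<phi>ww subset_iff split: if_splits)
    also have "\<dots> = (if i < j then 1 else 0)" using fin[of n] n by (simp add: P_def)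
    finally show "cdual_apply (f n) (x i * y j) = (if i < j then 1 else 0)" by (simp add: xy f(1))
  qed
  have n1: "norm (ptensor (\<rho> k) (\<rho> k)) \<le> 1" for k
    using norm_ptensor_le[of "\<rho> k" "\<rho> k"] mult_mono[OF \<rho>(2)[of k] \<rho>(2)[of k]] by simp
  show ?thesis
    by (rule not_arens_regularI[of x 1 y g]) (use n1 gxy in \<open>auto simp: x_def y_def\<close>)
qed

section \<open>Failure of strong Arens irregularity\<close>

text \<open>The left-hand side is the average of the bounded expressions over all signs, since mixed
  terms cancel. The signs are averaged one at a time, and the free \<open>u\<close>,
  \<open>v\<close> absorb those not yet averaged.\<close>

lemma bilinear_sign_average:
  fixes F :: "'a::complex_normed_vector \<Rightarrow> 'b::complex_normed_vector \<Rightarrow> complex" and N :: "'i set"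
  assumes F: "cbilinear_form F" and fin: "finite N"
    and bd: "\<And>s. (\<And>i. s i = 1 \<or> s i = (-1::real)) \<Longrightarrow>
      cmod (F (u + (\<Sum>i\<in>N. s i *\<^sub>R x i)) (v + (\<Sum>i\<in>N. s i *\<^sub>R y i))) \<le> C"
  shows "cmod (F u v + (\<Sum>i\<in>N. F (x i) (y i))) \<le> C"
  using fin bd
proof (induction N arbitrary: u v rule: finite_induct)
  case empty
  then show ?case using empty.prems[of "\<lambda>_. 1"] by simp
next
  case (insert m N)
  note B = cbilinear_form_simps[OF F]
  let ?R = "\<Sum>i\<in>N. F (x i) (y i)"
  have *: "cmod (F (u + t *\<^sub>R x m) (v + t *\<^sub>R y m) + ?R) \<le> C" if t: "t = 1 \<or> t = (-1::real)" for t
  proof (rule insert.IH)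
    fix s :: "'i \<Rightarrow> real" assume s: "\<And>i. s i = 1 \<or> s i = -1"
    let ?s = "s(m := t)"
    have "(\<Sum>i\<in>N. ?s i *\<^sub>R x i) = (\<Sum>i\<in>N. s i *\<^sub>R x i)" "(\<Sum>i\<in>N. ?s i *\<^sub>R y i) = (\<Sum>i\<in>N. s i *\<^sub>R y i)"
      using insert.hyps by (auto intro!: sum.cong)
    then show "cmod (F (u + t *\<^sub>R x m + (\<Sum>i\<in>N. s i *\<^sub>R x i)) (v + t *\<^sub>R y m + (\<Sum>i\<in>N. s i *\<^sub>R y i))) \<le> C"
      using insert.prems[of ?s] s t insert.hyps by (simp add: add.assoc)
  qed
  have minus: "F a (- b) = - F a b" for a b
    using B(4)[of a "-1" b] by (simp add: scaleC_minus1)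
  have 1: "F (u + p) (v + q) = F u v + F u q + F p v + F p q" for p q by (simp add: B(1,2))
  have 2: "F (u - p) (v - q) = F u v - F u q - F p v + F p q" for p q
    using 1[of "- p" "- q"] by (simp add: B(5) minus)
  have 3: "2 * (F u v + (F (x m) (y m) + ?R))
      = (F (u + x m) (v + y m) + ?R) + (F (u - x m) (v - y m) + ?R)"
    by (simp add: 1 2)
  have "cmod (2 * (F u v + (F (x m) (y m) + ?R))) \<le> C + C"
    unfolding 3 by (rule norm_triangle_mono) (use *[of 1] *[of "-1"] in simp_all)
  then have "cmod (F u v + (F (x m) (y m) + ?R)) \<le> C" unfolding norm_mult by simp
  then show ?case using insert.hyps by simp
qed

text \<open>Signed sums of orthogonal contractions are contractions, so sign averaging bounds the
  diagonal sum; phases put into \<open>x\<close> turn its terms into moduli.\<close>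

lemma orthogonal_bilinear_sum_le:
  fixes F :: "'a::{cstar_algebra, comm_ring} \<Rightarrow> 'a \<Rightarrow> complex" and N :: "'i set"
  assumes F: "cbilinear_form F" "\<And>a b. cmod (F a b) \<le> K * norm a * norm b" "K \<ge> 0" and fin: "finite N"
    and x: "\<And>i j. i \<in> N \<Longrightarrow> j \<in> N \<Longrightarrow> i \<noteq> j \<Longrightarrow> x i * x j = 0" "\<And>i. i \<in> N \<Longrightarrow> norm (x i) \<le> 1"
    and y: "\<And>i j. i \<in> N \<Longrightarrow> j \<in> N \<Longrightarrow> i \<noteq> j \<Longrightarrow> y i * y j = 0" "\<And>i. i \<in> N \<Longrightarrow> norm (y i) \<le> 1"
  shows "(\<Sum>i\<in>N. cmod (F (x i) (y i))) \<le> K"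
proof -
  note B = cbilinear_form_simps[OF F(1)]
  have "\<exists>\<theta>. cmod \<theta> = 1 \<and> \<theta> * F (x i) (y i) = of_real (cmod (F (x i) (y i)))" for i :: 'i
  proof (cases "F (x i) (y i) = 0")
    case True
    then show ?thesis by (intro exI[of _ 1]) simp
  next
    case False
    then show ?thesis
      by (intro exI[of _ "1 / sgn (F (x i) (y i))"]) (simp add: norm_divide norm_sgn, simp add: sgn_eq)
  qed
  then obtain \<theta> where \<theta>: "\<And>i. cmod (\<theta> i) = 1" "\<And>i. \<theta> i * F (x i) (y i) = of_real (cmod (F (x i) (y i)))" by metis
  have "cmod (F 0 0 + (\<Sum>i\<in>N. F (scaleC (\<theta> i) (x i)) (y i))) \<le> K"
  proof (rule bilinear_sign_average[OF F(1) fin])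
    fix s :: "'i \<Rightarrow> real" assume s: "\<And>i. s i = 1 \<or> s i = -1"
    then have s1: "\<bar>s i\<bar> = 1" for i by (metis abs_minus_cancel abs_one)
    have "norm (\<Sum>i\<in>N. s i *\<^sub>R scaleC (\<theta> i) (x i)) \<le> 1"
      by (rule orthogonal_sum_norm)
         (use x s1 \<theta>(1) in \<open>auto simp: norm_scaleC mult_scaleC_left mult_scaleC_right scaleC_zero_right\<close>)
    moreover have "norm (\<Sum>i\<in>N. s i *\<^sub>R y i) \<le> 1"
      by (rule orthogonal_sum_norm) (use y s1 in auto)
    ultimately have "K * norm (\<Sum>i\<in>N. s i *\<^sub>R scaleC (\<theta> i) (x i)) * norm (\<Sum>i\<in>N. s i *\<^sub>R y i) \<le> K * 1 * 1"
      using F(3) by (intro mult_mono) auto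
    then show "cmod (F (0 + (\<Sum>i\<in>N. s i *\<^sub>R scaleC (\<theta> i) (x i))) (0 + (\<Sum>i\<in>N. s i *\<^sub>R y i))) \<le> K"
      using F(2)[of "\<Sum>i\<in>N. s i *\<^sub>R scaleC (\<theta> i) (x i)" "\<Sum>i\<in>N. s i *\<^sub>R y i"] by simp
  qed
  moreover have "F 0 0 = 0" using B(1)[of 0 0 0] by simp
  moreover have "(\<Sum>i\<in>N. F (scaleC (\<theta> i) (x i)) (y i)) = of_real (\<Sum>i\<in>N. cmod (F (x i) (y i)))"
    by (simp add: B \<theta>(2))
  ultimately have "\<bar>\<Sum>i\<in>N. cmod (F (x i) (y i))\<bar> \<le> K" by (metis add_0 norm_of_real)
  then show ?thesis by simp
qed

text \<open>The n-th peak is the positive part of \<open>\<rho> n\<close> times the negative parts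
  of all earlier \<open>\<rho> i\<close>. For i < j one peak contains the positive and the other the
  negative part of \<open>\<rho> i\<close>. The pattern with its only positive sign at
  \<open>n\<close> attains the value one.\<close>

lemma orthogonal_peaks:
  fixes S :: "('a::{cstar_algebra, comm_ring} \<Rightarrow> complex) set"
  assumes S: "perfect S"
  obtains e :: "nat \<Rightarrow> 'a" and X where "\<And>n. unit_elem (e n)" "\<And>n. X n \<in> spec" "\<And>n. X n (e n) = 1"
    "\<And>i j. i \<noteq> j \<Longrightarrow> e i * e j = 0"
proof -
  obtain \<rho> :: "nat \<Rightarrow> 'a" and X where \<rho>: "\<And>i. star (\<rho> i) = \<rho> i" "\<And>i. norm (\<rho> i) \<le> 1"
    "\<And>n T. X n T \<in> spec" "\<And>n T i. i < n \<Longrightarrow> X n T (\<rho> i) = of_real (sg T i)"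
    using rademacher_system[OF S] by blast
  have h1: "continuous_on UNIV clamp01" "clamp01 0 = 0" using continuous_on_clamp01[OF continuous_on_id] by auto
  have h2: "continuous_on UNIV (\<lambda>t. clamp01 (- t))" "clamp01 (- 0) = 0" by (auto intro!: continuous_intros)
  define p where "p i = fcalc clamp01 (\<rho> i)" for i
  define q where "q i = fcalc (\<lambda>t. clamp01 (- t)) (\<rho> i)" for i
  have p: "\<omega> (p i) = of_real (clamp01 (Re (\<omega> (\<rho> i))))" and q: "\<omega> (q i) = of_real (clamp01 (- Re (\<omega> (\<rho> i))))"
    if "\<omega> \<in> chars" for \<omega> i
    unfolding p_def q_def using fcalc_apply[OF h1 \<rho>(1) that] fcalc_apply[OF h2 \<rho>(1) that] by auto
  have up: "unit_elem (p i)" and uq: "unit_elem (q i)" for i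
    unfolding p_def q_def by (intro unit_elem_fcalc h1 h2 \<rho>(1); simp)+
  define E where "E n m = rec_nat (p n) (\<lambda>i x. x * q i) m" for n m
  have E0: "E n 0 = p n" and ES: "E n (Suc m) = E n m * q m" for n m by (simp_all add: E_def)
  have Eap: "\<omega> (E n m) = \<omega> (p n) * (\<Prod>i<m. \<omega> (q i))" if "\<omega> \<in> chars" for \<omega> n m
    using that by (induction m) (simp_all add: E0 ES charsD)
  have pq: "\<omega> (p i) * \<omega> (q i) = 0" if "\<omega> \<in> chars" for \<omega> i
    using that by (auto simp: p q clamp01_def max_def min_def)
  have orth: "E i i * E j j = 0" if "i < j" for i j
  proof (rule chars_eqI)
    fix \<omega> :: "'a \<Rightarrow> complex" assume \<omega>: "\<omega> \<in> chars"
    have "(\<Prod>k<j. \<omega> (q k)) = \<omega> (q i) * (\<Prod>k\<in>{..<j} - {i}. \<omega> (q k))"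
      using that by (intro prod.remove) auto
    then show "\<omega> (E i i * E j j) = \<omega> 0"
      using \<omega> pq[OF \<omega>, of i] by (auto simp: charsD Eap chars_linear)
  qed
  show ?thesis
  proof (rule that[of "\<lambda>n. E n n" "\<lambda>n. X (Suc n) {n}"])
    show "unit_elem (E n n)" for n
    proof -
      have "unit_elem (E n m)" for m by (induction m) (simp_all add: E0 ES up uq unit_elem_mult)
      then show ?thesis .
    qed
    show "X (Suc n) {n} \<in> spec" for n by (rule \<rho>(3))
    show "X (Suc n) {n} (E n n) = 1" for n
    proof -
      have c: "X (Suc n) {n} \<in> chars" using \<rho>(3) spec_chars by blast
      have "X (Suc n) {n} (q i) = 1" if "i < n" for i
        using that c by (simp add: q \<rho>(4) sg_def clamp01_def)
      moreover have "X (Suc n) {n} (p n) = 1" using c by (simp add: p \<rho>(4) sg_def clamp01_def)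
      ultimately show ?thesis by (simp add: Eap[OF c])
    qed
    show "E i i * E j j = 0" if "i \<noteq> j" for i j
      using that orth[of i j] orth[of j i] by (metis mult.commute nat_neq_iff)
  qed
qed

text \<open>The witness is the weak* sum of the \<open>e\<^sub>n \<otimes> e\<^sub>n\<close>.\<close>

lemma perfect_imp_not_strongly_arens_irregular:
  fixes S :: "('a::{cstar_algebra, comm_ring} \<Rightarrow> complex) set"
  assumes S: "perfect S"
  shows "\<not> strongly_arens_irregular TYPE('a varopoulos)"
proof -
  obtain e :: "nat \<Rightarrow> 'a" and \<omega> where e: "\<And>n. unit_elem (e n)" and \<omega>: "\<And>n. \<omega> n \<in> spec" "\<And>n. \<omega> n (e n) = 1"
    and orth: "\<And>i j. i \<noteq> j \<Longrightarrow> e i * e j = 0"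
    using orthogonal_peaks[OF S] by blast
  have \<omega>c: "\<omega> n \<in> chars" for n using \<omega>(1) spec_chars by blast
  have off: "\<omega> n (e j) = 0" if "j \<noteq> n" for n j
    using charsD(2)[OF \<omega>c, of n "e j" "e n"] orth[OF that] \<omega>(2)[of n] chars_linear(3)[OF \<omega>c] by simp
  define E where "E n = ptensor (e n) (e n)" for n
  \<comment> \<open>Each norm is tested at an almost norming \<open>a n\<close>, \<open>b n\<close>.
    Multiplied by \<open>e n\<close> these become orthogonal families again, so the sum of the norms
    stays below \<open>norm f\<close>.\<close>
  have bound: "(\<Sum>n<N. norm (arens_fa f (E n))) \<le> norm f" for f :: "('a varopoulos) cdual" and N
  proof (rule field_le_epsilon)
    fix \<epsilon> :: real assume "\<epsilon> > 0"
    define d where "d = \<epsilon> / (real N + 1)"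
    have d: "d > 0" using \<open>\<epsilon> > 0\<close> by (simp add: d_def)
    have "\<exists>a b. norm a \<le> 1 \<and> norm b \<le> 1 \<and> norm (arens_fa f (E n)) - d < cmod (cdual_apply (arens_fa f (E n)) (ptensor a b))" for n
      using ptensor_functional_near_norm[OF d, of "arens_fa f (E n)"] by metis
    then obtain a b where ab: "\<And>n. norm (a n) \<le> 1" "\<And>n. norm (b n) \<le> 1"
      "\<And>n. norm (arens_fa f (E n)) - d < cmod (cdual_apply (arens_fa f (E n)) (ptensor (a n) (b n)))" by metis
    have "(\<Sum>n<N. norm (arens_fa f (E n))) \<le> (\<Sum>n<N. cmod (cdual_apply f (ptensor (e n * a n) (e n * b n))) + d)"
      using ab(3) by (intro sum_mono) (simp add: arens_fa_apply E_def ptensor_mult less_imp_le diff_less_eq)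
    also have "\<dots> = (\<Sum>n<N. cmod (cdual_apply f (ptensor (e n * a n) (e n * b n)))) + real N * d"
      by (simp add: sum.distrib)
    also have "\<dots> \<le> norm f + \<epsilon>"
    proof (rule add_mono)
      have o: "(e i * u) * (e j * v) = 0" if "i \<noteq> j" for i j u v
      proof -
        have "(e i * u) * (e j * v) = (e i * e j) * (u * v)" by (simp add: mult_ac)
        with orth[OF that] show ?thesis by simp
      qed
      have n: "norm (e i * u) \<le> 1" if "norm u \<le> 1" for i u
        using norm_mult_unit_elem_le(1)[OF e, of u i] that by (simp add: mult.commute)
      show "(\<Sum>n<N. cmod (cdual_apply f (ptensor (e n * a n) (e n * b n)))) \<le> norm f"
        by (rule orthogonal_bilinear_sum_le[of "\<lambda>a b. cdual_apply f (ptensor a b)"])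
           (use cbilinear_form_ptensor cmod_ptensor_le o n ab in auto)
      show "real N * d \<le> \<epsilon>" using \<open>\<epsilon> > 0\<close> by (simp add: d_def field_simps)
    qed
    finally show "(\<Sum>n<N. norm (arens_fa f (E n))) \<le> norm f + \<epsilon>" .
  qed
  have bound': "(\<Sum>n<N. cmod (cdual_apply f (E n))) \<le> norm f" for f :: "('a varopoulos) cdual" and N
    unfolding E_def
    by (rule orthogonal_bilinear_sum_le[of "\<lambda>a b. cdual_apply f (ptensor a b)"])
       (use cbilinear_form_ptensor cmod_ptensor_le orth unit_elem_norm[OF e] in auto)
  have sumE: "summable (\<lambda>n. cmod (cdual_apply f (E n)))" for f :: "('a varopoulos) cdual"
    by (rule summableI_nonneg_bounded[OF _ bound']) simp
  define X where "X = cdual_of (\<lambda>f :: ('a varopoulos) cdual. \<Sum>n. cdual_apply f (E n))"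
  have X: "cdual_apply X f = (\<Sum>n. cdual_apply f (E n))" for f
  proof -
    have "cdual_apply X = (\<lambda>f. \<Sum>n. cdual_apply f (E n))"
      unfolding X_def
    proof (rule cdual_apply_cdual_of[where K = 1])
      show "clinear_form (\<lambda>f :: ('a varopoulos) cdual. \<Sum>n. cdual_apply f (E n))"
        unfolding clinear_form_def
        using summable_norm_cancel[OF sumE]
        by (auto simp: cdual_apply_add_left cdual_apply_scaleC_left suminf_add suminf_mult)
      show "cmod (\<Sum>n. cdual_apply f (E n)) \<le> 1 * norm f" for f :: "('a varopoulos) cdual"
        using summable_norm[OF sumE, of f] suminf_le_const[OF sumE bound', of f] by simp
    qed
    then show ?thesis by simp
  qed
  have "X \<in> topological_centre"
  proof (rule topological_centreI)
    fix f :: "('a varopoulos) cdual"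
    define b where "b n = norm (arens_fa f (E n))" for n
    have sb: "summable b" unfolding b_def by (rule summableI_nonneg_bounded[OF _ bound]) simp
    have le: "cmod (cdual_apply f (E n * v)) \<le> b n * norm v" for n v
      using norm_cdual_apply[of "arens_fa f (E n)" v] by (simp add: arens_fa_apply b_def)
    have sv: "summable (\<lambda>n. cmod (cdual_apply f (E n * v)))" for v
      by (rule summable_comparison_test'[OF summable_mult2[OF sb, of "norm v"], of 0]) (use le in auto)
    \<comment> \<open>This is the sum of the functionals \<open>arens_fa f (E n)\<close>. It
      converges in norm, so any \<open>Y\<close> in the bidual may be applied term by term.\<close>
    define g where "g = cdual_of (\<lambda>v. \<Sum>n. cdual_apply f (E n * v))"
    have g: "cdual_apply g v = (\<Sum>n. cdual_apply f (E n * v))" for v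
    proof -
      have "cdual_apply g = (\<lambda>v. \<Sum>n. cdual_apply f (E n * v))"
        unfolding g_def
      proof (rule cdual_apply_cdual_of[where K = "suminf b"])
        show "clinear_form (\<lambda>v. \<Sum>n. cdual_apply f (E n * v))"
          unfolding clinear_form_def
          using summable_norm_cancel[OF sv]
          by (auto simp: distrib_left mult_scaleC_right cdual_apply_simps suminf_add suminf_mult)
        show "cmod (\<Sum>n. cdual_apply f (E n * v)) \<le> suminf b * norm v" for v
        proof -
          have "cmod (\<Sum>n. cdual_apply f (E n * v)) \<le> (\<Sum>n. b n * norm v)"
            by (rule order_trans[OF summable_norm[OF sv] suminf_le[OF le sv summable_mult2[OF sb]]])
          then show ?thesis by (simp add: suminf_mult2[OF sb])
        qed
      qed
      then show ?thesis by simp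
    qed
    have tail: "norm (g - (\<Sum>n<N. arens_fa f (E n))) \<le> suminf b - (\<Sum>n<N. b n)" for N
    proof (rule norm_cdual_le)
      fix v
      have eq: "cdual_apply (g - (\<Sum>n<N. arens_fa f (E n))) v = (\<Sum>n. cdual_apply f (E (n + N) * v))"
        using suminf_minus_initial_segment[OF summable_norm_cancel[OF sv[of v]], of N]
        by (simp add: cdual_apply_diff_left cdual_apply_sum_left g arens_fa_apply)
      have sv': "summable (\<lambda>n. cmod (cdual_apply f (E (n + N) * v)))" using sv[of v] by (subst summable_iff_shift)
      have sb': "summable (\<lambda>n. b (n + N))" using sb by (subst summable_iff_shift)
      have "cmod (\<Sum>n. cdual_apply f (E (n + N) * v)) \<le> (\<Sum>n. b (n + N) * norm v)"
        by (rule order_trans[OF summable_norm[OF sv'] suminf_le[OF le sv' summable_mult2[OF sb']]])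
      also have "\<dots> = (suminf b - (\<Sum>n<N. b n)) * norm v"
        by (simp add: suminf_mult2[OF sb', symmetric] suminf_minus_initial_segment[OF sb])
      finally show "cmod (cdual_apply (g - (\<Sum>n<N. arens_fa f (E n))) v) \<le> (suminf b - (\<Sum>n<N. b n)) * norm v"
        by (simp add: eq)
    next
      show "0 \<le> suminf b - (\<Sum>n<N. b n)" using sum_le_suminf[OF sb, of "{..<N}"] by (simp add: b_def)
    qed
    have "cdual_apply (arens_product X Y) f = cdual_apply Y g" for Y
    proof -
      have "(\<lambda>N. norm Y * (suminf b - (\<Sum>n<N. b n))) \<longlonglongrightarrow> norm Y * (suminf b - suminf b)"
        by (intro tendsto_intros summable_LIMSEQ sb)
      then have lim0: "(\<lambda>N. norm Y * (suminf b - (\<Sum>n<N. b n))) \<longlonglongrightarrow> 0" by simp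
      have le': "cmod (cdual_apply Y g - (\<Sum>n<N. cdual_apply Y (arens_fa f (E n)))) \<le> norm Y * (suminf b - (\<Sum>n<N. b n))" for N
      proof -
        have "cdual_apply Y g - (\<Sum>n<N. cdual_apply Y (arens_fa f (E n))) = cdual_apply Y (g - (\<Sum>n<N. arens_fa f (E n)))"
          by (simp add: cdual_apply_simps)
        also have "cmod \<dots> \<le> norm Y * (suminf b - (\<Sum>n<N. b n))"
          by (rule order_trans[OF norm_cdual_apply mult_left_mono[OF tail]]) simp
        finally show ?thesis .
      qed
      have "(\<lambda>N. cdual_apply Y g - (\<Sum>n<N. cdual_apply Y (arens_fa f (E n)))) \<longlonglongrightarrow> 0"
        by (rule Lim_null_comparison[OF _ lim0]) (simp add: le')
      then have "(\<lambda>N. \<Sum>n<N. cdual_apply Y (arens_fa f (E n))) \<longlonglongrightarrow> cdual_apply Y g"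
        using tendsto_diff[OF tendsto_const[of "cdual_apply Y g"]] by fastforce
      then have "(\<lambda>n. cdual_apply Y (arens_fa f (E n))) sums cdual_apply Y g" by (simp add: sums_def)
      then show ?thesis by (simp add: arens_product_apply X arens_Yf_apply sums_iff)
    qed
    then show "\<exists>g. \<forall>Y. cdual_apply (arens_product X Y) f = cdual_apply Y g" by blast
  qed
  moreover have "X \<notin> range canonical_embedding"
  proof
    assume "X \<in> range canonical_embedding"
    then obtain u where u: "X = canonical_embedding u" by blast
    have fu: "(\<Sum>n. cdual_apply f (E n)) = cdual_apply f u" for f
      using X[of f] by (simp add: u canonical_embedding_apply)
    \<comment> \<open>If \<open>X\<close> came from \<open>u\<close>, each product of
      \<open>\<omega> n\<close> with itself would be 1 at \<open>u\<close>, and so would a cluster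
      point. But the cluster point vanishes at every \<open>E j\<close>, so its value at
      \<open>u\<close> is an empty sum.\<close>
    have "\<exists>f. (\<forall>a b. cdual_apply f (ptensor a b) = \<omega> n a * \<omega> n b) \<and> norm f \<le> 1" for n
    proof -
      have "cbilinear_form (\<lambda>a b. \<omega> n a * \<omega> n b)"
        by (auto simp: cbilinear_form_def clinear_form_def chars_linear[OF \<omega>c] algebra_simps)
      moreover have "cmod (\<omega> n a * \<omega> n b) \<le> 1 * norm a * norm b" for a b
        by (simp add: norm_mult mult_mono charsD(4)[OF \<omega>c])
      ultimately show ?thesis using bilinear_extension[of "\<lambda>a b. \<omega> n a * \<omega> n b" 1] by (metis zero_le_one)
    qed
    then obtain f where f: "\<And>n a b. cdual_apply (f n) (ptensor a b) = \<omega> n a * \<omega> n b" "\<And>n. norm (f n) \<le> 1" by metis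
    obtain g G where g: "G \<noteq> bot" "G \<le> sequentially" "\<And>x. ((\<lambda>n. cdual_apply (f n) x) \<longlongrightarrow> cdual_apply g x) G"
      using cdual_cluster_point[of f, OF f(2)] by blast
    have fE: "cdual_apply (f n) (E j) = (if j = n then 1 else 0)" for n j
      using off[of j n] \<omega>(2)[of n] by (simp add: E_def f(1))
    have "cdual_apply (f n) u = 1" for n
      unfolding fu[symmetric] fE by (rule sums_unique[symmetric]) (rule sums_single)
    then have "cdual_apply g u = 1" by (intro eventually_const_tendsto[OF g, of 0]) simp
    moreover have "cdual_apply g (E j) = 0" for j
      by (rule eventually_const_tendsto[OF g, of "Suc j"]) (simp add: fE)
    then have "cdual_apply g u = 0" by (simp flip: fu)
    ultimately show False by simp
  qed
  ultimately show ?thesis unfolding strongly_arens_irregular_def by blast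
qed

section \<open>Positive functionals\<close>

lemma positive_functionalD:
  assumes "positive_functional f"
  shows "clinear_form f" "f (star x * x) \<in> \<real>\<^sub>\<ge>\<^sub>0"
  using assms by (auto simp: positive_functional_def)

lemma positive_functional_pos:
  fixes f :: "'a::{cstar_algebra, comm_ring} \<Rightarrow> complex"
  assumes "positive_functional f" "pos_elem a"
  shows "Re (f a) \<ge> 0" "Im (f a) = 0"
proof -
  obtain x where "a = star x * x" using pos_elem_square[OF assms(2)] by blast
  then have "f a \<in> \<real>\<^sub>\<ge>\<^sub>0" using positive_functionalD(2)[OF assms(1)] by simp
  then show "Re (f a) \<ge> 0" "Im (f a) = 0" by (auto simp: complex_nonneg_Reals_iff)
qed

lemma pos_elem_diffI:
  assumes "\<And>\<omega>. \<omega> \<in> chars \<Longrightarrow> \<exists>s t. \<omega> a = of_real s \<and> \<omega> b = of_real t \<and> t \<le> s"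
  shows "pos_elem (a - b)"
proof (rule pos_elemI)
  fix \<omega> :: "'a \<Rightarrow> complex" assume \<omega>: "\<omega> \<in> chars"
  then obtain s t where "\<omega> a = of_real s" "\<omega> b = of_real t" "t \<le> s" using assms by blast
  then show "\<exists>r\<ge>0. \<omega> (a - b) = of_real r" using \<omega> by (intro exI[of _ "s - t"]) (simp add: chars_linear)
qed

lemma positive_functional_mono:
  fixes f :: "'a::{cstar_algebra, comm_ring} \<Rightarrow> complex"
  assumes "positive_functional f" "pos_elem (a - b)"
  shows "Re (f b) \<le> Re (f a)"
  using positive_functional_pos(1)[OF assms] clinear_form_simps(5)[OF positive_functionalD(1)[OF assms(1)], of a b]
  by simp

lemma selfadjoint_decomposition:
  fixes h :: "'a::{cstar_algebra, comm_ring}"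
  assumes h: "star h = h"
  shows "\<exists>p q. pos_elem p \<and> pos_elem q \<and> h = p - q \<and> norm p \<le> norm h \<and> norm q \<le> norm h
    \<and> (\<forall>\<omega>\<in>chars. \<omega> h = 0 \<longrightarrow> \<omega> p = 0 \<and> \<omega> q = 0)"
proof -
  have c1: "continuous_on UNIV (\<lambda>t::real. max 0 t)" "max 0 (0::real) = 0" by (auto intro!: continuous_intros)
  have c2: "continuous_on UNIV (\<lambda>t::real. max 0 (- t))" "max 0 (- 0::real) = 0" by (auto intro!: continuous_intros)
  let ?p = "fcalc (\<lambda>t. max 0 t) h" and ?q = "fcalc (\<lambda>t. max 0 (- t)) h"
  note p = fcalc_apply[OF c1 h] and q = fcalc_apply[OF c2 h]
  have re: "\<bar>Re (\<omega> h)\<bar> \<le> norm h" if "\<omega> \<in> chars" for \<omega>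
    using abs_Re_le_cmod[of "\<omega> h"] charsD(4)[OF that, of h] by linarith
  have "pos_elem ?p" by (rule pos_elem_fcalc[OF c1 h]) simp
  moreover have "pos_elem ?q" by (rule pos_elem_fcalc[OF c2 h]) simp
  moreover have "h = ?p - ?q"
  proof (rule chars_eqI)
    fix \<omega> :: "'a \<Rightarrow> complex" assume \<omega>: "\<omega> \<in> chars"
    have "\<omega> h = of_real (max 0 (Re (\<omega> h)) - max 0 (- Re (\<omega> h)))"
      using selfadjoint_Im[OF h \<omega>] by (auto simp: complex_eq_iff)
    then show "\<omega> h = \<omega> (?p - ?q)" using \<omega> by (simp add: chars_linear p q)
  qed
  moreover have "norm ?p \<le> norm h"
    by (rule norm_le_chars) (use re in \<open>fastforce simp: p\<close>)
  moreover have "norm ?q \<le> norm h"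
    by (rule norm_le_chars) (use re in \<open>fastforce simp: q\<close>)
  moreover have "\<omega> ?p = 0 \<and> \<omega> ?q = 0" if "\<omega> \<in> chars" "\<omega> h = 0" for \<omega> using that by (simp add: p q)
  ultimately show ?thesis by blast
qed

lemma cartesian_decomposition:
  fixes x :: "'a::{cstar_algebra, comm_ring}"
  shows "\<exists>u v. star u = u \<and> star v = v \<and> x = u + scaleC \<i> v \<and> norm u \<le> norm x \<and> norm v \<le> norm x
    \<and> (\<forall>\<omega>\<in>chars. \<omega> u = of_real (Re (\<omega> x)) \<and> \<omega> v = of_real (Im (\<omega> x)))"
proof -
  define u v where "u = (1/2) *\<^sub>R (x + star x)" and "v = scaleC (- \<i> / 2) (x - star x)"
  have u: "\<omega> u = of_real (Re (\<omega> x))" and v: "\<omega> v = of_real (Im (\<omega> x))" if "\<omega> \<in> chars" for \<omega>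
    using that by (simp_all add: u_def v_def chars_linear charsD complex_eq_iff)
  have "star u = u" by (rule selfadjointI) (simp add: u)
  moreover have "star v = v" by (rule selfadjointI) (simp add: v)
  moreover have "x = u + scaleC \<i> v"
    by (rule chars_eqI) (simp add: chars_linear(1,2) u v complex_eq_iff)
  moreover have "norm u \<le> norm x"
  proof (rule norm_le_chars)
    show "cmod (\<omega> u) \<le> norm x" if "\<omega> \<in> chars" for \<omega>
      unfolding u[OF that] using charsD(4)[OF that, of x] abs_Re_le_cmod[of "\<omega> x"] by simp
  qed
  moreover have "norm v \<le> norm x"
  proof (rule norm_le_chars)
    show "cmod (\<omega> v) \<le> norm x" if "\<omega> \<in> chars" for \<omega>
      unfolding v[OF that] using charsD(4)[OF that, of x] abs_Im_le_cmod[of "\<omega> x"] by simp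
  qed
  ultimately show ?thesis using u v by (intro exI[of _ u] exI[of _ v]) simp
qed

text \<open>The case \<open>N = {}\<close> is induction over the whole algebra.\<close>

lemma pos_elem_induct [consumes 1, case_names pos add scale]:
  fixes x :: "'a::{cstar_algebra, comm_ring}"
  assumes x: "\<forall>\<omega>\<in>N. \<omega> \<in> chars \<and> \<omega> x = 0"
    and pos: "\<And>p. pos_elem p \<Longrightarrow> \<forall>\<omega>\<in>N. \<omega> p = 0 \<Longrightarrow> P p"
    and add: "\<And>x y. P x \<Longrightarrow> P y \<Longrightarrow> P (x + y)" and sc: "\<And>c x. P x \<Longrightarrow> P (scaleC c x)"
  shows "P x"
proof -
  have sa: "P h" if h: "star h = h" "\<forall>\<omega>\<in>N. \<omega> h = 0" for h
  proof -
    obtain p q where pq: "pos_elem p" "pos_elem q" "h = p - q" "\<forall>\<omega>\<in>chars. \<omega> h = 0 \<longrightarrow> \<omega> p = 0 \<and> \<omega> q = 0"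
      using selfadjoint_decomposition[OF h(1)] by blast
    have "P p" "P q" using pos pq h(2) x by blast+
    then have "P (p + scaleC (-1) q)" using add sc by blast
    then show ?thesis by (simp add: pq(3) scaleC_minus1)
  qed
  obtain u v where uv: "star u = u" "star v = v" "x = u + scaleC \<i> v"
    "\<forall>\<omega>\<in>chars. \<omega> u = of_real (Re (\<omega> x)) \<and> \<omega> v = of_real (Im (\<omega> x))"
    using cartesian_decomposition[of x] by blast
  have "\<omega> u = 0 \<and> \<omega> v = 0" if "\<omega> \<in> N" for \<omega>
  proof -
    have "\<omega> \<in> chars" "\<omega> x = 0" using x that by auto
    then show ?thesis using bspec[OF uv(4), of \<omega>] by simp
  qed
  then have "P u" "P v" by (auto intro!: sa uv(1,2))
  then show ?thesis unfolding uv(3) using add sc by blast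
qed

lemma pos_elem_scaled_unit:
  fixes p :: "'a::{cstar_algebra, comm_ring}"
  assumes p: "pos_elem p" and r: "norm p \<le> r" "r > 0"
  shows "unit_elem ((1 / r) *\<^sub>R p)"
  unfolding unit_elem_def
proof
  fix \<omega> :: "'a \<Rightarrow> complex" assume \<omega>: "\<omega> \<in> chars"
  then obtain t where t: "t \<ge> 0" "\<omega> p = of_real t" using p by (auto simp: pos_elem_def)
  then have "t \<le> r" using charsD(4)[OF \<omega>, of p] r by simp
  then show "\<exists>s\<in>{0..1}. \<omega> ((1 / r) *\<^sub>R p) = of_real s"
    using t r \<omega> by (intro bexI[of _ "t / r"]) (simp_all add: chars_linear)
qed

text \<open>Automatic continuity: if values beyond 4^n occurred at \<open>a n\<close>, the positive
  element with terms 2^-n \<open>a n\<close> would dominate each term, and \<open>f\<close> would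
  exceed every 2^n there.\<close>

lemma positive_functional_bounded_on_unit_elems:
  fixes f :: "'a::{cstar_algebra, comm_ring} \<Rightarrow> complex"
  assumes f: "positive_functional f"
  shows "\<exists>K. \<forall>a. unit_elem a \<longrightarrow> Re (f a) \<le> K"
proof (rule ccontr)
  note L = clinear_form_simps[OF positive_functionalD(1)[OF f]]
  assume "\<not> ?thesis"
  then have "\<exists>a. unit_elem a \<and> Re (f a) > 4 ^ n" for n :: nat by (meson not_le)
  then obtain a where a: "\<And>n. unit_elem (a n)" "\<And>n::nat. Re (f (a n)) > 4 ^ n" by metis
  define c where "c n = (1/2) ^ n *\<^sub>R a n" for n
  have "summable c"
  proof (rule summable_comparison_test')
    show "summable (\<lambda>n. (1/2) ^ n :: real)" by (rule summable_geometric) simp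
    show "norm (c n) \<le> (1/2) ^ n" for n using unit_elem_norm[OF a(1), of n] by (simp add: c_def mult_left_le)
  qed
  then obtain s where s: "c sums s" by (auto simp: summable_def)
  have big: "Re (f s) \<ge> 2 ^ N" for N
  proof -
    have "pos_elem (s - c N)"
    proof (rule pos_elem_diffI)
      fix \<omega> :: "'a \<Rightarrow> complex" assume \<omega>: "\<omega> \<in> chars"
      have "\<exists>t. 0 \<le> t \<and> \<omega> (c n) = of_real t" for n
        using a(1)[of n] \<omega> by (force simp: unit_elem_def c_def chars_linear simp flip: of_real_mult of_real_power)
      then obtain t where t: "\<And>n. 0 \<le> t n" "\<And>n. \<omega> (c n) = of_real (t n)" by metis
      have "bounded_linear \<omega>"
        by (rule clinear_form_bounded_linear[of _ 1]) (use charsD[OF \<omega>] in auto)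
      from bounded_linear.sums[OF this s] have st: "(\<lambda>n. of_real (t n)) sums \<omega> s" by (simp add: t(2))
      have "summable t" using sums_summable[OF st] by (simp add: summable_of_real_iff)
      then have "\<omega> s = of_real (suminf t)" "t N \<le> suminf t"
        using st sums_of_real[of t "suminf t"] sum_le_suminf[of t "{N}"] t(1)
        by (auto dest: sums_unique2 simp: summable_sums)
      then show "\<exists>u v. \<omega> s = of_real u \<and> \<omega> (c N) = of_real v \<and> v \<le> u" using t(2) by blast
    qed
    then have "Re (f (c N)) \<le> Re (f s)" by (rule positive_functional_mono[OF f])
    moreover have "Re (f (c N)) = (1/2) ^ N * Re (f (a N))" by (simp add: c_def L flip: of_real_power)
    moreover have "(1/2) ^ N * Re (f (a N)) \<ge> (1/2) ^ N * 4 ^ N" using a(2)[of N] by (intro mult_left_mono) auto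
    moreover have "(1/2) ^ N * 4 ^ N = (2 ^ N :: real)" by (simp flip: power_mult_distrib)
    ultimately show ?thesis by linarith
  qed
  obtain N where "Re (f s) < 2 ^ N" using real_arch_pow[of 2 "Re (f s)"] by auto
  with big[of N] show False by simp
qed

text \<open>Every element is a combination of four positive ones of no larger norm; hence the factor
  4.\<close>

lemma positive_functional_bounded:
  fixes f :: "'a::{cstar_algebra, comm_ring} \<Rightarrow> complex"
  assumes f: "positive_functional f"
  obtains F where "cdual_apply F = f"
proof -
  note L = clinear_form_simps[OF positive_functionalD(1)[OF f]]
  obtain K where K: "\<And>a. unit_elem a \<Longrightarrow> Re (f a) \<le> K"
    using positive_functional_bounded_on_unit_elems[OF f] by blast
  have pos: "cmod (f p) \<le> K * r" if p: "pos_elem p" "norm p \<le> r" for p r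
  proof (cases "r = 0")
    case True
    then show ?thesis using p by (simp add: L)
  next
    case False
    then have r: "r > 0" using p(2) norm_ge_zero[of p] by linarith
    have "Re (f ((1 / r) *\<^sub>R p)) \<le> K" by (rule K[OF pos_elem_scaled_unit[OF p r]])
    then have "Re (f p) \<le> K * r" using r by (simp add: L field_simps)
    moreover have "cmod (f p) = Re (f p)"
      using positive_functional_pos[OF f p(1)] by (simp add: cmod_def)
    ultimately show ?thesis by simp
  qed
  have sa: "cmod (f h) \<le> 2 * K * r" if h: "star h = h" "norm h \<le> r" for h r
  proof -
    obtain p q where pq: "pos_elem p" "pos_elem q" "h = p - q" "norm p \<le> norm h" "norm q \<le> norm h"
      using selfadjoint_decomposition[OF h(1)] by blast
    have "cmod (f p) \<le> K * r" "cmod (f q) \<le> K * r" using pos pq h(2) by auto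
    then show ?thesis using norm_triangle_ineq4[of "f p" "f q"] by (simp add: pq(3) L)
  qed
  have "cmod (f x) \<le> (4 * K) * norm x" for x
  proof -
    obtain u v where uv: "star u = u" "star v = v" "x = u + scaleC \<i> v" "norm u \<le> norm x" "norm v \<le> norm x"
      using cartesian_decomposition[of x] by blast
    have "cmod (f x) = cmod (f u + \<i> * f v)" using uv(3) L(1,2) by metis
    also have "\<dots> \<le> cmod (f u) + cmod (f v)" using norm_triangle_ineq[of "f u" "\<i> * f v"] by (simp add: norm_mult)
    finally show ?thesis using sa[OF uv(1,4)] sa[OF uv(2,5)] by simp
  qed
  then show ?thesis
    using that cdual_apply_cdual_of[OF positive_functionalD(1)[OF f]] by blast
qed

lemma positive_functional_star:
  fixes f :: "'a::{cstar_algebra, comm_ring} \<Rightarrow> complex"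
  assumes f: "positive_functional f"
  shows "f (star x) = cnj (f x)"
proof -
  note L = clinear_form_simps[OF positive_functionalD(1)[OF f]]
  have "\<forall>\<omega>\<in>{}. \<omega> \<in> chars \<and> \<omega> x = 0" by simp
  then show ?thesis
  proof (induction x rule: pos_elem_induct)
    case (pos p)
    then show ?case using positive_functional_pos(2)[OF f pos(1)] pos_elem_selfadjoint[OF pos(1)]
      by (simp add: complex_eq_iff)
  qed (simp_all add: star_add star_scaleC L)
qed

text \<open>The substitute for the identity that the norm of a positive functional is its value at
  the unit. A near-norming element is rotated, replaced by its real part \<open>u\<close>, and then
  by min(1, |u|), which dominates \<open>u\<close>.\<close>

lemma positive_norm_approx:
  fixes g :: "'a::{cstar_algebra, comm_ring} cdual"
  assumes g: "positive_functional (cdual_apply g)" and d: "d > 0"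
  obtains e where "unit_elem e" "Re (cdual_apply g e) > norm g - d"
proof (cases "norm g - d < 0")
  case True
  then show ?thesis using that[of 0] by (auto simp: unit_elem_def chars_linear cdual_apply_simps)
next
  case False
  have "\<not> (\<forall>x. cmod (cdual_apply g x) \<le> (norm g - d) * norm x)"
    using norm_cdual_le[of g "norm g - d"] False d by auto
  then obtain x where x: "cmod (cdual_apply g x) > (norm g - d) * norm x" by (auto simp: not_le)
  then have x0: "x \<noteq> 0" by (auto simp: cdual_apply_simps)
  define \<theta> where "\<theta> = cnj (sgn (cdual_apply g x)) / of_real (norm x)"
  define y where "y = scaleC \<theta> x"
  have g0: "cdual_apply g x \<noteq> 0" 
  proof
    assume "cdual_apply g x = 0"
    moreover have "0 \<le> (norm g - d) * norm x" using False by (intro mult_nonneg_nonneg) auto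
    ultimately show False using x by simp
  qed
  have "cnj (sgn z) * z = of_real (cmod z)" for z
    by (cases "z = 0") (simp_all add: sgn_eq mult.commute[of "cnj z"] complex_norm_square[symmetric] power2_eq_square)
  then have gy: "cdual_apply g y = of_real (cmod (cdual_apply g x) / norm x)"
    by (simp add: y_def \<theta>_def cdual_apply_simps)
  have ny: "norm y \<le> 1" using x0 g0 by (simp add: y_def \<theta>_def norm_scaleC norm_divide norm_sgn)
  define u where "u = (1/2) *\<^sub>R (y + star y)"
  have u: "star u = u" by (simp add: u_def star_simps star_add star_star add.commute)
  have nu: "norm u \<le> 1"
    using norm_triangle_ineq[of y "star y"] ny by (simp add: u_def norm_star)
  have gu: "Re (cdual_apply g u) = cmod (cdual_apply g x) / norm x"
    by (simp add: u_def cdual_apply_simps positive_functional_star[OF g] gy)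
  define h where "h t = min 1 \<bar>t\<bar>" for t :: real
  have h: "continuous_on UNIV h" "h 0 = 0" unfolding h_def by (auto intro!: continuous_intros)
  have "pos_elem (fcalc h u - u)"
  proof (rule pos_elem_diffI)
    fix \<omega> :: "'a \<Rightarrow> complex" assume \<omega>: "\<omega> \<in> chars"
    have "Re (\<omega> u) \<le> 1" using charsD(4)[OF \<omega>, of u] complex_Re_le_cmod[of "\<omega> u"] nu by linarith
    moreover have "\<omega> u = of_real (Re (\<omega> u))" using selfadjoint_Im[OF u \<omega>] by (simp add: complex_eq_iff)
    moreover have "t \<le> h t" if "t \<le> 1" for t using that by (auto simp: h_def)
    ultimately show "\<exists>s t. \<omega> (fcalc h u) = of_real s \<and> \<omega> u = of_real t \<and> t \<le> s"
      using fcalc_apply[OF h u \<omega>] by blast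
  qed
  from positive_functional_mono[OF g this]
  have "Re (cdual_apply g (fcalc h u)) \<ge> cmod (cdual_apply g x) / norm x" by (simp add: gu)
  moreover have "cmod (cdual_apply g x) / norm x > norm g - d" using x x0 by (simp add: field_simps)
  ultimately show ?thesis using that[of "fcalc h u"] unit_elem_fcalc[OF h u] by (auto simp: h_def)
qed

text \<open>The join of two near-norming elements dominates both and is still a contraction, so it
  is near-norming for both functionals at once.\<close>

lemma positive_norm_add:
  fixes g1 g2 :: "'a::{cstar_algebra, comm_ring} cdual"
  assumes g1: "positive_functional (cdual_apply g1)" and g2: "positive_functional (cdual_apply g2)"
  shows "norm (g1 + g2) = norm g1 + norm g2"
proof (rule antisym[OF norm_triangle_ineq], rule field_le_epsilon)
  fix d :: real assume "d > 0"
  then have d: "d / 2 > 0" by simp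
  obtain e1 where e1: "unit_elem e1" "Re (cdual_apply g1 e1) > norm g1 - d / 2"
    using positive_norm_approx[OF g1 d] by blast
  obtain e2 where e2: "unit_elem e2" "Re (cdual_apply g2 e2) > norm g2 - d / 2"
    using positive_norm_approx[OF g2 d] by blast
  let ?e = "e1 + e2 - e1 * e2"
  have u: "unit_elem ?e" by (rule unit_elem_join[OF e1(1) e2(1)])
  have pos: "pos_elem (?e - e1) \<and> pos_elem (?e - e2)"
  proof -
    have "\<exists>s t r. \<omega> ?e = of_real r \<and> \<omega> e1 = of_real s \<and> \<omega> e2 = of_real t \<and> s \<le> r \<and> t \<le> r"
      if \<omega>: "\<omega> \<in> chars" for \<omega>
    proof -
      obtain s t where st: "s \<in> {0..1}" "\<omega> e1 = of_real s" "t \<in> {0..1}" "\<omega> e2 = of_real t"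
        using e1(1) e2(1) \<omega> unfolding unit_elem_def by blast
      have "s * t \<le> t" "s * t \<le> s" using st by (auto intro: mult_left_le mult_left_le_one_le)
      then show ?thesis using st \<omega>
        by (intro exI[of _ s] exI[of _ t] exI[of _ "s + t - s * t"]) (simp add: charsD chars_linear)
    qed
    then show ?thesis by (intro conjI pos_elem_diffI) blast+
  qed
  have "cmod (cdual_apply (g1 + g2) ?e) \<le> norm (g1 + g2) * 1"
    by (rule order_trans[OF norm_cdual_apply]) (intro mult_left_mono unit_elem_norm[OF u], simp)
  then have "Re (cdual_apply g1 ?e) + Re (cdual_apply g2 ?e) \<le> norm (g1 + g2)"
    using complex_Re_le_cmod[of "cdual_apply (g1 + g2) ?e"] by (simp add: cdual_apply_add_left)
  moreover have "Re (cdual_apply g1 e1) \<le> Re (cdual_apply g1 ?e)" "Re (cdual_apply g2 e2) \<le> Re (cdual_apply g2 ?e)"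
    using pos positive_functional_mono[OF g1] positive_functional_mono[OF g2] by blast+
  ultimately show "norm g1 + norm g2 \<le> norm (g1 + g2) + d" using e1(2) e2(2) by linarith
qed

section \<open>Pure states of a commutative C*-algebra are characters\<close>

lemma char_positive_functional:
  assumes "\<omega> \<in> chars"
  shows "positive_functional \<omega>"
  using charsD(1)[OF assms] by (simp add: positive_functional_def char_star_mult[OF assms])

lemma char_cdual:
  assumes "\<omega> \<in> chars"
  shows "cdual_apply (cdual_of \<omega>) = \<omega>" "norm (cdual_of \<omega>) \<le> 1"
proof -
  show 1: "cdual_apply (cdual_of \<omega>) = \<omega>"
    by (rule cdual_apply_cdual_of[where K = 1]) (use charsD[OF assms] in auto)
  show "norm (cdual_of \<omega>) \<le> 1" by (rule norm_cdual_le) (use charsD[OF assms] in \<open>auto simp: 1\<close>)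
qed

lemma unit_peak:
  fixes \<omega> :: "'a::{cstar_algebra, comm_ring} \<Rightarrow> complex"
  assumes "\<omega> \<in> spec"
  obtains e where "unit_elem e" "\<omega> e = 1"
  using orthogonal_bumps[of "{\<omega>}"] assms by (metis empty_subsetI finite.emptyI finite.insertI insert_subset insertI1)

text \<open>In a convex decomposition of \<open>\<omega>\<close> positivity forces the parts to
  vanish on the kernel of \<open>\<omega>\<close>; they are then multiples of
  \<open>\<omega>\<close>, and the norm fixes the factor.\<close>

lemma char_pure_state:
  fixes \<omega> :: "'a::{cstar_algebra, comm_ring} \<Rightarrow> complex"
  assumes \<omega>: "\<omega> \<in> spec"
  shows "pure_state (cdual_of \<omega>)"
proof -
  have c: "\<omega> \<in> chars" using \<omega> by (rule spec_chars)
  note ap = char_cdual(1)[OF c]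
  obtain e where e: "unit_elem e" "\<omega> e = 1" using unit_peak[OF \<omega>] by blast
  have "1 \<le> norm (cdual_of \<omega>) * norm e" using norm_cdual_apply[of "cdual_of \<omega>" e] by (simp add: ap e(2))
  also have "\<dots> \<le> norm (cdual_of \<omega>) * 1" by (intro mult_left_mono unit_elem_norm e) simp
  finally have n1: "norm (cdual_of \<omega>) = 1" using char_cdual(2)[OF c] by simp
  have st: "cdual_of \<omega> \<in> states" using n1 char_positive_functional[OF c] by (simp add: states_def ap)
  have eq: "a = cdual_of \<omega>"
    if a: "a \<in> states" and b: "b \<in> states" and u: "0 < u" and eqn: "cdual_of \<omega> = v *\<^sub>R b + u *\<^sub>R a" "0 \<le> v" for a b u v
  proof -
    have pa: "positive_functional (cdual_apply a)" and pb: "positive_functional (cdual_apply b)"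
      using a b by (auto simp: states_def)
    have eqx: "\<omega> x = of_real v * cdual_apply b x + of_real u * cdual_apply a x" for x
      using ap eqn(1) by (metis cdual_apply_add_left cdual_apply_scaleC_left scaleR_scaleC)
    have ker: "cdual_apply a x = 0" if "\<omega> x = 0" for x
    proof -
      have "\<forall>\<psi>\<in>{\<omega>}. \<psi> \<in> chars \<and> \<psi> x = 0" using c that by simp
      then show ?thesis
      proof (induction x rule: pos_elem_induct)
        case (pos p)
        have "0 = v * Re (cdual_apply b p) + u * Re (cdual_apply a p)"
          using arg_cong[OF eqx[of p], of Re] pos(2) by simp
        moreover have "0 \<le> v * Re (cdual_apply b p)" "0 \<le> u * Re (cdual_apply a p)"
          using positive_functional_pos(1)[OF pa pos(1)] positive_functional_pos(1)[OF pb pos(1)] eqn(2) u by auto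
        ultimately have "u * Re (cdual_apply a p) = 0" by linarith
        then have "Re (cdual_apply a p) = 0" using u by simp
        then show ?case using positive_functional_pos(2)[OF pa pos(1)] by (simp add: complex_eq_iff)
      qed (simp_all add: cdual_apply_simps)
    qed
    have ax: "cdual_apply a x = cdual_apply a e * \<omega> x" for x
      using ker[of "x - scaleC (\<omega> x) e"] c e(2) by (simp add: chars_linear cdual_apply_simps)
    have ae: "cdual_apply a e = of_real (Re (cdual_apply a e))" "Re (cdual_apply a e) \<ge> 0"
      using positive_functional_pos[OF pa unit_elem_pos[OF e(1)]] by (auto simp: complex_eq_iff)
    have "a = scaleC (cdual_apply a e) (cdual_of \<omega>)"
      by (rule cdual_eqI) (simp add: cdual_apply_scaleC_left ap ax[symmetric])
    then have "norm a = cmod (cdual_apply a e) * 1" by (metis n1 norm_scaleC)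
    then have "cmod (cdual_apply a e) = 1" using a by (simp add: states_def)
    then have "cdual_apply a e = 1" using ae by (metis abs_of_nonneg norm_of_real of_real_1)
    then have "cdual_apply a x = cdual_apply (cdual_of \<omega>) x" for x using ax[of x] by (simp only: ap mult_1)
    then show ?thesis by (rule cdual_eqI)
  qed
  show ?thesis
    unfolding pure_state_def extreme_point_of_def
  proof (intro conjI ballI notI)
    show "cdual_of \<omega> \<in> states" by (rule st)
    fix a b assume ab: "a \<in> states" "b \<in> states" "cdual_of \<omega> \<in> open_segment a b"
    then obtain u where u: "0 < u" "u < 1" "a \<noteq> b" "cdual_of \<omega> = (1 - u) *\<^sub>R a + u *\<^sub>R b"
      by (auto simp: in_segment)
    have "b = cdual_of \<omega>" by (rule eq[OF ab(2,1) u(1,4)]) (use u in simp)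
    moreover have "a = cdual_of \<omega>"
      by (rule eq[OF ab(1,2), of "1 - u" u]) (use u in \<open>simp_all add: add.commute\<close>)
    ultimately show False using u(3) by simp
  qed
qed

lemma positive_functional_mult:
  fixes f :: "'a::{cstar_algebra, comm_ring} cdual"
  assumes f: "positive_functional (cdual_apply f)" and e: "pos_elem e"
  shows "positive_functional (cdual_apply (arens_fa f e))"
proof -
  obtain y where y: "e = star y * y" using pos_elem_square[OF e] by blast
  have "e * (star x * x) = star (x * y) * (x * y)" for x by (simp add: y star_mult mult_ac)
  then show ?thesis
    using positive_functionalD(2)[OF f] clinear_form_cdual_apply by (simp add: positive_functional_def arens_fa_apply)
qed

text \<open>Both f(e \<cdot>) and its complement in \<open>f\<close> are positive, and their norms
  add up to one. So \<open>f\<close> is a convex combination of the normalised parts, and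
  extremality makes them multiples of \<open>f\<close>.\<close>

lemma pure_state_multiplier:
  fixes f :: "'a::{cstar_algebra, comm_ring} cdual"
  assumes ps: "pure_state f" and e: "unit_elem e"
  shows "\<exists>t\<ge>0. \<forall>x. cdual_apply f (e * x) = of_real t * cdual_apply f x"
proof -
  have st: "f \<in> states" and ext: "\<And>a b. a \<in> states \<Longrightarrow> b \<in> states \<Longrightarrow> f \<notin> open_segment a b"
    using ps by (auto simp: pure_state_def extreme_point_of_def)
  have f: "positive_functional (cdual_apply f)" "norm f = 1" using st by (auto simp: states_def)
  define g where "g = arens_fa f e"
  define k where "k = f - g"
  have g: "positive_functional (cdual_apply g)"
    unfolding g_def by (rule positive_functional_mult[OF f(1) unit_elem_pos[OF e]])
  have k: "positive_functional (cdual_apply k)"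
    unfolding positive_functional_def
  proof (intro conjI allI clinear_form_cdual_apply)
    fix x
    have "pos_elem (star x * x - e * (star x * x))"
    proof (rule pos_elem_diffI)
      fix \<omega> :: "'a \<Rightarrow> complex" assume \<omega>: "\<omega> \<in> chars"
      obtain t where t: "0 \<le> t" "t \<le> 1" "\<omega> e = of_real t" using e \<omega> by (auto simp: unit_elem_def)
      then have "\<omega> (e * (star x * x)) = of_real (t * (cmod (\<omega> x))\<^sup>2)"
        using \<omega> by (simp only: charsD(2)[of _ e] char_star_mult of_real_mult)
      moreover have "t * (cmod (\<omega> x))\<^sup>2 \<le> (cmod (\<omega> x))\<^sup>2" using t by (simp add: mult_left_le_one_le)
      ultimately show "\<exists>r s. \<omega> (star x * x) = of_real r \<and> \<omega> (e * (star x * x)) = of_real s \<and> s \<le> r"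
        using char_star_mult[OF \<omega>] by blast
    qed
    from positive_functional_pos[OF f(1) this]
    show "cdual_apply k (star x * x) \<in> \<real>\<^sub>\<ge>\<^sub>0"
      by (simp add: k_def g_def cdual_apply_diff_left arens_fa_apply complex_nonneg_Reals_iff cdual_apply_simps)
  qed
  define t where "t = norm g"
  have "norm (g + k) = norm g + norm k" by (rule positive_norm_add[OF g k])
  then have nk: "norm k = 1 - t" by (simp add: k_def f(2) t_def)
  have "g = t *\<^sub>R f"
  proof (cases "t = 0 \<or> t = 1")
    case True
    then show ?thesis using nk by (auto simp: t_def k_def)
  next
    case False
    then have t: "0 < t" "t < 1" using nk norm_ge_zero[of k] norm_ge_zero[of g] unfolding t_def by linarith+
    have sc: "(1 / r) *\<^sub>R h \<in> states" if "positive_functional (cdual_apply h)" "norm h = r" "r > 0"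
      for h :: "'a cdual" and r
    proof -
      have "positive_functional (cdual_apply ((1 / r) *\<^sub>R h))"
        unfolding positive_functional_def
      proof (intro conjI allI clinear_form_cdual_apply)
        fix x
        have "cdual_apply h (star x * x) \<in> \<real>\<^sub>\<ge>\<^sub>0" by (rule positive_functionalD(2)[OF that(1)])
        then show "cdual_apply ((1 / r) *\<^sub>R h) (star x * x) \<in> \<real>\<^sub>\<ge>\<^sub>0"
          using that(3) by (simp add: scaleR_scaleC cdual_apply_scaleC_left complex_nonneg_Reals_iff)
      qed
      then show ?thesis using that by (simp add: states_def)
    qed
    define a b where "a = (1 / t) *\<^sub>R g" and "b = (1 / (1 - t)) *\<^sub>R k"
    have ab: "a \<in> states" "b \<in> states" unfolding a_def b_def using sc g k nk t by (auto simp: t_def)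
    have feq: "f = (1 - t) *\<^sub>R b + t *\<^sub>R a" using t by (simp add: a_def b_def k_def)
    have "b = a"
    proof (rule ccontr)
      assume "b \<noteq> a"
      then have "f \<in> open_segment b a" using feq t by (auto simp: in_segment)
      with ext ab show False by blast
    qed
    then have "f = a" using feq by (simp flip: scaleR_add_left)
    then show ?thesis using t by (simp add: a_def)
  qed
  then have "cdual_apply f (e * x) = of_real t * cdual_apply f x" for x
    by (metis arens_fa_apply cdual_apply_scaleC_left g_def scaleR_scaleC)
  then show ?thesis by (intro exI[of _ t]) (simp add: t_def)
qed

text \<open>Exchanging \<open>e\<close> with a fixed \<open>e0\<close> shows that the factor in
  \<open>pure_state_multiplier\<close> is c f(e) with a constant c; hence c f is
  multiplicative.\<close>

lemma pure_state_imp_char: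
  fixes f :: "'a::{cstar_algebra, comm_ring} cdual"
  assumes ps: "pure_state f"
  shows "\<exists>c>0. \<exists>\<omega>\<in>chars. \<forall>x. cdual_apply f x = of_real c * \<omega> x"
proof -
  have f: "positive_functional (cdual_apply f)" "norm f = 1"
    using ps by (auto simp: pure_state_def extreme_point_of_def states_def)
  have re: "cdual_apply f e = of_real (Re (cdual_apply f e))" if "unit_elem e" for e
    using positive_functional_pos[OF f(1) unit_elem_pos[OF that]] by (simp add: complex_eq_iff)
  obtain t where t: "\<And>e. unit_elem e \<Longrightarrow> t e \<ge> 0"
    "\<And>e x. unit_elem e \<Longrightarrow> cdual_apply f (e * x) = of_real (t e) * cdual_apply f x"
    using pure_state_multiplier[OF ps] by metis
  obtain e0 where e0: "unit_elem e0" "Re (cdual_apply f e0) > 0"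
    using positive_norm_approx[OF f(1), of 1] f(2) by auto
  define c where "c = t e0 / Re (cdual_apply f e0)"
  have c0: "c \<ge> 0" using t(1)[OF e0(1)] e0(2) by (simp add: c_def)
  have te: "cdual_apply f (e * x) = of_real c * cdual_apply f e * cdual_apply f x" if "unit_elem e" for e x
  proof -
    have "of_real (t e) * cdual_apply f e0 = of_real (t e0) * cdual_apply f e"
      using t(2)[OF that, of e0] t(2)[OF e0(1), of e] by (simp add: mult.commute)
    then have "of_real (t e) = of_real c * cdual_apply f e"
      using e0(2) by (subst (asm) re[OF e0(1)]) (simp add: c_def field_simps)
    then show ?thesis using t(2)[OF that, of x] by simp
  qed
  have mult: "cdual_apply f (y * x) = of_real c * cdual_apply f y * cdual_apply f x" for x y
  proof -
    have "\<forall>\<omega>\<in>{}. \<omega> \<in> chars \<and> \<omega> y = 0" by simp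
    then show ?thesis
    proof (induction y rule: pos_elem_induct)
      case (pos p)
      define r where "r = norm p + 1"
      have r: "norm p \<le> r" "r > 0" by (auto simp: r_def add_nonneg_pos)
      have "p = r *\<^sub>R ((1 / r) *\<^sub>R p)" using r by simp
      then obtain e where e: "unit_elem e" "p = r *\<^sub>R e" using pos_elem_scaled_unit[OF pos(1) r] by blast
      show ?case by (simp add: e(2) cdual_apply_simps te[OF e(1)])
    next
      case (add y z)
      then show ?case by (simp add: distrib_right distrib_left cdual_apply_simps)
    next
      case (scale k y)
      then show ?case by (simp add: mult_scaleC_left cdual_apply_simps)
    qed
  qed
  have "c \<noteq> 0"
  proof
    assume "c = 0"
    obtain x where "e0 = star x * x" using pos_elem_square[OF unit_elem_pos[OF e0(1)]] by blast
    then have "cdual_apply f e0 = 0" using mult[of "star x" x] \<open>c = 0\<close> by simp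
    with e0(2) show False by simp
  qed
  with c0 have c: "c > 0" by simp
  \<comment> \<open>This makes c f a contraction, as membership in \<open>chars\<close> requires.
    For c > 1 some positive contraction has f(e) > 1/c, so f(e e) = c f(e)^2 > f(e), although e e
    lies below e.\<close>
  have "c \<le> 1"
  proof (rule ccontr)
    assume "\<not> c \<le> 1"
    then have "1 - 1 / c > 0" by simp
    then obtain e where e: "unit_elem e" "Re (cdual_apply f e) > norm f - (1 - 1 / c)"
      using positive_norm_approx[OF f(1)] by blast
    define r where "r = Re (cdual_apply f e)"
    have r: "r > 1 / c" using e(2) f(2) by (simp add: r_def)
    have "pos_elem (e - e * e)"
    proof (rule pos_elem_diffI)
      fix \<omega> :: "'a \<Rightarrow> complex" assume \<omega>: "\<omega> \<in> chars"
      obtain s where "0 \<le> s" "s \<le> 1" "\<omega> e = of_real s" using e(1) \<omega> by (auto simp: unit_elem_def)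
      then show "\<exists>u v. \<omega> e = of_real u \<and> \<omega> (e * e) = of_real v \<and> v \<le> u"
        using \<omega> by (intro exI[of _ s] exI[of _ "s * s"]) (simp add: charsD mult_left_le)
    qed
    then have "Re (cdual_apply f (e * e)) \<le> r" unfolding r_def by (rule positive_functional_mono[OF f(1)])
    moreover have "Re (cdual_apply f (e * e)) = c * r * r"
      by (subst mult, subst (1 2) re[OF e(1)]) (simp add: r_def)
    moreover have "c * r * r > 1 * r"
      using r c by (intro mult_strict_right_mono) (auto simp: field_simps intro: less_trans[of 0 "1 / c"])
    ultimately show False by simp
  qed
  define \<omega> where "\<omega> x = of_real c * cdual_apply f x" for x
  have "cmod (\<omega> x) \<le> norm x" for x
  proof -
    have "cmod (\<omega> x) = c * cmod (cdual_apply f x)" using c by (simp add: \<omega>_def norm_mult)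
    also have "\<dots> \<le> 1 * (norm f * norm x)" using \<open>c \<le> 1\<close> c by (intro mult_mono norm_cdual_apply) auto
    finally show ?thesis by (simp add: f(2))
  qed
  then have "\<omega> \<in> chars"
    by (simp add: chars_def clinear_form_def \<omega>_def cdual_apply_simps mult positive_functional_star[OF f(1)] algebra_simps)
  then show ?thesis using c
    by (intro exI[of _ "1 / c"] conjI bexI[of _ \<omega>]) (simp_all add: \<omega>_def)
qed

section \<open>Scattered algebras\<close>

lemma char_pos_elem_square:
  assumes "\<omega> \<in> chars" "star a = a"
  shows "\<omega> (a * a) = of_real ((Re (\<omega> a))\<^sup>2)"
  using selfadjoint_Im[OF assms(2,1)] charsD(2)[OF assms(1), of a a]
  by (simp add: complex_eq_iff power2_eq_square)

lemma has_sum_of_real_ge: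
  fixes u :: "'i \<Rightarrow> real"
  assumes s: "((\<lambda>i. of_real (u i) :: complex) has_sum l) I" and u: "\<And>i. i \<in> I \<Longrightarrow> u i \<ge> 0" and i: "i \<in> I"
  shows "u i \<le> Re l"
proof -
  have b: "(u has_sum Re l) I" using has_sum_Re[OF s] by simp
  have a: "(u has_sum u i) {i}" using has_sum_finite[of "{i}" u] by simp
  show ?thesis by (rule has_sum_mono_neutral[OF a b]) (use i u in auto)
qed

text \<open>A perfect set carries a positive functional under which the Rademacher system is an i.i.d. sequence of
  signs. At a character of mass \<open>r > 0\<close> all these signs have modulus one, so that their signed sum
  over \<open>N\<close> terms gives \<open>r N\<^sup>2 \<le> N\<close>.\<close>

lemma scattered_imp_no_perfect:
  fixes S :: "('a::{cstar_algebra, comm_ring} \<Rightarrow> complex) set"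
  assumes sc: "scattered TYPE('a)"
  shows "\<not> perfect S"
proof
  assume S: "perfect S"
  obtain \<rho> :: "nat \<Rightarrow> 'a" and X where \<rho>: "\<And>i. star (\<rho> i) = \<rho> i" "\<And>i. norm (\<rho> i) \<le> 1"
    "\<And>n T. X n T \<in> spec" "\<And>n T i. i < n \<Longrightarrow> X n T (\<rho> i) = of_real (sg T i)"
    using rademacher_system[OF S] by blast
  have Xc: "X n T \<in> chars" for n T using \<rho>(3) spec_chars by blast
  define \<phi> where "\<phi> n = sign_mean X n" for n
  have \<phi>lin: "clinear_form (\<phi> n)" for n unfolding \<phi>_def by (rule clinear_form_sign_mean[OF Xc])
  have \<phi>b: "cmod (\<phi> n a) \<le> 1 * norm a" for n a
  proof -
    have "cmod (\<Sum>T\<in>Pow {..<n}. X n T a) \<le> (\<Sum>T\<in>Pow {..<n}. norm a)"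
      by (rule sum_norm_le) (rule charsD(4)[OF Xc])
    then show ?thesis by (simp add: \<phi>_def sign_mean_def norm_divide norm_power card_Pow field_simps)
  qed
  have \<phi>pos: "\<phi> n (star x * x) \<in> \<real>\<^sub>\<ge>\<^sub>0" for n x
    by (simp add: \<phi>_def sign_mean_def char_star_mult[OF Xc] sum_nonneg flip: of_real_sum of_real_power)
  define f where "f n = cdual_of (\<phi> n)" for n
  have f: "cdual_apply (f n) = \<phi> n" for n unfolding f_def by (rule cdual_apply_cdual_of[OF \<phi>lin \<phi>b])
  have nf: "norm (f n) \<le> 1" for n by (rule norm_cdual_le) (use \<phi>b f in auto)
  obtain g F where g: "F \<noteq> bot" "F \<le> sequentially" "\<And>x. ((\<lambda>n. cdual_apply (f n) x) \<longlongrightarrow> cdual_apply g x) F"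
    using cdual_cluster_point[of f, OF nf] by blast
  have "positive_functional (cdual_apply g)"
    unfolding positive_functional_def
  proof (intro conjI allI clinear_form_cdual_apply)
    fix x
    show "cdual_apply g (star x * x) \<in> \<real>\<^sub>\<ge>\<^sub>0"
      by (rule Lim_in_closed_set[OF _ _ g(1) g(3)]) (auto simp: f \<phi>pos)
  qed
  then obtain I :: "nat set" and G where IG: "\<forall>i\<in>I. pure_functional (G i)" "\<forall>x. ((\<lambda>i. G i x) has_sum cdual_apply g x) I"
    using sc unfolding scattered_def by blast
  have "\<exists>r \<omega>. r \<ge> 0 \<and> \<omega> \<in> chars \<and> (\<forall>x. G i x = of_real r * \<omega> x)" if i: "i \<in> I" for i
  proof -
    obtain h r where h: "pure_state h" "0 \<le> r" "G i = (\<lambda>x. of_real r * cdual_apply h x)"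
      using IG(1) i unfolding pure_functional_def by blast
    obtain c \<omega> where c: "c > 0" "\<omega> \<in> chars" "\<forall>x. cdual_apply h x = of_real c * \<omega> x"
      using pure_state_imp_char[OF h(1)] by blast
    show ?thesis by (rule exI[of _ "r * c"], rule exI[of _ \<omega>]) (use h c in auto)
  qed
  then obtain r \<omega> where r: "\<And>i. i \<in> I \<Longrightarrow> r i \<ge> 0" "\<And>i. i \<in> I \<Longrightarrow> \<omega> i \<in> chars"
    "\<And>i x. i \<in> I \<Longrightarrow> G i x = of_real (r i) * \<omega> i x" by metis
  have hs: "((\<lambda>i. of_real (r i) * \<omega> i x) has_sum cdual_apply g x) I" for x
    using IG(2) r(3) has_sum_cong[of I "\<lambda>i. G i x" "\<lambda>i. of_real (r i) * \<omega> i x"] by auto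
  have mass: "r i * (Re (\<omega> i a))\<^sup>2 \<le> Re (cdual_apply g (a * a))" if i: "i \<in> I" and a: "star a = a" for i a
  proof (rule has_sum_of_real_ge[OF _ _ i])
    have "((\<lambda>i. of_real (r i) * \<omega> i (a * a)) has_sum cdual_apply g (a * a)) I
        = ((\<lambda>i. of_real (r i * (Re (\<omega> i a))\<^sup>2)) has_sum cdual_apply g (a * a)) I"
      by (rule has_sum_cong) (simp only: char_pos_elem_square[OF r(2) a] of_real_mult)
    with hs show "((\<lambda>i. of_real (r i * (Re (\<omega> i a))\<^sup>2)) has_sum cdual_apply g (a * a)) I" by blast
  qed (use r(1) in simp)
  have re: "\<omega> i (\<rho> k) = of_real (Re (\<omega> i (\<rho> k)))" if "i \<in> I" for i k
    using selfadjoint_Im[OF \<rho>(1) r(2)[OF that]] by (simp add: complex_eq_iff)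
  \<comment> \<open>The square of \<open>\<rho> 0\<close> acts as the unit: it has integral one, so
    at least one summand charges it.\<close>
  have g00: "cdual_apply g (\<rho> 0 * \<rho> 0) = 1"
  proof (rule eventually_const_tendsto[OF g])
    fix n :: nat assume "n \<ge> 1"
    then show "cdual_apply (f n) (\<rho> 0 * \<rho> 0) = 1"
      by (simp add: f \<phi>_def sign_mean_def charsD[OF Xc] \<rho>(4) card_Pow sg_square flip: of_real_mult)
  qed
  obtain i where i: "i \<in> I" "of_real (r i) * \<omega> i (\<rho> 0 * \<rho> 0) \<noteq> 0"
  proof (rule ccontr)
    assume "\<not> thesis"
    then have z: "\<And>i. i \<in> I \<Longrightarrow> of_real (r i) * \<omega> i (\<rho> 0 * \<rho> 0) = 0" using that by blast
    have "((\<lambda>i. of_real (r i) * \<omega> i (\<rho> 0 * \<rho> 0)) has_sum 0) I" by (rule has_sum_0) (rule z)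
    with hs[of "\<rho> 0 * \<rho> 0"] g00 show False using has_sum_unique by fastforce
  qed
  have ri: "r i > 0" and w0: "\<omega> i (\<rho> 0) \<noteq> 0"
    using i r(1)[OF i(1)] by (auto simp: charsD(2)[OF r(2)[OF i(1)]] less_le)
  define \<tau> where "\<tau> k = Re (\<omega> i (\<rho> k))" for k
  have \<tau>1: "\<bar>\<tau> k\<bar> \<le> 1" for k
    using abs_Re_le_cmod[of "\<omega> i (\<rho> k)"] charsD(4)[OF r(2)[OF i(1)], of "\<rho> k"] \<rho>(2)[of k] by (simp add: \<tau>_def)
  have \<tau>: "(\<tau> k)\<^sup>2 = 1" for k
  proof -
    \<comment> \<open>In terms of signs this is \<rho>_0^2 (1 - \<rho>_k^2): nonnegative at every
      character and zero under every mean with n > k. All summands are nonnegative with total zero,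
      so each vanishes.\<close>
    define z where "z = \<rho> 0 * \<rho> 0 - \<rho> 0 * \<rho> 0 * (\<rho> k * \<rho> k)"
    define u where "u j = r j * ((Re (\<omega> j (\<rho> 0)))\<^sup>2 * (1 - (Re (\<omega> j (\<rho> k)))\<^sup>2))" for j
    have gz: "cdual_apply g z = 0"
    proof (rule eventually_const_tendsto[OF g])
      fix n assume "n \<ge> Suc k"
      then show "cdual_apply (f n) z = 0"
        by (simp add: f \<phi>_def sign_mean_def z_def chars_linear[OF Xc] charsD[OF Xc] \<rho>(4) sg_square flip: of_real_mult)
    qed
    have "\<omega> j z = of_real ((Re (\<omega> j (\<rho> 0)))\<^sup>2 * (1 - (Re (\<omega> j (\<rho> k)))\<^sup>2))" if "j \<in> I" for j
    proof -
      note c = r(2)[OF that]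
      have "\<omega> j z = \<omega> j (\<rho> 0 * \<rho> 0) - \<omega> j (\<rho> 0 * \<rho> 0) * \<omega> j (\<rho> k * \<rho> k)"
        by (simp only: z_def chars_linear(5)[OF c] charsD(2)[OF c, of "\<rho> 0 * \<rho> 0"])
      then show ?thesis by (simp add: char_pos_elem_square[OF c \<rho>(1)] algebra_simps)
    qed
    then have "((\<lambda>j. of_real (r j) * \<omega> j z) has_sum cdual_apply g z) I
        = ((\<lambda>j. of_real (u j)) has_sum cdual_apply g z) I"
      by (intro has_sum_cong) (simp add: u_def)
    with hs[of z] gz have "((\<lambda>j. of_real (u j) :: complex) has_sum 0) I" by simp
    moreover have "u j \<ge> 0" if "j \<in> I" for j
    proof -
      have "\<bar>Re (\<omega> j (\<rho> k))\<bar> \<le> 1"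
        using abs_Re_le_cmod[of "\<omega> j (\<rho> k)"] charsD(4)[OF r(2)[OF that], of "\<rho> k"] \<rho>(2)[of k] by simp
      then have "(Re (\<omega> j (\<rho> k)))\<^sup>2 \<le> 1" by (simp add: abs_square_le_1)
      then show ?thesis using r(1)[OF that] by (simp add: u_def)
    qed
    ultimately have "u i \<le> Re 0" by (intro has_sum_of_real_ge[OF _ _ i(1)]) auto
    then have "r i * ((\<tau> 0)\<^sup>2 * (1 - (\<tau> k)\<^sup>2)) \<le> 0" by (simp add: u_def \<tau>_def)
    moreover have "(\<tau> 0)\<^sup>2 > 0" using w0 re[OF i(1), of 0] by (auto simp: \<tau>_def)
    ultimately have "1 \<le> (\<tau> k)\<^sup>2" using ri by (simp add: mult_le_0_iff)
    moreover have "(\<tau> k)\<^sup>2 \<le> 1" using \<tau>1[of k] by (simp add: abs_square_le_1)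
    ultimately show ?thesis by simp
  qed
  have est: "r i * (real N)\<^sup>2 \<le> real N" for N
  proof -
    define a where "a = (\<Sum>k<N. \<tau> k *\<^sub>R \<rho> k)"
    have a: "star a = a"
      unfolding a_def by (rule selfadjointI) (simp add: chars_linear selfadjoint_Im[OF \<rho>(1)])
    have "\<omega> i a = of_real (\<Sum>k<N. (\<tau> k)\<^sup>2)"
      using r(2)[OF i(1)] re[OF i(1)] by (simp add: a_def chars_linear \<tau>_def[symmetric] power2_eq_square)
    then have wa: "Re (\<omega> i a) = real N" by (simp add: \<tau>)
    have "cdual_apply g (a * a) = of_nat N"
    proof (rule eventually_const_tendsto[OF g])
      fix n assume n: "n \<ge> N"
      have Xa: "X n T (a * a) = of_real (\<Sum>k<N. \<Sum>l<N. \<tau> k * \<tau> l * (sg T k * sg T l))" for T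
        using n by (simp add: charsD[OF Xc] a_def chars_linear[OF Xc] \<rho>(4) sum_product mult_ac)
      have "(\<Sum>T\<in>Pow {..<n}. sg T k * sg T l) = (if k = l then 2 ^ n else 0)" if "k < N" "l < N" for k l
      proof (cases "k = l")
        case True
        then show ?thesis by (simp add: sg_square card_Pow)
      next
        case False
        have "(\<Sum>T\<in>Pow {..<n}. sg T k * sg T l) = 0"
          by (rule sign_sum_zero[of k]) (use False that n in \<open>auto simp: sg_flip\<close>)
        with False show ?thesis by simp
      qed
      then have "(\<Sum>T\<in>Pow {..<n}. \<Sum>k<N. \<Sum>l<N. \<tau> k * \<tau> l * (sg T k * sg T l))
          = (\<Sum>k<N. \<Sum>l<N. \<tau> k * \<tau> l * (if k = l then 2 ^ n else 0))"
        by (subst sum.swap, intro sum.cong refl, subst sum.swap, intro sum.cong refl)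
           (simp flip: sum_distrib_left)
      also have "\<dots> = (\<Sum>k<N. \<Sum>l<N. if k = l then (\<tau> k)\<^sup>2 * 2 ^ n else 0)"
        by (intro sum.cong refl) (simp add: power2_eq_square)
      also have "\<dots> = real N * 2 ^ n" by (simp add: \<tau>)
      finally show "cdual_apply (f n) (a * a) = of_nat N"
        by (simp add: f \<phi>_def sign_mean_def Xa flip: of_real_sum)
    qed
    then show ?thesis using mass[OF i(1) a] wa by simp
  qed
  obtain N :: nat where N: "real N * r i > 1" using reals_Archimedean3[OF ri] by blast
  then have "N > 0" by (cases N) auto
  then have "real N * (real N * r i) > real N * 1" using N by (intro mult_strict_left_mono) auto
  with est[of N] show False by (simp add: power2_eq_square mult_ac)
qed

text \<open>The measure of the singleton {\<omega>}, by outer regularity.\<close>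

definition point_mass :: "('a::{cstar_algebra, comm_ring} \<Rightarrow> complex) \<Rightarrow> ('a \<Rightarrow> complex) \<Rightarrow> real" where
  "point_mass f \<omega> = Inf {Re (f e) | e. unit_elem e \<and> \<omega> e = 1}"

lemma point_mass_bounds:
  fixes f :: "'a::{cstar_algebra, comm_ring} \<Rightarrow> complex"
  assumes f: "positive_functional f" and \<omega>: "\<omega> \<in> spec"
  shows "0 \<le> point_mass f \<omega>" "\<And>e. unit_elem e \<Longrightarrow> \<omega> e = 1 \<Longrightarrow> point_mass f \<omega> \<le> Re (f e)"
    "d > 0 \<Longrightarrow> \<exists>e. unit_elem e \<and> \<omega> e = 1 \<and> Re (f e) < point_mass f \<omega> + d"
proof -
  let ?A = "{Re (f e) | e. unit_elem e \<and> \<omega> e = 1}"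
  have ne: "?A \<noteq> {}" using unit_peak[OF \<omega>] by blast
  have nn: "0 \<le> x" if "x \<in> ?A" for x
  proof -
    from that obtain e where "x = Re (f e)" "unit_elem e" by blast
    then show ?thesis using positive_functional_pos(1)[OF f unit_elem_pos] by simp
  qed
  then have bdd: "bdd_below ?A" by (intro bdd_belowI[of _ 0])
  show "0 \<le> point_mass f \<omega>" unfolding point_mass_def by (rule cInf_greatest[OF ne nn])
  show "point_mass f \<omega> \<le> Re (f e)" if "unit_elem e" "\<omega> e = 1" for e
    unfolding point_mass_def by (rule cInf_lower[OF _ bdd]) (use that in blast)
  show "\<exists>e. unit_elem e \<and> \<omega> e = 1 \<and> Re (f e) < point_mass f \<omega> + d" if "d > 0"
  proof -
    have "Inf ?A < point_mass f \<omega> + d" using that by (simp add: point_mass_def)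
    from cInf_lessD[OF ne this] show ?thesis by blast
  qed
qed

text \<open>Bumps that nearly attain the point masses are multiplied by orthogonal bumps; this
  shrinks them, but the infimum still bounds their values below. The remaining error is the value of
  \<open>f\<close> at \<open>x\<close> minus its bump projection, of norm at most 2 ||x||.\<close>

lemma point_mass_approx:
  fixes f :: "'a::{cstar_algebra, comm_ring} cdual"
  assumes f: "positive_functional (cdual_apply f)" and N: "finite N" "N \<subseteq> spec"
    and small: "\<And>a. a \<in> vanish N \<Longrightarrow> cmod (cdual_apply f a) \<le> \<epsilon> * norm a" and \<epsilon>: "\<epsilon> \<ge> 0"
  shows "cmod ((\<Sum>\<omega>\<in>N. of_real (point_mass (cdual_apply f) \<omega>) * \<omega> x) - cdual_apply f x) \<le> 2 * \<epsilon> * norm x"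
proof (rule field_le_epsilon)
  fix \<delta> :: real assume "\<delta> > 0"
  define d where "d = \<delta> / (real (card N) * norm x + 1)"
  have "0 \<le> real (card N) * norm x" by simp
  then have d: "d > 0" using \<open>\<delta> > 0\<close> unfolding d_def by (intro divide_pos_pos) linarith+
  let ?m = "point_mass (cdual_apply f)"
  obtain b where b: "\<And>\<omega>. \<omega> \<in> N \<Longrightarrow> unit_elem (b \<omega>)" "\<And>\<omega>. \<omega> \<in> N \<Longrightarrow> \<omega> (b \<omega>) = 1"
    "\<And>\<omega> \<psi>. \<omega> \<noteq> \<psi> \<Longrightarrow> b \<omega> * b \<psi> = 0" using orthogonal_bumps[OF N] by blast
  have "\<exists>k. unit_elem k \<and> \<omega> k = 1 \<and> Re (cdual_apply f k) < ?m \<omega> + d" if "\<omega> \<in> N" for \<omega>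
    using point_mass_bounds(3)[OF f _ d] that N by blast
  then obtain k where k: "\<And>\<omega>. \<omega> \<in> N \<Longrightarrow> unit_elem (k \<omega>)" "\<And>\<omega>. \<omega> \<in> N \<Longrightarrow> \<omega> (k \<omega>) = 1"
    "\<And>\<omega>. \<omega> \<in> N \<Longrightarrow> Re (cdual_apply f (k \<omega>)) < ?m \<omega> + d" by metis
  define e where "e \<omega> = k \<omega> * b \<omega>" for \<omega>
  have e: "unit_elem (e \<omega>)" "\<omega> (e \<omega>) = 1" if "\<omega> \<in> N" for \<omega>
  proof -
    have c: "\<omega> \<in> chars" using that N spec_chars by blast
    show "unit_elem (e \<omega>)" using that b k by (simp add: e_def unit_elem_mult)
    show "\<omega> (e \<omega>) = 1" unfolding e_def charsD(2)[OF c] b(2)[OF that] k(2)[OF that] by simp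
  qed
  have eo: "e \<omega> * e \<psi> = 0" if "\<omega> \<noteq> \<psi>" for \<omega> \<psi>
  proof -
    have "e \<omega> * e \<psi> = (k \<omega> * k \<psi>) * (b \<omega> * b \<psi>)" by (simp add: e_def mult_ac)
    with b(3)[OF that] show ?thesis by simp
  qed
  have diff: "cmod (of_real (?m \<omega>) - cdual_apply f (e \<omega>)) \<le> d" if \<omega>: "\<omega> \<in> N" for \<omega>
  proof -
    have "pos_elem (k \<omega> - e \<omega>)"
    proof (rule pos_elem_diffI)
      fix \<psi> :: "'a \<Rightarrow> complex" assume \<psi>: "\<psi> \<in> chars"
      obtain s t where "0 \<le> s" "s \<le> 1" "\<psi> (k \<omega>) = of_real s" "0 \<le> t" "t \<le> 1" "\<psi> (b \<omega>) = of_real t"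
        using b(1)[OF \<omega>] k(1)[OF \<omega>] \<psi> unfolding unit_elem_def by force
      then show "\<exists>u v. \<psi> (k \<omega>) = of_real u \<and> \<psi> (e \<omega>) = of_real v \<and> v \<le> u"
        using \<psi> by (intro exI[of _ s] exI[of _ "s * t"]) (simp add: charsD e_def mult_left_le)
    qed
    then have "Re (cdual_apply f (e \<omega>)) < ?m \<omega> + d"
      using positive_functional_mono[OF f] k(3)[OF \<omega>] by (meson le_less_trans)
    moreover have "?m \<omega> \<le> Re (cdual_apply f (e \<omega>))"
      using point_mass_bounds(2)[OF f] e[OF \<omega>] \<omega> N by blast
    moreover have "cdual_apply f (e \<omega>) = of_real (Re (cdual_apply f (e \<omega>)))"
      using positive_functional_pos(2)[OF f unit_elem_pos[OF e(1)[OF \<omega>]]] by (simp add: complex_eq_iff)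
    then have "cmod (of_real (?m \<omega>) - cdual_apply f (e \<omega>)) = \<bar>?m \<omega> - Re (cdual_apply f (e \<omega>))\<bar>"
      by (metis norm_of_real of_real_diff)
    ultimately show ?thesis by linarith
  qed
  let ?P = "\<Sum>\<omega>\<in>N. scaleC (\<omega> x) (e \<omega>)"
  have "\<forall>\<omega>\<in>N. unit_elem (e \<omega>) \<and> \<omega> (e \<omega>) = 1" "\<forall>\<omega> \<psi>. \<omega> \<noteq> \<psi> \<longrightarrow> e \<omega> * e \<psi> = 0"
    using e eo by blast+
  note P = bump_projection[OF N this, of x]
  have "(\<Sum>\<omega>\<in>N. of_real (?m \<omega>) * \<omega> x) - cdual_apply f x
      = (\<Sum>\<omega>\<in>N. (of_real (?m \<omega>) - cdual_apply f (e \<omega>)) * \<omega> x) - cdual_apply f (x - ?P)"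
    by (simp add: cdual_apply_simps sum_subtractf algebra_simps)
  then have "cmod ((\<Sum>\<omega>\<in>N. of_real (?m \<omega>) * \<omega> x) - cdual_apply f x)
      \<le> cmod (\<Sum>\<omega>\<in>N. (of_real (?m \<omega>) - cdual_apply f (e \<omega>)) * \<omega> x) + cmod (cdual_apply f (x - ?P))"
    by (simp only: norm_triangle_ineq4)
  also have "cmod (\<Sum>\<omega>\<in>N. (of_real (?m \<omega>) - cdual_apply f (e \<omega>)) * \<omega> x) \<le> (\<Sum>\<omega>\<in>N. d * norm x)"
  proof (rule sum_norm_le)
    fix \<omega> assume \<omega>: "\<omega> \<in> N"
    then have "\<omega> \<in> chars" using N spec_chars by blast
    then show "cmod ((of_real (?m \<omega>) - cdual_apply f (e \<omega>)) * \<omega> x) \<le> d * norm x"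
      unfolding norm_mult using diff[OF \<omega>] d by (intro mult_mono charsD(4)) auto
  qed
  also have "\<dots> = (real (card N) * norm x) * (\<delta> / (real (card N) * norm x + 1))" by (simp add: d_def)
  also have "\<dots> \<le> \<delta>" using \<open>\<delta> > 0\<close> by (intro mult_divide_add_one_le) auto
  also have "cmod (cdual_apply f (x - ?P)) \<le> \<epsilon> * (2 * norm x)"
    using small[OF P(1)] mult_left_mono[OF P(3) \<epsilon>] by linarith
  finally show "cmod ((\<Sum>\<omega>\<in>N. of_real (?m \<omega>) * \<omega> x) - cdual_apply f x) \<le> 2 * \<epsilon> * norm x + \<delta>" by simp
qed

lemma vanish_mono: "M \<subseteq> N \<Longrightarrow> vanish N \<subseteq> vanish M"
  by (auto simp: vanish_def)

text \<open>The countable union \<open>L\<close> of the finite sets for \<epsilon> = 1/(n+1)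
  contains all relevant atoms. A partial sum over any finite part of \<open>L\<close> containing
  \<open>M n\<close> has error at most 2 ||x|| / (n+1).\<close>

lemma atomic_imp_scattered:
  assumes at: "\<And>f :: 'a::{cstar_algebra, comm_ring} cdual. atomic f"
  shows "scattered TYPE('a)"
  unfolding scattered_def
proof (intro allI impI)
  fix f0 :: "'a \<Rightarrow> complex" assume pos0: "positive_functional f0"
  obtain f where f0: "f0 = cdual_apply f" using positive_functional_bounded[OF pos0] by metis
  have f: "positive_functional (cdual_apply f)" using pos0 by (simp add: f0)
  have "\<exists>M. finite M \<and> M \<subseteq> spec \<and> (\<forall>a\<in>vanish M. cmod (cdual_apply f a) \<le> inverse (real (Suc n)) * norm a)" for n
    using at[of f] unfolding atomic_def by simp
  then obtain M where M: "\<And>n. finite (M n)" "\<And>n. M n \<subseteq> spec"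
    "\<And>n a. a \<in> vanish (M n) \<Longrightarrow> cmod (cdual_apply f a) \<le> inverse (real (Suc n)) * norm a" by metis
  define L where "L = (\<Union>n. M n)"
  have cL: "countable L" unfolding L_def by (rule countable_UN) (auto simp: M(1) countable_finite)
  have Ls: "L \<subseteq> spec" using M(2) by (auto simp: L_def)
  let ?m = "point_mass (cdual_apply f)"
  define G where "G i x = of_real (?m (from_nat_into L i)) * from_nat_into L i x" for i and x :: 'a
  have G: "G (to_nat_on L \<omega>) x = of_real (?m \<omega>) * \<omega> x" if "\<omega> \<in> L" for \<omega> x
    using cL that by (simp add: G_def)
  show "\<exists>(I :: nat set) g. (\<forall>i\<in>I. pure_functional (g i)) \<and> (\<forall>x. ((\<lambda>i. g i x) has_sum f0 x) I)"
  proof (rule exI[of _ "to_nat_on L ` L"], rule exI[of _ G], intro conjI ballI allI)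
    fix i assume "i \<in> to_nat_on L ` L"
    then obtain \<omega> where \<omega>: "\<omega> \<in> L" "i = to_nat_on L \<omega>" by blast
    then have ws: "\<omega> \<in> spec" using Ls by blast
    have "G i = (\<lambda>x. of_real (?m \<omega>) * cdual_apply (cdual_of \<omega>) x)"
      using G[OF \<omega>(1)] \<omega>(2) char_cdual(1)[OF spec_chars[OF ws]] by (simp add: fun_eq_iff)
    then show "pure_functional (G i)"
      unfolding pure_functional_def
      using char_pure_state[OF ws] point_mass_bounds(1)[OF f ws] by blast
  next
    fix x
    have "((\<lambda>\<omega>. of_real (?m \<omega>) * \<omega> x) has_sum cdual_apply f x) L"
      unfolding has_sum_def
    proof (rule tendstoI)
      fix \<epsilon> :: real assume "\<epsilon> > 0"
      have "\<epsilon> / (2 * norm x + 1) > 0" using \<open>\<epsilon> > 0\<close> by (simp add: add_nonneg_pos)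
      then obtain n where n: "inverse (real (Suc n)) < \<epsilon> / (2 * norm x + 1)" using reals_Archimedean by blast
      have "dist (\<Sum>\<omega>\<in>N. of_real (?m \<omega>) * \<omega> x) (cdual_apply f x) < \<epsilon>" if N: "finite N" "M n \<subseteq> N" "N \<subseteq> L" for N
      proof -
        have "cmod ((\<Sum>\<omega>\<in>N. of_real (?m \<omega>) * \<omega> x) - cdual_apply f x) \<le> 2 * inverse (real (Suc n)) * norm x"
        proof (rule point_mass_approx[OF f N(1)])
          show "N \<subseteq> spec" using N(3) Ls by blast
          show "cmod (cdual_apply f a) \<le> inverse (real (Suc n)) * norm a" if "a \<in> vanish N" for a
            using that vanish_mono[OF N(2)] by (intro M(3)) blast
        qed simp
        also have "\<dots> \<le> inverse (real (Suc n)) * (2 * norm x + 1)" by (simp add: algebra_simps)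
        also have "\<dots> < (\<epsilon> / (2 * norm x + 1)) * (2 * norm x + 1)"
          using n by (intro mult_strict_right_mono) (auto simp: add_nonneg_pos)
        also have "\<dots> = \<epsilon>" using norm_ge_zero[of x] by (simp add: add_nonneg_eq_0_iff)
        finally show ?thesis by (simp add: dist_norm)
      qed
      moreover have "M n \<subseteq> L" by (auto simp: L_def)
      ultimately show "\<forall>\<^sub>F N in finite_subsets_at_top L. dist (\<Sum>\<omega>\<in>N. of_real (?m \<omega>) * \<omega> x) (cdual_apply f x) < \<epsilon>"
        unfolding eventually_finite_subsets_at_top using M(1)[of n] by blast
    qed
    then have "((\<lambda>\<omega>. G (to_nat_on L \<omega>) x) has_sum cdual_apply f x) L"
      using has_sum_cong[of L "\<lambda>\<omega>. G (to_nat_on L \<omega>) x" "\<lambda>\<omega>. of_real (?m \<omega>) * \<omega> x"] G by blast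
    then show "((\<lambda>i. G i x) has_sum f0 x) (to_nat_on L ` L)"
      using has_sum_reindex[OF inj_on_to_nat_on[OF cL], of "\<lambda>i. G i x"] by (simp add: f0 o_def)
  qed
qed

section \<open>Bounded bilinear forms on scattered algebras\<close>

text \<open>A derandomised fourth moment estimate: each sign is chosen so as not to decrease the expectation over the
  remaining ones.\<close>

lemma sign_choice:
  fixes \<alpha> \<beta> :: "'i \<Rightarrow> real" and x :: "nat \<Rightarrow> 'i \<Rightarrow> real"
  assumes \<beta>: "\<And>i. \<beta> i \<ge> 0"
  shows "\<exists>s. (\<forall>n. s n = 1 \<or> s n = (-1::real)) \<and>
    (\<Sum>i\<in>I. \<alpha> i * ((u i)\<^sup>2 + (\<Sum>n<N. (x n i)\<^sup>2))
        - \<beta> i * ((u i)^4 + 6 * (u i)\<^sup>2 * (\<Sum>n<N. (x n i)\<^sup>2) + 3 * (\<Sum>n<N. (x n i)\<^sup>2)\<^sup>2))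
    \<le> (\<Sum>i\<in>I. \<alpha> i * (u i + (\<Sum>n<N. s n * x n i))\<^sup>2 - \<beta> i * (u i + (\<Sum>n<N. s n * x n i))^4)"
proof (induction N arbitrary: u)
  case 0
  show ?case by (intro exI[of _ "\<lambda>_. 1"]) simp
next
  case (Suc N)
  define S where "S i = (\<Sum>n<N. (x n i)\<^sup>2)" for i
  define E where "E u \<sigma> = (\<Sum>i\<in>I. \<alpha> i * ((u i)\<^sup>2 + \<sigma> i) - \<beta> i * ((u i)^4 + 6 * (u i)\<^sup>2 * \<sigma> i + 3 * (\<sigma> i)\<^sup>2))"
    for u \<sigma> :: "'i \<Rightarrow> real"
  \<comment> \<open>The expression uses the Gaussian fourth moment 3\<sigma>^2, which exceeds that
    of a sum of signs. The surplus reappears as 4 b y^4 when one sign is averaged, and it has the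
    right sign because b \<ge> 0.\<close>
  have key: "2 * (\<alpha>' * (w\<^sup>2 + (\<sigma> + y\<^sup>2)) - b * (w^4 + 6 * w\<^sup>2 * (\<sigma> + y\<^sup>2) + 3 * (\<sigma> + y\<^sup>2)\<^sup>2))
      \<le> (\<alpha>' * ((w + y)\<^sup>2 + \<sigma>) - b * ((w + y)^4 + 6 * (w + y)\<^sup>2 * \<sigma> + 3 * \<sigma>\<^sup>2))
        + (\<alpha>' * ((w - y)\<^sup>2 + \<sigma>) - b * ((w - y)^4 + 6 * (w - y)\<^sup>2 * \<sigma> + 3 * \<sigma>\<^sup>2))"
    if "b \<ge> 0" for \<alpha>' b w y \<sigma> :: real
  proof -
    have "(\<alpha>' * ((w + y)\<^sup>2 + \<sigma>) - b * ((w + y)^4 + 6 * (w + y)\<^sup>2 * \<sigma> + 3 * \<sigma>\<^sup>2))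
        + (\<alpha>' * ((w - y)\<^sup>2 + \<sigma>) - b * ((w - y)^4 + 6 * (w - y)\<^sup>2 * \<sigma> + 3 * \<sigma>\<^sup>2))
        - 2 * (\<alpha>' * (w\<^sup>2 + (\<sigma> + y\<^sup>2)) - b * (w^4 + 6 * w\<^sup>2 * (\<sigma> + y\<^sup>2) + 3 * (\<sigma> + y\<^sup>2)\<^sup>2)) = 4 * b * y^4"
      by (simp add: power2_eq_square power4_eq_xxxx algebra_simps)
    moreover have "0 \<le> 4 * b * y^4" using that by simp
    ultimately show ?thesis by linarith
  qed
  have "2 * E u (\<lambda>i. S i + (x N i)\<^sup>2) \<le> E (\<lambda>i. u i + x N i) S + E (\<lambda>i. u i - x N i) S"
    unfolding E_def sum_distrib_left sum.distrib[symmetric] by (intro sum_mono key \<beta>)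
  then have "\<exists>t. (t = 1 \<or> t = -1) \<and> E u (\<lambda>i. S i + (x N i)\<^sup>2) \<le> E (\<lambda>i. u i + t * x N i) S"
  proof (cases "E u (\<lambda>i. S i + (x N i)\<^sup>2) \<le> E (\<lambda>i. u i + x N i) S")
    case True
    then show ?thesis by (intro exI[of _ 1]) simp
  next
    case False
    with \<open>2 * _ \<le> _\<close> have "E u (\<lambda>i. S i + (x N i)\<^sup>2) \<le> E (\<lambda>i. u i - x N i) S" by linarith
    then show ?thesis by (intro exI[of _ "-1"]) simp
  qed
  then obtain t where t: "t = 1 \<or> t = -1" "E u (\<lambda>i. S i + (x N i)\<^sup>2) \<le> E (\<lambda>i. u i + t * x N i) S" by blast
  obtain s where s: "\<forall>n. s n = 1 \<or> s n = (-1::real)"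
    "E (\<lambda>i. u i + t * x N i) S \<le> (\<Sum>i\<in>I. \<alpha> i * (u i + t * x N i + (\<Sum>n<N. s n * x n i))\<^sup>2
      - \<beta> i * (u i + t * x N i + (\<Sum>n<N. s n * x n i))^4)"
    using Suc.IH[of "\<lambda>i. u i + t * x N i"] unfolding E_def S_def by blast
  let ?s = "s(N := t)"
  have e1: "u i + (\<Sum>n<Suc N. ?s n * x n i) = u i + t * x N i + (\<Sum>n<N. s n * x n i)" for i by simp
  have e2: "(\<Sum>n<Suc N. (x n i)\<^sup>2) = S i + (x N i)\<^sup>2" for i by (simp add: S_def)
  show ?case
  proof (intro exI[of _ ?s] conjI)
    show "\<forall>n. ?s n = 1 \<or> ?s n = -1" using s(1) t(1) by simp
  qed (unfold e1 e2, rule order_trans[OF t(2)[unfolded E_def] s(2)[unfolded E_def]])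
qed

text \<open>The quartic \<open>(3 t\<^sup>2 / l - t\<^sup>4 / l\<^sup>3) / 2\<close> touches \<open>\<bar>t\<bar>\<close> from below at \<open>t = l\<close>; for \<open>l = 0\<close> it is zero.\<close>

lemma abs_ge_quartic:
  fixes l t :: real
  assumes "l \<ge> 0"
  shows "3 / (2 * l) * t\<^sup>2 - 1 / (2 * l^3) * t^4 \<le> \<bar>t\<bar>"
proof (cases "l = 0")
  case False
  with assms have l: "l > 0" by simp
  define y where "y = \<bar>t\<bar> / l"
  have y: "y \<ge> 0" using l by (simp add: y_def)
  have "0 \<le> l / 2 * (y * ((y - 1)\<^sup>2 * (y + 2)))" using y l by simp
  also have "\<dots> = l * y - (3 / 2 * l * y\<^sup>2 - 1 / 2 * l * y^4)"
    by (simp add: power2_eq_square power4_eq_xxxx algebra_simps)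
  finally have "0 \<le> l * y - (3 / 2 * l * y\<^sup>2 - 1 / 2 * l * y^4)" .
  moreover have "l * y = \<bar>t\<bar>" using l by (simp add: y_def)
  moreover have "3 / 2 * l * y\<^sup>2 = 3 / (2 * l) * t\<^sup>2" using l by (simp add: y_def power_divide power2_eq_square)
  moreover have "1 / 2 * l * y^4 = 1 / (2 * l^3) * t^4"
    using l by (simp add: y_def power_divide power4_eq_xxxx power3_eq_cube)
  ultimately show ?thesis by linarith
qed simp

text \<open>One choice of signs serves all \<open>i\<close> together, because the summed quartic
  minorant is what \<open>sign_choice\<close> controls. Cauchy-Schwarz compares the sum of moduli
  with the square function and contributes the root of N.\<close>

lemma khinchine_signs:
  fixes x :: "nat \<Rightarrow> 'i \<Rightarrow> real"
  obtains s where "\<And>n. s n = 1 \<or> s n = (-1::real)"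
    "(\<Sum>i\<in>I. \<Sum>n<N. \<bar>x n i\<bar>) \<le> sqrt (3 * real N) * (\<Sum>i\<in>I. \<bar>\<Sum>n<N. s n * x n i\<bar>)"
proof -
  define S where "S i = (\<Sum>n<N. (x n i)\<^sup>2)" for i
  \<comment> \<open>The expectation 3 S / (2 l) - 3 S^2 / (2 l^3) of the minorant is largest for l^2
    = 3 S, where it equals l/3.\<close>
  define l where "l i = sqrt (3 * S i)" for i
  have S: "S i \<ge> 0" for i by (simp add: S_def sum_nonneg)
  have l: "l i \<ge> 0" for i using S by (simp add: l_def)
  have Sl: "S i = (l i)\<^sup>2 / 3" for i using S by (simp add: l_def)
  obtain s where s: "\<forall>n. s n = 1 \<or> s n = (-1::real)"
    "(\<Sum>i\<in>I. 3 / (2 * l i) * S i - 1 / (2 * (l i)^3) * (3 * (S i)\<^sup>2))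
      \<le> (\<Sum>i\<in>I. 3 / (2 * l i) * (\<Sum>n<N. s n * x n i)\<^sup>2 - 1 / (2 * (l i)^3) * (\<Sum>n<N. s n * x n i)^4)"
    using sign_choice[where \<beta> = "\<lambda>i. 1 / (2 * (l i)^3)" and \<alpha> = "\<lambda>i. 3 / (2 * l i)" and u = "\<lambda>_. 0"
        and I = I and N = N and x = x] l unfolding S_def by auto
  have "3 / (2 * l i) * S i - 1 / (2 * (l i)^3) * (3 * (S i)\<^sup>2) = l i / 3" for i
    by (cases "l i = 0") (simp_all add: Sl field_simps power2_eq_square power3_eq_cube)
  then have "(\<Sum>i\<in>I. l i / 3)
      \<le> (\<Sum>i\<in>I. 3 / (2 * l i) * (\<Sum>n<N. s n * x n i)\<^sup>2 - 1 / (2 * (l i)^3) * (\<Sum>n<N. s n * x n i)^4)"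
    using s(2) by (simp only:)
  also have "\<dots> \<le> (\<Sum>i\<in>I. \<bar>\<Sum>n<N. s n * x n i\<bar>)" by (intro sum_mono abs_ge_quartic l)
  finally have 1: "(\<Sum>i\<in>I. l i / 3) \<le> (\<Sum>i\<in>I. \<bar>\<Sum>n<N. s n * x n i\<bar>)" .
  have 2: "(\<Sum>n<N. \<bar>x n i\<bar>) \<le> sqrt (3 * real N) * (l i / 3)" for i
  proof (rule power2_le_imp_le)
    have "(\<Sum>n<N. 1 * \<bar>x n i\<bar>)\<^sup>2 \<le> (\<Sum>n<N. 1\<^sup>2) * (\<Sum>n<N. \<bar>x n i\<bar>\<^sup>2)" by (rule Cauchy_Schwarz_ineq_sum)
    then have "(\<Sum>n<N. \<bar>x n i\<bar>)\<^sup>2 \<le> real N * S i" by (simp add: S_def)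
    also have "\<dots> = (sqrt (3 * real N) * (l i / 3))\<^sup>2"
      by (simp add: Sl power_mult_distrib power_divide)
    finally show "(\<Sum>n<N. \<bar>x n i\<bar>)\<^sup>2 \<le> (sqrt (3 * real N) * (l i / 3))\<^sup>2" .
    show "0 \<le> sqrt (3 * real N) * (l i / 3)" using l by simp
  qed
  have "(\<Sum>i\<in>I. \<Sum>n<N. \<bar>x n i\<bar>) \<le> (\<Sum>i\<in>I. sqrt (3 * real N) * (l i / 3))" by (rule sum_mono) (rule 2)
  also have "\<dots> = sqrt (3 * real N) * (\<Sum>i\<in>I. l i / 3)" by (simp add: sum_distrib_left)
  also have "\<dots> \<le> sqrt (3 * real N) * (\<Sum>i\<in>I. \<bar>\<Sum>n<N. s n * x n i\<bar>)" by (intro mult_left_mono 1) simp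
  finally show ?thesis using that s(1) by blast
qed

lemma orthogonal_functional_sum_le:
  fixes f :: "'a::{cstar_algebra, comm_ring} \<Rightarrow> complex" and y :: "'i \<Rightarrow> 'a"
  assumes f: "clinear_form f" "\<And>b. cmod (f b) \<le> K * norm b" "K \<ge> 0"
    and y: "\<And>i j. i \<in> N \<Longrightarrow> j \<in> N \<Longrightarrow> i \<noteq> j \<Longrightarrow> y i * y j = 0" "\<And>i. i \<in> N \<Longrightarrow> norm (y i) \<le> 1"
  shows "(\<Sum>i\<in>N. cmod (f (y i))) \<le> K"
proof -
  define \<theta> where "\<theta> i = cnj (sgn (f (y i)))" for i
  have \<theta>: "\<theta> i * f (y i) = of_real (cmod (f (y i)))" for i
    unfolding \<theta>_def
    by (cases "f (y i) = 0") (simp_all add: sgn_eq mult.commute[of "cnj _"] complex_norm_square[symmetric] power2_eq_square)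
  have \<theta>1: "cmod (\<theta> i) \<le> 1" for i by (simp add: \<theta>_def norm_sgn)
  have "norm (\<Sum>i\<in>N. scaleC (\<theta> i) (y i)) \<le> 1"
  proof (rule orthogonal_sum_norm)
    show "norm (scaleC (\<theta> i) (y i)) \<le> 1" if "i \<in> N" for i
      using mult_mono[OF \<theta>1 y(2)[OF that]] by (simp add: norm_scaleC)
  qed (simp_all add: mult_scaleC_left mult_scaleC_right y(1) scaleC_zero_right)
  then have "cmod (f (\<Sum>i\<in>N. scaleC (\<theta> i) (y i))) \<le> K"
    using f(2)[of "\<Sum>i\<in>N. scaleC (\<theta> i) (y i)"] mult_left_mono[OF _ f(3), of "norm (\<Sum>i\<in>N. scaleC (\<theta> i) (y i))" 1] by simp
  moreover have "f (\<Sum>i\<in>N. scaleC (\<theta> i) (y i)) = of_real (\<Sum>i\<in>N. cmod (f (y i)))"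
    by (simp add: clinear_form_simps[OF f(1)] \<theta>)
  ultimately have "\<bar>\<Sum>i\<in>N. cmod (f (y i))\<bar> \<le> K" by (metis norm_of_real)
  then show ?thesis by simp
qed

lemma bounded_form_left:
  assumes "cbilinear_form F" "\<And>a b. cmod (F a b) \<le> K * norm a * norm b"
  shows "cdual_apply (cdual_of (F a)) = F a" "cdual_apply (cdual_of (\<lambda>a. F a b)) = (\<lambda>a. F a b)"
proof -
  have "clinear_form (F a)" "clinear_form (\<lambda>a. F a b)" using assms(1) by (auto simp: cbilinear_form_def)
  moreover have "cmod (F a b) \<le> (K * norm a) * norm b" "cmod (F a b) \<le> (K * norm b) * norm a" for a b
    using assms(2)[of a b] by (simp_all add: mult_ac)
  ultimately show "cdual_apply (cdual_of (F a)) = F a" "cdual_apply (cdual_of (\<lambda>a. F a b)) = (\<lambda>a. F a b)"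
    by (blast intro: cdual_apply_cdual_of)+
qed

text \<open>Each \<open>F (a n)\<close> carries mass at least \<epsilon>/2 on one finite set of
  bumps, and the signs from \<open>khinchine_signs\<close> keep enough of the total mass in a single
  contraction. Real and imaginary parts together have mass at most 2 K, and squaring N \<epsilon>/2
  \<le> sqrt(3 N) 2 K produces the constant 48.\<close>

lemma orthogonal_family_bound:
  fixes F :: "'a::{cstar_algebra, comm_ring} \<Rightarrow> 'a \<Rightarrow> complex"
  assumes at: "\<And>f :: 'a cdual. atomic f"
    and F: "cbilinear_form F" "\<And>a b. cmod (F a b) \<le> K * norm a * norm b" "K \<ge> 0" and \<epsilon>: "\<epsilon> > 0"
    and a: "\<And>m n. m < N \<Longrightarrow> n < N \<Longrightarrow> m \<noteq> n \<Longrightarrow> a m * a n = 0" "\<And>n. n < N \<Longrightarrow> norm (a n) \<le> 1"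
    and b: "\<And>n. n < N \<Longrightarrow> norm (b n) \<le> 1" and big: "\<And>n. n < N \<Longrightarrow> cmod (F (a n) (b n)) > \<epsilon>"
  shows "real N \<le> 48 * (K / \<epsilon>)\<^sup>2"
proof -
  have lin: "clinear_form (F c)" for c using F(1) by (simp add: cbilinear_form_def)
  have "\<exists>M. finite M \<and> M \<subseteq> spec \<and> (\<forall>c\<in>vanish M. cmod (F (a n) c) \<le> \<epsilon> / 4 * norm c)" for n
    using at[of "cdual_of (F (a n))", unfolded atomic_def bounded_form_left(1)[OF F(1,2)], rule_format, of "\<epsilon> / 4"] \<epsilon>
    by simp
  then obtain M where M: "\<And>n. finite (M n)" "\<And>n. M n \<subseteq> spec"
    "\<And>n c. c \<in> vanish (M n) \<Longrightarrow> cmod (F (a n) c) \<le> \<epsilon> / 4 * norm c" by metis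
  define L where "L = (\<Union>n<N. M n)"
  have L: "finite L" "L \<subseteq> spec" using M(1,2) by (auto simp: L_def)
  obtain e where e: "\<And>\<omega>. \<omega> \<in> L \<Longrightarrow> unit_elem (e \<omega>)" "\<And>\<omega>. \<omega> \<in> L \<Longrightarrow> \<omega> (e \<omega>) = 1"
    "\<And>\<omega> \<psi>. \<omega> \<noteq> \<psi> \<Longrightarrow> e \<omega> * e \<psi> = 0" using orthogonal_bumps[OF L] by blast
  have e': "\<forall>\<omega>\<in>L. unit_elem (e \<omega>) \<and> \<omega> (e \<omega>) = 1" "\<forall>\<omega> \<psi>. \<omega> \<noteq> \<psi> \<longrightarrow> e \<omega> * e \<psi> = 0"
    using e by blast+
  have row: "(\<Sum>\<omega>\<in>L. cmod (F (a n) (e \<omega>))) \<ge> \<epsilon> / 2" if n: "n < N" for n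
  proof -
    let ?P = "\<Sum>\<omega>\<in>L. scaleC (\<omega> (b n)) (e \<omega>)"
    note P = bump_projection[OF L e', of "b n"]
    have "b n - ?P \<in> vanish (M n)" using P(1) vanish_mono[of "M n" L] n by (auto simp: L_def)
    from M(3)[OF this] have "cmod (F (a n) (b n - ?P)) \<le> \<epsilon> / 4 * norm (b n - ?P)" .
    also have "\<dots> \<le> \<epsilon> / 4 * 2" using P(3) b[OF n] \<epsilon> by (intro mult_left_mono) auto
    finally have 1: "cmod (F (a n) (b n - ?P)) \<le> \<epsilon> / 2" by simp
    have "F (a n) ?P = (\<Sum>\<omega>\<in>L. \<omega> (b n) * F (a n) (e \<omega>))" by (simp add: clinear_form_simps[OF lin])
    also have "cmod \<dots> \<le> (\<Sum>\<omega>\<in>L. cmod (F (a n) (e \<omega>)))"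
    proof (rule sum_norm_le)
      fix \<omega> assume "\<omega> \<in> L"
      then have "\<omega> \<in> chars" using L spec_chars by blast
      then have "cmod (\<omega> (b n)) \<le> 1" using charsD(4) b[OF n] order_trans by blast
      then show "cmod (\<omega> (b n) * F (a n) (e \<omega>)) \<le> cmod (F (a n) (e \<omega>))"
        unfolding norm_mult by (rule mult_left_le_one_le[OF norm_ge_zero norm_ge_zero])
    qed
    finally have 2: "cmod (F (a n) ?P) \<le> (\<Sum>\<omega>\<in>L. cmod (F (a n) (e \<omega>)))" .
    have "F (a n) (b n) = F (a n) (b n - ?P) + F (a n) ?P"
      unfolding clinear_form_simps(5)[OF lin] by simp
    then have "cmod (F (a n) (b n)) \<le> cmod (F (a n) (b n - ?P)) + cmod (F (a n) ?P)"
      using norm_triangle_ineq[of "F (a n) (b n - ?P)" "F (a n) ?P"] by (simp only:)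
    with 1 2 big[OF n] show ?thesis by linarith
  qed
  \<comment> \<open>The sign lemma is real, so each bump occurs twice, once for the real and once
    for the imaginary part.\<close>
  define I where "I = L \<times> (UNIV :: bool set)"
  define x where "x n p = (if snd p then Re (F (a n) (e (fst p))) else Im (F (a n) (e (fst p))))" for n p
  have sumI: "(\<Sum>p\<in>I. h p) = (\<Sum>\<omega>\<in>L. h (\<omega>, True) + h (\<omega>, False))" for h :: "_ \<Rightarrow> real"
    by (simp add: I_def sum.cartesian_product' UNIV_bool add.commute)
  obtain s where s: "\<And>n. s n = 1 \<or> s n = (-1::real)"
    "(\<Sum>p\<in>I. \<Sum>n<N. \<bar>x n p\<bar>) \<le> sqrt (3 * real N) * (\<Sum>p\<in>I. \<bar>\<Sum>n<N. s n * x n p\<bar>)"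
    using khinchine_signs[where x = x and I = I and N = N] by blast
  define c where "c = (\<Sum>n<N. s n *\<^sub>R a n)"
  have nc: "norm c \<le> 1"
    unfolding c_def
  proof (rule orthogonal_sum_norm)
    show "norm (s n *\<^sub>R a n) \<le> 1" if "n \<in> {..<N}" for n using s(1)[of n] a(2)[of n] that by auto
  qed (auto simp: a(1))
  have Fc: "F c (e \<omega>) = (\<Sum>n<N. of_real (s n) * F (a n) (e \<omega>))" for \<omega>
  proof -
    have "clinear_form (\<lambda>a. F a (e \<omega>))" using F(1) by (simp add: cbilinear_form_def)
    note L = clinear_form_simps[OF this]
    show ?thesis unfolding c_def L(7) L(6) ..
  qed
  have "(\<Sum>p\<in>I. \<bar>\<Sum>n<N. s n * x n p\<bar>) = (\<Sum>\<omega>\<in>L. \<bar>Re (F c (e \<omega>))\<bar> + \<bar>Im (F c (e \<omega>))\<bar>)"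
    by (simp add: sumI x_def Fc)
  also have "\<dots> \<le> (\<Sum>\<omega>\<in>L. 2 * cmod (F c (e \<omega>)))"
  proof (rule sum_mono)
    show "\<bar>Re (F c (e \<omega>))\<bar> + \<bar>Im (F c (e \<omega>))\<bar> \<le> 2 * cmod (F c (e \<omega>))" for \<omega>
      using abs_Re_le_cmod[of "F c (e \<omega>)"] abs_Im_le_cmod[of "F c (e \<omega>)"] by linarith
  qed
  also have "\<dots> = 2 * (\<Sum>\<omega>\<in>L. cmod (F c (e \<omega>)))" by (simp add: sum_distrib_left)
  also have "\<dots> \<le> 2 * K"
  proof (intro mult_left_mono orthogonal_functional_sum_le[OF lin])
    show "cmod (F c b) \<le> K * norm b" for b
      using F(2)[of c b] mult_mono[OF mult_left_le[OF nc F(3)] order_refl[of "norm b"]] F(3) by simp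
    show "norm (e \<omega>) \<le> 1" if "\<omega> \<in> L" for \<omega> by (rule unit_elem_norm[OF e(1)[OF that]])
  qed (simp_all add: F(3) e(3))
  finally have W: "(\<Sum>p\<in>I. \<bar>\<Sum>n<N. s n * x n p\<bar>) \<le> 2 * K" .
  have "real N * (\<epsilon> / 2) = (\<Sum>n<N. \<epsilon> / 2)" by simp
  also have "\<dots> \<le> (\<Sum>n<N. \<Sum>\<omega>\<in>L. cmod (F (a n) (e \<omega>)))" by (intro sum_mono row) simp
  also have "\<dots> \<le> (\<Sum>n<N. \<Sum>p\<in>I. \<bar>x n p\<bar>)"
    unfolding sumI by (intro sum_mono) (simp add: x_def cmod_le)
  also have "\<dots> \<le> sqrt (3 * real N) * (\<Sum>p\<in>I. \<bar>\<Sum>n<N. s n * x n p\<bar>)"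
    by (subst sum.swap) (rule s(2))
  also have "\<dots> \<le> sqrt (3 * real N) * (2 * K)" by (intro mult_left_mono W) simp
  finally have fin: "real N * (\<epsilon> / 2) \<le> sqrt (3 * real N) * (2 * K)" .
  then have "(real N * (\<epsilon> / 2))\<^sup>2 \<le> (sqrt (3 * real N) * (2 * K))\<^sup>2"
    using \<epsilon> by (intro power_mono) auto
  then have "real N * (real N * \<epsilon>\<^sup>2) \<le> real N * (48 * K\<^sup>2)"
    by (simp add: power_mult_distrib power2_eq_square field_simps)
  then have "real N * \<epsilon>\<^sup>2 \<le> 48 * K\<^sup>2 \<or> N = 0" by (cases "N = 0") auto
  then show ?thesis using \<epsilon> by (auto simp: power_divide field_simps)
qed

text \<open>Among the orthogonal families on which the form exceeds \<open>\<epsilon>\<close> choose one of maximal size, and perturb it to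
  vanish near the finitely many characters carrying almost all of the functionals \<open>F(\<cdot>, b\<^sub>n)\<close>.\<close>

lemma bounded_form_concentrates:
  fixes F :: "'a::{cstar_algebra, comm_ring} \<Rightarrow> 'a \<Rightarrow> complex"
  assumes at: "\<And>f :: 'a cdual. atomic f"
    and F: "cbilinear_form F" "\<And>a b. cmod (F a b) \<le> K * norm a * norm b" "K \<ge> 0" and \<epsilon>: "\<epsilon> > 0"
  shows "\<exists>M. finite M \<and> M \<subseteq> spec \<and>
    (\<forall>a\<in>vanish M. \<forall>b. norm a \<le> 1 \<longrightarrow> norm b \<le> 1 \<longrightarrow> cmod (F a b) \<le> \<epsilon>)"
proof -
  note B = cbilinear_form_simps[OF F(1)]
  have lin: "clinear_form (\<lambda>a. F a b)" for b using F(1) by (simp add: cbilinear_form_def)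
  define Q where "Q N \<longleftrightarrow> (\<exists>a b. (\<forall>m<N. \<forall>n<N. m \<noteq> n \<longrightarrow> a m * a n = 0) \<and>
    (\<forall>n<N. norm (a n) \<le> 1 \<and> norm (b n) \<le> 1 \<and> \<epsilon> < cmod (F (a n) (b n))))" for N :: nat
  have bnd: "real N \<le> 48 * (K / \<epsilon>)\<^sup>2" if "Q N" for N
    using that orthogonal_family_bound[OF at F \<epsilon>] unfolding Q_def by metis
  have "\<exists>N. Q N \<and> \<not> Q (Suc N)"
  proof (rule ccontr)
    assume "\<nexists>N. Q N \<and> \<not> Q (Suc N)"
    moreover have "Q 0" by (simp add: Q_def)
    ultimately have "Q N" for N by (induction N) blast+
    then have "real N \<le> 48 * (K / \<epsilon>)\<^sup>2" for N using bnd by blast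
    then show False using reals_Archimedean2 not_le by blast
  qed
  then obtain N where N: "Q N" "\<not> Q (Suc N)" by blast
  then obtain a b where ab: "\<And>m n. m < N \<Longrightarrow> n < N \<Longrightarrow> m \<noteq> n \<Longrightarrow> a m * a n = 0"
    "\<And>n. n < N \<Longrightarrow> norm (a n) \<le> 1" "\<And>n. n < N \<Longrightarrow> norm (b n) \<le> 1" "\<And>n. n < N \<Longrightarrow> \<epsilon> < cmod (F (a n) (b n))"
    unfolding Q_def by blast
  \<comment> \<open>The values of the chosen family exceed \<epsilon> strictly. Only half of each
    gap is given away, so the perturbed family still exceeds \<epsilon>.\<close>
  have "\<exists>M. finite M \<and> M \<subseteq> spec \<and> (\<forall>c\<in>vanish M. cmod (F c (b n)) \<le> (cmod (F (a n) (b n)) - \<epsilon>) / 2 * norm c)"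
    if "n < N" for n
    using at[of "cdual_of (\<lambda>c. F c (b n))"] ab(4)[OF that] unfolding atomic_def bounded_form_left(2)[OF F(1,2)]
    by (meson diff_gt_0_iff_gt half_gt_zero)
  then obtain M where M: "\<And>n. n < N \<Longrightarrow> finite (M n)" "\<And>n. n < N \<Longrightarrow> M n \<subseteq> spec"
    "\<And>n c. n < N \<Longrightarrow> c \<in> vanish (M n) \<Longrightarrow> cmod (F c (b n)) \<le> (cmod (F (a n) (b n)) - \<epsilon>) / 2 * norm c" by metis
  define L where "L = (\<Union>n<N. M n)"
  have L: "finite L" "L \<subseteq> spec" using M(1,2) by (auto simp: L_def)
  have "cmod (F c d) \<le> \<epsilon>" if c: "c \<in> vanish L" "norm c \<le> 1" and d: "norm d \<le> 1" for c d
  proof (rule ccontr)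
    assume "\<not> cmod (F c d) \<le> \<epsilon>"
    then have gap: "cmod (F c d) - \<epsilon> > 0" by simp
    define \<eta> where "\<eta> = (cmod (F c d) - \<epsilon>) / 2 / (K + 1)"
    have \<eta>: "\<eta> > 0" using gap F(3) by (simp add: \<eta>_def)
    obtain u e where ue: "unit_elem u" "unit_elem e" "u * e = e" "\<And>\<omega>. \<omega> \<in> L \<Longrightarrow> \<omega> e = 1" "norm (c * u) \<le> \<eta>"
      using vanish_near[OF L c(1) \<eta>] by blast
    \<comment> \<open>From \<open>u * e = e\<close> it follows that \<open>c'\<close> is orthogonal
      to \<open>e\<close>, hence to all \<open>a n * e\<close>, and can be adjoined to the perturbed
      family.\<close>
    define c' where "c' = c - c * u"
    have "cmod (F (c * u) d) \<le> K * norm (c * u) * norm d" by (rule F(2))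
    also have "\<dots> \<le> K * \<eta> * 1" using ue(5) d F(3) \<eta> by (intro mult_mono) auto
    also have "\<dots> \<le> (cmod (F c d) - \<epsilon>) / 2"
      unfolding \<eta>_def using mult_divide_add_one_le[OF F(3), of "(cmod (F c d) - \<epsilon>) / 2"] gap by simp
    finally have "cmod (F (c * u) d) \<le> (cmod (F c d) - \<epsilon>) / 2" .
    moreover have "F c d = F c' d + F (c * u) d" by (simp add: c'_def clinear_form_simps(5)[OF lin])
    then have "cmod (F c d) \<le> cmod (F c' d) + cmod (F (c * u) d)" by (metis norm_triangle_ineq)
    ultimately have c'F: "\<epsilon> < cmod (F c' d)" using gap by (simp add: field_simps)
    have c'n: "norm c' \<le> 1" using norm_mult_unit_elem_le(2)[OF ue(1), of c] c(2) by (simp add: c'_def)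
    have ec': "e * c' = 0"
    proof -
      have "e * c' = c * (e - u * e)" by (simp add: c'_def algebra_simps)
      then show ?thesis by (simp add: ue(3))
    qed
    define a' where "a' n = (if n < N then a n * e else c')" for n
    define b' where "b' n = (if n < N then b n else d)" for n
    have "Q (Suc N)"
      unfolding Q_def
    proof (rule exI[of _ a'], rule exI[of _ b'], intro conjI allI impI)
      show "a' m * a' n = 0" if "m < Suc N" "n < Suc N" "m \<noteq> n" for m n
      proof -
        have "(a m * e) * (a n * e) = (a m * a n) * (e * e)" "(a m * e) * c' = a m * (e * c')"
          "c' * (a n * e) = a n * (e * c')" by (simp_all add: mult_ac)
        then show ?thesis using that ab(1)[of m n] ec' by (auto simp: a'_def)
      qed
      fix n assume n: "n < Suc N"
      show "norm (a' n) \<le> 1"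
        using c'n ab(2)[of n] norm_mult_unit_elem_le(1)[OF ue(2), of "a n"] by (auto simp: a'_def)
      show "norm (b' n) \<le> 1" using d ab(3)[of n] by (auto simp: b'_def)
      show "\<epsilon> < cmod (F (a' n) (b' n))"
      proof (cases "n < N")
        case False
        then show ?thesis using c'F by (simp add: a'_def b'_def)
      next
        case True
        have "a n - a n * e \<in> vanish (M n)"
          unfolding vanish_def
        proof safe
          fix \<omega> assume "\<omega> \<in> M n"
          then have \<omega>: "\<omega> \<in> chars" "\<omega> \<in> L" using M(2)[OF True] spec_chars True by (auto simp: L_def)
          show "\<omega> (a n - a n * e) = 0" using chars_linear(5)[OF \<omega>(1)] charsD(2)[OF \<omega>(1)] ue(4)[OF \<omega>(2)] by simp
        qed
        from M(3)[OF True this] have "cmod (F (a n - a n * e) (b n)) \<le> (cmod (F (a n) (b n)) - \<epsilon>) / 2 * norm (a n - a n * e)" .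
        also have "\<dots> \<le> (cmod (F (a n) (b n)) - \<epsilon>) / 2 * 1"
          using norm_mult_unit_elem_le(2)[OF ue(2), of "a n"] ab(2,4)[OF True] by (intro mult_left_mono) auto
        finally have "cmod (F (a n - a n * e) (b n)) \<le> (cmod (F (a n) (b n)) - \<epsilon>) / 2" by simp
        moreover have "F (a n) (b n) = F (a n - a n * e) (b n) + F (a n * e) (b n)"
          by (simp add: clinear_form_simps(5)[OF lin])
        then have "cmod (F (a n) (b n)) \<le> cmod (F (a n - a n * e) (b n)) + cmod (F (a n * e) (b n))"
          by (metis norm_triangle_ineq)
        ultimately show ?thesis using True ab(4)[OF True] by (simp add: a'_def b'_def field_simps)
      qed
    qed
    with N(2) show False by simp
  qed
  then show ?thesis using L by blast
qed

section \<open>Arens regularity for scattered algebras\<close>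

text \<open>The functional \<open>f \<cdot> X\<close> with \<open>\<langle>f \<cdot> X, a\<rangle> = \<langle>X, a \<cdot> f\<rangle>\<close>: if \<open>Y \<mapsto> \<langle>X \<box> Y, f\<rangle>\<close> is weak* continuous, it is evaluation
  at this functional.\<close>

definition arens_right :: "'a::complex_normed_algebra cdual cdual \<Rightarrow> 'a cdual \<Rightarrow> 'a cdual" where
  "arens_right X f = cdual_of (\<lambda>a. cdual_apply X (arens_Yf (canonical_embedding a) f))"

lemma arens_Yf_simps:
  "arens_Yf (Y + Y') f = arens_Yf Y f + arens_Yf Y' f" "arens_Yf (scaleC c Y) f = scaleC c (arens_Yf Y f)"
  "arens_Yf Y (f + g) = arens_Yf Y f + arens_Yf Y g" "arens_Yf Y (scaleC c f) = scaleC c (arens_Yf Y f)"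
proof -
  have 1: "arens_fa (f + g) a = arens_fa f a + arens_fa g a" for a
    by (rule cdual_eqI) (simp add: arens_fa_apply cdual_apply_add_left)
  have 2: "arens_fa (scaleC c f) a = scaleC c (arens_fa f a)" for a
    by (rule cdual_eqI) (simp add: arens_fa_apply cdual_apply_scaleC_left)
  show "arens_Yf (Y + Y') f = arens_Yf Y f + arens_Yf Y' f" "arens_Yf (scaleC c Y) f = scaleC c (arens_Yf Y f)"
    "arens_Yf Y (f + g) = arens_Yf Y f + arens_Yf Y g" "arens_Yf Y (scaleC c f) = scaleC c (arens_Yf Y f)"
    by (rule cdual_eqI, simp add: arens_Yf_apply cdual_apply_add_left cdual_apply_scaleC_left 1 2 cdual_apply_simps)+
qed

lemma canonical_embedding_linear:
  "canonical_embedding (a + b) = canonical_embedding a + canonical_embedding b"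
  "canonical_embedding (scaleC c a) = scaleC c (canonical_embedding a)"
  by (rule cdual_eqI, simp add: canonical_embedding_apply cdual_apply_add_left cdual_apply_scaleC_left cdual_apply_simps)+

lemma arens_right_apply: "cdual_apply (arens_right X f) a = cdual_apply X (arens_Yf (canonical_embedding a) f)"
  and norm_arens_right: "norm (arens_right X f) \<le> norm X * norm f"
proof -
  have b: "cmod (cdual_apply X (arens_Yf (canonical_embedding a) f)) \<le> (norm X * norm f) * norm a" for a
  proof -
    have "norm (arens_Yf (canonical_embedding a) f) \<le> norm a * norm f"
      by (rule order_trans[OF norm_arens_Yf mult_right_mono[OF norm_canonical_embedding_le]]) simp
    then have "norm X * norm (arens_Yf (canonical_embedding a) f) \<le> norm X * (norm a * norm f)"
      by (intro mult_left_mono) auto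
    then show ?thesis
      using norm_cdual_apply[of X "arens_Yf (canonical_embedding a) f"] by (simp add: mult_ac)
  qed
  have "cdual_apply (arens_right X f) = (\<lambda>a. cdual_apply X (arens_Yf (canonical_embedding a) f))"
    unfolding arens_right_def using b
    by (intro cdual_apply_cdual_of)
       (auto simp: clinear_form_def canonical_embedding_linear arens_Yf_simps cdual_apply_simps)
  then show 1: "cdual_apply (arens_right X f) a = cdual_apply X (arens_Yf (canonical_embedding a) f)" for a by simp
  show "norm (arens_right X f) \<le> norm X * norm f" using b by (intro norm_cdual_le) (auto simp: 1)
qed

lemma arens_right_simps:
  "arens_right X (f + g) = arens_right X f + arens_right X g"
  "arens_right X (scaleC c f) = scaleC c (arens_right X f)"
  by (rule cdual_eqI, simp add: arens_right_apply arens_Yf_simps cdual_apply_add_left cdual_apply_scaleC_left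
      cdual_apply_simps)+

text \<open>Equality of the two Arens products at \<open>f\<close>, that is, weak almost periodicity
  of \<open>f\<close>.\<close>

definition arens_symmetric :: "'a::complex_normed_algebra cdual \<Rightarrow> bool" where
  "arens_symmetric f \<longleftrightarrow> (\<forall>X Y. cdual_apply X (arens_Yf Y f) = cdual_apply Y (arens_right X f))"

lemma arens_symmetric_add: "arens_symmetric f \<Longrightarrow> arens_symmetric g \<Longrightarrow> arens_symmetric (f + g)"
  by (simp add: arens_symmetric_def arens_Yf_simps arens_right_simps cdual_apply_simps)

lemma arens_symmetric_scaleC: "arens_symmetric f \<Longrightarrow> arens_symmetric (scaleC c f)"
  by (simp add: arens_symmetric_def arens_Yf_simps arens_right_simps cdual_apply_simps)

lemma arens_symmetric_closed:
  fixes f :: "'a::complex_normed_algebra cdual"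
  assumes "\<And>\<epsilon>. \<epsilon> > 0 \<Longrightarrow> \<exists>g. arens_symmetric g \<and> norm (f - g) \<le> \<epsilon>"
  shows "arens_symmetric f"
  unfolding arens_symmetric_def
proof (intro allI)
  fix X Y :: "'a cdual cdual"
  define D where "D h = cdual_apply X (arens_Yf Y h) - cdual_apply Y (arens_right X h)" for h :: "'a cdual"
  have Dadd: "D (g + h) = D g + D h" for g h
    by (simp add: D_def arens_Yf_simps arens_right_simps cdual_apply_simps)
  have Db: "cmod (D h) \<le> 2 * norm X * norm Y * norm h" for h
  proof -
    have "cmod (cdual_apply X (arens_Yf Y h)) \<le> norm X * (norm Y * norm h)"
      by (rule order_trans[OF norm_cdual_apply mult_left_mono[OF norm_arens_Yf]]) simp
    moreover have "cmod (cdual_apply Y (arens_right X h)) \<le> norm Y * (norm X * norm h)"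
      by (rule order_trans[OF norm_cdual_apply mult_left_mono[OF norm_arens_right]]) simp
    ultimately show ?thesis
      using norm_triangle_ineq4[of "cdual_apply X (arens_Yf Y h)" "cdual_apply Y (arens_right X h)"]
      by (simp add: D_def mult_ac)
  qed
  define C where "C = 2 * norm X * norm Y"
  have "cmod (D f) \<le> 0 + \<epsilon>" if "\<epsilon> > 0" for \<epsilon>
  proof -
    have C: "C \<ge> 0" by (simp add: C_def)
    then have "\<epsilon> / (C + 1) > 0" using that by simp
    then obtain g where g: "arens_symmetric g" "norm (f - g) \<le> \<epsilon> / (C + 1)" using assms by blast
    have "D f = D (f - g) + D g" using Dadd[of "f - g" g] by simp
    also have "D g = 0" using g(1) by (simp add: D_def arens_symmetric_def)
    finally have "cmod (D f) \<le> C * norm (f - g)" using Db[of "f - g"] by (simp add: C_def)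
    also have "\<dots> \<le> C * (\<epsilon> / (C + 1))" by (rule mult_left_mono[OF g(2) C])
    also have "\<dots> \<le> \<epsilon>" using C that by (intro mult_divide_add_one_le) auto
    finally show ?thesis by simp
  qed
  then have "cmod (D f) \<le> 0" by (rule field_le_epsilon)
  then show "cdual_apply X (arens_Yf Y f) = cdual_apply Y (arens_right X f)" by (simp add: D_def)
qed

text \<open>Translates of a multiplicative functional are multiples of it, so both sides equal the
  product of the values of \<open>X\<close> and \<open>Y\<close> at \<open>f\<close>.\<close>

lemma multiplicative_imp_arens_symmetric:
  assumes "\<And>a b. cdual_apply f (a * b) = cdual_apply f a * cdual_apply f b"
  shows "arens_symmetric f"
proof -
  have "arens_fa f a = scaleC (cdual_apply f a) f" for a
    by (rule cdual_eqI) (simp add: arens_fa_apply assms cdual_apply_scaleC_left)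
  then have 1: "arens_Yf Y f = scaleC (cdual_apply Y f) f" for Y
    by (intro cdual_eqI) (simp add: arens_Yf_apply cdual_apply_scaleC_left cdual_apply_simps)
  then have "arens_right X f = scaleC (cdual_apply X f) f" for X
    by (intro cdual_eqI) (simp add: arens_right_apply canonical_embedding_apply cdual_apply_scaleC_left cdual_apply_simps)
  with 1 show ?thesis by (simp add: arens_symmetric_def cdual_apply_simps)
qed

lemma arens_symmetric_sum:
  "(\<And>i. i \<in> I \<Longrightarrow> arens_symmetric (f i)) \<Longrightarrow> arens_symmetric (\<Sum>i\<in>I. f i)"
proof (induction I rule: infinite_finite_induct)
  case (insert i I)
  then show ?case by (simp add: arens_symmetric_add)
qed (auto intro: multiplicative_imp_arens_symmetric simp: cdual_apply_zero_left)

section \<open>Products of characters as building blocks of bilinear forms\<close>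

lemma product_functional:
  fixes f :: "'a::complex_normed_vector cdual" and g :: "'b::complex_normed_vector cdual"
  shows "\<exists>t. \<forall>a b. cdual_apply t (ptensor a b) = cdual_apply f a * cdual_apply g b"
proof -
  have "cmod (cdual_apply f a * cdual_apply g b) \<le> (norm f * norm g) * norm a * norm b" for a b
  proof -
    have "cmod (cdual_apply f a) * cmod (cdual_apply g b) \<le> (norm f * norm a) * (norm g * norm b)"
      by (intro mult_mono norm_cdual_apply) auto
    then show ?thesis by (simp add: norm_mult mult_ac)
  qed
  then show ?thesis
    using bilinear_extension[OF cbilinear_form_product[OF clinear_form_cdual_apply clinear_form_cdual_apply],
        of f g "norm f * norm g"] by (metis mult_nonneg_nonneg norm_ge_zero)
qed

lemma char_product_arens_symmetric:
  fixes t :: "('a::cstar_algebra varopoulos) cdual"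
  assumes \<omega>: "\<omega> \<in> chars" "\<psi> \<in> chars" and t: "\<And>a b. cdual_apply t (ptensor a b) = \<omega> a * \<psi> b"
  shows "arens_symmetric t"
proof (rule multiplicative_imp_arens_symmetric)
  have ct: "continuous_on UNIV (cdual_apply t)" by (rule linear_continuous_on[OF bounded_linear_cdual_apply])
  have el: "cdual_apply t (ptensor a b * v) = cdual_apply t (ptensor a b) * cdual_apply t v" for a b v
  proof (induction v rule: projective_of_induct)
    case closed
    show ?case by (intro closed_Collect_eq continuous_intros continuous_on_compose2[OF ct]) auto
  next
    case (add s u)
    then show ?case by (simp add: distrib_left cdual_apply_simps)
  next
    case (elem c d)
    show ?case by (simp add: ptensor_mult t charsD(2)[OF \<omega>(1)] charsD(2)[OF \<omega>(2)])
  qed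
  show "cdual_apply t (u * v) = cdual_apply t u * cdual_apply t v" for u v
  proof (induction u rule: projective_of_induct)
    case closed
    show ?case by (intro closed_Collect_eq continuous_intros continuous_on_compose2[OF ct]) auto
  next
    case (add s u)
    then show ?case by (simp add: distrib_right cdual_apply_simps)
  qed (rule el)
qed

text \<open>The variables are treated one after the other: concentration in the first variable
  leaves a finite sum of products of a character with an arbitrary functional, and atomicity of that
  functional does the rest.\<close>

lemma atomic_imp_arens_symmetric:
  fixes f :: "('a::{cstar_algebra, comm_ring} varopoulos) cdual"
  assumes at: "\<And>f :: 'a cdual. atomic f"
  shows "arens_symmetric f"
proof -
  obtain \<tau> :: "'a cdual \<Rightarrow> 'a cdual \<Rightarrow> ('a varopoulos) cdual"
    where \<tau>: "\<And>f g a b. cdual_apply (\<tau> f g) (ptensor a b) = cdual_apply f a * cdual_apply g b"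
    using product_functional by metis
  have half: "arens_symmetric (\<tau> (cdual_of \<omega>) g)" if \<omega>: "\<omega> \<in> chars" for \<omega> and g :: "'a cdual"
  proof (rule arens_symmetric_closed)
    fix \<epsilon> :: real assume "\<epsilon> > 0"
    obtain M where M: "finite M" "M \<subseteq> spec" "\<And>b. b \<in> vanish M \<Longrightarrow> cmod (cdual_apply g b) \<le> \<epsilon> / 2 * norm b"
      by (rule atomicE[OF at[of g], of "\<epsilon> / 2"]) (use \<open>\<epsilon> > 0\<close> in auto)
    obtain e where e: "\<And>\<psi>. \<psi> \<in> M \<Longrightarrow> unit_elem (e \<psi>)" "\<And>\<psi>. \<psi> \<in> M \<Longrightarrow> \<psi> (e \<psi>) = 1"
      "\<And>\<psi> \<psi>'. \<psi> \<noteq> \<psi>' \<Longrightarrow> e \<psi> * e \<psi>' = 0" using orthogonal_bumps[OF M(1,2)] by blast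
    have e': "\<forall>\<psi>\<in>M. unit_elem (e \<psi>) \<and> \<psi> (e \<psi>) = 1" "\<forall>\<psi> \<psi>'. \<psi> \<noteq> \<psi>' \<longrightarrow> e \<psi> * e \<psi>' = 0"
      using e by blast+
    have Mc: "\<psi> \<in> chars" if "\<psi> \<in> M" for \<psi> using M(2) that spec_chars by blast
    let ?g = "\<Sum>\<psi>\<in>M. scaleC (cdual_apply g (e \<psi>)) (\<tau> (cdual_of \<omega>) (cdual_of \<psi>))"
    have "arens_symmetric ?g"
    proof (intro arens_symmetric_sum arens_symmetric_scaleC)
      fix \<psi> assume "\<psi> \<in> M"
      then have \<psi>: "\<psi> \<in> chars" using M(2) spec_chars by blast
      show "arens_symmetric (\<tau> (cdual_of \<omega>) (cdual_of \<psi>))"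
        by (rule char_product_arens_symmetric[OF \<omega> \<psi>]) (simp add: \<tau> char_cdual \<omega> \<psi>)
    qed
    moreover have "norm (\<tau> (cdual_of \<omega>) g - ?g) \<le> \<epsilon>"
    proof (rule ptensor_functional_norm_le)
      fix a b
      let ?P = "\<Sum>\<psi>\<in>M. scaleC (\<psi> b) (e \<psi>)"
      note P = bump_projection[OF M(1,2) e', of b]
      have "cdual_apply ?g (ptensor a b) = \<omega> a * (\<Sum>\<psi>\<in>M. \<psi> b * cdual_apply g (e \<psi>))"
        unfolding cdual_apply_sum_left cdual_apply_scaleC_left \<tau> char_cdual(1)[OF \<omega>] sum_distrib_left
        by (intro sum.cong refl) (simp add: char_cdual(1)[OF Mc] mult_ac)
      also have "(\<Sum>\<psi>\<in>M. \<psi> b * cdual_apply g (e \<psi>)) = cdual_apply g ?P" by (simp add: cdual_apply_simps)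
      finally have "cdual_apply (\<tau> (cdual_of \<omega>) g - ?g) (ptensor a b) = \<omega> a * cdual_apply g (b - ?P)"
        by (simp only: cdual_apply_diff_left \<tau> char_cdual(1)[OF \<omega>] cdual_apply_simps(5) right_diff_distrib)
      moreover have "cmod (cdual_apply g (b - ?P)) \<le> \<epsilon> * norm b"
        using order_trans[OF M(3)[OF P(1)] mult_left_mono[OF P(3)]] \<open>\<epsilon> > 0\<close> by simp
      then have "cmod (\<omega> a) * cmod (cdual_apply g (b - ?P)) \<le> norm a * (\<epsilon> * norm b)"
        by (intro mult_mono charsD(4)[OF \<omega>]) auto
      ultimately show "cmod (cdual_apply (\<tau> (cdual_of \<omega>) g - ?g) (ptensor a b)) \<le> \<epsilon> * norm a * norm b"
        by (simp add: norm_mult mult_ac)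
    qed (use \<open>\<epsilon> > 0\<close> in simp)
    ultimately show "\<exists>h. arens_symmetric h \<and> norm (\<tau> (cdual_of \<omega>) g - h) \<le> \<epsilon>" by blast
  qed
  define F where "F a b = cdual_apply f (ptensor a b)" for a b
  have F: "cbilinear_form F" "\<And>a b. cmod (F a b) \<le> norm f * norm a * norm b"
    unfolding F_def using cbilinear_form_ptensor cmod_ptensor_le by blast+
  note B = cbilinear_form_simps[OF F(1)]
  show ?thesis
  proof (rule arens_symmetric_closed)
    fix \<epsilon> :: real assume "\<epsilon> > 0"
    then have "\<epsilon> / 2 > 0" by simp
    then obtain M where M: "finite M" "M \<subseteq> spec"
      "\<And>a b. a \<in> vanish M \<Longrightarrow> norm a \<le> 1 \<Longrightarrow> norm b \<le> 1 \<Longrightarrow> cmod (F a b) \<le> \<epsilon> / 2"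
      using bounded_form_concentrates[OF at F norm_ge_zero] by metis
    have M': "cmod (F a b) \<le> \<epsilon> / 2 * norm a * norm b" if a: "a \<in> vanish M" for a b
    proof (cases "a = 0 \<or> b = 0")
      case True
      then show ?thesis using B(3)[of 0 0 b] B(4)[of a 0 0] by (auto simp: scaleC_zero_right)
    next
      case False
      have "(1 / norm a) *\<^sub>R a \<in> vanish M"
      proof -
        have "M \<subseteq> chars" using M(2) spec_chars by blast
        with a show ?thesis by (auto simp: vanish_def chars_linear subset_iff)
      qed
      then have "cmod (F ((1 / norm a) *\<^sub>R a) ((1 / norm b) *\<^sub>R b)) \<le> \<epsilon> / 2"
        using False by (intro M(3)) auto
      moreover have "F ((1 / norm a) *\<^sub>R a) ((1 / norm b) *\<^sub>R b) = of_real (1 / norm a) * (of_real (1 / norm b) * F a b)"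
        unfolding scaleR_scaleC B(3,4) by simp
      ultimately show ?thesis using False by (simp add: norm_mult norm_divide field_simps)
    qed
    obtain e where e: "\<And>\<psi>. \<psi> \<in> M \<Longrightarrow> unit_elem (e \<psi>)" "\<And>\<psi>. \<psi> \<in> M \<Longrightarrow> \<psi> (e \<psi>) = 1"
      "\<And>\<psi> \<psi>'. \<psi> \<noteq> \<psi>' \<Longrightarrow> e \<psi> * e \<psi>' = 0" using orthogonal_bumps[OF M(1,2)] by blast
    have e': "\<forall>\<psi>\<in>M. unit_elem (e \<psi>) \<and> \<psi> (e \<psi>) = 1" "\<forall>\<psi> \<psi>'. \<psi> \<noteq> \<psi>' \<longrightarrow> e \<psi> * e \<psi>' = 0"
      using e by blast+
    have Mc: "\<psi> \<in> chars" if "\<psi> \<in> M" for \<psi> using M(2) that spec_chars by blast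
    let ?g = "\<Sum>\<psi>\<in>M. \<tau> (cdual_of \<psi>) (cdual_of (F (e \<psi>)))"
    have "arens_symmetric ?g"
      using M(2) spec_chars by (intro arens_symmetric_sum half) blast
    moreover have "norm (f - ?g) \<le> \<epsilon>"
    proof (rule ptensor_functional_norm_le)
      fix a b
      let ?P = "\<Sum>\<psi>\<in>M. scaleC (\<psi> a) (e \<psi>)"
      note P = bump_projection[OF M(1,2) e', of a]
      have lin: "clinear_form (\<lambda>a. F a b)" using F(1) by (simp add: cbilinear_form_def)
      have "cdual_apply ?g (ptensor a b) = (\<Sum>\<psi>\<in>M. \<psi> a * F (e \<psi>) b)"
        unfolding cdual_apply_sum_left \<tau> bounded_form_left(1)[OF F]
        by (intro sum.cong refl) (simp add: char_cdual(1)[OF Mc] mult_ac)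
      also have "\<dots> = F ?P b" by (simp add: clinear_form_simps[OF lin])
      finally have eq: "cdual_apply (f - ?g) (ptensor a b) = F (a - ?P) b"
        by (simp only: cdual_apply_diff_left F_def[symmetric] clinear_form_simps(5)[OF lin])
      have "cmod (F (a - ?P) b) \<le> \<epsilon> / 2 * norm (a - ?P) * norm b" by (rule M'[OF P(1)])
      also have "\<dots> \<le> \<epsilon> / 2 * (2 * norm a) * norm b"
        using \<open>\<epsilon> > 0\<close> by (intro mult_right_mono mult_left_mono P(3)) auto
      finally show "cmod (cdual_apply (f - ?g) (ptensor a b)) \<le> \<epsilon> * norm a * norm b"
        unfolding eq by simp
    qed (use \<open>\<epsilon> > 0\<close> in simp)
    ultimately show "\<exists>g. arens_symmetric g \<and> norm (f - g) \<le> \<epsilon>" by blast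
  qed
qed

lemma atomic_imp_arens_regular:
  assumes at: "\<And>f :: 'a::{cstar_algebra, comm_ring} cdual. atomic f"
  shows "arens_regular TYPE('a varopoulos)"
proof -
  have "X \<in> topological_centre" for X :: "('a varopoulos) cdual cdual"
  proof (rule topological_centreI)
    fix f :: "('a varopoulos) cdual"
    have "arens_symmetric f" by (rule atomic_imp_arens_symmetric[OF at])
    then show "\<exists>g. \<forall>Y. cdual_apply (arens_product X Y) f = cdual_apply Y g"
      by (intro exI[of _ "arens_right X f"]) (simp add: arens_product_apply arens_symmetric_def)
  qed
  then show ?thesis by (auto simp: arens_regular_def)
qed

text \<open>Both directions turn on whether a non-atomic functional on the algebra exists. If none
  does, the tensor square is Arens regular and the algebra is scattered; if one does, a perfect set
  refutes regularity, strong irregularity and scatteredness alike.\<close>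

theorem corollary4p6:
  shows "\<not> arens_regular TYPE('a::{cstar_algebra, comm_ring} varopoulos) \<and>
         \<not> strongly_arens_irregular TYPE('a varopoulos)
         \<longleftrightarrow> \<not> scattered TYPE('a)"
proof
  assume "\<not> arens_regular TYPE('a varopoulos) \<and> \<not> strongly_arens_irregular TYPE('a varopoulos)"
  then obtain f :: "'a cdual" where "\<not> atomic f" using atomic_imp_arens_regular by blast
  then show "\<not> scattered TYPE('a)" using non_atomic_imp_perfect scattered_imp_no_perfect by blast
next
  assume "\<not> scattered TYPE('a)"
  then obtain f :: "'a cdual" where "\<not> atomic f" using atomic_imp_scattered by blast
  then obtain S :: "('a \<Rightarrow> complex) set" where "perfect S" using non_atomic_imp_perfect by blast
  then show "\<not> arens_regular TYPE('a varopoulos) \<and> \<not> strongly_arens_irregular TYPE('a varopoulos)"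
    using perfect_imp_not_arens_regular perfect_imp_not_strongly_arens_irregular by blast
qed

end
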